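(* Let $\Theta$ be an inner function and let $A\in\mathcal{T}(\Theta)$. (1) If there exists $\mu\in\mathcal{V}_2(\Theta)$ such that $A=A^\Theta_\mu$, then $A$ is compact. (2) If $A$ is compact and positive (i.e. $\langle Af,f\rangle\ge 0$ for all $f\in K_\Theta$), then there exists $\mu\in\mathcal{V}_2^+(\Theta)$ such that $A=A^\Theta_\mu$.
   Context: $\mathbb{D}$ is the open unit disc and $\mathbb{T}$ the unit circle with normalized Lebesgue measure $m$. $H^p$ is the Hardy space of $\mathbb{D}$, identified through boundary values with a subspace of $L^p=L^p(\mathbb{T},m)$. An inner function is $\Theta\in H^\infty$ with $|\Theta|=1$ $m$-a.e. on $\mathbb{T}$. The model space is $K_\Theta=H^2\ominus\Theta H^2$; $P_\Theta$ is the orthogonal projection of $L^2$ onto $K_\Theta$. For $\phi\in L^2$, $A^\Theta_\phi$ is the operator with domain $K_\Theta\cap H^\infty$ (dense in $K_\Theta$) given by $A^\Theta_\phi f=P_\Theta(\phi f)$. If it extends to a bounded operator on $K_\Theta$, the extension is called a truncated Toeplitz operator (TTO); $\mathcal{T}(\Theta)$ is the set of all TTOs on $K_\Theta$. $\mathcal{C}_2(\Theta)$ is the set of finite complex Borel measures $\mu$ on $\mathbb{T}$ such that the embedding $K_\Theta\hookrightarrow L^2(|\mu|)$ is bounded, meaning: there is $C>0$ with $\|f\|_{L^2(|\mu|)}\le C\|f\|_2$ for all $f\in K_\Theta$ that extend continuously to $\overline{\mathbb{D}}$. Such $f$ are dense in $K_\Theta$, and $\iota_\mu:K_\Theta\to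 L^2(|\mu|)$ denotes the resulting bounded extension of $f\mapsto f|_{\mathbb{T}}$. $\mathcal{V}_2(\Theta)$ is the set of $\mu\in\mathcal{C}_2(\Theta)$ for which $\iota_\mu$ is compact; $\mathcal{V}^+_2(\Theta)$ is the set of positive measures in $\mathcal{V}_2(\Theta)$. For $\mu\in\mathcal{C}_2(\Theta)$, $A^\Theta_\mu$ is the bounded operator on $K_\Theta$ defined by $\langle A^\Theta_\mu f,g\rangle=\int_{\mathbb{T}}\iota_\mu(f)\,\overline{\iota_\mu(g)}\,d\mu$ for $f,g\in K_\Theta$ (it is known to belong to $\mathcal{T}(\Theta)$). *)

theory Defs
  imports "HOL-Analysis.Analysis"
begin

section \<open>The unit circle and spaces of square-integrable functions\<close>

definition circle_borel :: "complex measure" where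
  "circle_borel = restrict_space borel (sphere 0 1)"

definition circle_measure :: "complex measure" where
  "circle_measure = distr (uniform_measure lborel {0..<2 * pi}) circle_borel cis"

text \<open>
  Elements of an \<open>L\<^sup>2\<close>-space are represented by functions, and equality in \<open>L\<^sup>2\<close> is equality
  almost everywhere. Subspaces of \<open>L\<^sup>2\<close> contain every measurable representative of their elements.
\<close>

definition L2_space :: "'a measure \<Rightarrow> ('a \<Rightarrow> complex) set" where
  "L2_space M = {f \<in> borel_measurable M. integrable M (\<lambda>x. (cmod (f x))\<^sup>2)}"

definition L2_inner :: "'a measure \<Rightarrow> ('a \<Rightarrow> complex) \<Rightarrow> ('a \<Rightarrow> complex) \<Rightarrow> complex" where
  "L2_inner M f g = (\<integral>x. f x * cnj (g x) \<partial>M)"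

definition L2_norm :: "'a measure \<Rightarrow> ('a \<Rightarrow> complex) \<Rightarrow> real" where
  "L2_norm M f = sqrt (\<integral>x. (cmod (f x))\<^sup>2 \<partial>M)"

text \<open>
  The topology of the \<open>L\<^sup>2\<close>-seminorm on functions. Its Kolmogorov quotient is the norm topology
  on the space of a.e. classes, and compactness and closures agree on both sides.
\<close>

definition L2_topology :: "'a measure \<Rightarrow> ('a \<Rightarrow> complex) topology" where
  "L2_topology M = topology (\<lambda>U. U \<subseteq> L2_space M \<and>
     (\<forall>f\<in>U. \<exists>e>0. \<forall>g\<in>L2_space M. L2_norm M (\<lambda>x. g x - f x) < e \<longrightarrow> g \<in> U))"

lemma openin_L2_topology:
  "openin (L2_topology M) U \<longleftrightarrow> U \<subseteq> L2_space M \<and>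
     (\<forall>f\<in>U. \<exists>e>0. \<forall>g\<in>L2_space M. L2_norm M (\<lambda>x. g x - f x) < e \<longrightarrow> g \<in> U)"
proof -
  have "istopology (\<lambda>U. U \<subseteq> L2_space M \<and>
     (\<forall>f\<in>U. \<exists>e>0. \<forall>g\<in>L2_space M. L2_norm M (\<lambda>x. g x - f x) < e \<longrightarrow> g \<in> U))"
    (is "istopology ?P")
    unfolding istopology_def
  proof (intro conjI allI impI)
    fix S T assume S: "?P S" and T: "?P T"
    show "S \<inter> T \<subseteq> L2_space M" using S by blast
    show "\<forall>f\<in>S \<inter> T. \<exists>e>0. \<forall>g\<in>L2_space M. L2_norm M (\<lambda>x. g x - f x) < e \<longrightarrow> g \<in> S \<inter> T"
    proof
      fix f assume f: "f \<in> S \<inter> T"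
      obtain d where "d > 0" "\<forall>g\<in>L2_space M. L2_norm M (\<lambda>x. g x - f x) < d \<longrightarrow> g \<in> S"
        using S f by blast
      moreover obtain e where "e > 0"
          "\<forall>g\<in>L2_space M. L2_norm M (\<lambda>x. g x - f x) < e \<longrightarrow> g \<in> T"
        using T f by blast
      ultimately show "\<exists>e>0. \<forall>g\<in>L2_space M. L2_norm M (\<lambda>x. g x - f x) < e \<longrightarrow> g \<in> S \<inter> T"
        by (intro exI[of _ "min d e"]) auto
    qed
  next
    fix \<K> assume K: "\<forall>S\<in>\<K>. ?P S"
    then show "\<Union>\<K> \<subseteq> L2_space M" by blast
    show "\<forall>f\<in>\<Union>\<K>. \<exists>e>0. \<forall>g\<in>L2_space M. L2_norm M (\<lambda>x. g x - f x) < e \<longrightarrow> g \<in> \<Union>\<K>"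
    proof
      fix f assume "f \<in> \<Union>\<K>"
      then obtain S where S: "S \<in> \<K>" "f \<in> S" by blast
      then obtain e where "e > 0"
          "\<forall>g\<in>L2_space M. L2_norm M (\<lambda>x. g x - f x) < e \<longrightarrow> g \<in> S"
        using K by blast
      then show "\<exists>e>0. \<forall>g\<in>L2_space M. L2_norm M (\<lambda>x. g x - f x) < e \<longrightarrow> g \<in> \<Union>\<K>"
        using S(1) by blast
    qed
  qed
  then show ?thesis
    by (simp add: L2_topology_def topology_inverse')
qed

text \<open>
  Bounded linear maps from a subspace \<open>D\<close> of \<open>L\<^sup>2(M)\<close> into a subspace \<open>E\<close> of \<open>L\<^sup>2(N)\<close>.
  Linearity and boundedness force \<open>T\<close> to respect a.e. equality.
\<close>

definition L2_bounded_linear ::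
  "'a measure \<Rightarrow> ('a \<Rightarrow> complex) set \<Rightarrow> 'b measure \<Rightarrow> ('b \<Rightarrow> complex) set
    \<Rightarrow> (('a \<Rightarrow> complex) \<Rightarrow> ('b \<Rightarrow> complex)) \<Rightarrow> bool" where
  "L2_bounded_linear M D N E T \<longleftrightarrow>
     (\<forall>f\<in>D. T f \<in> E) \<and>
     (\<forall>f\<in>D. \<forall>g\<in>D. AE y in N. T (\<lambda>x. f x + g x) y = T f y + T g y) \<and>
     (\<forall>f\<in>D. \<forall>c. AE y in N. T (\<lambda>x. c * f x) y = c * T f y) \<and>
     (\<exists>C. \<forall>f\<in>D. L2_norm N (T f) \<le> C * L2_norm M f)"

definition L2_compact_operator ::
  "'a measure \<Rightarrow> ('a \<Rightarrow> complex) set \<Rightarrow> 'b measure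
    \<Rightarrow> (('a \<Rightarrow> complex) \<Rightarrow> ('b \<Rightarrow> complex)) \<Rightarrow> bool" where
  "L2_compact_operator M D N T \<longleftrightarrow>
     compactin (L2_topology N) (L2_topology N closure_of (T ` {f \<in> D. L2_norm M f \<le> 1}))"

section \<open>Hardy spaces, inner functions and model spaces\<close>

definition has_boundary_values :: "(complex \<Rightarrow> complex) \<Rightarrow> (complex \<Rightarrow> complex) \<Rightarrow> bool" where
  "has_boundary_values F f \<longleftrightarrow>
     (AE \<zeta> in circle_measure. ((\<lambda>r. F (of_real r * \<zeta>)) \<longlongrightarrow> f \<zeta>) (at_left (1::real)))"

definition H2_disc :: "(complex \<Rightarrow> complex) set" where
  "H2_disc = {F. F holomorphic_on ball 0 1 \<and>
     (\<exists>C. \<forall>r\<in>{0..<1}. (\<integral>\<zeta>. (cmod (F (of_real r * \<zeta>)))\<^sup>2 \<partial>circle_measure) \<le> C)}"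

definition Hinf_disc :: "(complex \<Rightarrow> complex) set" where
  "Hinf_disc = {F. F holomorphic_on ball 0 1 \<and> bounded (F ` ball 0 1)}"

definition H2 :: "(complex \<Rightarrow> complex) set" where
  "H2 = {f \<in> L2_space circle_measure. \<exists>F\<in>H2_disc. has_boundary_values F f}"

definition Hinf :: "(complex \<Rightarrow> complex) set" where
  "Hinf = {f \<in> borel_measurable circle_measure. \<exists>F\<in>Hinf_disc. has_boundary_values F f}"

definition inner_function :: "(complex \<Rightarrow> complex) \<Rightarrow> bool" where
  "inner_function \<Theta> \<longleftrightarrow> \<Theta> \<in> Hinf \<and> (AE \<zeta> in circle_measure. cmod (\<Theta> \<zeta>) = 1)"

definition model_space :: "(complex \<Rightarrow> complex) \<Rightarrow> (complex \<Rightarrow> complex) set" where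
  "model_space \<Theta> = {f \<in> H2. \<forall>g\<in>H2. L2_inner circle_measure f (\<lambda>\<zeta>. \<Theta> \<zeta> * g \<zeta>) = 0}"

definition model_projection ::
  "(complex \<Rightarrow> complex) \<Rightarrow> (complex \<Rightarrow> complex) \<Rightarrow> (complex \<Rightarrow> complex)" where
  "model_projection \<Theta> h = (SOME k. k \<in> model_space \<Theta> \<and>
     (\<forall>g\<in>model_space \<Theta>. L2_inner circle_measure (\<lambda>\<zeta>. h \<zeta> - k \<zeta>) g = 0))"

section \<open>Truncated Toeplitz operators\<close>

definition bounded_operator_on_model ::
  "(complex \<Rightarrow> complex) \<Rightarrow> ((complex \<Rightarrow> complex) \<Rightarrow> (complex \<Rightarrow> complex)) \<Rightarrow> bool" where
  "bounded_operator_on_model \<Theta> A \<longleftrightarrow>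
     L2_bounded_linear circle_measure (model_space \<Theta>) circle_measure (model_space \<Theta>) A"

definition TTO ::
  "(complex \<Rightarrow> complex) \<Rightarrow> ((complex \<Rightarrow> complex) \<Rightarrow> (complex \<Rightarrow> complex)) set" where
  "TTO \<Theta> = {A. bounded_operator_on_model \<Theta> A \<and>
     (\<exists>\<phi>\<in>L2_space circle_measure. \<forall>f\<in>model_space \<Theta> \<inter> Hinf.
        AE \<zeta> in circle_measure. A f \<zeta> = model_projection \<Theta> (\<lambda>\<xi>. \<phi> \<xi> * f \<xi>) \<zeta>)}"

text \<open>
  The model space is closed in \<open>L\<^sup>2\<close>, so taking the closure in \<open>L\<^sup>2\<close> or in the model space
  makes no difference.
\<close>

definition compact_on_model ::
  "(complex \<Rightarrow> complex) \<Rightarrow> ((complex \<Rightarrow> complex) \<Rightarrow> (complex \<Rightarrow> complex)) \<Rightarrow> bool" where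
  "compact_on_model \<Theta> A \<longleftrightarrow>
     L2_compact_operator circle_measure (model_space \<Theta>) circle_measure A"

definition positive_on_model ::
  "(complex \<Rightarrow> complex) \<Rightarrow> ((complex \<Rightarrow> complex) \<Rightarrow> (complex \<Rightarrow> complex)) \<Rightarrow> bool" where
  "positive_on_model \<Theta> A \<longleftrightarrow>
     (\<forall>f\<in>model_space \<Theta>. L2_inner circle_measure (A f) f \<in> \<real>\<^sub>\<ge>\<^sub>0)"

section \<open>Complex Borel measures on the circle\<close>

text \<open>
  A complex measure is a countably additive complex-valued function on the Borel subsets of the
  circle; its values on other sets are irrelevant. It is automatically of finite total variation.
\<close>

definition complex_circle_measure :: "(complex set \<Rightarrow> complex) \<Rightarrow> bool" where
  "complex_circle_measure \<mu> \<longleftrightarrow>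
     (\<forall>E::nat \<Rightarrow> complex set. range E \<subseteq> sets circle_borel \<longrightarrow> disjoint_family E \<longrightarrow>
        (\<lambda>n. \<mu> (E n)) sums \<mu> (\<Union>n. E n))"

definition positive_circle_measure :: "(complex set \<Rightarrow> complex) \<Rightarrow> bool" where
  "positive_circle_measure \<mu> \<longleftrightarrow>
     complex_circle_measure \<mu> \<and> (\<forall>E\<in>sets circle_borel. \<mu> E \<in> \<real>\<^sub>\<ge>\<^sub>0)"

definition variation :: "(complex set \<Rightarrow> complex) \<Rightarrow> complex measure" where
  "variation \<mu> = measure_of (space circle_borel) (sets circle_borel)
     (\<lambda>E. SUP P \<in> {P::nat \<Rightarrow> complex set. range P \<subseteq> sets circle_borel \<and> disjoint_family P \<and>
                     (\<Union>n. P n) = E}. \<Sum>n. ennreal (cmod (\<mu> (P n))))"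

text \<open>
  Integration against \<open>\<mu>\<close> uses the polar decomposition \<open>d\<mu> = h d|\<mu>|\<close> with \<open>|h| = 1\<close>, in which
  \<open>h\<close> is unique up to a \<open>|\<mu>|\<close>-null set.
\<close>

definition polar_density :: "(complex set \<Rightarrow> complex) \<Rightarrow> complex \<Rightarrow> complex" where
  "polar_density \<mu> = (SOME h. h \<in> borel_measurable (variation \<mu>) \<and>
     (\<forall>\<zeta>\<in>sphere 0 1. cmod (h \<zeta>) = 1) \<and>
     (\<forall>E\<in>sets circle_borel. \<mu> E = (\<integral>\<zeta>. indicator E \<zeta> * h \<zeta> \<partial>variation \<mu>)))"

definition complex_measure_integral ::
  "(complex set \<Rightarrow> complex) \<Rightarrow> (complex \<Rightarrow> complex) \<Rightarrow> complex" where
  "complex_measure_integral \<mu> f = (\<integral>\<zeta>. f \<zeta> * polar_density \<mu> \<zeta> \<partial>variation \<mu>)"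

section \<open>Carleson measures for model spaces and the operators they induce\<close>

text \<open>
  The functions in the model space with a continuous extension to the closed disc. Such an \<open>F\<close>
  is given on the closed disc; its restriction to the circle is its boundary function.
\<close>

definition K_cont :: "(complex \<Rightarrow> complex) \<Rightarrow> (complex \<Rightarrow> complex) set" where
  "K_cont \<Theta> = {F \<in> model_space \<Theta>. continuous_on (cball 0 1) F \<and> F holomorphic_on ball 0 1}"

definition C2 :: "(complex \<Rightarrow> complex) \<Rightarrow> (complex set \<Rightarrow> complex) set" where
  "C2 \<Theta> = {\<mu>. complex_circle_measure \<mu> \<and>
     (\<exists>C>0. \<forall>F\<in>K_cont \<Theta>. L2_norm (variation \<mu>) F \<le> C * L2_norm circle_measure F)}"

text \<open>
  The bounded extension of \<open>F \<mapsto> F|\<^sub>\<T>\<close> from \<open>K_cont \<Theta>\<close> to the model space; it is unique up to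
  \<open>|\<mu>|\<close>-null sets because \<open>K_cont \<Theta>\<close> is dense.
\<close>

definition embedding ::
  "(complex \<Rightarrow> complex) \<Rightarrow> (complex set \<Rightarrow> complex) \<Rightarrow> (complex \<Rightarrow> complex) \<Rightarrow> (complex \<Rightarrow> complex)"
  where
  "embedding \<Theta> \<mu> = (SOME T.
     L2_bounded_linear circle_measure (model_space \<Theta>) (variation \<mu>) (L2_space (variation \<mu>)) T \<and>
     (\<forall>F\<in>K_cont \<Theta>. AE \<zeta> in variation \<mu>. T F \<zeta> = F \<zeta>))"

definition V2 :: "(complex \<Rightarrow> complex) \<Rightarrow> (complex set \<Rightarrow> complex) set" where
  "V2 \<Theta> = {\<mu> \<in> C2 \<Theta>.
     L2_compact_operator circle_measure (model_space \<Theta>) (variation \<mu>) (embedding \<Theta> \<mu>)}"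

definition V2_pos :: "(complex \<Rightarrow> complex) \<Rightarrow> (complex set \<Rightarrow> complex) set" where
  "V2_pos \<Theta> = {\<mu> \<in> V2 \<Theta>. positive_circle_measure \<mu>}"

text \<open>
  \<open>A\<close> is the operator \<open>A\<^sub>\<mu>\<close>: the form determines a bounded operator on the model space uniquely.
\<close>

definition is_measure_operator ::
  "(complex \<Rightarrow> complex) \<Rightarrow> (complex set \<Rightarrow> complex)
    \<Rightarrow> ((complex \<Rightarrow> complex) \<Rightarrow> (complex \<Rightarrow> complex)) \<Rightarrow> bool" where
  "is_measure_operator \<Theta> \<mu> A \<longleftrightarrow> bounded_operator_on_model \<Theta> A \<and>
     (\<forall>f\<in>model_space \<Theta>. \<forall>g\<in>model_space \<Theta>. L2_inner circle_measure (A f) g =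
        complex_measure_integral \<mu> (\<lambda>\<zeta>. embedding \<Theta> \<mu> f \<zeta> * cnj (embedding \<Theta> \<mu> g \<zeta>)))"

end

(*
  Part (1): <A u, A u> = int (iota u) cnj (iota (A u)) d mu gives ||A u|| <= C ||iota u||, so A inherits
  compactness from the embedding iota.

  Part (2): a truncated Toeplitz operator satisfies <A f, f> = int phi |f|^2 dm for bounded f in K_Theta.
  If h >= 0 is bounded and Theta h has only positive frequencies (as for h = |f|^2), then h plus a small
  strictly positive weight of the same kind equals |g|^2 for an outer function g, and g lies in K_Theta
  because Theta cnj(g) = Theta h / g. Hence h |-> int phi h dm is nonnegative on every combination h >= 0
  of functions |f|^2, although phi itself need not be positive, and solving a moment problem
  represents this functional by a positive measure: int |f|^2 d mu = <A f, f> for all continuous f in K_Theta. Here a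
  countable family of f suffices, because the disc algebra is separable, and the measure is obtained as a
  weak limit of absolutely continuous measures minimising a weighted sum of squared residuals. By density
  of the continuous functions in K_Theta (Aleksandrov) and polarization, A = A_mu. Finally
  ||iota u||^2 = <A u, u> <= ||A u|| ||u||, so iota inherits compactness from A.
*)

theory Submission
  imports Defs "HOL-Probability.Probability" "HOL-Complex_Analysis.Complex_Analysis"
begin

section \<open>Square-integrable functions\<close>

text \<open>Carleson measures are tested only on \<open>K_cont \<Theta>\<close>, and
  \<open>embedding\<close> is a choice pinned down by its values there. Yet nothing in the
  definition of \<open>model_space\<close> provides a nonzero continuous function: for a general
  \<Theta> even the reproducing kernels need not extend continuously to the closed disc. Density of
  \<open>K_cont \<Theta>\<close> is therefore settled before \<open>embedding\<close> is touched.

  Two existence statements are of separation type: a multiplier that makes countably many functions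
  uniformly small, and a measure with prescribed moments. Both come from minimising a sum of squares
  over a convex set. Compactness (Montel, or tightness of measures) provides the minimiser, and its
  residual is the separating functional in explicit form.

  \<open>H2\<close> is defined by radial limits while the computations use Fourier coefficients;
  Fatou's theorem is proved to identify the two.

  The strictly positive weight exists because the functions in \<open>K_cont \<Theta>\<close> have
  no common zero on the circle unless all of them vanish there, a consequence of invariance under
  the backward shift.\<close>

lemma borel_measurable_cnj_comp [measurable (raw)]:
  "f \<in> borel_measurable M \<Longrightarrow> (\<lambda>x. cnj (f x)) \<in> borel_measurable M"
  by (rule borel_measurable_continuous_on[OF continuous_on_cnj[OF continuous_on_id]])

lemma L2_measurable [measurable_dest]: "f \<in> L2_space M \<Longrightarrow> f \<in> borel_measurable M"
  by (simp add: L2_space_def)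

lemma L2_integrable_sq: "f \<in> L2_space M \<Longrightarrow> integrable M (\<lambda>x. (cmod (f x))\<^sup>2)"
  by (simp add: L2_space_def)

lemma L2_norm_nonneg [simp]: "0 \<le> L2_norm M f"
  by (simp add: L2_norm_def)

lemma L2_norm_sq: "(L2_norm M f)\<^sup>2 = (\<integral>x. (cmod (f x))\<^sup>2 \<partial>M)"
  by (simp add: L2_norm_def)

lemma L2_spaceI_bound:
  assumes "f \<in> borel_measurable M" "integrable M g" "AE x in M. (cmod (f x))\<^sup>2 \<le> g x"
  shows "f \<in> L2_space M"
  unfolding L2_space_def using assms
  by (auto intro!: Bochner_Integration.integrable_bound[OF assms(2)] elim!: AE_mp)

lemma L2_space_bounded:
  assumes "finite_measure M" "f \<in> borel_measurable M" "AE x in M. cmod (f x) \<le> B"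
  shows "f \<in> L2_space M"
proof -
  interpret finite_measure M by fact
  show ?thesis
  proof (rule L2_spaceI_bound[of _ _ "\<lambda>_. B\<^sup>2"])
    show "AE x in M. (cmod (f x))\<^sup>2 \<le> B\<^sup>2" using assms(3) by eventually_elim (rule power_mono, auto)
  qed (use assms in auto)
qed

lemma L2_zero [simp]: "(\<lambda>x. 0) \<in> L2_space M"
  by (simp add: L2_space_def)

lemma L2_add:
  assumes "f \<in> L2_space M" "g \<in> L2_space M" shows "(\<lambda>x. f x + g x) \<in> L2_space M"
proof (rule L2_spaceI_bound)
  show "integrable M (\<lambda>x. 2 * (cmod (f x))\<^sup>2 + 2 * (cmod (g x))\<^sup>2)"
    using assms by (simp add: L2_space_def)
  have "(cmod (a + b))\<^sup>2 \<le> 2 * (cmod a)\<^sup>2 + 2 * (cmod b)\<^sup>2" for a b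
  proof -
    have "(cmod (a + b))\<^sup>2 \<le> (cmod a + cmod b)\<^sup>2" by (intro power_mono norm_triangle_ineq) auto
    also have "\<dots> \<le> 2 * (cmod a)\<^sup>2 + 2 * (cmod b)\<^sup>2"
      using sum_squares_bound[of "cmod a" "cmod b"] by (simp add: power2_sum)
    finally show ?thesis .
  qed
  then show "AE x in M. (cmod (f x + g x))\<^sup>2 \<le> 2 * (cmod (f x))\<^sup>2 + 2 * (cmod (g x))\<^sup>2" by simp
qed (use assms in measurable)

lemma L2_scale: "f \<in> L2_space M \<Longrightarrow> (\<lambda>x. c * f x) \<in> L2_space M"
  by (auto simp: L2_space_def norm_mult power_mult_distrib)

lemma L2_uminus: "f \<in> L2_space M \<Longrightarrow> (\<lambda>x. - f x) \<in> L2_space M"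
  by (auto simp: L2_space_def)

lemma L2_diff:
  "f \<in> L2_space M \<Longrightarrow> g \<in> L2_space M \<Longrightarrow> (\<lambda>x. f x - g x) \<in> L2_space M"
  using L2_add[of f M "\<lambda>x. - g x"] by (auto dest: L2_uminus)

lemma L2_sum:
  "(\<And>i. i \<in> I \<Longrightarrow> f i \<in> L2_space M) \<Longrightarrow> (\<lambda>x. \<Sum>i\<in>I. f i x) \<in> L2_space M"
  by (induction I rule: infinite_finite_induct) (auto intro: L2_add)

lemma L2_cnj: "f \<in> L2_space M \<Longrightarrow> (\<lambda>x. cnj (f x)) \<in> L2_space M"
  by (auto simp: L2_space_def)

lemma L2_mult_bounded:
  assumes "f \<in> L2_space M" "g \<in> borel_measurable M" "AE x in M. cmod (g x) \<le> B"
  shows "(\<lambda>x. g x * f x) \<in> L2_space M"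
proof (rule L2_spaceI_bound)
  show "integrable M (\<lambda>x. B\<^sup>2 * (cmod (f x))\<^sup>2)" using assms by (simp add: L2_space_def)
  show "AE x in M. (cmod (g x * f x))\<^sup>2 \<le> B\<^sup>2 * (cmod (f x))\<^sup>2"
    using assms(3) by eventually_elim
      (simp add: norm_mult power_mult_distrib mult_right_mono power_mono)
qed (use assms in measurable)

lemma L2_cong_AE:
  assumes "f \<in> L2_space M" "g \<in> borel_measurable M" "AE x in M. f x = g x"
  shows "g \<in> L2_space M"
  by (rule L2_spaceI_bound[OF assms(2) L2_integrable_sq[OF assms(1)]])
     (use assms(3) in \<open>auto elim!: AE_mp\<close>)

lemma L2_norm_cong_AE:
  assumes "f \<in> borel_measurable M" "g \<in> borel_measurable M" "AE x in M. f x = g x"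
  shows "L2_norm M f = L2_norm M g"
  unfolding L2_norm_def
  by (rule arg_cong[of _ _ sqrt], rule integral_cong_AE) (use assms in \<open>auto elim!: AE_mp\<close>)

lemma L2_inner_cong_AE:
  assumes "f \<in> borel_measurable M" "f' \<in> borel_measurable M" "AE x in M. f x = f' x"
    "g \<in> borel_measurable M" "g' \<in> borel_measurable M" "AE x in M. g x = g' x"
  shows "L2_inner M f g = L2_inner M f' g'"
  unfolding L2_inner_def
  by (rule integral_cong_AE) (use assms in \<open>auto elim!: AE_mp\<close>)

lemma L2_integrable_norm_mult:
  assumes "f \<in> L2_space M" "g \<in> L2_space M"
  shows "integrable M (\<lambda>x. cmod (f x) * cmod (g x))"
proof (rule Bochner_Integration.integrable_bound)
  show "integrable M (\<lambda>x. (cmod (f x))\<^sup>2 + (cmod (g x))\<^sup>2)"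
    using assms by (simp add: L2_space_def)
  have "norm (cmod (f x) * cmod (g x)) \<le> norm ((cmod (f x))\<^sup>2 + (cmod (g x))\<^sup>2)" for x
  proof -
    have "0 \<le> cmod (f x) * cmod (g x)" "2 * (cmod (f x) * cmod (g x)) \<le> (cmod (f x))\<^sup>2 + (cmod (g x))\<^sup>2"
      using sum_squares_bound[of "cmod (f x)" "cmod (g x)"] by (auto simp: mult.assoc)
    then have "cmod (f x) * cmod (g x) \<le> (cmod (f x))\<^sup>2 + (cmod (g x))\<^sup>2" by linarith
    then show ?thesis by simp
  qed
  then show "AE x in M. norm (cmod (f x) * cmod (g x)) \<le> norm ((cmod (f x))\<^sup>2 + (cmod (g x))\<^sup>2)"
    by simp
qed (use assms in measurable)

lemma L2_integrable_mult:
  assumes "f \<in> L2_space M" "g \<in> L2_space M"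
  shows "integrable M (\<lambda>x. f x * g x)"
  by (rule Bochner_Integration.integrable_bound[OF L2_integrable_norm_mult[OF assms]])
     (use assms in \<open>auto simp: norm_mult\<close>)

lemma L2_integrable_inner:
  "f \<in> L2_space M \<Longrightarrow> g \<in> L2_space M \<Longrightarrow> integrable M (\<lambda>x. f x * cnj (g x))"
  by (intro L2_integrable_mult L2_cnj)

lemma L2_norm_mult_le:
  assumes f: "f \<in> L2_space M" and g: "g \<in> L2_space M"
  shows "(\<integral>x. cmod (f x) * cmod (g x) \<partial>M) \<le> L2_norm M f * L2_norm M g"
proof -
  define a b c where "a = (\<integral>x. (cmod (f x))\<^sup>2 \<partial>M)" and "b = (\<integral>x. (cmod (g x))\<^sup>2 \<partial>M)"
    and "c = (\<integral>x. cmod (f x) * cmod (g x) \<partial>M)"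
  have nn: "0 \<le> a" "0 \<le> b" "0 \<le> c" by (simp_all add: a_def b_def c_def)
  have q: "0 \<le> a * t\<^sup>2 - 2 * c * t + b" for t
  proof -
    have "0 \<le> (\<integral>x. (cmod (f x) * t - cmod (g x))\<^sup>2 \<partial>M)" by simp
    also have "\<dots> = (\<integral>x. t\<^sup>2 * (cmod (f x))\<^sup>2 - (2 * t) * (cmod (f x) * cmod (g x)) + (cmod (g x))\<^sup>2 \<partial>M)"
      by (rule Bochner_Integration.integral_cong) (auto simp: power2_diff algebra_simps power_mult_distrib)
    also have "\<dots> = t\<^sup>2 * a - (2 * t) * c + b"
      using f g by (simp add: a_def b_def c_def L2_integrable_sq L2_integrable_norm_mult)
    finally show ?thesis by (simp add: algebra_simps)
  qed
  have "c\<^sup>2 \<le> a * b"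
  proof (cases "a = 0")
    case True
    have "c = 0"
    proof (rule ccontr)
      assume "c \<noteq> 0"
      \<comment> \<open>At this \<open>t\<close> the expression \<open>b - 2 * c * t\<close> equals
        \<open>-1\<close>.\<close>
      then show False using q[of "(b + 1) / (2 * c)"] True by (simp add: field_simps)
    qed
    then show ?thesis using nn by simp
  next
    case False
    then have "a > 0" using nn by simp
    have "0 \<le> a * (a * (c / a)\<^sup>2 - 2 * c * (c / a) + b)"
      using q[of "c / a"] \<open>a > 0\<close> by (intro mult_nonneg_nonneg) auto
    also have "\<dots> = a * b - c\<^sup>2"
      using \<open>a > 0\<close> by (simp add: field_simps power2_eq_square)
    finally show ?thesis by simp
  qed
  then have "c \<le> sqrt (a * b)" by (rule real_le_rsqrt)
  then show ?thesis by (simp add: L2_norm_def a_def b_def c_def real_sqrt_mult)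
qed

lemma L2_integral_mult_le:
  assumes "f \<in> L2_space M" "g \<in> L2_space M"
  shows "cmod (\<integral>x. f x * g x \<partial>M) \<le> L2_norm M f * L2_norm M g"
proof -
  have "cmod (\<integral>x. f x * g x \<partial>M) \<le> (\<integral>x. cmod (f x * g x) \<partial>M)" by (rule integral_norm_bound)
  also have "\<dots> \<le> L2_norm M f * L2_norm M g"
    using L2_norm_mult_le[OF assms] by (simp add: norm_mult)
  finally show ?thesis .
qed

lemma L2_norm_cnj [simp]: "L2_norm M (\<lambda>x. cnj (f x)) = L2_norm M f"
  by (simp add: L2_norm_def)

lemma L2_Cauchy_Schwarz:
  assumes "f \<in> L2_space M" "g \<in> L2_space M"
  shows "cmod (L2_inner M f g) \<le> L2_norm M f * L2_norm M g"
  using L2_integral_mult_le[OF assms(1) L2_cnj[OF assms(2)]] by (simp add: L2_inner_def)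

lemma L2_norm_triangle:
  assumes f: "f \<in> L2_space M" and g: "g \<in> L2_space M"
  shows "L2_norm M (\<lambda>x. f x + g x) \<le> L2_norm M f + L2_norm M g"
proof (rule power2_le_imp_le)
  have "(L2_norm M (\<lambda>x. f x + g x))\<^sup>2 \<le> (\<integral>x. (cmod (f x))\<^sup>2 + 2 * (cmod (f x) * cmod (g x)) + (cmod (g x))\<^sup>2 \<partial>M)"
    unfolding L2_norm_sq
  proof (rule integral_mono)
    show "integrable M (\<lambda>x. (cmod (f x + g x))\<^sup>2)" using L2_add[OF f g] by (rule L2_integrable_sq)
    show "integrable M (\<lambda>x. (cmod (f x))\<^sup>2 + 2 * (cmod (f x) * cmod (g x)) + (cmod (g x))\<^sup>2)"
      using f g by (simp add: L2_integrable_sq L2_integrable_norm_mult)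
    fix x
    have "(cmod (f x + g x))\<^sup>2 \<le> (cmod (f x) + cmod (g x))\<^sup>2"
      by (intro power_mono norm_triangle_ineq) auto
    then show "(cmod (f x + g x))\<^sup>2 \<le> (cmod (f x))\<^sup>2 + 2 * (cmod (f x) * cmod (g x)) + (cmod (g x))\<^sup>2"
      by (simp add: power2_sum)
  qed
  also have "\<dots> = (L2_norm M f)\<^sup>2 + 2 * (\<integral>x. cmod (f x) * cmod (g x) \<partial>M) + (L2_norm M g)\<^sup>2"
    using f g by (simp add: L2_integrable_sq L2_integrable_norm_mult L2_norm_sq)
  also have "\<dots> \<le> (L2_norm M f + L2_norm M g)\<^sup>2"
    using L2_norm_mult_le[OF f g] by (simp add: power2_sum)
  finally show "(L2_norm M (\<lambda>x. f x + g x))\<^sup>2 \<le> (L2_norm M f + L2_norm M g)\<^sup>2" .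
qed simp

lemma L2_norm_scale: "L2_norm M (\<lambda>x. c * f x) = cmod c * L2_norm M f"
  by (simp add: L2_norm_def norm_mult power_mult_distrib real_sqrt_mult)

lemma L2_norm_minus_commute: "L2_norm M (\<lambda>x. f x - g x) = L2_norm M (\<lambda>x. g x - f x)"
  by (simp add: L2_norm_def norm_minus_commute)

lemma L2_norm_triangle_diff:
  assumes "f \<in> L2_space M" "g \<in> L2_space M" "h \<in> L2_space M"
  shows "L2_norm M (\<lambda>x. f x - h x) \<le> L2_norm M (\<lambda>x. f x - g x) + L2_norm M (\<lambda>x. g x - h x)"
  using L2_norm_triangle[OF L2_diff[OF assms(1,2)] L2_diff[OF assms(2,3)]] by simp

lemma L2_norm_triangle_sub:
  assumes "f \<in> L2_space M" "g \<in> L2_space M"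
  shows "L2_norm M (\<lambda>x. f x - g x) \<le> L2_norm M f + L2_norm M g"
  using L2_norm_triangle[OF assms(1) L2_uminus[OF assms(2)]] by (simp add: L2_norm_def)

lemma L2_norm_reverse_triangle:
  assumes "f \<in> L2_space M" "g \<in> L2_space M"
  shows "\<bar>L2_norm M f - L2_norm M g\<bar> \<le> L2_norm M (\<lambda>x. f x - g x)"
  using L2_norm_triangle[OF L2_diff[OF assms] assms(2)]
    L2_norm_triangle[OF L2_diff[OF assms(2,1)] assms(1)] L2_norm_minus_commute[of M f g]
  by simp

lemma L2_norm_sum_le:
  assumes "finite I" "\<And>i. i \<in> I \<Longrightarrow> f i \<in> L2_space M"
  shows "L2_norm M (\<lambda>x. \<Sum>i\<in>I. f i x) \<le> (\<Sum>i\<in>I. L2_norm M (f i))"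
  using assms
proof (induction I rule: finite_induct)
  case empty then show ?case by (simp add: L2_norm_def)
next
  case (insert i I)
  have "L2_norm M (\<lambda>x. f i x + (\<Sum>i\<in>I. f i x)) \<le> L2_norm M (f i) + L2_norm M (\<lambda>x. \<Sum>i\<in>I. f i x)"
    using insert.prems by (intro L2_norm_triangle L2_sum) auto
  also have "\<dots> \<le> L2_norm M (f i) + (\<Sum>i\<in>I. L2_norm M (f i))" using insert by simp
  finally show ?case using insert by simp
qed

lemma L2_norm_mono:
  assumes "g \<in> L2_space M" "f \<in> borel_measurable M" "AE x in M. cmod (f x) \<le> cmod (g x)"
  shows "L2_norm M f \<le> L2_norm M g"
  unfolding L2_norm_def
proof (rule real_sqrt_le_mono, rule integral_mono_AE)
  show *: "AE x in M. (cmod (f x))\<^sup>2 \<le> (cmod (g x))\<^sup>2"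
    using assms(3) by (auto elim!: AE_mp intro!: power_mono)
  show "integrable M (\<lambda>x. (cmod (g x))\<^sup>2)" using assms(1) by (rule L2_integrable_sq)
  show "integrable M (\<lambda>x. (cmod (f x))\<^sup>2)"
    using L2_spaceI_bound[OF assms(2) L2_integrable_sq[OF assms(1)] *] by (rule L2_integrable_sq)
qed

lemma L2_norm_mult_bounded:
  assumes "f \<in> L2_space M" "g \<in> borel_measurable M" "AE x in M. cmod (g x) \<le> B" "0 \<le> B"
  shows "L2_norm M (\<lambda>x. g x * f x) \<le> B * L2_norm M f"
proof -
  have "L2_norm M (\<lambda>x. g x * f x) \<le> L2_norm M (\<lambda>x. of_real B * f x)"
  proof (rule L2_norm_mono)
    show "AE x in M. cmod (g x * f x) \<le> cmod (complex_of_real B * f x)"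
      using assms(3) by eventually_elim (use assms(4) in \<open>simp add: norm_mult mult_right_mono\<close>)
  qed (use assms in \<open>auto intro: L2_scale\<close>)
  then show ?thesis using assms(4) by (simp add: L2_norm_scale)
qed

lemma (in prob_space) L2_norm_le_bound:
  assumes "f \<in> borel_measurable M" "AE x in M. cmod (f x) \<le> B" "0 \<le> B"
  shows "L2_norm M f \<le> B"
  using L2_norm_mult_bounded[of "\<lambda>_. 1" M f B] assms
  by (simp add: L2_norm_def[of M "\<lambda>x. 1"] prob_space L2_space_def)

lemma L2_norm_eq_0_iff:
  assumes "f \<in> L2_space M"
  shows "L2_norm M f = 0 \<longleftrightarrow> (AE x in M. f x = 0)"
  unfolding L2_norm_def real_sqrt_eq_zero_cancel_iff
  by (subst integral_nonneg_eq_0_iff_AE) (use assms in \<open>auto simp: L2_integrable_sq\<close>)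

lemma L2_inner_add_left:
  "f \<in> L2_space M \<Longrightarrow> g \<in> L2_space M \<Longrightarrow> h \<in> L2_space M \<Longrightarrow>
   L2_inner M (\<lambda>x. f x + g x) h = L2_inner M f h + L2_inner M g h"
  by (simp add: L2_inner_def algebra_simps L2_integrable_inner)

lemma L2_inner_add_right:
  "f \<in> L2_space M \<Longrightarrow> g \<in> L2_space M \<Longrightarrow> h \<in> L2_space M \<Longrightarrow>
   L2_inner M h (\<lambda>x. f x + g x) = L2_inner M h f + L2_inner M h g"
  by (simp add: L2_inner_def algebra_simps L2_integrable_inner)

lemma L2_inner_diff_left:
  "f \<in> L2_space M \<Longrightarrow> g \<in> L2_space M \<Longrightarrow> h \<in> L2_space M \<Longrightarrow>
   L2_inner M (\<lambda>x. f x - g x) h = L2_inner M f h - L2_inner M g h"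
  by (simp add: L2_inner_def algebra_simps L2_integrable_inner)

lemma L2_inner_diff_right:
  "f \<in> L2_space M \<Longrightarrow> g \<in> L2_space M \<Longrightarrow> h \<in> L2_space M \<Longrightarrow>
   L2_inner M h (\<lambda>x. f x - g x) = L2_inner M h f - L2_inner M h g"
  by (simp add: L2_inner_def algebra_simps L2_integrable_inner)

lemma L2_inner_scale_left: "L2_inner M (\<lambda>x. c * f x) g = c * L2_inner M f g"
  by (simp add: L2_inner_def mult.assoc)

lemma L2_inner_scale_right: "L2_inner M f (\<lambda>x. c * g x) = cnj c * L2_inner M f g"
proof -
  have "L2_inner M f (\<lambda>x. c * g x) = (\<integral>x. cnj c * (f x * cnj (g x)) \<partial>M)"
    unfolding L2_inner_def by (rule Bochner_Integration.integral_cong) auto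
  then show ?thesis by (simp add: L2_inner_def)
qed

lemma L2_inner_sum_left:
  assumes "\<And>i. i \<in> I \<Longrightarrow> f i \<in> L2_space M" "g \<in> L2_space M"
  shows "L2_inner M (\<lambda>x. \<Sum>i\<in>I. f i x) g = (\<Sum>i\<in>I. L2_inner M (f i) g)"
  using assms by (simp add: L2_inner_def sum_distrib_right L2_integrable_inner)

lemma L2_inner_commute: "L2_inner M f g = cnj (L2_inner M g f)"
proof -
  have "cnj (L2_inner M g f) = (\<integral>x. cnj (g x * cnj (f x)) \<partial>M)"
    unfolding L2_inner_def by (rule Bochner_Integration.integral_cnj [symmetric])
  then show ?thesis by (simp add: L2_inner_def mult.commute)
qed

lemma L2_inner_self: "L2_inner M f f = of_real ((L2_norm M f)\<^sup>2)"
  unfolding L2_inner_def L2_norm_sq complex_norm_square [symmetric]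
  by (rule integral_complex_of_real)

lemma L2_norm_sq_diff_scale:
  assumes f: "f \<in> L2_space M" and g: "g \<in> L2_space M"
  shows "(L2_norm M (\<lambda>x. f x - c * g x))\<^sup>2 =
    (L2_norm M f)\<^sup>2 - 2 * Re (cnj c * L2_inner M f g) + (cmod c)\<^sup>2 * (L2_norm M g)\<^sup>2"
proof -
  note cg = L2_scale[OF g, of c]
  have "complex_of_real ((L2_norm M (\<lambda>x. f x - c * g x))\<^sup>2) =
     L2_inner M f f - c * cnj (L2_inner M f g) - cnj c * L2_inner M f g + c * cnj c * L2_inner M g g"
    unfolding L2_inner_self[symmetric]
    using f g cg L2_inner_commute[of M g f]
    by (simp add: L2_inner_diff_left L2_inner_diff_right L2_diff L2_inner_scale_left
        L2_inner_scale_right algebra_simps)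
  from arg_cong[OF this, of Re] show ?thesis
    by (simp add: L2_inner_self complex_norm_square[symmetric] cmod_power2 power2_eq_square algebra_simps)
qed

text \<open>First-order condition of a minimisation in one direction: dividing by \<open>t\<close>
  and letting it tend to 0 removes the quadratic term. Only \<open>t\<close> between 0 and 1 is
  assumed, which is all that a segment inside a convex set offers.\<close>

lemma nonpos_if_quadratic_bound:
  fixes a b :: real
  assumes "\<And>t. 0 < t \<Longrightarrow> t \<le> 1 \<Longrightarrow> a * t \<le> b * t\<^sup>2"
  shows "a \<le> 0"
proof (rule ccontr)
  assume "\<not> a \<le> 0"
  define t where "t = min 1 (a / (2 * (\<bar>b\<bar> + 1)))"
  have t: "0 < t" "t \<le> 1" "t \<le> a / (2 * (\<bar>b\<bar> + 1))" using \<open>\<not> a \<le> 0\<close> by (auto simp: t_def)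
  have "a \<le> b * t" using assms[OF t(1,2)] t(1) by (simp add: power2_eq_square)
  also have "\<dots> \<le> (\<bar>b\<bar> + 1) * t" using t by (intro mult_right_mono) auto
  also have "\<dots> \<le> a / 2" using t(3) by (simp add: field_simps)
  finally show False using \<open>\<not> a \<le> 0\<close> by simp
qed

text \<open>A subsequence whose consecutive differences \<open>d k\<close> have norm below
  \<open>1 / 2 ^ k\<close> converges a.e.: the sum of the
  \<open>2 ^ k * (cmod (d k x))\<^sup>2\<close> has finite integral and controls the sum of the
  \<open>cmod (d k x)\<close> up to a geometric series. Fatou's lemma turns this into norm
  convergence of the whole sequence.\<close>

lemma L2_complete:
  assumes u: "\<And>n. u n \<in> L2_space M"
    and cauchy: "\<And>e. e > 0 \<Longrightarrow> \<exists>N. \<forall>i\<ge>N. \<forall>j\<ge>N. L2_norm M (\<lambda>x. u i x - u j x) < e"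
  obtains f where "f \<in> L2_space M" "(\<lambda>n. L2_norm M (\<lambda>x. u n x - f x)) \<longlonglongrightarrow> 0"
proof -
  have "\<forall>k. \<exists>N. \<forall>i\<ge>N. \<forall>j\<ge>N. L2_norm M (\<lambda>x. u i x - u j x) < 1 / 2 ^ k"
    by (intro allI cauchy) simp
  then obtain N where N: "\<And>k i j. i \<ge> N k \<Longrightarrow> j \<ge> N k \<Longrightarrow> L2_norm M (\<lambda>x. u i x - u j x) < 1 / 2 ^ k"
    by metis
  define s where "s = rec_nat (N 0) (\<lambda>k m. Suc (max m (N (Suc k))))"
  have sS: "s (Suc k) = Suc (max (s k) (N (Suc k)))" for k by (simp add: s_def)
  have sm: "strict_mono s" by (rule strict_monoI_Suc) (simp add: sS)
  have sN: "s k \<ge> N k" for k by (cases k) (auto simp: sS, simp add: s_def)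
  define d where "d k x = u (s (Suc k)) x - u (s k) x" for k x
  have dL2: "d k \<in> L2_space M" for k unfolding d_def by (intro L2_diff u)
  have dn: "(\<integral>\<^sup>+x. ennreal ((cmod (d k x))\<^sup>2) \<partial>M) \<le> ennreal ((1/4) ^ k)" for k
  proof -
    have "L2_norm M (d k) < 1 / 2 ^ k"
      unfolding d_def using N[of k "s (Suc k)" "s k"] sN[of k] strict_monoD[OF sm, of k "Suc k"] by simp
    then have "(L2_norm M (d k))\<^sup>2 \<le> (1 / 2 ^ k)\<^sup>2" by (intro power_mono) auto
    also have "(1 / 2 ^ k)\<^sup>2 = (1/4::real) ^ k"
      by (simp add: power_divide power2_eq_square power_mult_distrib[symmetric])
    finally show ?thesis
      by (subst nn_integral_eq_integral) (auto simp: L2_norm_sq L2_integrable_sq[OF dL2])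
  qed
  have "(\<integral>\<^sup>+x. (\<Sum>k. ennreal (2 ^ k * (cmod (d k x))\<^sup>2)) \<partial>M) = (\<Sum>k. \<integral>\<^sup>+x. ennreal (2 ^ k * (cmod (d k x))\<^sup>2) \<partial>M)"
    by (rule nn_integral_suminf) (use dL2 in measurable)
  also have "\<dots> \<le> (\<Sum>k. ennreal ((1/2) ^ k))"
  proof (rule suminf_le)
    fix k
    have "(\<integral>\<^sup>+x. ennreal (2 ^ k * (cmod (d k x))\<^sup>2) \<partial>M) = ennreal (2 ^ k) * (\<integral>\<^sup>+x. ennreal ((cmod (d k x))\<^sup>2) \<partial>M)"
      using dL2[of k] by (subst nn_integral_cmult[symmetric]) (auto simp: ennreal_mult)
    also have "\<dots> \<le> ennreal (2 ^ k) * ennreal ((1/4) ^ k)" by (intro mult_left_mono dn) simp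
    also have "\<dots> = ennreal ((1/2) ^ k)"
      by (subst ennreal_mult[symmetric]) (auto simp: power_mult_distrib[symmetric])
    finally show "(\<integral>\<^sup>+x. ennreal (2 ^ k * (cmod (d k x))\<^sup>2) \<partial>M) \<le> ennreal ((1/2) ^ k)" .
  qed auto
  also have "\<dots> < \<infinity>"
    by (subst suminf_ennreal2) (auto simp: summable_geometric)
  finally have fin: "(\<integral>\<^sup>+x. (\<Sum>k. ennreal (2 ^ k * (cmod (d k x))\<^sup>2)) \<partial>M) \<noteq> \<infinity>" by simp
  have "AE x in M. (\<Sum>k. ennreal (2 ^ k * (cmod (d k x))\<^sup>2)) \<noteq> \<infinity>"
    by (rule nn_integral_PInf_AE[OF _ fin]) (use dL2 in measurable)
  then have conv: "AE x in M. convergent (\<lambda>k. u (s k) x)"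
  proof eventually_elim
    case (elim x)
    have "summable (\<lambda>k. 2 ^ k * (cmod (d k x))\<^sup>2)"
      using elim by (intro summable_suminf_not_top) auto
    then have "summable (\<lambda>k. (1/2) ^ k + 2 ^ k * (cmod (d k x))\<^sup>2)"
      by (intro summable_add) (auto simp: summable_geometric)
    then have "summable (\<lambda>k. norm (d k x))"
    proof (rule summable_comparison_test'[where N=0])
      fix k :: nat
      \<comment> \<open>Arithmetic-geometric mean inequality for \<open>cmod (d k x) * 2 ^ k\<close>
        and 1; dividing by \<open>2 ^ k\<close> leaves the summable term
        \<open>(1/2) ^ k\<close>.\<close>
      have "2 * (cmod (d k x) * 2 ^ k) * 1 \<le> (cmod (d k x) * 2 ^ k)\<^sup>2 + 1\<^sup>2" by (rule sum_squares_bound)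
      moreover have "(cmod (d k x) * 2 ^ k)\<^sup>2 + 1\<^sup>2 = 2 ^ k * ((1/2) ^ k + 2 ^ k * (cmod (d k x))\<^sup>2)"
        by (simp add: power_mult_distrib power2_eq_square algebra_simps power_one_over)
      ultimately have "2 ^ k * (2 * cmod (d k x)) \<le> 2 ^ k * ((1/2) ^ k + 2 ^ k * (cmod (d k x))\<^sup>2)"
        by (simp add: algebra_simps)
      then have "2 * cmod (d k x) \<le> (1/2) ^ k + 2 ^ k * (cmod (d k x))\<^sup>2"
        by (rule mult_left_le_imp_le) simp
      then show "norm (norm (d k x)) \<le> (1/2) ^ k + 2 ^ k * (cmod (d k x))\<^sup>2"
        using norm_ge_zero[of "d k x"] unfolding real_norm_def abs_norm_cancel by linarith
    qed
    then have "summable (\<lambda>k. d k x)" by (rule summable_norm_cancel)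
    then have "convergent (\<lambda>n. \<Sum>k<n. d k x)" by (simp add: summable_iff_convergent)
    then have "convergent (\<lambda>n. (\<Sum>k<n. d k x) + u (s 0) x)"
      by (intro convergent_add convergent_const)
    moreover have "(\<Sum>k<n. d k x) + u (s 0) x = u (s n) x" for n
      unfolding d_def by (subst sum_lessThan_telescope) simp
    ultimately show ?case by simp
  qed
  define f where "f x = lim (\<lambda>k. u (s k) x)" for x
  have fm [measurable]: "f \<in> borel_measurable M"
    unfolding f_def by (rule borel_measurable_lim_metric) (use u in measurable)
  \<comment> \<open>Fatou's lemma in the index \<open>j\<close> of the subsequence, with
    \<open>n\<close> fixed: here the estimate reaches all \<open>n \<ge> N k\<close> and not only
    the subsequence.\<close>
  have bound: "(\<integral>\<^sup>+x. ennreal ((cmod (u n x - f x))\<^sup>2) \<partial>M) \<le> ennreal ((1 / 2 ^ k)\<^sup>2)" if "n \<ge> N k" for n k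
  proof -
    have "(\<integral>\<^sup>+x. ennreal ((cmod (u n x - f x))\<^sup>2) \<partial>M) =
          (\<integral>\<^sup>+x. liminf (\<lambda>j. ennreal ((cmod (u n x - u (s j) x))\<^sup>2)) \<partial>M)"
    proof (rule nn_integral_cong_AE)
      show "AE x in M. ennreal ((cmod (u n x - f x))\<^sup>2) = liminf (\<lambda>j. ennreal ((cmod (u n x - u (s j) x))\<^sup>2))"
        using conv
      proof eventually_elim
        case (elim x)
        then have "(\<lambda>j. u (s j) x) \<longlonglongrightarrow> f x" by (simp add: f_def convergent_LIMSEQ_iff)
        then have "(\<lambda>j. ennreal ((cmod (u n x - u (s j) x))\<^sup>2)) \<longlonglongrightarrow> ennreal ((cmod (u n x - f x))\<^sup>2)"
          by (intro tendsto_intros)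
        from lim_imp_Liminf[OF _ this] show ?case by simp
      qed
    qed
    also have "\<dots> \<le> liminf (\<lambda>j. \<integral>\<^sup>+x. ennreal ((cmod (u n x - u (s j) x))\<^sup>2) \<partial>M)"
      by (rule nn_integral_liminf) (use u in measurable)
    also have "\<dots> \<le> ennreal ((1 / 2 ^ k)\<^sup>2)"
    proof (rule Liminf_le)
      show "\<forall>\<^sub>F j in sequentially. (\<integral>\<^sup>+x. ennreal ((cmod (u n x - u (s j) x))\<^sup>2) \<partial>M) \<le> ennreal ((1 / 2 ^ k)\<^sup>2)"
        using eventually_ge_at_top[of "N k"]
      proof eventually_elim
        case (elim j)
        have "s j \<ge> N k" using elim strict_mono_imp_increasing[OF sm, of j] by simp
        then have "L2_norm M (\<lambda>x. u n x - u (s j) x) < 1 / 2 ^ k" using N that by blast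
        then have "(L2_norm M (\<lambda>x. u n x - u (s j) x))\<^sup>2 \<le> (1 / 2 ^ k)\<^sup>2" by (intro power_mono) auto
        then show ?case
          by (subst nn_integral_eq_integral) (auto simp: L2_norm_sq L2_integrable_sq[OF L2_diff[OF u u]])
      qed
    qed simp
    finally show ?thesis .
  qed
  have dif: "(\<lambda>x. u n x - f x) \<in> L2_space M \<and> L2_norm M (\<lambda>x. u n x - f x) \<le> 1 / 2 ^ k" if "n \<ge> N k" for n k
  proof
    have "(\<integral>\<^sup>+x. ennreal (norm ((cmod (u n x - f x))\<^sup>2)) \<partial>M) < \<infinity>"
      using bound[OF that] by (auto intro: le_less_trans)
    then have i: "integrable M (\<lambda>x. (cmod (u n x - f x))\<^sup>2)"
      by (intro integrableI_bounded) (use u in measurable)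
    then show 1: "(\<lambda>x. u n x - f x) \<in> L2_space M" using u[of n] by (auto simp: L2_space_def)
    have "(L2_norm M (\<lambda>x. u n x - f x))\<^sup>2 \<le> (1 / 2 ^ k)\<^sup>2"
      using bound[OF that] i
      by (subst (asm) nn_integral_eq_integral) (auto simp: L2_norm_sq)
    then show "L2_norm M (\<lambda>x. u n x - f x) \<le> 1 / 2 ^ k" by (rule power2_le_imp_le) simp
  qed
  show ?thesis
  proof (rule that)
    have "(\<lambda>x. u (N 0) x - (u (N 0) x - f x)) \<in> L2_space M" 
      by (rule L2_diff[OF u]) (use dif[of 0 "N 0"] in simp)
    moreover have "(\<lambda>x. u (N 0) x - (u (N 0) x - f x)) = f" by auto
    ultimately show "f \<in> L2_space M" by simp
    show "(\<lambda>n. L2_norm M (\<lambda>x. u n x - f x)) \<longlonglongrightarrow> 0"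
    proof (rule LIMSEQ_I)
      fix r :: real assume "r > 0"
      then obtain k where k: "(1/2) ^ k < r" using real_arch_pow_inv[of r "1/2"] by auto
      have "norm (L2_norm M (\<lambda>x. u n x - f x) - 0) < r" if "n \<ge> N k" for n
        using dif[OF that] k by (simp add: power_one_over)
      then show "\<exists>no. \<forall>n\<ge>no. norm (L2_norm M (\<lambda>x. u n x - f x) - 0) < r" by blast
    qed
  qed
qed

lemma L2_limit_inner:
  assumes "\<And>n. u n \<in> L2_space M" "f \<in> L2_space M" "(\<lambda>n. L2_norm M (\<lambda>x. u n x - f x)) \<longlonglongrightarrow> 0"
    "g \<in> L2_space M"
  shows "(\<lambda>n. L2_inner M (u n) g) \<longlonglongrightarrow> L2_inner M f g"
proof (rule LIM_zero_cancel, rule Lim_null_comparison)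
  show "\<forall>\<^sub>F n in sequentially. norm (L2_inner M (u n) g - L2_inner M f g)
      \<le> L2_norm M (\<lambda>x. u n x - f x) * L2_norm M g"
    using L2_Cauchy_Schwarz[OF L2_diff[OF assms(1) assms(2)] assms(4)] assms
    by (simp add: L2_inner_diff_left)
  show "(\<lambda>n. L2_norm M (\<lambda>x. u n x - f x) * L2_norm M g) \<longlonglongrightarrow> 0"
    using tendsto_mult_right[OF assms(3), of "L2_norm M g"] by simp
qed

lemma L2_limit_norm:
  assumes "\<And>n. u n \<in> L2_space M" "f \<in> L2_space M" "(\<lambda>n. L2_norm M (\<lambda>x. u n x - f x)) \<longlonglongrightarrow> 0"
  shows "(\<lambda>n. L2_norm M (u n)) \<longlonglongrightarrow> L2_norm M f"
proof (rule LIM_zero_cancel, rule Lim_null_comparison[OF _ assms(3)])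
  show "\<forall>\<^sub>F n in sequentially. norm (L2_norm M (u n) - L2_norm M f) \<le> L2_norm M (\<lambda>x. u n x - f x)"
    using L2_norm_reverse_triangle[OF assms(1) assms(2)] by simp
qed

lemma L2_limit_unique:
  assumes "\<And>n. u n \<in> L2_space M" "f \<in> L2_space M" "g \<in> L2_space M"
    "(\<lambda>n. L2_norm M (\<lambda>x. u n x - f x)) \<longlonglongrightarrow> 0" "(\<lambda>n. L2_norm M (\<lambda>x. u n x - g x)) \<longlonglongrightarrow> 0"
  shows "AE x in M. f x = g x"
proof -
  have "(\<lambda>n. L2_norm M (\<lambda>x. f x - g x)) \<longlonglongrightarrow> 0"
  proof (rule Lim_null_comparison)
    show "\<forall>\<^sub>F n in sequentially. norm (L2_norm M (\<lambda>x. f x - g x))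
        \<le> L2_norm M (\<lambda>x. u n x - f x) + L2_norm M (\<lambda>x. u n x - g x)"
      using L2_norm_triangle_diff[OF assms(2) assms(1) assms(3)] by (simp add: L2_norm_minus_commute)
  qed (use tendsto_add[OF assms(4,5)] in simp)
  then have "L2_norm M (\<lambda>x. f x - g x) = 0" by (simp add: LIMSEQ_const_iff)
  then show ?thesis using L2_norm_eq_0_iff[OF L2_diff[OF assms(2,3)]] by simp
qed

lemma L2_parallelogram:
  assumes "f \<in> L2_space M" "g \<in> L2_space M"
  shows "(L2_norm M (\<lambda>x. f x + g x))\<^sup>2 + (L2_norm M (\<lambda>x. f x - g x))\<^sup>2
    = 2 * (L2_norm M f)\<^sup>2 + 2 * (L2_norm M g)\<^sup>2"
  using L2_norm_sq_diff_scale[OF assms, of 1] L2_norm_sq_diff_scale[OF assms, of "-1"] by simp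

text \<open>\<open>K\<close> is given as an annihilator, so it is closed because inner products are
  continuous, and the minimising sequence for the distance to \<open>h\<close> has its limit in
  \<open>K\<close>. The model space is later written in this form to obtain
  \<open>model_projection\<close>.\<close>

lemma L2_orthogonal_projection:
  assumes B: "B \<subseteq> L2_space M" and h: "h \<in> L2_space M"
  defines "K \<equiv> {f \<in> L2_space M. \<forall>b\<in>B. L2_inner M f b = 0}"
  obtains k where "k \<in> K" "\<And>g. g \<in> K \<Longrightarrow> L2_inner M (\<lambda>x. h x - k x) g = 0"
proof -
  have KL: "f \<in> L2_space M" if "f \<in> K" for f using that by (simp add: K_def)
  have Klin: "(\<lambda>x. f x + c * g x) \<in> K" if "f \<in> K" "g \<in> K" for f g c
    using that B by (auto simp: K_def L2_inner_add_left L2_add L2_scale L2_inner_scale_left subset_iff)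
  have K0: "(\<lambda>x. 0) \<in> K" by (simp add: K_def L2_inner_def)
  define n where "n k = L2_norm M (\<lambda>x. h x - k x)" for k
  define d where "d = (INF k\<in>K. (n k)\<^sup>2)"
  have bdd: "bdd_below ((\<lambda>k. (n k)\<^sup>2) ` K)" by (rule bdd_belowI[of _ 0]) auto
  have dle: "d \<le> (n k)\<^sup>2" if "k \<in> K" for k unfolding d_def by (rule cINF_lower[OF bdd that])
  have "\<exists>k\<in>K. (n k)\<^sup>2 < d + e" if "e > 0" for e
    using cInf_lessD[of "(\<lambda>k. (n k)\<^sup>2) ` K" "d + e"] K0 that by (auto simp: d_def)
  then have "\<forall>j::nat. \<exists>k\<in>K. (n k)\<^sup>2 < d + 1 / Suc j" by simp
  then obtain u where uK: "\<And>j. u j \<in> K" and u: "\<And>j::nat. (n (u j))\<^sup>2 < d + 1 / Suc j" by metis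
  have close: "(L2_norm M (\<lambda>x. u i x - u j x))\<^sup>2 \<le> 2 / Suc i + 2 / Suc j" for i j
  proof -
    \<comment> \<open>The midpoint of two almost minimal elements still has squared distance at
      least \<open>d\<close>, so the parallelogram law bounds their difference.\<close>
    define mid where "mid x = (1/2) * u i x + (1/2) * u j x" for x
    have midK: "mid \<in> K"
      using Klin[OF Klin[OF K0 uK[of i], of "1/2"] uK[of j], of "1/2"] by (simp add: mid_def[abs_def])
    have e1: "(\<lambda>x. (h x - u i x) + (h x - u j x)) = (\<lambda>x. 2 * (h x - mid x))"
      by (simp add: mid_def fun_eq_iff)
    have e2: "(\<lambda>x. (h x - u i x) - (h x - u j x)) = (\<lambda>x. u j x - u i x)" by auto
    have "4 * (n mid)\<^sup>2 + (L2_norm M (\<lambda>x. u j x - u i x))\<^sup>2 = 2 * (n (u i))\<^sup>2 + 2 * (n (u j))\<^sup>2"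
      using L2_parallelogram[OF L2_diff[OF h KL[OF uK[of i]]] L2_diff[OF h KL[OF uK[of j]]]]
      unfolding e1 e2 L2_norm_scale n_def by (simp add: power_mult_distrib)
    moreover have "d \<le> (n mid)\<^sup>2" by (rule dle[OF midK])
    ultimately have "(L2_norm M (\<lambda>x. u j x - u i x))\<^sup>2 \<le> 2 * (1 / Suc i) + 2 * (1 / Suc j)"
      using u[of i] u[of j] by linarith
    then show ?thesis by (subst L2_norm_minus_commute) simp
  qed
  obtain k where k: "k \<in> L2_space M" "(\<lambda>n. L2_norm M (\<lambda>x. u n x - k x)) \<longlonglongrightarrow> 0"
  proof (rule L2_complete[of u])
    fix e :: real assume "e > 0"
    obtain N where N: "inverse (real (Suc N)) < e\<^sup>2 / 4"
      using reals_Archimedean[of "e\<^sup>2/4"] \<open>e > 0\<close> by auto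
    have "L2_norm M (\<lambda>x. u i x - u j x) < e" if "i \<ge> N" "j \<ge> N" for i j
    proof (rule power2_less_imp_less)
      have "1 / real (Suc i) \<le> 1 / real (Suc N)" "1 / real (Suc j) \<le> 1 / real (Suc N)"
        using that by (auto intro!: divide_left_mono)
      then show "(L2_norm M (\<lambda>x. u i x - u j x))\<^sup>2 < e\<^sup>2"
        using close[of i j] N by (simp add: inverse_eq_divide)
    qed (use \<open>e > 0\<close> in simp)
    then show "\<exists>N. \<forall>i\<ge>N. \<forall>j\<ge>N. L2_norm M (\<lambda>x. u i x - u j x) < e" by blast
  qed (use uK KL in auto)
  have kK: "k \<in> K"
  proof -
    have "L2_inner M k b = 0" if "b \<in> B" for b
    proof -
      have "(\<lambda>n. L2_inner M (u n) b) \<longlonglongrightarrow> L2_inner M k b"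
        by (rule L2_limit_inner) (use k uK KL B that in auto)
      moreover have "L2_inner M (u n) b = 0" for n using uK[of n] that by (simp add: K_def)
      ultimately show ?thesis by (simp add: LIMSEQ_const_iff)
    qed
    then show ?thesis using k by (simp add: K_def)
  qed
  have nk: "(n k)\<^sup>2 \<le> d"
  proof (rule LIMSEQ_le)
    have e: "(\<lambda>x. h x - u j x - (h x - k x)) = (\<lambda>x. k x - u j x)" for j by auto
    have "(\<lambda>j. n (u j)) \<longlonglongrightarrow> n k"
      unfolding n_def
      by (rule L2_limit_norm) (use k uK KL h in \<open>auto intro!: L2_diff simp: e L2_norm_minus_commute\<close>)
    then show "(\<lambda>j. (n (u j))\<^sup>2) \<longlonglongrightarrow> (n k)\<^sup>2" by (intro tendsto_intros)
    show "(\<lambda>j. d + 1 / Suc j) \<longlonglongrightarrow> d"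
      using tendsto_add[OF tendsto_const LIMSEQ_inverse_real_of_nat, of d] by (simp add: inverse_eq_divide)
    show "\<exists>N. \<forall>j\<ge>N. (n (u j))\<^sup>2 \<le> d + 1 / Suc j" using u less_imp_le by blast
  qed
  show ?thesis
  proof (rule that[OF kK])
    fix g assume g: "g \<in> K"
    define a where "a = L2_inner M (\<lambda>x. h x - k x) g"
    note hk = L2_diff[OF h k(1)]
    \<comment> \<open>\<open>k\<close> is moved in the direction \<open>a * g\<close>; with this
      phase the squared distance decreases to first order at the rate
      \<open>2 * (cmod a)\<^sup>2\<close>.\<close>
    have "2 * (cmod a)\<^sup>2 \<le> 0"
    proof (rule nonpos_if_quadratic_bound)
      fix t :: real assume "0 < t" "t \<le> 1"
      have "(n k)\<^sup>2 \<le> (n (\<lambda>x. k x + (of_real t * a) * g x))\<^sup>2"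
        using nk dle[OF Klin[OF kK g]] by (rule order_trans)
      also have "\<dots> = (L2_norm M (\<lambda>x. (h x - k x) - (of_real t * a) * g x))\<^sup>2"
        by (simp add: n_def algebra_simps)
      also have "\<dots> = (n k)\<^sup>2 - 2 * Re (cnj (of_real t * a) * a) + (cmod (of_real t * a))\<^sup>2 * (L2_norm M g)\<^sup>2"
        by (subst L2_norm_sq_diff_scale[OF hk KL[OF g]]) (simp add: n_def a_def)
      also have "Re (cnj (of_real t * a) * a) = t * (cmod a)\<^sup>2"
        by (simp add: cmod_power2 algebra_simps) (simp add: power2_eq_square algebra_simps)
      finally show "2 * (cmod a)\<^sup>2 * t \<le> ((cmod a)\<^sup>2 * (L2_norm M g)\<^sup>2) * t\<^sup>2"
        using \<open>0 < t\<close> by (simp add: norm_mult power_mult_distrib mult_ac)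
    qed
    then show "L2_inner M (\<lambda>x. h x - k x) g = 0" by (simp add: a_def)
  qed
qed

section \<open>Compact operators\<close>

lemma topspace_L2_topology [simp]: "topspace (L2_topology M) = L2_space M"
proof -
  have "openin (L2_topology M) (L2_space M)"
    unfolding openin_L2_topology by (auto intro!: exI[of _ 1])
  then show ?thesis
    using openin_L2_topology openin_subset openin_topspace by (metis subset_antisym)
qed

lemma openin_L2_ball:
  assumes "f \<in> L2_space M"
  shows "openin (L2_topology M) {g \<in> L2_space M. L2_norm M (\<lambda>x. g x - f x) < e}"
  unfolding openin_L2_topology
proof (intro conjI ballI)
  fix g assume "g \<in> {g \<in> L2_space M. L2_norm M (\<lambda>x. g x - f x) < e}"
  then have g: "g \<in> L2_space M" "L2_norm M (\<lambda>x. g x - f x) < e" by auto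
  show "\<exists>e'>0. \<forall>h\<in>L2_space M. L2_norm M (\<lambda>x. h x - g x) < e' \<longrightarrow>
      h \<in> {g \<in> L2_space M. L2_norm M (\<lambda>x. g x - f x) < e}"
  proof (intro exI conjI ballI impI)
    show "0 < e - L2_norm M (\<lambda>x. g x - f x)" using g by simp
    fix h assume h: "h \<in> L2_space M" "L2_norm M (\<lambda>x. h x - g x) < e - L2_norm M (\<lambda>x. g x - f x)"
    then show "h \<in> {g \<in> L2_space M. L2_norm M (\<lambda>x. g x - f x) < e}"
      using L2_norm_triangle_diff[OF h(1) g(1) assms] by simp
  qed
qed auto

lemma L2_closure_approx:
  assumes "p \<in> L2_topology M closure_of X" "X \<subseteq> L2_space M" "e > 0"
  obtains x where "x \<in> X" "L2_norm M (\<lambda>y. p y - x y) < e"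
proof -
  have p: "p \<in> L2_space M" using assms(1) closure_of_subset_topspace by fastforce
  have "L2_norm M (\<lambda>x. p x - p x) < e" using \<open>e > 0\<close> by (simp add: L2_norm_def)
  then have pin: "p \<in> {g \<in> L2_space M. L2_norm M (\<lambda>x. g x - p x) < e}" using p by simp
  have meets: "\<exists>x\<in>X. x \<in> U" if "p \<in> U" "openin (L2_topology M) U" for U
    using assms(1) that unfolding in_closure_of by blast
  obtain x where x: "x \<in> X" "L2_norm M (\<lambda>y. x y - p y) < e"
    using meets[OF pin openin_L2_ball[OF p]] by auto
  show ?thesis
  proof (rule that[OF x(1)])
    show "L2_norm M (\<lambda>y. p y - x y) < e" using x(2) by (subst L2_norm_minus_commute)
  qed
qed

lemma L2_closure_ofI:
  assumes "p \<in> L2_space M" "\<And>e. e > 0 \<Longrightarrow> \<exists>x\<in>X. L2_norm M (\<lambda>y. p y - x y) < e" "X \<subseteq> L2_space M"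
  shows "p \<in> L2_topology M closure_of X"
  unfolding in_closure_of
proof (intro conjI allI impI)
  fix U assume U: "p \<in> U \<and> openin (L2_topology M) U"
  then obtain e where "e > 0" "\<forall>g\<in>L2_space M. L2_norm M (\<lambda>x. g x - p x) < e \<longrightarrow> g \<in> U"
    by (auto simp: openin_L2_topology)
  then show "\<exists>y. y \<in> X \<and> y \<in> U"
    using assms(2)[of e] assms(3) by (subst (asm) L2_norm_minus_commute) blast
qed (use assms in simp)

text \<open>The centres are taken from \<open>X\<close> itself: when \<open>X\<close> is the image
  of the unit ball under an operator they have preimages there, which lets nets be carried from one
  operator to another.\<close>

definition L2_totally_bounded :: "'a measure \<Rightarrow> ('a \<Rightarrow> complex) set \<Rightarrow> bool" where
  "L2_totally_bounded M X \<longleftrightarrow>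
     (\<forall>e>0. \<exists>F. finite F \<and> F \<subseteq> X \<and> (\<forall>f\<in>X. \<exists>g\<in>F. L2_norm M (\<lambda>x. f x - g x) < e))"

lemma L2_totally_bounded_if_compact_closure:
  assumes X: "X \<subseteq> L2_space M" and c: "compactin (L2_topology M) (L2_topology M closure_of X)"
  shows "L2_totally_bounded M X"
  unfolding L2_totally_bounded_def
proof (intro allI impI)
  fix e :: real assume "e > 0"
  define B where "B f = {g \<in> L2_space M. L2_norm M (\<lambda>x. g x - f x) < e}" for f
  have "L2_topology M closure_of X \<subseteq> \<Union>(B ` X)"
  proof
    fix p assume p: "p \<in> L2_topology M closure_of X"
    then obtain x where "x \<in> X" "L2_norm M (\<lambda>y. p y - x y) < e"
      using L2_closure_approx[OF p X \<open>e > 0\<close>] by blast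
    moreover have "p \<in> L2_space M" using p closure_of_subset_topspace by fastforce
    ultimately show "p \<in> \<Union>(B ` X)" by (auto simp: B_def)
  qed
  moreover have "\<forall>U\<in>B ` X. openin (L2_topology M) U" using X by (auto simp: B_def intro: openin_L2_ball)
  ultimately obtain \<F> where F: "finite \<F>" "\<F> \<subseteq> B ` X" "L2_topology M closure_of X \<subseteq> \<Union>\<F>"
    using c unfolding compactin_def by (metis (no_types, lifting))
  obtain F where "F \<subseteq> X" "finite F" "\<F> = B ` F" using finite_subset_image[OF F(1,2)] by blast
  moreover have "X \<subseteq> L2_topology M closure_of X" by (rule closure_of_subset) (use X in simp)
  ultimately show "\<exists>F. finite F \<and> F \<subseteq> X \<and> (\<forall>f\<in>X. \<exists>g\<in>F. L2_norm M (\<lambda>x. f x - g x) < e)"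
    using F(3) by (intro exI[of _ F]) (auto simp: B_def subset_iff)
qed

lemma compact_closure_if_L2_totally_bounded:
  assumes X: "X \<subseteq> L2_space M" and tb: "L2_totally_bounded M X"
  shows "compactin (L2_topology M) (L2_topology M closure_of X)"
proof -
  \<comment> \<open>The metric-space library needs a genuine metric, so each a.e. class is replaced by a representative.\<close>
  define rep where "rep f = (SOME g. g \<in> L2_space M \<and> (AE x in M. g x = f x))" for f :: "'a \<Rightarrow> complex"
  have rep: "rep f \<in> L2_space M \<and> (AE x in M. rep f x = f x)" if "f \<in> L2_space M" for f
    unfolding rep_def by (rule someI[of _ f]) (use that in simp)
  \<comment> \<open>Functions that are equal a.e. have the same admissible representatives, so the
    choice operator returns the same one.\<close>
  have rep_eq: "rep f = rep g" if "AE x in M. f x = g x" for f g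
  proof -
    have "(\<lambda>h. h \<in> L2_space M \<and> (AE x in M. h x = f x)) = (\<lambda>h. h \<in> L2_space M \<and> (AE x in M. h x = g x))"
      using that by (auto simp: fun_eq_iff elim: AE_mp)
    then show ?thesis by (simp add: rep_def)
  qed
  define R where "R = rep ` L2_space M"
  define d where "d f g = L2_norm M (\<lambda>x. f x - g x)" for f g
  have RL: "R \<subseteq> L2_space M" using rep by (auto simp: R_def)
  have repR: "rep f \<in> R" if "f \<in> L2_space M" for f using that by (simp add: R_def)
  have fix_rep: "rep f = f" if "f \<in> R" for f
    using that rep rep_eq by (auto simp: R_def)
  interpret Q: Metric_space R d
  proof
    fix f g h
    show "0 \<le> d f g" by (simp add: d_def)
    show "d f g = d g f" unfolding d_def by (rule L2_norm_minus_commute)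
    assume f: "f \<in> R" and g: "g \<in> R"
    show "d f g = 0 \<longleftrightarrow> f = g"
    proof
      assume "d f g = 0"
      then have "AE x in M. f x - g x = 0"
        using L2_norm_eq_0_iff[OF L2_diff, of f M g] f g RL by (auto simp: d_def)
      then have "rep f = rep g" by (intro rep_eq) simp
      then show "f = g" using fix_rep f g by simp
    qed (simp add: d_def L2_norm_def)
    assume "h \<in> R"
    then show "d f h \<le> d f g + d g h"
      unfolding d_def using f g RL by (intro L2_norm_triangle_diff) auto
  qed
  have dist_rep: "d (rep f) (rep g) = d f g" if "f \<in> L2_space M" "g \<in> L2_space M" for f g
    unfolding d_def using rep[OF that(1)] rep[OF that(2)] that
    by (intro L2_norm_cong_AE) (auto elim: AE_mp)
  have dist_rep1: "d (rep f) g = d f g" if "f \<in> L2_space M" "g \<in> L2_space M" for f g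
    unfolding d_def using rep[OF that(1)] that
    by (intro L2_norm_cong_AE) (auto elim: AE_mp)
  have complete: "Q.mcomplete"
    unfolding Q.mcomplete_def
  proof (intro allI impI)
    fix u assume u: "Q.MCauchy u"
    then have uR: "u n \<in> R" for n by (auto simp: Q.MCauchy_def)
    obtain f where f: "f \<in> L2_space M" "(\<lambda>n. L2_norm M (\<lambda>x. u n x - f x)) \<longlonglongrightarrow> 0"
    proof (rule L2_complete)
      show "\<exists>N. \<forall>i\<ge>N. \<forall>j\<ge>N. L2_norm M (\<lambda>x. u i x - u j x) < e" if "e > 0" for e
        using u that by (simp add: Q.MCauchy_def d_def)
    qed (use uR RL in auto)
    have "d (u n) (rep f) = L2_norm M (\<lambda>x. u n x - f x)" for n
      using dist_rep1[OF f(1), of "u n"] uR RL L2_norm_minus_commute[of M "u n"]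
      by (auto simp: d_def subset_iff)
    then have "limitin Q.mtopology u (rep f) sequentially"
      unfolding Q.limitin_metric_dist_null using f uR by (simp add: repR)
    then show "\<exists>x. limitin Q.mtopology u x sequentially" by blast
  qed
  have "Q.mtotally_bounded (rep ` X)"
    unfolding Q.mtotally_bounded_def
  proof (intro allI impI)
    fix e :: real assume "e > 0"
    then obtain F where F: "finite F" "F \<subseteq> X" "\<forall>f\<in>X. \<exists>g\<in>F. L2_norm M (\<lambda>x. f x - g x) < e"
      using tb by (auto simp: L2_totally_bounded_def)
    have "rep ` X \<subseteq> (\<Union>x\<in>rep ` F. Q.mball x e)"
    proof
      fix p assume "p \<in> rep ` X"
      then obtain f where f: "f \<in> X" "p = rep f" by auto
      then obtain g where g: "g \<in> F" "L2_norm M (\<lambda>x. f x - g x) < e" using F by auto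
      then have "d (rep g) (rep f) < e"
        using dist_rep[of f g] f F X Q.commute[of "rep g"] by (auto simp: d_def subset_iff)
      then show "p \<in> (\<Union>x\<in>rep ` F. Q.mball x e)"
        using f g F X by (auto simp: subset_iff intro!: bexI[of _ g] repR)
    qed
    then show "\<exists>K. finite K \<and> K \<subseteq> rep ` X \<and> rep ` X \<subseteq> (\<Union>x\<in>K. Q.mball x e)"
      using F by (intro exI[of _ "rep ` F"]) auto
  qed
  then have C: "compactin Q.mtopology (Q.mtopology closure_of (rep ` X))"
    using Q.mtotally_bounded_eq_compact_closure_of[OF complete] by blast
  define C where "C = Q.mtopology closure_of (rep ` X)"
  have "continuous_map Q.mtopology (L2_topology M) id"
    unfolding continuous_map_def
  proof (intro conjI allI impI)
    fix U assume U: "openin (L2_topology M) U"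
    show "openin Q.mtopology {x \<in> topspace Q.mtopology. id x \<in> U}"
      unfolding Q.openin_mtopology
    proof (intro conjI allI impI)
      fix x assume "x \<in> {x \<in> topspace Q.mtopology. id x \<in> U}"
      then obtain e where "e > 0" "\<forall>g\<in>L2_space M. L2_norm M (\<lambda>y. g y - x y) < e \<longrightarrow> g \<in> U"
        using U by (auto simp: openin_L2_topology)
      then show "\<exists>r>0. Q.mball x r \<subseteq> {x \<in> topspace Q.mtopology. id x \<in> U}"
        using RL Q.commute by (intro exI[of _ e]) (auto simp: d_def subset_iff)
    qed auto
  qed (use RL in auto)
  then have CL: "compactin (L2_topology M) C"
    using image_compactin[OF C] by (fastforce simp: C_def)
  have repC: "rep p \<in> C" if p: "p \<in> L2_topology M closure_of X" for p
    unfolding C_def Q.metric_closure_of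
  proof (safe)
    have pL: "p \<in> L2_space M" using p closure_of_subset_topspace by fastforce
    then show "rep p \<in> R" by (simp add: R_def)
    fix e :: real assume "e > 0"
    then obtain x where x: "x \<in> X" "L2_norm M (\<lambda>y. p y - x y) < e"
      using L2_closure_approx[OF p X] by blast
    then have "d (rep p) (rep x) < e" using dist_rep[OF pL] X by (auto simp: d_def)
    then show "\<exists>y\<in>rep ` X. y \<in> Q.mball (rep p) e"
      using x X pL by (auto intro!: bexI[of _ x] repR)
  qed
  have CK: "C \<subseteq> L2_topology M closure_of X"
  proof
    fix c assume c: "c \<in> C"
    then have cR: "c \<in> R" and "\<forall>r>0. \<exists>y\<in>rep ` X. y \<in> Q.mball c r"
      by (auto simp: C_def Q.metric_closure_of)
    then have *: "\<forall>r>0. \<exists>x\<in>X. d c (rep x) < r" by auto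
    show "c \<in> L2_topology M closure_of X"
    proof (rule L2_closure_ofI)
      fix e :: real assume "e > 0"
      then obtain x where "x \<in> X" "d c (rep x) < e" using * by blast
      then show "\<exists>x\<in>X. L2_norm M (\<lambda>y. c y - x y) < e"
        using dist_rep1[of x c] X cR RL Q.commute[of c "rep x"] L2_norm_minus_commute[of M c x]
        by (intro bexI[of _ x]) (auto simp: d_def subset_iff)
    qed (use cR RL X in auto)
  qed
  \<comment> \<open>A cover of the closure restricts to the compact set \<open>C\<close> of
    representatives. The finite subcover still catches every \<open>p\<close>, since an open set
    containing \<open>rep p\<close> contains all functions of the space at seminorm distance 0 from
    it.\<close>
  show ?thesis
    unfolding compactin_def
  proof (intro conjI allI impI)
    fix \<U> assume U: "Ball \<U> (openin (L2_topology M)) \<and> L2_topology M closure_of X \<subseteq> \<Union>\<U>"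
    then obtain \<F> where F: "finite \<F>" "\<F> \<subseteq> \<U>" "C \<subseteq> \<Union>\<F>"
      using CL CK unfolding compactin_def by (meson order_trans)
    have "L2_topology M closure_of X \<subseteq> \<Union>\<F>"
    proof
      fix p assume p: "p \<in> L2_topology M closure_of X"
      then have pL: "p \<in> L2_space M" using closure_of_subset_topspace by fastforce
      obtain V where V: "V \<in> \<F>" "rep p \<in> V" using repC[OF p] F by auto
      have "openin (L2_topology M) V" using U F V by auto
      then obtain e where "e > 0" "\<forall>g\<in>L2_space M. L2_norm M (\<lambda>x. g x - rep p x) < e \<longrightarrow> g \<in> V"
        using V(2) unfolding openin_L2_topology by blast
      moreover have "L2_norm M (\<lambda>x. p x - rep p x) = 0"
        using dist_rep1[OF pL pL] by (subst L2_norm_minus_commute) (simp add: d_def L2_norm_def)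
      ultimately show "p \<in> \<Union>\<F>" using V pL by auto
    qed
    then show "\<exists>\<F>. finite \<F> \<and> \<F> \<subseteq> \<U> \<and> L2_topology M closure_of X \<subseteq> \<Union>\<F>"
      using F by blast
  qed (use closure_of_subset_topspace in fastforce)
qed

text \<open>Finite nets for the image under \<open>T\<close> pull back to the unit ball and push
  forward to nets for \<open>S\<close>, whatever the relation between \<open>d\<close> and
  \<open>e\<close>. One half of the theorem takes for \<open>T\<close> the embedding and for
  \<open>S\<close> the operator; the other exchanges the roles, and there the embedding is
  controlled only by a square root.\<close>

lemma L2_compact_operator_transfer:
  assumes T: "\<And>f. f \<in> D \<Longrightarrow> T f \<in> L2_space N1" and S: "\<And>f. f \<in> D \<Longrightarrow> S f \<in> L2_space N2"
    and compact: "L2_compact_operator M D N1 T"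
    and close: "\<And>e. e > 0 \<Longrightarrow> \<exists>d>0. \<forall>f\<in>D. \<forall>g\<in>D. L2_norm M f \<le> 1 \<longrightarrow> L2_norm M g \<le> 1 \<longrightarrow>
       L2_norm N1 (\<lambda>x. T f x - T g x) < d \<longrightarrow> L2_norm N2 (\<lambda>x. S f x - S g x) < e"
  shows "L2_compact_operator M D N2 S"
proof -
  define B where "B = {f \<in> D. L2_norm M f \<le> 1}"
  have "L2_totally_bounded N1 (T ` B)"
    by (rule L2_totally_bounded_if_compact_closure)
       (use compact T in \<open>auto simp: L2_compact_operator_def B_def\<close>)
  moreover have "L2_totally_bounded N2 (S ` B)" if tb: "L2_totally_bounded N1 (T ` B)"
    unfolding L2_totally_bounded_def
  proof (intro allI impI)
    fix e :: real assume "e > 0"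
    then obtain d where d: "d > 0" "\<And>f g. f \<in> B \<Longrightarrow> g \<in> B \<Longrightarrow>
       L2_norm N1 (\<lambda>x. T f x - T g x) < d \<Longrightarrow> L2_norm N2 (\<lambda>x. S f x - S g x) < e"
      using close[of e] by (auto simp: B_def)
    obtain F where F: "finite F" "F \<subseteq> T ` B" "\<forall>f\<in>B. \<exists>g\<in>F. L2_norm N1 (\<lambda>x. T f x - g x) < d"
      using tb d(1) by (auto simp: L2_totally_bounded_def)
    obtain G where G: "G \<subseteq> B" "finite G" "F = T ` G" using finite_subset_image[OF F(1,2)] by blast
    have "\<exists>g\<in>S ` G. L2_norm N2 (\<lambda>x. S f x - g x) < e" if "f \<in> B" for f
    proof -
      obtain g where "g \<in> G" "L2_norm N1 (\<lambda>x. T f x - T g x) < d"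
        using bspec[OF F(3) \<open>f \<in> B\<close>] G(3) by auto
      then show ?thesis using d(2)[OF that, of g] G by auto
    qed
    then show "\<exists>F. finite F \<and> F \<subseteq> S ` B \<and> (\<forall>f\<in>S ` B. \<exists>g\<in>F. L2_norm N2 (\<lambda>x. f x - g x) < e)"
      using G by (intro exI[of _ "S ` G"]) auto
  qed
  ultimately show ?thesis
    unfolding L2_compact_operator_def B_def[symmetric]
    by (intro compact_closure_if_L2_totally_bounded) (use S in \<open>auto simp: B_def\<close>)
qed

section \<open>Total variation and polar decomposition\<close>

lemma ennreal_norm_le_suminf:
  fixes a :: "nat \<Rightarrow> complex"
  assumes "a sums s" shows "ennreal (cmod s) \<le> (\<Sum>n. ennreal (cmod (a n)))"
proof (cases "(\<Sum>n. ennreal (cmod (a n))) = top")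
  case False
  then have sm: "summable (\<lambda>n. cmod (a n))" by (intro summable_suminf_not_top) auto
  have "cmod s \<le> (\<Sum>n. cmod (a n))" using summable_norm[OF sm] sums_unique[OF assms] by simp
  then show ?thesis using sm by (simp add: suminf_ennreal2 ennreal_leI)
qed simp

definition circle_partitions :: "complex set \<Rightarrow> (nat \<Rightarrow> complex set) set" where
  "circle_partitions E =
     {P. range P \<subseteq> sets circle_borel \<and> disjoint_family P \<and> (\<Union>n. P n) = E}"

text \<open>The set function inside \<open>variation\<close>, named before it is known to be a
  measure: \<open>measure_of\<close> returns it as \<open>emeasure\<close> only once positivity and
  countable additivity are established.\<close>

definition total_variation :: "(complex set \<Rightarrow> complex) \<Rightarrow> complex set \<Rightarrow> ennreal" where
  "total_variation \<mu> E = (SUP P \<in> circle_partitions E. \<Sum>n. ennreal (cmod (\<mu> (P n))))"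

lemma sets_variation [simp, measurable_cong]: "sets (variation \<mu>) = sets circle_borel"
  by (simp add: variation_def sets.sigma_sets_eq sets.space_closed)

lemma space_circle_borel: "space circle_borel = sphere 0 1"
  by (simp add: circle_borel_def space_restrict_space)

lemma space_variation [simp]: "space (variation \<mu>) = sphere 0 1"
  using sets_eq_imp_space_eq[OF sets_variation] by (simp add: space_circle_borel)

lemma trivial_partition: "E \<in> sets circle_borel \<Longrightarrow> (\<lambda>n. if n = 0 then E else {}) \<in> circle_partitions E"
  by (auto simp: circle_partitions_def disjoint_family_on_def split: if_splits)

lemma total_variation_upper:
  "P \<in> circle_partitions E \<Longrightarrow> (\<Sum>n. ennreal (cmod (\<mu> (P n)))) \<le> total_variation \<mu> E"
  unfolding total_variation_def by (rule SUP_upper)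

context
  fixes \<mu> :: "complex set \<Rightarrow> complex"
  assumes cm: "complex_circle_measure \<mu>"
begin

lemma complex_measure_sums:
  "P \<in> circle_partitions E \<Longrightarrow> (\<lambda>n. \<mu> (P n)) sums \<mu> E"
  using cm by (auto simp: complex_circle_measure_def circle_partitions_def)

lemma complex_measure_empty: "\<mu> {} = 0"
proof -
  have "(\<lambda>n. \<mu> {}) sums \<mu> {}"
    using complex_measure_sums[of "\<lambda>_. {}" "{}"] by (simp add: circle_partitions_def disjoint_family_on_def)
  then show ?thesis using summable_const_iff sums_summable by blast
qed

lemma complex_measure_union:
  assumes "A \<in> sets circle_borel" "B \<in> sets circle_borel" "A \<inter> B = {}"
  shows "\<mu> (A \<union> B) = \<mu> A + \<mu> B"
proof -
  have "binaryset A B \<in> circle_partitions (A \<union> B)"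
    using assms by (auto simp: circle_partitions_def UN_binaryset_eq binaryset_def disjoint_family_on_def)
  from complex_measure_sums[OF this]
  have "(\<lambda>n. \<mu> (binaryset A B n)) sums \<mu> (A \<union> B)" .
  moreover have "(\<lambda>n. \<mu> (binaryset A B n)) sums (\<mu> A + \<mu> B)"
    by (rule binaryset_sums) (rule complex_measure_empty)
  ultimately show ?thesis by (rule sums_unique2)
qed

lemma complex_measure_Union:
  assumes "finite I" "\<And>i. i \<in> I \<Longrightarrow> A i \<in> sets circle_borel" "disjoint_family_on A I"
  shows "\<mu> (\<Union>i\<in>I. A i) = (\<Sum>i\<in>I. \<mu> (A i))"
  using assms
proof (induction I rule: finite_induct)
  case empty then show ?case by (simp add: complex_measure_empty)
next
  case (insert i I)
  have "\<mu> (A i \<union> (\<Union>i\<in>I. A i)) = \<mu> (A i) + \<mu> (\<Union>i\<in>I. A i)"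
    using insert by (intro complex_measure_union sets.finite_UN) (auto simp: disjoint_family_on_def)
  then show ?case using insert by (simp add: disjoint_family_on_insert)
qed

lemma norm_le_total_variation:
  assumes "E \<in> sets circle_borel" shows "ennreal (cmod (\<mu> E)) \<le> total_variation \<mu> E"
proof -
  have "ennreal (cmod (\<mu> E)) \<le> (\<Sum>n. ennreal (cmod (\<mu> (if n = 0 then E else {}))))"
    by (rule ennreal_norm_le_suminf[OF complex_measure_sums[OF trivial_partition[OF assms]]])
  also have "\<dots> \<le> total_variation \<mu> E"
    by (rule total_variation_upper[OF trivial_partition[OF assms]])
  finally show ?thesis .
qed

text \<open>A partition of \<open>A\<close> becomes one of \<open>B\<close> when
  \<open>B - A\<close> is put in front.\<close>

lemma total_variation_mono:
  assumes "A \<subseteq> B" "A \<in> sets circle_borel" "B \<in> sets circle_borel"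
  shows "total_variation \<mu> A \<le> total_variation \<mu> B"
  unfolding total_variation_def[of \<mu> A]
proof (rule SUP_least)
  fix P assume P: "P \<in> circle_partitions A"
  define R where "R n = (case n of 0 \<Rightarrow> B - A | Suc m \<Rightarrow> P m)" for n
  have PA: "P n \<subseteq> A" for n using P by (auto simp: circle_partitions_def)
  have "R \<in> circle_partitions B"
    unfolding circle_partitions_def
  proof (intro CollectI conjI)
    show "range R \<subseteq> sets circle_borel"
      using P assms by (auto simp: R_def circle_partitions_def split: nat.splits)
    show "disjoint_family R" unfolding disjoint_family_on_def
      using P PA by (auto simp: R_def circle_partitions_def disjoint_family_on_def split: nat.splits)
    have "(\<Union>n. R n) = R 0 \<union> (\<Union>n. R (Suc n))"
    proof (intro equalityI subsetI)
      fix x assume "x \<in> (\<Union>n. R n)"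
      then obtain n where "x \<in> R n" by blast
      then show "x \<in> R 0 \<union> (\<Union>n. R (Suc n))" by (cases n) auto
    qed blast
    also have "\<dots> = B" using P assms by (auto simp: R_def circle_partitions_def)
    finally show "(\<Union>n. R n) = B" .
  qed
  have "(\<Sum>n. ennreal (cmod (\<mu> (P n)))) = (\<Sum>n. ennreal (cmod (\<mu> (R (n + 1)))))" by (simp add: R_def)
  also have "\<dots> \<le> (\<Sum>n. ennreal (cmod (\<mu> (R (n + 1))))) + (\<Sum>n<1. ennreal (cmod (\<mu> (R n))))" by simp
  also have "\<dots> = (\<Sum>n. ennreal (cmod (\<mu> (R n))))"
    by (rule suminf_offset[symmetric]) simp
  also have "\<dots> \<le> total_variation \<mu> B" by (rule total_variation_upper) fact
  finally show "(\<Sum>n. ennreal (cmod (\<mu> (P n)))) \<le> total_variation \<mu> B" .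
qed

text \<open>Upper bound for the union: cut each piece of a partition along the \<open>E i\<close>
  and exchange the double sum. Lower bound: glue nearly optimal partitions of the
  \<open>E i\<close>, with errors adding up to \<open>e\<close>, by means of
  \<open>prod_decode\<close>.\<close>

lemma total_variation_suminf:
  assumes E: "range E \<subseteq> sets circle_borel" "disjoint_family E"
  shows "(\<Sum>i. total_variation \<mu> (E i)) = total_variation \<mu> (\<Union>i. E i)"
proof (rule antisym)
  show "total_variation \<mu> (\<Union>i. E i) \<le> (\<Sum>i. total_variation \<mu> (E i))"
    unfolding total_variation_def[of \<mu> "\<Union>i. E i"]
  proof (rule SUP_least)
    fix P assume P: "P \<in> circle_partitions (\<Union>i. E i)"
    have rows: "(\<lambda>i. P n \<inter> E i) \<in> circle_partitions (P n)" for n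
      unfolding circle_partitions_def
    proof (intro CollectI conjI)
      show "disjoint_family (\<lambda>i. P n \<inter> E i)" using E by (fastforce simp: disjoint_family_on_def)
    qed (use P E in \<open>auto simp: circle_partitions_def\<close>)
    have cols: "(\<lambda>n. P n \<inter> E i) \<in> circle_partitions (E i)" for i
      unfolding circle_partitions_def
    proof (intro CollectI conjI)
      show "disjoint_family (\<lambda>n. P n \<inter> E i)"
        using P by (fastforce simp: circle_partitions_def disjoint_family_on_def)
    qed (use P E in \<open>auto simp: circle_partitions_def\<close>)
    have "(\<Sum>n. ennreal (cmod (\<mu> (P n)))) \<le> (\<Sum>n. \<Sum>i. ennreal (cmod (\<mu> (P n \<inter> E i))))"
      by (intro suminf_le ennreal_norm_le_suminf complex_measure_sums[OF rows]) auto
    also have "\<dots> = (\<integral>\<^sup>+n. (\<Sum>i. ennreal (cmod (\<mu> (P n \<inter> E i)))) \<partial>count_space UNIV)"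
      by (rule nn_integral_count_space_nat[symmetric])
    also have "\<dots> = (\<Sum>i. \<integral>\<^sup>+n. ennreal (cmod (\<mu> (P n \<inter> E i))) \<partial>count_space UNIV)"
      by (rule nn_integral_suminf) simp
    also have "\<dots> = (\<Sum>i. \<Sum>n. ennreal (cmod (\<mu> (P n \<inter> E i))))"
      unfolding nn_integral_count_space_nat ..
    also have "\<dots> \<le> (\<Sum>i. total_variation \<mu> (E i))"
      by (intro suminf_le total_variation_upper cols) auto
    finally show "(\<Sum>n. ennreal (cmod (\<mu> (P n)))) \<le> (\<Sum>i. total_variation \<mu> (E i))" .
  qed
next
  let ?T = "total_variation \<mu> (\<Union>i. E i)"
  show "(\<Sum>i. total_variation \<mu> (E i)) \<le> ?T"
  proof (rule ennreal_le_epsilon)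
    fix e :: real assume T: "?T < top" and "e > 0"
    have fin: "total_variation \<mu> (E i) < top" for i
      using total_variation_mono[of "E i" "\<Union>i. E i"] E T by (auto intro: le_less_trans)
    have "\<exists>P\<in>circle_partitions (E i). total_variation \<mu> (E i) \<le>
        (\<Sum>n. ennreal (cmod (\<mu> (P n)))) + ennreal (e * (1/2) ^ Suc i)" for i
    proof (rule ccontr)
      assume "\<not> ?thesis"
      then have *: "(\<Sum>n. ennreal (cmod (\<mu> (P n)))) + ennreal (e * (1/2) ^ Suc i) \<le> total_variation \<mu> (E i)"
        if "P \<in> circle_partitions (E i)" for P using that by force
      have "(SUP P\<in>circle_partitions (E i). (\<Sum>n. ennreal (cmod (\<mu> (P n)))) + ennreal (e * (1/2) ^ Suc i))
          \<le> total_variation \<mu> (E i)" using * by (rule SUP_least)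
      moreover have "(SUP P\<in>circle_partitions (E i). (\<Sum>n. ennreal (cmod (\<mu> (P n)))) + ennreal (e * (1/2) ^ Suc i))
          = total_variation \<mu> (E i) + ennreal (e * (1/2) ^ Suc i)"
        unfolding total_variation_def
        by (rule ennreal_SUP_add_left) (use trivial_partition E in blast)
      moreover have "total_variation \<mu> (E i) < total_variation \<mu> (E i) + ennreal (e * (1/2) ^ Suc i)"
        
      proof -
        have "total_variation \<mu> (E i) + 0 < total_variation \<mu> (E i) + ennreal (e * (1/2) ^ Suc i)"
          using fin[of i] \<open>e > 0\<close> by (intro ennreal_add_left_cancel_less[THEN iffD2]) (auto simp: less_top)
        then show ?thesis by simp
      qed
      ultimately show False by simp
    qed
    then obtain P where P: "\<And>i. P i \<in> circle_partitions (E i)"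
      and Ple: "\<And>i. total_variation \<mu> (E i) \<le> (\<Sum>n. ennreal (cmod (\<mu> (P i n)))) + ennreal (e * (1/2) ^ Suc i)"
      by metis
    define R where "R k = P (fst (prod_decode k)) (snd (prod_decode k))" for k
    have "R \<in> circle_partitions (\<Union>i. E i)"
      unfolding circle_partitions_def
    proof (intro CollectI conjI)
      have "P i n \<in> sets circle_borel" for i n using P[of i] by (auto simp: circle_partitions_def)
      then show "range R \<subseteq> sets circle_borel" by (auto simp: R_def)
      have PE: "P i n \<subseteq> E i" for i n using P by (auto simp: circle_partitions_def)
      show "disjoint_family R"
        unfolding disjoint_family_on_def
      proof (intro ballI impI)
        fix k l :: nat assume "k \<noteq> l"
        then have "prod_decode k \<noteq> prod_decode l" by (simp add: prod_decode_eq)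
        then consider "fst (prod_decode k) \<noteq> fst (prod_decode l)"
          | "fst (prod_decode k) = fst (prod_decode l)" "snd (prod_decode k) \<noteq> snd (prod_decode l)"
          by (auto simp: prod_eq_iff)
        then show "R k \<inter> R l = {}"
        proof cases
          case 1
          then have "E (fst (prod_decode k)) \<inter> E (fst (prod_decode l)) = {}"
            using E by (auto simp: disjoint_family_on_def)
          then show ?thesis using PE by (fastforce simp: R_def)
        next
          case 2
          then show ?thesis using P[of "fst (prod_decode l)"]
            by (auto simp: R_def circle_partitions_def disjoint_family_on_def)
        qed
      qed
      show "(\<Union>n. R n) = (\<Union>i. E i)"
      proof
        show "(\<Union>n. R n) \<subseteq> (\<Union>i. E i)" using PE by (auto simp: R_def)
        show "(\<Union>i. E i) \<subseteq> (\<Union>n. R n)"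
        proof
          fix x assume "x \<in> (\<Union>i. E i)"
          then obtain i where "x \<in> E i" by blast
          moreover have "(\<Union>n. P i n) = E i" using P[of i] by (simp add: circle_partitions_def)
          ultimately obtain n where "x \<in> P i n" by blast
          then have "x \<in> R (prod_encode (i, n))" by (simp add: R_def)
          then show "x \<in> (\<Union>n. R n)" by blast
        qed
      qed
    qed
    then have R: "(\<Sum>k. ennreal (cmod (\<mu> (R k)))) \<le> ?T" by (rule total_variation_upper)
    have "(\<Sum>k. ennreal (cmod (\<mu> (R k)))) = (\<Sum>i. \<Sum>n. ennreal (cmod (\<mu> (P i n))))"
      unfolding R_def
      by (rule suminf_ennreal_2dimen[where f = "\<lambda>p. ennreal (cmod (\<mu> (P (fst p) (snd p))))"]) simp
    moreover have "(\<Sum>i. total_variation \<mu> (E i)) \<le>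
        (\<Sum>i. (\<Sum>n. ennreal (cmod (\<mu> (P i n)))) + ennreal (e * (1/2) ^ Suc i))"
      by (intro suminf_le Ple) auto
    moreover have "\<dots> = (\<Sum>i. \<Sum>n. ennreal (cmod (\<mu> (P i n)))) + (\<Sum>i. ennreal (e * (1/2) ^ Suc i))"
      by (rule suminf_add[symmetric]) auto
    moreover have "(\<Sum>i. ennreal (e * (1/2) ^ Suc i)) = ennreal e"
      using sums_mult[OF power_half_series, of e] \<open>e > 0\<close>
      by (intro suminf_ennreal_eq) auto
    ultimately show "(\<Sum>i. total_variation \<mu> (E i)) \<le> ?T + ennreal e"
      using R by (metis (no_types, lifting) add_right_mono order_trans)
  qed
qed

lemma emeasure_variation:
  assumes "E \<in> sets circle_borel" shows "emeasure (variation \<mu>) E = total_variation \<mu> E"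
proof (rule emeasure_measure_of)
  show "variation \<mu> = measure_of (space circle_borel) (sets circle_borel) (total_variation \<mu>)"
    by (simp add: variation_def total_variation_def[abs_def] circle_partitions_def)
  show "sets circle_borel \<subseteq> Pow (space circle_borel)" by (rule sets.space_closed)
  have "\<mu> (P n) = 0" if "P \<in> circle_partitions {}" for P n
    using that complex_measure_empty by (auto simp: circle_partitions_def)
  then have "total_variation \<mu> {} = 0"
    by (auto simp: total_variation_def intro!: antisym SUP_least)
  then show "positive (sets (variation \<mu>)) (total_variation \<mu>)" by (simp add: positive_def)
  show "countably_additive (sets (variation \<mu>)) (total_variation \<mu>)"
    by (rule countably_additiveI) (simp add: total_variation_suminf)
qed (use assms in simp)

text \<open>Each modulus is at most the sum of the positive parts of the rotations by
  \<open>1\<close>, \<open>-1\<close>, \<open>\<i>\<close>, \<open>-\<i>\<close>. For one rotation,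
  the sum over the indices with positive part is bounded by the modulus of a subsum; the factor 4
  comes from taking the best of the four.\<close>

lemma large_subfamily:
  fixes z :: "'i \<Rightarrow> complex"
  assumes "finite I" shows "\<exists>J\<subseteq>I. (\<Sum>i\<in>I. cmod (z i)) \<le> 4 * cmod (\<Sum>i\<in>J. z i)"
proof -
  have key: "\<exists>J\<subseteq>I. (\<Sum>i\<in>I. max 0 (Re (u * z i))) \<le> cmod (\<Sum>i\<in>J. z i)" if "cmod u = 1" for u
  proof (intro exI conjI)
    let ?J = "{i\<in>I. Re (u * z i) > 0}"
    have "(\<Sum>i\<in>I. max 0 (Re (u * z i))) = (\<Sum>i\<in>?J. Re (u * z i))"
      using assms by (intro sum.mono_neutral_cong_right) auto
    also have "\<dots> = Re (u * (\<Sum>i\<in>?J. z i))" by (simp add: sum_distrib_left)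
    also have "\<dots> \<le> cmod (\<Sum>i\<in>?J. z i)"
      using complex_Re_le_cmod[of "u * (\<Sum>i\<in>?J. z i)"] that by (simp add: norm_mult)
    finally show "(\<Sum>i\<in>I. max 0 (Re (u * z i))) \<le> cmod (\<Sum>i\<in>?J. z i)" .
  qed auto
  obtain J1 J2 J3 J4 where J: "J1 \<subseteq> I" "J2 \<subseteq> I" "J3 \<subseteq> I" "J4 \<subseteq> I"
    "(\<Sum>i\<in>I. max 0 (Re (1 * z i))) \<le> cmod (\<Sum>i\<in>J1. z i)"
    "(\<Sum>i\<in>I. max 0 (Re (-1 * z i))) \<le> cmod (\<Sum>i\<in>J2. z i)"
    "(\<Sum>i\<in>I. max 0 (Re (\<i> * z i))) \<le> cmod (\<Sum>i\<in>J3. z i)"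
    "(\<Sum>i\<in>I. max 0 (Re (-\<i> * z i))) \<le> cmod (\<Sum>i\<in>J4. z i)"
    using key[of 1] key[of "-1"] key[of \<i>] key[of "-\<i>"] by auto
  have "(\<Sum>i\<in>I. cmod (z i)) \<le> (\<Sum>i\<in>I. max 0 (Re (1 * z i)) + max 0 (Re (-1 * z i))
      + max 0 (Re (\<i> * z i)) + max 0 (Re (-\<i> * z i)))"
  proof (rule sum_mono)
    fix i
    show "cmod (z i) \<le> max 0 (Re (1 * z i)) + max 0 (Re (-1 * z i)) + max 0 (Re (\<i> * z i)) + max 0 (Re (-\<i> * z i))"
      using cmod_le[of "z i"] by (auto simp: max_def)
  qed
  also have "\<dots> \<le> cmod (\<Sum>i\<in>J1. z i) + cmod (\<Sum>i\<in>J2. z i) + cmod (\<Sum>i\<in>J3. z i) + cmod (\<Sum>i\<in>J4. z i)"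
    unfolding sum.distrib by (intro add_mono J)
  finally have s: "(\<Sum>i\<in>I. cmod (z i)) \<le> cmod (\<Sum>i\<in>J1. z i) + cmod (\<Sum>i\<in>J2. z i) + cmod (\<Sum>i\<in>J3. z i) + cmod (\<Sum>i\<in>J4. z i)" .
  show ?thesis
  proof (rule ccontr)
    assume "\<not> ?thesis"
    then have "4 * cmod (\<Sum>i\<in>J. z i) < (\<Sum>i\<in>I. cmod (z i))" if "J \<subseteq> I" for J
      using that by (meson not_le)
    from this[OF J(1)] this[OF J(2)] this[OF J(3)] this[OF J(4)] s show False by linarith
  qed
qed

text \<open>The subfamily lemma yields \<open>A\<close> whose value exceeds that of \<open>E\<close>
  by at least 1 in modulus, so \<open>A\<close> and \<open>E - A\<close> both have values of modulus
  at least 1. One of them has infinite variation; the other is split off.\<close>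

lemma infinite_variation_split:
  assumes E: "E \<in> sets circle_borel" and inf: "total_variation \<mu> E = top"
  shows "\<exists>E'\<in>sets circle_borel. E' \<subseteq> E \<and> total_variation \<mu> E' = top \<and> 1 \<le> cmod (\<mu> (E - E'))"
proof -
  have "ennreal (4 * (cmod (\<mu> E) + 1)) < total_variation \<mu> E" using inf by simp
  then obtain P where P: "P \<in> circle_partitions E"
    and "ennreal (4 * (cmod (\<mu> E) + 1)) < (\<Sum>n. ennreal (cmod (\<mu> (P n))))"
    unfolding total_variation_def less_SUP_iff by blast
  then obtain N where "ennreal (4 * (cmod (\<mu> E) + 1)) < (\<Sum>n<N. ennreal (cmod (\<mu> (P n))))"
    unfolding suminf_eq_SUP less_SUP_iff by blast
  then have N: "4 * (cmod (\<mu> E) + 1) < (\<Sum>n<N. cmod (\<mu> (P n)))"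
    by (subst (asm) sum_ennreal) (auto simp: ennreal_less_iff simp del: ennreal_plus)
  obtain J where J: "J \<subseteq> {..<N}" "(\<Sum>n<N. cmod (\<mu> (P n))) \<le> 4 * cmod (\<Sum>i\<in>J. \<mu> (P i))"
    using large_subfamily[of "{..<N}" "\<lambda>n. \<mu> (P n)"] by auto
  have finJ: "finite J" using J finite_subset by blast
  define A where "A = (\<Union>i\<in>J. P i)"
  have A: "A \<in> sets circle_borel" "A \<subseteq> E"
    using P finJ by (auto simp: A_def circle_partitions_def intro!: sets.finite_UN)
  have "\<mu> A = (\<Sum>i\<in>J. \<mu> (P i))"
    unfolding A_def using P finJ
    by (intro complex_measure_Union) (auto simp: circle_partitions_def disjoint_family_on_def)
  then have muA: "cmod (\<mu> E) + 1 \<le> cmod (\<mu> A)" using J N by simp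
  have "\<mu> E = \<mu> A + \<mu> (E - A)"
    using complex_measure_union[of A "E - A"] A E by (simp add: Un_absorb1)
  then have "cmod (\<mu> A) \<le> cmod (\<mu> E) + cmod (\<mu> (E - A))"
    using norm_triangle_ineq4[of "\<mu> E" "\<mu> (E - A)"] by simp
  then have muB: "1 \<le> cmod (\<mu> (E - A))" using muA by simp
  have "total_variation \<mu> E = total_variation \<mu> A + total_variation \<mu> (E - A)"
    using plus_emeasure[of A "variation \<mu>" "E - A"] A E by (simp add: emeasure_variation Un_absorb1)
  then have "total_variation \<mu> A = top \<or> total_variation \<mu> (E - A) = top"
    using inf by (metis ennreal_add_eq_top)
  then show ?thesis
  proof
    assume "total_variation \<mu> A = top"
    then show ?thesis using A muB by blast
  next
    assume "total_variation \<mu> (E - A) = top"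
    moreover have "E - (E - A) = A" using A by blast
    ultimately show ?thesis using A E muA by (intro bexI[of _ "E - A"]) (auto intro: order_trans[rotated])
  qed
qed

text \<open>If the total variation were infinite, repeated splitting would give disjoint sets
  \<open>D n\<close> with \<open>cmod (\<mu> (D n)) \<ge> 1\<close>, although the series of their
  values converges.\<close>

lemma finite_measure_variation: "finite_measure (variation \<mu>)"
proof (rule finite_measureI)
  have "total_variation \<mu> (sphere 0 1) \<noteq> top"
  proof
    assume top: "total_variation \<mu> (sphere 0 1) = top"
    define Q where "Q E \<longleftrightarrow> E \<in> sets circle_borel \<and> total_variation \<mu> E = top" for E
    have "\<forall>E. \<exists>E'. Q E \<longrightarrow> Q E' \<and> E' \<subseteq> E \<and> 1 \<le> cmod (\<mu> (E - E'))"
      using infinite_variation_split unfolding Q_def by blast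
    then obtain nxt where nx: "\<And>E. Q E \<Longrightarrow> Q (nxt E) \<and> nxt E \<subseteq> E \<and> 1 \<le> cmod (\<mu> (E - nxt E))" by metis
    define E where "E n = (nxt ^^ n) (sphere 0 1)" for n
    have Q0: "Q (sphere 0 1)" using top sets.top[of circle_borel] by (simp add: Q_def space_circle_borel)
    have QE: "Q (E n)" for n by (induction n) (auto simp: E_def Q0 nx)
    have ES: "E (Suc n) = nxt (E n)" for n by (simp add: E_def)
    have anti: "E n \<subseteq> E m" if "m \<le> n" for m n
      using that by (rule lift_Suc_antimono_le[of E, rotated]) (use nx[OF QE] ES in auto)
    define D where "D n = E n - E (Suc n)" for n
    have "disjoint_family D"
      unfolding disjoint_family_on_def
    proof (intro ballI impI)
      fix m n :: nat assume "m \<noteq> n"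
      then consider "Suc m \<le> n" | "Suc n \<le> m" by linarith
      then show "D m \<inter> D n = {}"
        by cases (use anti in \<open>auto simp: D_def\<close>)
    qed
    moreover have "range D \<subseteq> sets circle_borel" using QE by (auto simp: D_def Q_def)
    ultimately have "(\<lambda>n. \<mu> (D n)) sums \<mu> (\<Union>n. D n)"
      using cm by (simp add: complex_circle_measure_def)
    then have "(\<lambda>n. \<mu> (D n)) \<longlonglongrightarrow> 0" using sums_summable summable_LIMSEQ_zero by blast
    then have "\<forall>\<^sub>F n in sequentially. cmod (\<mu> (D n)) < 1"
      using order_tendstoD(2)[OF tendsto_norm, of _ 0 sequentially 1] by simp
    moreover have "1 \<le> cmod (\<mu> (D n))" for n using nx[OF QE[of n]] by (simp add: D_def ES)
    ultimately show False by (simp add: not_less[symmetric] eventually_sequentially) blast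
  qed
  then show "emeasure (variation \<mu>) (space (variation \<mu>)) \<noteq> \<infinity>"
    using emeasure_variation sets.top[of circle_borel] by (simp add: space_circle_borel)
qed

section \<open>Densities with respect to the variation, and the polar decomposition\<close>

lemma norm_le_variation:
  assumes "E \<in> sets circle_borel" shows "cmod (\<mu> E) \<le> measure (variation \<mu>) E"
proof -
  interpret finite_measure "variation \<mu>" by (rule finite_measure_variation)
  show ?thesis
    using norm_le_total_variation[OF assms] emeasure_variation[OF assms] by (metis emeasure_eq_measure ennreal_le_iff measure_nonneg)
qed

text \<open>Radon-Nikodym is applied to nonnegative measures, so \<nu> is shifted by the variation
  that dominates it; the density sought is the one obtained minus 1.\<close>

lemma real_density_exists:
  fixes \<nu> :: "complex set \<Rightarrow> real"
  assumes sums: "\<And>E. range E \<subseteq> sets circle_borel \<Longrightarrow> disjoint_family E \<Longrightarrow> (\<lambda>n. \<nu> (E n)) sums \<nu> (\<Union>n. E n)"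
    and le: "\<And>E. E \<in> sets circle_borel \<Longrightarrow> \<bar>\<nu> E\<bar> \<le> measure (variation \<mu>) E"
  shows "\<exists>d. integrable (variation \<mu>) d \<and>
    (\<forall>E\<in>sets circle_borel. \<nu> E = (\<integral>z. indicator E z * d z \<partial>variation \<mu>))"
proof -
  let ?V = "variation \<mu>"
  interpret V: finite_measure ?V by (rule finite_measure_variation)
  define N where "N = measure_of (space circle_borel) (sets circle_borel) (\<lambda>E. ennreal (measure ?V E + \<nu> E))"
  have setsN [simp]: "sets N = sets circle_borel"
    by (simp add: N_def sets.sigma_sets_eq sets.space_closed)
  have nn: "0 \<le> measure ?V E + \<nu> E" if "E \<in> sets circle_borel" for E using le[OF that] by linarith
  have N: "emeasure N E = ennreal (measure ?V E + \<nu> E)" if "E \<in> sets circle_borel" for E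
  proof (rule emeasure_measure_of[OF N_def])
    show "positive (sets N) (\<lambda>E. ennreal (measure ?V E + \<nu> E))"
      using le[of "{}"] by (simp add: positive_def)
    show "countably_additive (sets N) (\<lambda>E. ennreal (measure ?V E + \<nu> E))"
    proof (rule countably_additiveI)
      fix A :: "nat \<Rightarrow> complex set" assume A: "range A \<subseteq> sets N" "disjoint_family A"
      have "(\<lambda>i. measure ?V (A i) + \<nu> (A i)) sums (measure ?V (\<Union>i. A i) + \<nu> (\<Union>i. A i))"
        using A by (intro sums_add V.finite_measure_UNION sums) auto
      then show "(\<Sum>i. ennreal (measure ?V (A i) + \<nu> (A i))) = ennreal (measure ?V (\<Union>i. A i) + \<nu> (\<Union>i. A i))"
        using A nn by (intro suminf_ennreal_eq) auto
    qed
    show "sets circle_borel \<subseteq> Pow (space circle_borel)" by (rule sets.space_closed)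
  qed (use that in simp)
  have "absolutely_continuous ?V N"
    unfolding absolutely_continuous_def
  proof
    fix E assume "E \<in> null_sets ?V"
    then have "E \<in> sets circle_borel" "measure ?V E = 0" by (auto simp: V.emeasure_eq_measure)
    then show "E \<in> null_sets N" using N[of E] le[of E] by (auto intro!: null_setsI)
  qed
  then obtain f where f: "f \<in> borel_measurable ?V" "density ?V f = N"
    using V.Radon_Nikodym[of N] by auto
  have dens: "(\<integral>\<^sup>+z. f z * indicator E z \<partial>?V) = ennreal (measure ?V E + \<nu> E)" if "E \<in> sets circle_borel" for E
    using emeasure_density[OF f(1), of E] that N[OF that] f(2) by simp
  have "(\<integral>\<^sup>+z. f z \<partial>?V) \<noteq> \<infinity>"
    using dens[OF sets.top] nn_integral_cong[of ?V "\<lambda>z. f z * indicator (space circle_borel) z" f]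
    by (simp add: space_circle_borel) (metis ennreal_neq_top infinity_ennreal_def)
  then have "AE z in ?V. f z \<noteq> \<infinity>" by (rule nn_integral_PInf_AE[OF f(1)])
  then have fe: "AE z in ?V. f z = ennreal (enn2real (f z))" by eventually_elim (simp add: less_top)
  have int: "has_bochner_integral ?V (\<lambda>z. indicator E z * enn2real (f z)) (measure ?V E + \<nu> E)"
    if E: "E \<in> sets circle_borel" for E
  proof (rule has_bochner_integral_nn_integral)
    show "(\<integral>\<^sup>+z. ennreal (indicator E z * enn2real (f z)) \<partial>?V) = ennreal (measure ?V E + \<nu> E)"
      unfolding dens[OF E, symmetric]
      by (rule nn_integral_cong_AE, use fe in eventually_elim) (auto simp: indicator_def)
  qed (use f(1) E nn[OF E] in auto)
  have idf: "integrable ?V (\<lambda>z. enn2real (f z))"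
  proof -
    have "integrable ?V (\<lambda>z. indicator (space circle_borel) z * enn2real (f z))"
      using int[OF sets.top] by (auto simp: has_bochner_integral_iff)
    then show ?thesis
      by (subst Bochner_Integration.integrable_cong[OF refl, of _ _ "\<lambda>z. indicator (space circle_borel) z * enn2real (f z)"])
         (auto simp: space_circle_borel)
  qed
  show ?thesis
  proof (intro exI conjI ballI)
    show "integrable ?V (\<lambda>z. enn2real (f z) - 1)" using idf by simp
    fix E assume E: "E \<in> sets circle_borel"
    have "(\<integral>z. indicator E z * (enn2real (f z) - 1) \<partial>?V)
        = (\<integral>z. indicator E z * enn2real (f z) - indicator E z \<partial>?V)"
      by (simp add: algebra_simps)
    also have "\<dots> = (measure ?V E + \<nu> E) - measure ?V E"
    proof (subst Bochner_Integration.integral_diff)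
      show "integrable ?V (indicat_real E)"
        using E by (intro integrable_real_indicator) (auto simp: V.emeasure_eq_measure)
      have "E \<inter> sphere 0 1 = E" using sets.sets_into_space[OF E] by (auto simp: space_circle_borel)
      then show "(\<integral>z. indicator E z * enn2real (f z) \<partial>?V) - (\<integral>z. indicat_real E z \<partial>?V)
          = (measure ?V E + \<nu> E) - measure ?V E"
        using int[OF E] E by (simp add: has_bochner_integral_iff)
    qed (use int[OF E] in \<open>simp add: has_bochner_integral_iff\<close>)
    finally show "\<nu> E = (\<integral>z. indicator E z * (enn2real (f z) - 1) \<partial>?V)" by simp
  qed
qed

text \<open>The combined density \<open>g\<close> of real and imaginary part satisfies
  \<open>cmod (g z) \<le> 1\<close> a.e., because \<mu> is dominated by its variation. Conversely
  the total variation is at most the integral of \<open>cmod (g z)\<close>, so the modulus cannot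
  drop below 1 on a set of positive measure.\<close>

lemma polar_decomposition_exists:
  "\<exists>h. h \<in> borel_measurable (variation \<mu>) \<and> (\<forall>z\<in>sphere 0 1. cmod (h z) = 1) \<and>
     (\<forall>E\<in>sets circle_borel. \<mu> E = (\<integral>z. indicator E z * h z \<partial>variation \<mu>))"
proof -
  let ?V = "variation \<mu>"
  interpret V: finite_measure ?V by (rule finite_measure_variation)
  have s: "(\<lambda>n. \<mu> (E n)) sums \<mu> (\<Union>n. E n)"
    if "range E \<subseteq> sets circle_borel" "disjoint_family E" for E :: "nat \<Rightarrow> complex set"
    using cm that by (simp add: complex_circle_measure_def)
  obtain d1 where d1: "integrable ?V d1"
    "\<And>E. E \<in> sets circle_borel \<Longrightarrow> Re (\<mu> E) = (\<integral>z. indicator E z * d1 z \<partial>?V)"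
    using real_density_exists[of "\<lambda>E. Re (\<mu> E)"] sums_Re[OF s] norm_le_variation abs_Re_le_cmod order_trans
    by meson
  obtain d2 where d2: "integrable ?V d2"
    "\<And>E. E \<in> sets circle_borel \<Longrightarrow> Im (\<mu> E) = (\<integral>z. indicator E z * d2 z \<partial>?V)"
    using real_density_exists[of "\<lambda>E. Im (\<mu> E)"] sums_Im[OF s] norm_le_variation abs_Im_le_cmod order_trans
    by meson
  define g where "g z = of_real (d1 z) + \<i> * of_real (d2 z)" for z
  have gi: "integrable ?V g"
    using d1(1) d2(1) by (auto simp: g_def[abs_def])
  have gm [measurable]: "g \<in> borel_measurable ?V" using gi by auto
  have igi: "integrable ?V (\<lambda>z. indicator E z * g z)" if "E \<in> sets circle_borel" for E
    using integrable_mult_indicator[of E ?V g] gi that 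
    by (subst Bochner_Integration.integrable_cong[OF refl, of _ _ "\<lambda>z. indicator E z *\<^sub>R g z"])
       (auto simp: indicator_def)
  have g: "\<mu> E = (\<integral>z. indicator E z * g z \<partial>?V)" if E: "E \<in> sets circle_borel" for E
  proof -
    have "Re (\<integral>z. indicator E z * g z \<partial>?V) = (\<integral>z. indicator E z * d1 z \<partial>?V)"
      by (subst integral_Re[OF igi[OF E], symmetric], rule Bochner_Integration.integral_cong)
         (auto simp: g_def indicator_def)
    moreover have "Im (\<integral>z. indicator E z * g z \<partial>?V) = (\<integral>z. indicator E z * d2 z \<partial>?V)"
      by (subst integral_Im[OF igi[OF E], symmetric], rule Bochner_Integration.integral_cong)
         (auto simp: g_def indicator_def)
    ultimately show ?thesis using d1(2)[OF E] d2(2)[OF E] by (simp add: complex_eq_iff)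
  qed
  \<comment> \<open>Over the set \<open>E\<close> where \<open>Re (u * g z)\<close> exceeds 1, the
    excess integrates to \<open>Re (u * \<mu> E) - measure ?V E\<close>, which is at most 0; so
    \<open>E\<close> is null.\<close>
  have half: "AE z in ?V. Re (u * g z) \<le> 1" if u: "cmod u = 1" for u
  proof -
    define E where "E = {z \<in> space ?V. 1 < Re (u * g z)}"
    have "E \<in> sets ?V" unfolding E_def by measurable
    then have E: "E \<in> sets circle_borel" by simp
    have i: "integrable ?V (\<lambda>z. indicator E z * (Re (u * g z) - 1))"
      using integrable_mult_indicator[of E ?V "\<lambda>z. Re (u * g z) - 1"] gi E by simp
    have "(\<integral>z. indicator E z * (Re (u * g z) - 1) \<partial>?V)
        = (\<integral>z. Re (u * (indicator E z * g z)) - indicator E z \<partial>?V)"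
      by (rule Bochner_Integration.integral_cong) (auto simp: indicator_def)
    also have "\<dots> = (\<integral>z. Re (u * (indicator E z * g z)) \<partial>?V) - (\<integral>z. indicator E z \<partial>?V)"
      using igi[OF E] E
      by (intro Bochner_Integration.integral_diff integrable_Re integrable_real_indicator
          integrable_mult_right) (auto simp: V.emeasure_eq_measure)
    also have "\<dots> = Re (u * \<mu> E) - measure ?V E"
      using igi[OF E] sets.sets_into_space[OF E]
      by (subst integral_Re) (auto simp: g[OF E] space_circle_borel Int_absorb2)
    also have "\<dots> \<le> 0"
      using complex_Re_le_cmod[of "u * \<mu> E"] norm_le_variation[OF E] u by (simp add: norm_mult)
    finally have "(\<integral>z. indicator E z * (Re (u * g z) - 1) \<partial>?V) \<le> 0" .
    moreover have nn: "0 \<le> indicator E z * (Re (u * g z) - 1)" for z by (auto simp: indicator_def E_def)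
    ultimately have "(\<integral>z. indicator E z * (Re (u * g z) - 1) \<partial>?V) = 0"
      by (intro antisym Bochner_Integration.integral_nonneg) auto
    then have "AE z in ?V. indicator E z * (Re (u * g z) - 1) = 0"
      using integral_nonneg_eq_0_iff_AE[OF i] nn by simp
    then show ?thesis by (auto simp: E_def indicator_def not_less elim!: AE_mp)
  qed
  \<comment> \<open>Countably many directions keep the exceptional set null, and by density and
    continuity they give all directions.\<close>
  have "AE z in ?V. \<forall>q::rat. Re (cis (of_rat q) * g z) \<le> 1"
    unfolding AE_all_countable by (intro allI half) simp
  then have le1: "AE z in ?V. cmod (g z) \<le> 1"
  proof eventually_elim
    case (elim z)
    have "closed {t. Re (cis t * g z) \<le> 1}" by (intro closed_Collect_le continuous_intros)
    moreover have "\<rat> \<subseteq> {t. Re (cis t * g z) \<le> 1}" using elim by (auto elim!: Rats_cases)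
    ultimately have "closure \<rat> \<subseteq> {t. Re (cis t * g z) \<le> 1}" by (simp add: closure_minimal)
    then have "\<And>t. Re (cis t * g z) \<le> 1" unfolding Rats_closure_real by blast
    then have "Re (cis (- Arg (g z)) * g z) \<le> 1" .
    moreover have "cis (- Arg (g z)) * g z = of_real (cmod (g z))"
    proof -
      have "g z = of_real (cmod (g z)) * cis (Arg (g z))" using rcis_cmod_Arg[of "g z"] by (simp add: rcis_def)
      then have "cis (- Arg (g z)) * g z = of_real (cmod (g z)) * (cis (- Arg (g z)) * cis (Arg (g z)))"
        by (metis mult.left_commute)
      then show ?thesis by (simp add: cis_mult)
    qed
    ultimately show ?case by simp
  qed
  have top: "sphere 0 1 \<in> sets circle_borel" using sets.top[of circle_borel] by (simp add: space_circle_borel)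
  have "emeasure ?V (sphere 0 1) \<le> ennreal (\<integral>z. cmod (g z) \<partial>?V)"
    unfolding emeasure_variation[OF top] total_variation_def
  proof (rule SUP_least)
    fix P assume P: "P \<in> circle_partitions (sphere 0 1)"
    then have Pm: "P n \<in> sets circle_borel" for n by (auto simp: circle_partitions_def)
    have "(\<Sum>n. ennreal (cmod (\<mu> (P n)))) \<le> (\<Sum>n. \<integral>\<^sup>+z. ennreal (cmod (g z)) * indicator (P n) z \<partial>?V)"
    proof (rule suminf_le)
      fix n
      have "ennreal (cmod (\<mu> (P n))) \<le> (\<integral>\<^sup>+z. ennreal (cmod (indicator (P n) z * g z)) \<partial>?V)"
        unfolding g[OF Pm] by (rule integral_norm_bound_ennreal[OF igi[OF Pm]])
      also have "\<dots> = (\<integral>\<^sup>+z. ennreal (cmod (g z)) * indicator (P n) z \<partial>?V)"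
        by (rule nn_integral_cong) (auto simp: indicator_def)
      finally show "ennreal (cmod (\<mu> (P n))) \<le> \<dots>" .
    qed auto
    also have "\<dots> = (\<integral>\<^sup>+z. (\<Sum>n. ennreal (cmod (g z)) * indicator (P n) z) \<partial>?V)"
      using Pm by (intro nn_integral_suminf[symmetric]) auto
    also have "\<dots> = (\<integral>\<^sup>+z. ennreal (cmod (g z)) \<partial>?V)"
    proof (rule nn_integral_cong)
      fix z assume "z \<in> space ?V"
      have "(\<Sum>n. ennreal (cmod (g z)) * indicator (P n) z) = ennreal (cmod (g z)) * (\<Sum>n. indicator (P n) z)"
        by simp
      also have "(\<Sum>n. indicator (P n) z :: ennreal) = indicator (\<Union>n. P n) z"
        by (rule suminf_indicator) (use P in \<open>simp add: circle_partitions_def\<close>)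
      finally show "(\<Sum>n. ennreal (cmod (g z)) * indicator (P n) z) = ennreal (cmod (g z))"
        using P \<open>z \<in> space ?V\<close> by (simp add: circle_partitions_def)
    qed
    also have "\<dots> = ennreal (\<integral>z. cmod (g z) \<partial>?V)"
      using gi by (intro nn_integral_eq_integral) auto
    finally show "(\<Sum>n. ennreal (cmod (\<mu> (P n)))) \<le> ennreal (\<integral>z. cmod (g z) \<partial>?V)" .
  qed
  then have "(\<integral>z. 1 - cmod (g z) \<partial>?V) \<le> 0"
    using gi by (simp add: V.emeasure_eq_measure)
  moreover have "0 \<le> (\<integral>z. 1 - cmod (g z) \<partial>?V)"
    using le1 by (intro integral_nonneg_AE) (auto elim!: AE_mp)
  ultimately have "(\<integral>z. 1 - cmod (g z) \<partial>?V) = 0" by simp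
  then have g1: "AE z in ?V. cmod (g z) = 1"
    using le1 gi by (subst (asm) integral_nonneg_eq_0_iff_AE) (auto elim!: AE_mp)
  \<comment> \<open>\<open>polar_density\<close> demands modulus 1 at every point of the circle, not
    only a.e.\<close>
  define h where "h z = (if cmod (g z) = 1 then g z else 1)" for z
  have hm: "h \<in> borel_measurable ?V" unfolding h_def[abs_def] by measurable
  have hg: "AE z in ?V. h z = g z" using g1 by eventually_elim (simp add: h_def)
  show ?thesis
  proof (intro exI conjI ballI)
    show "h \<in> borel_measurable ?V" by (rule hm)
    show "cmod (h z) = 1" for z by (simp add: h_def)
    fix E assume E: "E \<in> sets circle_borel"
    show "\<mu> E = (\<integral>z. indicator E z * h z \<partial>?V)"
      unfolding g[OF E] using hg hm E by (intro integral_cong_AE) (auto elim!: AE_mp)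
  qed
qed

lemma polar_density:
  "polar_density \<mu> \<in> borel_measurable (variation \<mu>)"
  "z \<in> sphere 0 1 \<Longrightarrow> cmod (polar_density \<mu> z) = 1"
  "E \<in> sets circle_borel \<Longrightarrow> \<mu> E = (\<integral>z. indicator E z * polar_density \<mu> z \<partial>variation \<mu>)"
  using someI_ex[OF polar_decomposition_exists] unfolding polar_density_def by blast+

end

text \<open>Every partition sum equals the measure of the set, so the variation is \<open>M\<close>.
  The polar density has modulus 1 and integral equal to the total mass, which forces its real part,
  and hence itself, to be 1 a.e.\<close>

lemma
  assumes M: "finite_measure M" "sets M = sets circle_borel"
  defines "\<mu> \<equiv> \<lambda>E. of_real (measure M E)"
  shows positive_circle_measure_of_measure: "positive_circle_measure \<mu>"
    and variation_of_measure: "variation \<mu> = M"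
    and complex_measure_integral_of_measure:
      "f \<in> borel_measurable M \<Longrightarrow> complex_measure_integral \<mu> f = (\<integral>z. f z \<partial>M)"
proof -
  interpret M: finite_measure M by fact
  show pos: "positive_circle_measure \<mu>"
    unfolding positive_circle_measure_def complex_circle_measure_def \<mu>_def
  proof (intro conjI allI impI ballI)
    fix E :: "nat \<Rightarrow> complex set" assume "range E \<subseteq> sets circle_borel" "disjoint_family E"
    then show "(\<lambda>n. complex_of_real (measure M (E n))) sums of_real (measure M (\<Union>n. E n))"
      using M by (intro sums_of_real M.finite_measure_UNION) auto
  qed simp
  then have cm: "complex_circle_measure \<mu>" by (simp add: positive_circle_measure_def)
  show var: "variation \<mu> = M"
  proof (rule measure_eqI)
    show "sets (variation \<mu>) = sets M" using M by simp
    fix E assume "E \<in> sets (variation \<mu>)"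
    then have E: "E \<in> sets circle_borel" by simp
    have "(\<Sum>n. ennreal (cmod (\<mu> (P n)))) = emeasure M E" if "P \<in> circle_partitions E" for P
    proof -
      have P: "range P \<subseteq> sets M" "disjoint_family P" "(\<Union>n. P n) = E"
        using that M(2) by (auto simp: circle_partitions_def)
      have "ennreal (cmod (\<mu> (P n))) = emeasure M (P n)" for n
        by (simp add: \<mu>_def M.emeasure_eq_measure)
      then show ?thesis using suminf_emeasure[OF P(1,2)] P(3) by simp
    qed
    then have "total_variation \<mu> E = (SUP P\<in>circle_partitions E. emeasure M E)"
      unfolding total_variation_def by (rule SUP_cong[OF refl])
    also have "\<dots> = emeasure M E" using trivial_partition[OF E] by (intro SUP_const) auto
    finally show "emeasure (variation \<mu>) E = emeasure M E" by (simp add: emeasure_variation[OF cm E])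
  qed
  note pd = polar_density[OF cm, unfolded var]
  have sp: "space M = sphere 0 1" using sets_eq_imp_space_eq[OF M(2)] by (simp add: space_circle_borel)
  have pdi: "integrable M (polar_density \<mu>)"
    by (rule M.integrable_const_bound[of _ 1]) (use pd sp in auto)
  have "of_real (measure M (space M)) = (\<integral>z. indicator (space M) z * polar_density \<mu> z \<partial>M)"
    using pd(3)[of "space M"] M by (metis \<mu>_def sets.top)
  also have "\<dots> = (\<integral>z. polar_density \<mu> z \<partial>M)"
    by (rule Bochner_Integration.integral_cong) auto
  finally have "measure M (space M) = Re (\<integral>z. polar_density \<mu> z \<partial>M)"
    by (metis Re_complex_of_real)
  also have "\<dots> = (\<integral>z. Re (polar_density \<mu> z) \<partial>M)" using integral_Re[OF pdi] by simp
  finally have "(\<integral>z. 1 - Re (polar_density \<mu> z) \<partial>M) = 0"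
    by (subst Bochner_Integration.integral_diff) (use pdi in auto)
  moreover have nn: "AE z in M. 0 \<le> 1 - Re (polar_density \<mu> z)"
    using pd(2) complex_Re_le_cmod sp by (intro AE_I2) (metis diff_ge_0_iff_ge)
  ultimately have "AE z in M. 1 - Re (polar_density \<mu> z) = 0"
    using pdi by (subst (asm) integral_nonneg_eq_0_iff_AE) auto
  then have one: "AE z in M. polar_density \<mu> z = 1"
  proof (rule AE_mp, intro AE_I2 impI)
    fix z assume "z \<in> space M" "1 - Re (polar_density \<mu> z) = 0"
    then show "polar_density \<mu> z = 1"
      using pd(2)[of z] sp by (auto simp: complex_eq_iff cmod_def)
  qed
  assume f: "f \<in> borel_measurable M"
  show "complex_measure_integral \<mu> f = (\<integral>z. f z \<partial>M)"
    unfolding complex_measure_integral_def var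
    using one f pd(1) by (intro integral_cong_AE) (auto elim!: AE_mp)
qed

section \<open>The circle\<close>

abbreviation \<mm> :: "complex measure" where
  "\<mm> \<equiv> circle_measure"

lemma sets_circle_measure [simp, measurable_cong]: "sets \<mm> = sets circle_borel"
  by (simp add: circle_measure_def)

lemma space_circle_measure [simp]: "space \<mm> = sphere 0 1"
  by (simp add: circle_measure_def space_circle_borel)

lemma measurable_cis_circle: "cis \<in> measurable borel circle_borel"
  unfolding circle_borel_def
  by (rule measurable_restrict_space2)
     (auto intro!: borel_measurable_continuous_onI continuous_intros simp: cis_conv_exp)

lemma measurable_cis_uniform: "cis \<in> measurable (uniform_measure lborel {0..<2 * pi}) circle_borel"
  using measurable_cis_circle by (simp add: measurable_cong_sets[of "uniform_measure lborel {0..<2 * pi}" borel])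

interpretation circle: prob_space \<mm>
proof -
  interpret U: prob_space "uniform_measure lborel {0..<2 * pi}"
    by (rule prob_space_uniform_measure) auto
  show "prob_space \<mm>"
    unfolding circle_measure_def by (rule U.prob_space_distr[OF measurable_cis_uniform])
qed

lemma continuous_on_sphere_measurable:
  "continuous_on (sphere 0 1) f \<Longrightarrow> f \<in> borel_measurable circle_borel"
  unfolding circle_borel_def by (rule borel_measurable_continuous_on_restrict)

lemma circle_measurable_iff: "f \<in> borel_measurable \<mm> \<longleftrightarrow> f \<in> borel_measurable circle_borel"
  by (rule measurable_cong_sets[THEN arg_cong[where f="\<lambda>S. f \<in> S"]]) simp_all

lemma continuous_on_sphere_bounded:
  assumes "continuous_on (sphere 0 1) (f :: complex \<Rightarrow> complex)"
  obtains B where "0 < B" "\<And>z. z \<in> sphere 0 1 \<Longrightarrow> cmod (f z) \<le> B"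
proof -
  have "bounded (f ` sphere 0 1)"
    by (intro compact_imp_bounded compact_continuous_image assms compact_sphere)
  then show ?thesis using that unfolding bounded_pos by (metis imageI)
qed

lemma continuous_on_sphere_L2:
  assumes "continuous_on (sphere 0 1) f" "finite_measure M" "sets M = sets circle_borel"
  shows "f \<in> L2_space M"
proof -
  obtain B where B: "\<And>z. z \<in> sphere 0 1 \<Longrightarrow> cmod (f z) \<le> B"
    using continuous_on_sphere_bounded[OF assms(1)] by blast
  have "f \<in> borel_measurable M"
    using continuous_on_sphere_measurable[OF assms(1)] measurable_cong_sets[OF assms(3) refl] by blast
  moreover have "space M = sphere 0 1" using sets_eq_imp_space_eq[OF assms(3)] by (simp add: space_circle_borel)
  ultimately show ?thesis using B by (intro L2_space_bounded[OF assms(2), of _ B]) auto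
qed

lemma circle_integral:
  fixes f :: "complex \<Rightarrow> complex"
  assumes f: "f \<in> borel_measurable \<mm>"
  shows "(\<integral>z. f z \<partial>\<mm>) = (\<integral>t. indicator {0..<2*pi} t *\<^sub>R f (cis t) \<partial>lborel) / (2 * pi)"
proof -
  have fb: "f \<in> borel_measurable circle_borel" using f by (simp add: circle_measurable_iff)
  have m: "(\<lambda>t. f (cis t)) \<in> borel_measurable lborel"
    using measurable_comp[OF measurable_cis_circle fb] by (simp add: comp_def)
  have "(\<integral>z. f z \<partial>\<mm>) = (\<integral>t. f (cis t) \<partial>uniform_measure lborel {0..<2*pi})"
    unfolding circle_measure_def by (rule integral_distr[OF measurable_cis_uniform fb])
  also have "\<dots> = (\<integral>t. (indicator {0..<2*pi} t / (2*pi)) *\<^sub>R f (cis t) \<partial>lborel)"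
  proof -
    have e: "uniform_measure lborel {0..<2*pi} = density lborel (\<lambda>t. ennreal (indicator {0..<2*pi} t / (2*pi)))"
      unfolding uniform_measure_def
      by (rule arg_cong[where f="density lborel"])
         (auto simp: fun_eq_iff indicator_def divide_ennreal ennreal_1[symmetric] simp del: ennreal_1)
    show ?thesis unfolding e by (rule integral_density) (use m in auto)
  qed
  also have "\<dots> = (\<integral>t. (indicator {0..<2*pi} t *\<^sub>R f (cis t)) / (2*pi) \<partial>lborel)"
    by (rule Bochner_Integration.integral_cong) (auto simp: indicator_def scaleR_conv_of_real)
  finally show ?thesis by simp
qed

section \<open>Characters and Fourier coefficients\<close>

lemma powi_measurable [measurable]: "(\<lambda>z. z powi n) \<in> borel_measurable \<mm>"
  unfolding circle_measurable_iff
  by (rule continuous_on_sphere_measurable) (intro continuous_intros, auto)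

lemma norm_powi_sphere [simp]: "z \<in> sphere 0 1 \<Longrightarrow> cmod (z powi n) = 1"
  by (simp add: norm_power_int)

lemma cnj_powi_sphere: "z \<in> sphere 0 1 \<Longrightarrow> cnj (z powi n) = z powi (- n)"
proof -
  assume "z \<in> sphere 0 1"
  then have "cmod z = 1" by simp
  then have "z * cnj z = 1" by (simp add: complex_norm_square[symmetric])
  then have "cnj z = inverse z" by (rule inverse_unique[symmetric])
  then show ?thesis by (simp add: power_int_minus power_int_inverse)
qed

lemma powi_L2 [simp]: "(\<lambda>z. z powi n) \<in> L2_space \<mm>"
  by (rule continuous_on_sphere_L2[OF _ circle.finite_measure_axioms])
     (auto intro!: continuous_intros)

lemma circle_integral_powi: "(\<integral>y. y powi n \<partial>\<mm>) = (if n = 0 then 1 else 0)"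
proof (cases "n = 0")
  case True
  then show ?thesis using circle.prob_space by (simp add: lebesgue_integral_const)
next
  case False
  have ci: "cis t powi n = cis (of_int n * t)" for t by (simp add: Complex.cis_power_int)
  let ?F = "\<lambda>t. cis (of_int n * t) / (\<i> * of_int n)"
  have "(\<integral>t. indicator {0..2*pi} t *\<^sub>R cis (of_int n * t) \<partial>lborel) = ?F (2*pi) - ?F 0"
  proof (rule integral_FTC_atLeastAtMost)
    fix x assume "0 \<le> x" "x \<le> 2 * pi"
    show "(?F has_vector_derivative cis (of_int n * x)) (at x within {0..2*pi})"
    proof -
      have "((\<lambda>z. exp (\<i> * (of_int n * z)) / (\<i> * of_int n)) has_field_derivative
          exp (\<i> * (of_int n * of_real x))) (at (of_real x))"
        using False by (auto intro!: derivative_eq_intros simp: algebra_simps)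
      from has_vector_derivative_real_field[OF this] show ?thesis by (simp add: cis_conv_exp)
    qed
  next
    show "continuous_on {0..2 * pi} (\<lambda>t. cis (of_int n * t))"
      unfolding cis_conv_exp by (intro continuous_intros)
  qed simp
  also have "cis (of_int n * (2*pi)) = 1"
    using cis_power_int[of "2*pi" n] cis_2pi by simp
  finally have "(\<integral>t. indicator {0..2*pi} t *\<^sub>R cis (of_int n * t) \<partial>lborel) = 0" by simp
  moreover have "(\<integral>t. indicator {0..2*pi} t *\<^sub>R cis (of_int n * t) \<partial>lborel)
      = (\<integral>t. indicator {0..<2*pi} t *\<^sub>R cis (of_int n * t) \<partial>lborel)"
  proof (rule integral_cong_AE)
    have "AE t in lborel. t \<noteq> 2 * pi" by (rule AE_lborel_singleton)
    then show "AE t in lborel. indicator {0..2*pi} t *\<^sub>R cis (of_int n * t) = indicator {0..<2*pi} t *\<^sub>R cis (of_int n * t)"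
      by eventually_elim (auto simp: indicator_def)
  qed (auto simp: cis_conv_exp)
  ultimately show ?thesis using False by (simp add: circle_integral ci)
qed

definition fourier :: "(complex \<Rightarrow> complex) \<Rightarrow> int \<Rightarrow> complex" where
  "fourier f n = (\<integral>z. f z * z powi (- n) \<partial>\<mm>)"

lemma integrable_mult_powi:
  assumes "integrable \<mm> f"
  shows "integrable \<mm> (\<lambda>z. f z * z powi n)"
proof (rule Bochner_Integration.integrable_bound[OF assms])
  show "(\<lambda>z. f z * z powi n) \<in> borel_measurable \<mm>"
    using assms by measurable
qed (auto intro!: AE_I2 simp: norm_mult)

lemma L2_integrable: "f \<in> L2_space \<mm> \<Longrightarrow> integrable \<mm> f"
  using L2_integrable_mult[of f \<mm> "\<lambda>_. 1"] by (simp add: L2_space_def)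

lemma fourier_eq_inner: "fourier f n = L2_inner \<mm> f (\<lambda>z. z powi n)"
  unfolding fourier_def L2_inner_def
  by (rule Bochner_Integration.integral_cong[OF refl]) (simp add: cnj_powi_sphere del: complex_cnj_power_int)

lemma norm_fourier_le:
  assumes "integrable \<mm> f" shows "cmod (fourier f n) \<le> (\<integral>z. cmod (f z) \<partial>\<mm>)"
proof -
  have "cmod (fourier f n) \<le> (\<integral>z. cmod (f z * z powi (- n)) \<partial>\<mm>)"
    unfolding fourier_def by (rule integral_norm_bound)
  also have "\<dots> = (\<integral>z. cmod (f z) \<partial>\<mm>)"
    by (rule Bochner_Integration.integral_cong) (auto simp: norm_mult)
  finally show ?thesis .
qed

section \<open>Cauchy and Poisson integrals\<close>

definition cauchy_integral :: "(complex \<Rightarrow> complex) \<Rightarrow> complex \<Rightarrow> complex" where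
  "cauchy_integral f z = (\<integral>\<xi>. f \<xi> * (\<xi> / (\<xi> - z)) \<partial>\<mm>)"

lemma cauchy_integral_sums:
  assumes f: "integrable \<mm> f" and z: "cmod z < 1"
  shows "(\<lambda>n. fourier f (int n) * z ^ n) sums cauchy_integral f z"
    and "summable (\<lambda>n. cmod (fourier f (int n) * z ^ n))"
proof -
  define I where "I = (\<integral>y. cmod (f y) \<partial>\<mm>)"
  have geo: "summable (\<lambda>n. cmod z ^ n * I)"
    using z by (intro summable_mult2 summable_geometric) simp
  have int: "integrable \<mm> (\<lambda>\<xi>. f \<xi> * \<xi> powi (- int n) * z ^ n)" for n
    using integrable_mult_powi[OF f] by simp
  have nrm: "(\<integral>\<xi>. norm (f \<xi> * \<xi> powi (- int n) * z ^ n) \<partial>\<mm>) = cmod z ^ n * I" for n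
  proof -
    have "(\<integral>\<xi>. norm (f \<xi> * \<xi> powi (- int n) * z ^ n) \<partial>\<mm>)
        = (\<integral>\<xi>. cmod z ^ n * cmod (f \<xi>) \<partial>\<mm>)"
      by (rule Bochner_Integration.integral_cong) (auto simp: norm_mult norm_power norm_power_int)
    then show ?thesis by (simp add: I_def)
  qed
  have pt: "(\<lambda>n. f \<xi> * \<xi> powi (- int n) * z ^ n) sums (f \<xi> * (\<xi> / (\<xi> - z)))" if "\<xi> \<in> sphere 0 1" for \<xi>
  proof -
    have x: "cmod \<xi> = 1" "\<xi> \<noteq> 0" using that by auto
    have "(\<lambda>n. (z / \<xi>) ^ n) sums (1 / (1 - z / \<xi>))"
      by (rule geometric_sums) (use x z in \<open>simp add: norm_divide\<close>)
    then have "(\<lambda>n. f \<xi> * (z / \<xi>) ^ n) sums (f \<xi> * (1 / (1 - z / \<xi>)))" by (rule sums_mult)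
    moreover have "1 / (1 - z / \<xi>) = \<xi> / (\<xi> - z)" using x z by (auto simp: field_simps)
    moreover have "f \<xi> * (z / \<xi>) ^ n = f \<xi> * \<xi> powi (- int n) * z ^ n" for n
      using x by (simp add: power_int_minus power_divide field_simps)
    ultimately show ?thesis by simp
  qed
  have sm: "AE \<xi> in \<mm>. summable (\<lambda>n. norm (f \<xi> * \<xi> powi (- int n) * z ^ n))"
  proof (rule AE_I2)
    fix \<xi> assume "\<xi> \<in> space \<mm>"
    then have "norm (f \<xi> * \<xi> powi (- int n) * z ^ n) = cmod (f \<xi>) * cmod z ^ n" for n
      by (simp add: norm_mult norm_power norm_power_int)
    then show "summable (\<lambda>n. norm (f \<xi> * \<xi> powi (- int n) * z ^ n))"
      using z by (simp add: summable_mult summable_geometric)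
  qed
  have "(\<lambda>n. \<integral>\<xi>. f \<xi> * \<xi> powi (- int n) * z ^ n \<partial>\<mm>) sums
      (\<integral>\<xi>. (\<Sum>n. f \<xi> * \<xi> powi (- int n) * z ^ n) \<partial>\<mm>)"
    by (rule sums_integral[OF int sm]) (simp add: nrm geo)
  moreover have "(\<integral>\<xi>. (\<Sum>n. f \<xi> * \<xi> powi (- int n) * z ^ n) \<partial>\<mm>) = cauchy_integral f z"
    unfolding cauchy_integral_def
    by (rule Bochner_Integration.integral_cong) (auto simp: sums_unique[OF pt, symmetric])
  moreover have "(\<integral>\<xi>. f \<xi> * \<xi> powi (- int n) * z ^ n \<partial>\<mm>) = fourier f (int n) * z ^ n" for n
    unfolding fourier_def by (rule integral_mult_left_zero)
  ultimately show "(\<lambda>n. fourier f (int n) * z ^ n) sums cauchy_integral f z" by (simp only:)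
  show "summable (\<lambda>n. cmod (fourier f (int n) * z ^ n))"
  proof (rule summable_comparison_test'[OF geo, of 0])
    show "norm (cmod (fourier f (int n) * z ^ n)) \<le> cmod z ^ n * I" for n
      using mult_right_mono[OF norm_fourier_le[OF f, of "int n"], of "cmod z ^ n"]
      by (simp add: norm_mult norm_power I_def mult.commute)
  qed
qed

lemma cauchy_integral_holomorphic:
  assumes "integrable \<mm> f" shows "cauchy_integral f holomorphic_on ball 0 1"
proof (rule power_series_holomorphic)
  show "(\<lambda>n. fourier f (int n) * (w - 0) ^ n) sums cauchy_integral f w" if "w \<in> ball 0 1" for w
    using cauchy_integral_sums(1)[OF assms, of w] that by simp
qed

definition poisson :: "complex \<Rightarrow> complex \<Rightarrow> real" where
  "poisson z \<xi> = (1 - (cmod z)\<^sup>2) / (cmod (\<xi> - z))\<^sup>2"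

definition poisson_integral :: "(complex \<Rightarrow> complex) \<Rightarrow> complex \<Rightarrow> complex" where
  "poisson_integral f z = (\<integral>\<xi>. of_real (poisson z \<xi>) * f \<xi> \<partial>\<mm>)"

lemma poisson_nonneg: "cmod z < 1 \<Longrightarrow> 0 \<le> poisson z \<xi>"
  by (auto simp: poisson_def power_le_one intro!: divide_nonneg_nonneg)

text \<open>On the circle \<open>\<xi> * cnj \<xi> = 1\<close> reduces the numerator over
  \<open>(\<xi> - z) * cnj (\<xi> - z)\<close> to \<open>1 - z * cnj z\<close>. Through this
  identity Poisson integrals are governed by Fourier coefficients.\<close>

lemma poisson_eq_cauchy:
  assumes "\<xi> \<in> sphere 0 1" "cmod z < 1"
  shows "of_real (poisson z \<xi>) = \<xi> / (\<xi> - z) + cnj (\<xi> / (\<xi> - z)) - 1"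
proof -
  have ne: "\<xi> - z \<noteq> 0" using assms by auto
  have x1: "\<xi> * cnj \<xi> = 1" using assms by (simp add: complex_norm_square[symmetric])
  have ne': "cnj (\<xi> - z) \<noteq> 0" using ne by (simp del: complex_cnj_diff)
  have "\<xi> / (\<xi> - z) + cnj (\<xi> / (\<xi> - z)) - 1 = (\<xi> * cnj (\<xi> - z) + cnj \<xi> * (\<xi> - z) - (\<xi> - z) * cnj (\<xi> - z)) / ((\<xi> - z) * cnj (\<xi> - z))"
    unfolding complex_cnj_divide using ne ne' by (simp add: divide_simps del: complex_cnj_diff)
  also have "\<xi> * cnj (\<xi> - z) + cnj \<xi> * (\<xi> - z) - (\<xi> - z) * cnj (\<xi> - z) = 1 - z * cnj z"
    using x1 by (simp add: algebra_simps)
  finally show ?thesis by (simp add: poisson_def complex_norm_square del: of_real_power complex_cnj_diff)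
qed

lemma poisson_measurable [measurable]: "poisson z \<in> borel_measurable \<mm>"
  unfolding poisson_def[abs_def] circle_measurable_iff
  by (rule borel_measurable_divide) (auto intro!: continuous_on_sphere_measurable continuous_intros)

lemma kernel_measurable: "(\<lambda>\<xi>. \<xi> / (\<xi> - z)) \<in> borel_measurable \<mm>" if "cmod z < 1"
  unfolding circle_measurable_iff
  by (rule continuous_on_sphere_measurable) (use that in \<open>auto intro!: continuous_intros\<close>)

lemma kernel_bound:
  assumes "\<xi> \<in> sphere 0 1" "cmod z < 1" shows "cmod (\<xi> / (\<xi> - z)) \<le> 1 / (1 - cmod z)"
proof -
  have "1 - cmod z \<le> cmod (\<xi> - z)" using norm_triangle_ineq2[of \<xi> z] assms by simp
  then show ?thesis using assms by (simp add: norm_divide frac_le)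
qed

lemma integrable_kernel:
  assumes "integrable \<mm> f" "cmod z < 1"
  shows "integrable \<mm> (\<lambda>\<xi>. f \<xi> * (\<xi> / (\<xi> - z)))"
proof (rule Bochner_Integration.integrable_bound)
  show "integrable \<mm> (\<lambda>\<xi>. (1 / (1 - cmod z)) * cmod (f \<xi>))" using assms by simp
  show "AE \<xi> in \<mm>. norm (f \<xi> * (\<xi> / (\<xi> - z))) \<le> norm ((1 / (1 - cmod z)) * cmod (f \<xi>))"
  proof (rule AE_I2)
    fix \<xi> assume "\<xi> \<in> space \<mm>"
    then have "cmod (f \<xi>) * cmod (\<xi> / (\<xi> - z)) \<le> cmod (f \<xi>) * (1 / (1 - cmod z))"
      using assms(2) by (intro mult_left_mono kernel_bound) auto
    then show "norm (f \<xi> * (\<xi> / (\<xi> - z))) \<le> norm ((1 / (1 - cmod z)) * cmod (f \<xi>))"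
      unfolding norm_mult[of "f \<xi>"] using assms(2) by (simp add: mult.commute)
  qed
qed (use assms kernel_measurable[OF assms(2)] in measurable)

lemma poisson_integral_eq_cauchy:
  assumes f: "integrable \<mm> f" and z: "cmod z < 1"
  shows "poisson_integral f z = cauchy_integral f z + cnj (cauchy_integral (\<lambda>\<xi>. cnj (f \<xi>)) z) - fourier f 0"
proof -
  have fc: "integrable \<mm> (\<lambda>\<xi>. cnj (f \<xi>))" using f by simp
  have "poisson_integral f z = (\<integral>\<xi>. f \<xi> * (\<xi> / (\<xi> - z)) + cnj (cnj (f \<xi>) * (\<xi> / (\<xi> - z))) - f \<xi> \<partial>\<mm>)"
    unfolding poisson_integral_def
    by (rule Bochner_Integration.integral_cong[OF refl], subst poisson_eq_cauchy[OF _ z])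
       (auto simp: algebra_simps)
  also have "\<dots> = cauchy_integral f z + (\<integral>\<xi>. cnj (cnj (f \<xi>) * (\<xi> / (\<xi> - z))) \<partial>\<mm>) - fourier f 0"
    using f integrable_kernel[OF f z] integrable_cnj[OF integrable_kernel[OF fc z]]
    by (simp add: cauchy_integral_def fourier_def del: complex_cnj_mult)
  also have "(\<integral>\<xi>. cnj (cnj (f \<xi>) * (\<xi> / (\<xi> - z))) \<partial>\<mm>) = cnj (cauchy_integral (\<lambda>\<xi>. cnj (f \<xi>)) z)"
    unfolding cauchy_integral_def by (rule Bochner_Integration.integral_cnj)
  finally show ?thesis .
qed

lemma fourier_powi: "fourier (\<lambda>z. z powi k) n = (if n = k then 1 else 0)"
proof -
  have "fourier (\<lambda>z. z powi k) n = (\<integral>z. z powi (k - n) \<partial>\<mm>)"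
    unfolding fourier_def
  proof (rule Bochner_Integration.integral_cong[OF refl])
    fix z assume "z \<in> space \<mm>"
    then have "z \<noteq> 0" by auto
    then show "z powi k * z powi (- n) = z powi (k - n)"
      using power_int_add[of z k "- n"] by simp
  qed
  then show ?thesis by (simp add: circle_integral_powi)
qed

lemma fourier_cnj: "fourier (\<lambda>z. cnj (f z)) n = cnj (fourier f (- n))"
proof -
  have "fourier (\<lambda>z. cnj (f z)) n = (\<integral>z. cnj (f z * z powi n) \<partial>\<mm>)"
    unfolding fourier_def
    by (rule Bochner_Integration.integral_cong[OF refl]) (simp add: cnj_powi_sphere del: complex_cnj_power_int)
  also have "\<dots> = cnj (fourier f (- n))" unfolding fourier_def by (simp only: Bochner_Integration.integral_cnj minus_minus)
  finally show ?thesis .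
qed

lemma cauchy_integral_one: "cmod z < 1 \<Longrightarrow> cauchy_integral (\<lambda>_. 1) z = 1"
proof -
  assume z: "cmod z < 1"
  have f1: "fourier (\<lambda>_. 1) (int n) = (if n = 0 then 1 else 0)" for n
    using fourier_powi[of 0 "int n"] by simp
  have "(\<lambda>n. fourier (\<lambda>_. 1) (int n) * z ^ n) sums cauchy_integral (\<lambda>_. 1) z"
    by (rule cauchy_integral_sums(1)[OF _ z]) simp
  moreover have "(\<lambda>n. fourier (\<lambda>_. 1) (int n) * z ^ n) = (\<lambda>n. if n = 0 then 1 else 0)"
    by (auto simp: f1)
  moreover have "(\<lambda>n. if n = (0::nat) then 1 else 0) sums (1::complex)" using sums_single[of 0 "\<lambda>_. 1"] by simp
  ultimately show ?thesis using sums_unique2 by metis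
qed

lemma poisson_integral_one: "cmod z < 1 \<Longrightarrow> poisson_integral (\<lambda>_. 1) z = 1"
  using poisson_integral_eq_cauchy[of "\<lambda>_. 1" z] cauchy_integral_one[of z] fourier_powi[of 0 0] by simp

lemma poisson_upper:
  assumes "\<xi> \<in> sphere 0 1" "cmod z < 1" shows "poisson z \<xi> \<le> 2 / (1 - cmod z)"
proof -
  have d: "1 - cmod z \<le> cmod (\<xi> - z)" using norm_triangle_ineq2[of \<xi> z] assms by simp
  have "poisson z \<xi> \<le> (1 - (cmod z)\<^sup>2) / (1 - cmod z)\<^sup>2"
    unfolding poisson_def using assms d
    by (intro divide_left_mono power_mono mult_pos_pos) (auto simp: power_le_one)
  also have "\<dots> = (1 + cmod z) / (1 - cmod z)"
  proof -
    have "1 - (cmod z)\<^sup>2 = (1 + cmod z) * (1 - cmod z)" by (simp add: power2_eq_square algebra_simps)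
    then show ?thesis using assms by (simp add: power2_eq_square)
  qed
  also have "\<dots> \<le> 2 / (1 - cmod z)" using assms by (intro divide_right_mono) auto
  finally show ?thesis .
qed

lemma integrable_poisson_mult:
  assumes "integrable \<mm> f" "cmod z < 1"
  shows "integrable \<mm> (\<lambda>\<xi>. of_real (poisson z \<xi>) * (f \<xi> :: complex))"
proof (rule Bochner_Integration.integrable_bound)
  show "integrable \<mm> (\<lambda>\<xi>. (2 / (1 - cmod z)) * cmod (f \<xi>))" using assms by simp
  show "AE \<xi> in \<mm>. norm (of_real (poisson z \<xi>) * f \<xi>) \<le> norm ((2 / (1 - cmod z)) * cmod (f \<xi>))"
  proof (rule AE_I2)
    fix \<xi> assume x: "\<xi> \<in> space \<mm>"
    have "poisson z \<xi> * cmod (f \<xi>) \<le> (2 / (1 - cmod z)) * cmod (f \<xi>)"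
      using x assms(2) by (intro mult_right_mono poisson_upper) auto
    then show "norm (of_real (poisson z \<xi>) * f \<xi>) \<le> norm ((2 / (1 - cmod z)) * cmod (f \<xi>))"
      using poisson_nonneg[OF assms(2), of \<xi>] assms(2) by (simp add: norm_mult)
  qed
qed (use assms in measurable)

lemma poisson_integral_diff:
  assumes "integrable \<mm> f" "integrable \<mm> g" "cmod z < 1"
  shows "poisson_integral (\<lambda>\<xi>. f \<xi> - g \<xi>) z = poisson_integral f z - poisson_integral g z"
  unfolding poisson_integral_def using integrable_poisson_mult[OF assms(1,3)] integrable_poisson_mult[OF assms(2,3)]
  by (simp add: algebra_simps)

lemma poisson_integral_add:
  assumes "integrable \<mm> f" "integrable \<mm> g" "cmod z < 1"
  shows "poisson_integral (\<lambda>\<xi>. f \<xi> + g \<xi>) z = poisson_integral f z + poisson_integral g z"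
  unfolding poisson_integral_def using integrable_poisson_mult[OF assms(1,3)] integrable_poisson_mult[OF assms(2,3)]
  by (simp add: algebra_simps)

lemma poisson_integral_scale: "poisson_integral (\<lambda>\<xi>. c * f \<xi>) z = c * poisson_integral f z"
proof -
  have "poisson_integral (\<lambda>\<xi>. c * f \<xi>) z = (\<integral>\<xi>. c * (of_real (poisson z \<xi>) * f \<xi>) \<partial>\<mm>)"
    unfolding poisson_integral_def by (rule Bochner_Integration.integral_cong) auto
  then show ?thesis by (simp add: poisson_integral_def)
qed

lemma norm_poisson_integral_le:
  assumes "integrable \<mm> f" "cmod z < 1"
  shows "cmod (poisson_integral f z) \<le> (\<integral>\<xi>. poisson z \<xi> * cmod (f \<xi>) \<partial>\<mm>)"
proof -
  have "cmod (poisson_integral f z) \<le> (\<integral>\<xi>. cmod (of_real (poisson z \<xi>) * f \<xi>) \<partial>\<mm>)"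
    unfolding poisson_integral_def by (rule integral_norm_bound)
  also have "\<dots> = (\<integral>\<xi>. poisson z \<xi> * cmod (f \<xi>) \<partial>\<mm>)"
    by (rule Bochner_Integration.integral_cong) (auto simp: norm_mult poisson_nonneg[OF assms(2)])
  finally show ?thesis .
qed

section \<open>Fatou's theorem\<close>

lemma borel_Int_sphere: "A \<in> sets borel \<Longrightarrow> A \<inter> sphere 0 1 \<in> sets circle_borel"
  unfolding circle_borel_def sets_restrict_space by auto

text \<open>Up to \<open>pi / 3\<close> the cosine is at least 1/2; beyond it the sine is at least
  \<open>sqrt 3 / 2\<close>, which exceeds \<open>pi / 4\<close>.\<close>

lemma half_le_sin:
  assumes "0 \<le> x" "x \<le> pi / 2" shows "x / 2 \<le> sin x"
proof (cases "x \<le> pi / 3")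
  case True
  show ?thesis
  proof (cases "x = 0")
    case False
    then obtain z where z: "0 < z" "z < x" "sin x - sin 0 = (x - 0) * cos z"
      using MVT2[of 0 x sin cos] assms by (auto intro: DERIV_sin)
    have "cos (pi / 3) \<le> cos z" using z True assms pi_gt_zero by (intro cos_monotone_0_pi_le) auto
    then have "x * (1/2) \<le> x * cos z" using assms by (intro mult_left_mono) (auto simp: cos_60)
    then show ?thesis using z by simp
  qed simp
next
  case False
  have "sqrt 3 / 2 = sin (pi / 3)" by (simp add: sin_60)
  also have "\<dots> \<le> sin x" using False assms by (intro sin_monotone_2pi_le) auto
  finally have "sqrt 3 / 2 \<le> sin x" .
  moreover have "x / 2 \<le> sqrt 3 / 2"
  proof -
    have "1.7 \<le> sqrt (3::real)" by (rule real_le_rsqrt) (simp add: power2_eq_square)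
    then show ?thesis using assms pi_less_4 pi_approx by simp
  qed
  ultimately show ?thesis by simp
qed

lemma dist_cis: "cmod (cis t - cis s) = 2 * \<bar>sin ((t - s) / 2)\<bar>"
proof -
  have "cis t - cis s = cis s * (cis (t - s) - 1)" by (simp add: algebra_simps cis_mult)
  then have "cmod (cis t - cis s) = cmod (exp (\<i> * of_real (t - s)) - 1)"
    by (simp add: norm_mult cis_conv_exp)
  then show ?thesis by (simp only: dist_exp_i_1)
qed

text \<open>A chord of length at most \<open>r\<close> means an angle within \<open>2 * r\<close> of
  \<open>s\<close> modulo \<open>2 * pi\<close>; within one period the shifts by \<open>-1\<close>,
  \<open>0\<close>, \<open>1\<close> cover all cases. The total length \<open>12 * r\<close> divided
  by \<open>2 * pi\<close> is below \<open>4 * r\<close>.\<close>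

lemma circle_emeasure_cball:
  assumes z: "z \<in> sphere 0 1" and r: "0 \<le> r"
  shows "emeasure \<mm> (cball z r \<inter> sphere 0 1) \<le> ennreal (4 * r)"
proof -
  obtain s where s: "z = cis s" "0 \<le> s" "s < 2 * pi"
    using z Arg2pi by (metis dist_0_norm mem_sphere complex_norm_eq_1_exp cis_conv_exp Arg2pi_ge_0 Arg2pi_lt_2pi)
  define I where "I k = {s + 2 * pi * k - 2 * r .. s + 2 * pi * k + 2 * r}" for k :: real
  define A where "A = {t \<in> {0..<2*pi}. cmod (cis t - z) \<le> r}"
  have "A \<subseteq> I (-1) \<union> I 0 \<union> I 1"
  proof
    fix t assume "t \<in> A"
    then have t: "0 \<le> t" "t < 2 * pi" "2 * \<bar>sin ((t - s) / 2)\<bar> \<le> r" by (auto simp: A_def s dist_cis)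
    define x where "x = \<bar>t - s\<bar> / 2"
    have x: "0 \<le> x" "x < pi" using s t by (auto simp: x_def abs_if)
    have sx: "\<bar>sin ((t - s) / 2)\<bar> = sin x"
    proof (cases "t \<ge> s")
      case True
      then have "(t - s) / 2 = x" by (simp add: x_def)
      then show ?thesis using sin_ge_zero[of x] x by simp
    next
      case False
      then have "(t - s) / 2 = - x" by (simp add: x_def field_simps)
      then show ?thesis using sin_ge_zero[of x] x by simp
    qed
    show "t \<in> I (-1) \<union> I 0 \<union> I 1"
    proof (cases "x \<le> pi / 2")
      case True
      then have "x \<le> r" using half_le_sin[OF x(1)] t(3) sx by simp
      then have "t \<in> I 0" using r by (auto simp: I_def x_def abs_if split: if_splits)
      then show ?thesis by blast
    next
      case False
      have "(pi - x) / 2 \<le> sin (pi - x)" using False x by (intro half_le_sin) auto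
      then have "pi - x \<le> r" using t(3) sx by simp
      then have "t \<in> (if s \<le> t then I 1 else I (-1))" using r s(2,3) t(1,2) by (auto simp: I_def x_def field_simps)
      then show ?thesis by (auto split: if_splits)
    qed
  qed
  then have "emeasure lborel A \<le> emeasure lborel (I (-1) \<union> I 0 \<union> I 1)"
    by (intro emeasure_mono) (auto simp: I_def)
  also have "\<dots> \<le> emeasure lborel (I (-1)) + emeasure lborel (I 0) + emeasure lborel (I 1)"
    by (intro order_trans[OF emeasure_subadditive] add_mono) (auto simp: I_def)
  also have "\<dots> = ennreal (12 * r)"
    using r by (simp add: I_def ennreal_plus[symmetric] del: ennreal_plus)
  finally have A: "emeasure lborel A \<le> ennreal (12 * r)" .
  have B: "cball z r \<inter> sphere 0 1 \<in> sets circle_borel"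
    by (simp add: borel_Int_sphere)
  have pre: "cis -` (cball z r \<inter> sphere 0 1) \<in> sets lborel"
    using measurable_sets[OF measurable_cis_circle B] by simp
  have "emeasure \<mm> (cball z r \<inter> sphere 0 1)
      = emeasure (uniform_measure lborel {0..<2*pi}) (cis -` (cball z r \<inter> sphere 0 1))"
    unfolding circle_measure_def using measurable_cis_uniform B by (simp add: emeasure_distr)
  also have "\<dots> = emeasure lborel ({0..<2*pi} \<inter> cis -` (cball z r \<inter> sphere 0 1)) / emeasure lborel {0..<2*pi}"
    by (rule emeasure_uniform_measure) (use pre in auto)
  also have "{0..<2*pi} \<inter> cis -` (cball z r \<inter> sphere 0 1) = A"
    by (auto simp: A_def dist_norm norm_minus_commute)
  also have "emeasure lborel A / emeasure lborel {0..<2*pi} \<le> ennreal (12 * r) / ennreal (2 * pi)"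
    using A by (simp add: divide_right_mono_ennreal)
  also have "\<dots> = ennreal (12 * r / (2 * pi))" using r by (intro divide_ennreal) auto
  also have "\<dots> \<le> ennreal (4 * r)"
  proof (rule ennreal_leI)
    have "12 * r \<le> (4 * r) * (2 * pi)" using r pi_gt3 mult_left_mono[of 3 pi "8 * r"] by simp
    then show "12 * r / (2 * pi) \<le> 4 * r" by (subst pos_divide_le_eq) auto
  qed
  finally show ?thesis .
qed

text \<open>With \<open>d = 1 - r\<close> and \<open>D = cmod (\<xi> - of_real r * z)\<close> the
  kernel is at most \<open>2 * d / D\<^sup>2\<close>, and \<open>D\<close> dominates both
  \<open>d\<close> and half of \<open>cmod (\<xi> - z)\<close>. The least \<open>j\<close> with
  \<open>cmod (\<xi> - z) \<le> 2 ^ j * d\<close> therefore has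
  \<open>d * 2 ^ j \<le> 4 * D\<close>, whence the constant 32.\<close>

lemma poisson_dyadic_bound:
  assumes "z \<in> sphere 0 1" "\<xi> \<in> sphere 0 1" "0 \<le> r" "r < 1"
  shows "\<exists>j. \<xi> \<in> cball z (2 ^ j * (1 - r)) \<and> poisson (of_real r * z) \<xi> \<le> 32 / ((1 - r) * 4 ^ j)"
proof -
  define d where "d = 1 - r"
  have d: "0 < d" using assms by (simp add: d_def)
  have nz: "cmod (of_real r * z) = r" using assms by (simp add: norm_mult)
  define D where "D = cmod (\<xi> - of_real r * z)"
  have Dd: "d \<le> D" using norm_triangle_ineq2[of \<xi> "of_real r * z"] assms nz by (simp add: D_def d_def)
  have "z - of_real r * z = of_real d * z" by (simp add: d_def algebra_simps)
  then have "cmod (z - of_real r * z) = d" using assms d by (simp add: norm_mult)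
  then have "cmod (\<xi> - z) \<le> D + d"
    using norm_triangle_ineq4[of "\<xi> - of_real r * z" "z - of_real r * z"] by (simp add: D_def)
  then have Dx: "cmod (\<xi> - z) \<le> 2 * D" using Dd by simp
  have "1 - r\<^sup>2 = (1 + r) * d" by (simp add: d_def power2_eq_square algebra_simps)
  also have "\<dots> \<le> 2 * d" using assms d by (intro mult_right_mono) auto
  finally have P: "poisson (of_real r * z) \<xi> \<le> 2 * d / D\<^sup>2"
    using Dd d by (simp add: poisson_def nz D_def[symmetric] divide_right_mono)
  obtain n where "cmod (\<xi> - z) / d < 2 ^ n" using real_arch_pow[of 2 "cmod (\<xi> - z) / d"] by auto
  then have ex: "\<exists>n. cmod (\<xi> - z) \<le> 2 ^ n * d" using d by (auto simp: field_simps intro: less_imp_le)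
  define j where "j = (LEAST n. cmod (\<xi> - z) \<le> 2 ^ n * d)"
  have j: "cmod (\<xi> - z) \<le> 2 ^ j * d" unfolding j_def by (rule LeastI_ex[OF ex])
  have "d * 2 ^ j \<le> 4 * D"
  proof (cases j)
    case 0
    then show ?thesis using Dd d by simp
  next
    case (Suc i)
    then have "\<not> cmod (\<xi> - z) \<le> 2 ^ i * d"
      using not_less_Least[of i "\<lambda>n. cmod (\<xi> - z) \<le> 2 ^ n * d"] by (simp add: j_def)
    then have "2 ^ i * d \<le> 2 * D" using Dx by linarith
    then show ?thesis using Suc by (simp add: mult.commute)
  qed
  then have "(d * 2 ^ j / 4)\<^sup>2 \<le> D\<^sup>2" using d by (intro power_mono) auto
  then have "2 * d / D\<^sup>2 \<le> 2 * d / (d * 2 ^ j / 4)\<^sup>2"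
    using d Dd by (intro divide_left_mono) auto
  also have "\<dots> = 32 / (d * 4 ^ j)"
    using d by (simp add: power2_eq_square field_simps power_mult_distrib[symmetric])
  finally have "poisson (of_real r * z) \<xi> \<le> 32 / (d * 4 ^ j)" using P by simp
  then show ?thesis using j by (intro exI[of _ j]) (auto simp: dist_norm norm_minus_commute d_def)
qed

text \<open>In the sum of the dyadic bounds ball \<open>j\<close> contributes at most
  \<open>32 * c / 2 ^ j\<close>: the kernel gains a factor \<open>1 / 4 ^ j\<close> while the radius
  grows only by \<open>2 ^ j\<close>. The series adds up to \<open>64 * c\<close>.\<close>

lemma poisson_average_le:
  assumes f: "integrable \<mm> f" and z: "x \<in> sphere 0 1" and r: "0 \<le> r" "r < 1"
    and avg: "\<And>\<rho>. 0 < \<rho> \<Longrightarrow> (\<integral>\<^sup>+\<xi>. ennreal (cmod (f \<xi>)) * indicator (cball x \<rho>) \<xi> \<partial>\<mm>) \<le> ennreal (c * \<rho>)"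
    and c: "0 \<le> c"
  shows "cmod (poisson_integral f (of_real r * x)) \<le> 64 * c"
proof -
  let ?z = "of_real r * x"
  define d where "d = 1 - r"
  have d: "0 < d" using r by (simp add: d_def)
  have nz: "cmod ?z < 1" using z r by (simp add: norm_mult)
  have fm [measurable]: "f \<in> borel_measurable \<mm>" using f by simp
  have cm [measurable]: "cball x \<rho> \<inter> sphere 0 1 \<in> sets \<mm>" for \<rho>
    by (simp add: borel_Int_sphere)
  have im [measurable]: "(\<lambda>\<xi>. indicator (cball x \<rho>) \<xi> :: ennreal) \<in> borel_measurable \<mm>" for \<rho>
    by (subst measurable_cong[of _ _ "indicator (cball x \<rho> \<inter> sphere 0 1)"]) (auto simp: indicator_def)
  have ipr: "integrable \<mm> (\<lambda>\<xi>. poisson ?z \<xi> * cmod (f \<xi>))"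
    using integrable_norm[OF integrable_poisson_mult[OF f nz]] poisson_nonneg[OF nz]
    by (simp add: norm_mult)
  have "ennreal (\<integral>\<xi>. poisson ?z \<xi> * cmod (f \<xi>) \<partial>\<mm>)
      = (\<integral>\<^sup>+\<xi>. ennreal (poisson ?z \<xi> * cmod (f \<xi>)) \<partial>\<mm>)"
    using ipr poisson_nonneg[OF nz] by (intro nn_integral_eq_integral[symmetric]) auto
  also have "\<dots> \<le> (\<integral>\<^sup>+\<xi>. (\<Sum>j. ennreal (32 / (d * 4 ^ j)) * (ennreal (cmod (f \<xi>)) * indicator (cball x (2 ^ j * d)) \<xi>)) \<partial>\<mm>)"
  proof (rule nn_integral_mono)
    fix \<xi> assume "\<xi> \<in> space \<mm>"
    then obtain j where j: "\<xi> \<in> cball x (2 ^ j * d)" "poisson ?z \<xi> \<le> 32 / (d * 4 ^ j)"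
      using poisson_dyadic_bound[OF z _ r, of \<xi>] by (auto simp: d_def)
    have "ennreal (poisson ?z \<xi> * cmod (f \<xi>)) \<le> ennreal (32 / (d * 4 ^ j) * cmod (f \<xi>))"
      using j by (intro ennreal_leI mult_right_mono) auto
    also have "\<dots> = ennreal (32 / (d * 4 ^ j)) * (ennreal (cmod (f \<xi>)) * indicator (cball x (2 ^ j * d)) \<xi>)"
      using j d by (subst ennreal_mult) auto
    also have "\<dots> \<le> (\<Sum>j. ennreal (32 / (d * 4 ^ j)) * (ennreal (cmod (f \<xi>)) * indicator (cball x (2 ^ j * d)) \<xi>))"
      using sum_le_suminf[of "\<lambda>j. ennreal (32 / (d * 4 ^ j)) * (ennreal (cmod (f \<xi>)) * indicator (cball x (2 ^ j * d)) \<xi>)" "{j}"]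
      by simp
    finally show "ennreal (poisson ?z \<xi> * cmod (f \<xi>)) \<le> (\<Sum>j. ennreal (32 / (d * 4 ^ j)) * (ennreal (cmod (f \<xi>)) * indicator (cball x (2 ^ j * d)) \<xi>))" .
  qed
  also have "\<dots> = (\<Sum>j. ennreal (32 / (d * 4 ^ j)) * (\<integral>\<^sup>+\<xi>. ennreal (cmod (f \<xi>)) * indicator (cball x (2 ^ j * d)) \<xi> \<partial>\<mm>))"
    by (simp add: nn_integral_suminf nn_integral_cmult)
  also have "\<dots> \<le> (\<Sum>j. ennreal (32 * c * (1/2) ^ j))"
  proof (rule suminf_le)
    fix j :: nat
    have "ennreal (32 / (d * 4 ^ j)) * (\<integral>\<^sup>+\<xi>. ennreal (cmod (f \<xi>)) * indicator (cball x (2 ^ j * d)) \<xi> \<partial>\<mm>)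
        \<le> ennreal (32 / (d * 4 ^ j)) * ennreal (c * (2 ^ j * d))"
      using d by (intro mult_left_mono avg) auto
    also have "\<dots> = ennreal (32 / (d * 4 ^ j) * (c * (2 ^ j * d)))"
      using d c by (subst ennreal_mult) auto
    also have "32 / (d * 4 ^ j) * (c * (2 ^ j * d)) = 32 * c * (1/2) ^ j"
    proof -
      have "(4::real) ^ j = 2 ^ j * 2 ^ j" by (simp flip: power_mult_distrib)
      then show ?thesis using d by (simp add: field_simps power_one_over)
    qed
    finally show "ennreal (32 / (d * 4 ^ j)) * (\<integral>\<^sup>+\<xi>. ennreal (cmod (f \<xi>)) * indicator (cball x (2 ^ j * d)) \<xi> \<partial>\<mm>)
        \<le> ennreal (32 * c * (1/2) ^ j)" .
  qed auto
  also have "\<dots> = ennreal (64 * c)"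
    using sums_mult[OF geometric_sums[of "1/2::real"], of "32 * c"] c
    by (intro suminf_ennreal_eq) auto
  finally have "(\<integral>\<xi>. poisson ?z \<xi> * cmod (f \<xi>) \<partial>\<mm>) \<le> 64 * c"
    using c by (subst (asm) ennreal_le_iff) auto
  then show ?thesis using norm_poisson_integral_le[OF f nz] by simp
qed

text \<open>
  The weak-type estimate: the exceptional set of large ball averages is covered, by Vitali's lemma,
  by five-fold enlargements of disjoint balls on which the average is large.
\<close>

lemma maximal_weak_type:
  assumes f: "integrable \<mm> f" and c: "0 < c"
  shows "\<exists>N\<in>sets \<mm>. emeasure \<mm> N \<le> ennreal (20 / c * (\<integral>\<xi>. cmod (f \<xi>) \<partial>\<mm>)) \<and>
    (\<forall>y\<in>sphere 0 1 - N. \<forall>r. 0 \<le> r \<longrightarrow> r < 1 \<longrightarrow> cmod (poisson_integral f (of_real r * y)) \<le> 64 * c)"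
proof -
  define I where "I = (\<integral>\<xi>. cmod (f \<xi>) \<partial>\<mm>)"
  define a where "a y \<rho> = (\<integral>\<^sup>+\<xi>. ennreal (cmod (f \<xi>)) * indicator (cball y \<rho>) \<xi> \<partial>\<mm>)" for y \<rho>
  define S where "S = {y \<in> sphere 0 1. \<exists>\<rho>>0. ennreal (c * \<rho>) < a y \<rho>}"
  have fm [measurable]: "f \<in> borel_measurable \<mm>" using f by simp
  have nnI: "(\<integral>\<^sup>+\<xi>. ennreal (cmod (f \<xi>)) \<partial>\<mm>) = ennreal I"
    unfolding I_def using f by (intro nn_integral_eq_integral) auto
  have I0: "0 \<le> I" by (simp add: I_def)
  have im [measurable]: "(\<lambda>\<xi>. indicator (cball y \<rho>) \<xi> :: ennreal) \<in> borel_measurable \<mm>" for y \<rho>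
    by (subst measurable_cong[of _ _ "indicator (cball y \<rho> \<inter> sphere 0 1)"])
       (auto simp: indicator_def borel_Int_sphere intro!: borel_measurable_indicator)
  have a_le: "a y \<rho> \<le> ennreal I" for y \<rho>
    unfolding a_def nnI[symmetric] by (rule nn_integral_mono) (auto simp: indicator_def)
  obtain \<rho> where \<rho>: "\<And>y. y \<in> S \<Longrightarrow> 0 < \<rho> y \<and> ennreal (c * \<rho> y) < a y (\<rho> y)"
  proof -
    have "\<forall>y\<in>S. \<exists>\<rho>. 0 < \<rho> \<and> ennreal (c * \<rho>) < a y \<rho>" by (auto simp: S_def)
    then show ?thesis using that by (metis bchoice)
  qed
  \<comment> \<open>Vitali's lemma requires bounded radii; a ball carrying more than
    \<open>c * \<rho> y\<close> of the integral of \<open>cmod (f \<xi>)\<close> has radius at most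
    \<open>I / c\<close>.\<close>
  have \<rho>B: "\<rho> y \<le> I / c" if "y \<in> S" for y
  proof -
    have "ennreal (c * \<rho> y) \<le> ennreal I" using \<rho>[OF that] a_le[of y "\<rho> y"] by (meson less_imp_le order_trans)
    then have "c * \<rho> y \<le> I" using I0 by (subst (asm) ennreal_le_iff) auto
    then show ?thesis using c by (simp add: field_simps)
  qed
  obtain C where C: "countable C" "C \<subseteq> S"
    "pairwise (\<lambda>i j. disjnt (cball i (\<rho> i)) (cball j (\<rho> j))) C"
    "S \<subseteq> (\<Union>i\<in>C. cball i (5 * \<rho> i))"
  proof (rule Vitali_covering_lemma_cballs[where S=S and K=S and a="\<lambda>i. i" and r=\<rho> and B="I / c"])
    show "S \<subseteq> (\<Union>i\<in>S. cball i (\<rho> i))" using \<rho> by (force intro: less_imp_le)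
  qed (use \<rho> \<rho>B in auto)
  define N where "N = (\<Union>i\<in>C. cball i (5 * \<rho> i) \<inter> sphere 0 1)"
  have ballm: "cball i s \<inter> sphere 0 1 \<in> sets \<mm>" for i s
    by (simp add: borel_Int_sphere)
  have N: "N \<in> sets \<mm>" unfolding N_def 
    by (rule sets.countable_UN'[OF C(1)]) (use ballm in blast)
  define e where "e n = from_nat_into C n" for n
  define J where "J = to_nat_on C ` C"
  have eJ: "e n \<in> C" "to_nat_on C (e n) = n" if "n \<in> J" for n
    using that C(1) by (auto simp: J_def e_def)
  have Ce: "\<exists>n\<in>J. e n = i" if "i \<in> C" for i using that C(1) by (auto simp: J_def e_def intro!: bexI[of _ i])
  define Y where "Y n = (if n \<in> J then cball (e n) (\<rho> (e n)) else {})" for n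
  define Z where "Z n = (if n \<in> J then cball (e n) (5 * \<rho> (e n)) \<inter> sphere 0 1 else {})" for n
  have dY: "disjoint_family Y"
    unfolding disjoint_family_on_def
  proof (intro ballI impI)
    fix m n :: nat assume "m \<noteq> n"
    show "Y m \<inter> Y n = {}"
    proof (cases "m \<in> J \<and> n \<in> J")
      case True
      then have "e m \<noteq> e n" using eJ \<open>m \<noteq> n\<close> by metis
      then have "disjnt (cball (e m) (\<rho> (e m))) (cball (e n) (\<rho> (e n)))"
        using C(3) eJ True by (auto simp: pairwise_def)
      then show ?thesis using True by (simp add: Y_def disjnt_def)
    qed (auto simp: Y_def)
  qed
  have imY [measurable]: "(\<lambda>\<xi>. indicator (Y n) \<xi> :: ennreal) \<in> borel_measurable \<mm>" for n
    unfolding Y_def by (cases "n \<in> J") auto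
  have Zle: "emeasure \<mm> (Z n) \<le> ennreal (20 / c) * (\<integral>\<^sup>+\<xi>. ennreal (cmod (f \<xi>)) * indicator (Y n) \<xi> \<partial>\<mm>)" for n
  proof (cases "n \<in> J")
    case True
    then have eS: "e n \<in> S" using eJ C by auto
    then have "e n \<in> sphere 0 1" by (simp add: S_def)
    \<comment> \<open>The factor 4 from the measure of arcs times 5 from the enlargement gives the
      constant 20.\<close>
    then have "emeasure \<mm> (Z n) \<le> ennreal (4 * (5 * \<rho> (e n)))"
      using circle_emeasure_cball[of "e n" "5 * \<rho> (e n)"] True \<rho>[OF eS] by (simp add: Z_def)
    also have "\<dots> = ennreal (20 / c) * ennreal (c * \<rho> (e n))"
      using c \<rho>[OF eS] by (subst ennreal_mult[symmetric]) auto
    also have "\<dots> \<le> ennreal (20 / c) * a (e n) (\<rho> (e n))"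
      using \<rho>[OF eS] by (intro mult_left_mono) auto
    finally show ?thesis using True by (simp add: a_def Y_def)
  qed (simp add: Z_def)
  have "N = (\<Union>n. Z n)"
  proof (intro equalityI subsetI)
    fix x assume "x \<in> N"
    then obtain i where i: "i \<in> C" "x \<in> cball i (5 * \<rho> i) \<inter> sphere 0 1" by (auto simp: N_def)
    then obtain n where "n \<in> J" "e n = i" using Ce by blast
    then have "x \<in> Z n" using i by (simp add: Z_def)
    then show "x \<in> (\<Union>n. Z n)" by blast
  next
    fix x assume "x \<in> (\<Union>n. Z n)"
    then obtain n where "x \<in> Z n" by blast
    then show "x \<in> N" using eJ by (auto simp: Z_def N_def split: if_splits)
  qed
  moreover have "range Z \<subseteq> sets \<mm>" using ballm by (auto simp: Z_def)
  ultimately have "emeasure \<mm> N \<le> (\<Sum>n. emeasure \<mm> (Z n))"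
    by (simp only: emeasure_subadditive_countably)
  also have "\<dots> \<le> (\<Sum>n. ennreal (20 / c) * (\<integral>\<^sup>+\<xi>. ennreal (cmod (f \<xi>)) * indicator (Y n) \<xi> \<partial>\<mm>))"
    by (intro suminf_le Zle) auto
  also have "\<dots> = ennreal (20 / c) * (\<integral>\<^sup>+\<xi>. (\<Sum>n. ennreal (cmod (f \<xi>)) * indicator (Y n) \<xi>) \<partial>\<mm>)"
    by (subst nn_integral_suminf) auto
  also have "\<dots> \<le> ennreal (20 / c) * (\<integral>\<^sup>+\<xi>. ennreal (cmod (f \<xi>)) \<partial>\<mm>)"
  proof (intro mult_left_mono nn_integral_mono)
    fix \<xi>
    have "(\<Sum>n. ennreal (cmod (f \<xi>)) * indicator (Y n) \<xi>) = ennreal (cmod (f \<xi>)) * indicator (\<Union>n. Y n) \<xi>"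
      by (simp add: suminf_indicator[OF dY])
    also have "\<dots> \<le> ennreal (cmod (f \<xi>))" by (auto simp: indicator_def)
    finally show "(\<Sum>n. ennreal (cmod (f \<xi>)) * indicator (Y n) \<xi>) \<le> ennreal (cmod (f \<xi>))" .
  qed auto
  also have "\<dots> = ennreal (20 / c * I)" unfolding nnI using c I0 by (intro ennreal_mult[symmetric]) auto
  finally have Nle: "emeasure \<mm> N \<le> ennreal (20 / c * I)" .
  show ?thesis
  proof (intro bexI[of _ N] conjI ballI allI impI)
    fix y r assume z: "y \<in> sphere 0 1 - N" and r: "0 \<le> (r::real)" "r < 1"
    then have "y \<notin> S" using C(4) by (auto simp: N_def)
    then have "a y \<rho> \<le> ennreal (c * \<rho>)" if "0 < \<rho>" for \<rho> 
      using z that unfolding S_def by (metis (mono_tags, lifting) DiffD1 mem_Collect_eq not_less)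
    then show "cmod (poisson_integral f (of_real r * y)) \<le> 64 * c"
      using z r c by (intro poisson_average_le[OF f]) (auto simp: a_def)
  qed (use N Nle in \<open>auto simp: I_def\<close>)
qed

section \<open>Almost everywhere radial limits of Poisson integrals\<close>

definition fatou_property :: "(complex \<Rightarrow> complex) \<Rightarrow> bool" where
  "fatou_property f \<longleftrightarrow> integrable \<mm> f \<and>
     (AE z in \<mm>. ((\<lambda>r. poisson_integral f (of_real r * z)) \<longlongrightarrow> f z) (at_left 1))"

lemma eventually_at_left_1: "\<forall>\<^sub>F r in at_left (1::real). 0 < r \<and> r < 1"
  using eventually_at_left_real[of 0 1] by (auto elim: eventually_mono)

lemma fatou_property_add:
  assumes "fatou_property f" "fatou_property g" shows "fatou_property (\<lambda>\<xi>. f \<xi> + g \<xi>)"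
  unfolding fatou_property_def
proof
  have f: "integrable \<mm> f" and g: "integrable \<mm> g"
    using assms by (auto simp: fatou_property_def)
  then show "integrable \<mm> (\<lambda>\<xi>. f \<xi> + g \<xi>)" by simp
  have "AE z in \<mm>. ((\<lambda>r. poisson_integral f (of_real r * z)) \<longlongrightarrow> f z) (at_left 1)"
    "AE z in \<mm>. ((\<lambda>r. poisson_integral g (of_real r * z)) \<longlongrightarrow> g z) (at_left 1)"
    using assms by (auto simp: fatou_property_def)
  then show "AE z in \<mm>. ((\<lambda>r. poisson_integral (\<lambda>\<xi>. f \<xi> + g \<xi>) (of_real r * z)) \<longlongrightarrow> f z + g z) (at_left 1)"
    using AE_space
  proof eventually_elim
    case (elim z)
    show ?case
    proof (rule Lim_transform_eventually[OF tendsto_add[OF elim(1,2)]])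
      show "\<forall>\<^sub>F r in at_left 1. poisson_integral f (of_real r * z) + poisson_integral g (of_real r * z)
          = poisson_integral (\<lambda>\<xi>. f \<xi> + g \<xi>) (of_real r * z)"
        using eventually_at_left_1
        by eventually_elim (use elim(3) in \<open>simp add: poisson_integral_add f g norm_mult\<close>)
    qed
  qed
qed

lemma fatou_property_scale:
  assumes "fatou_property f" shows "fatou_property (\<lambda>\<xi>. c * f \<xi>)"
  unfolding fatou_property_def poisson_integral_scale
proof
  have "AE z in \<mm>. ((\<lambda>r. poisson_integral f (of_real r * z)) \<longlongrightarrow> f z) (at_left 1)"
    using assms by (simp add: fatou_property_def)
  then show "AE z in \<mm>. ((\<lambda>r. c * poisson_integral f (of_real r * z)) \<longlongrightarrow> c * f z) (at_left 1)"
    by eventually_elim (rule tendsto_mult_left)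
qed (use assms in \<open>simp add: fatou_property_def\<close>)

lemma fatou_property_cong:
  assumes "fatou_property f" "\<And>\<xi>. \<xi> \<in> sphere 0 1 \<Longrightarrow> f \<xi> = g \<xi>" shows "fatou_property g"
proof -
  have "poisson_integral f z = poisson_integral g z" for z
    unfolding poisson_integral_def by (rule Bochner_Integration.integral_cong) (use assms in auto)
  moreover have "integrable \<mm> f \<longleftrightarrow> integrable \<mm> g"
    by (rule Bochner_Integration.integrable_cong) (use assms in auto)
  moreover have "AE x in \<mm>. ((\<lambda>r. poisson_integral f (of_real r * x)) \<longlongrightarrow> f x) (at_left 1)"
    using assms(1) by (simp add: fatou_property_def)
  then have "AE x in \<mm>. ((\<lambda>r. poisson_integral f (of_real r * x)) \<longlongrightarrow> g x) (at_left 1)"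
    using AE_space by eventually_elim (use assms(2) in simp)
  ultimately show ?thesis using assms(1) by (simp add: fatou_property_def)
qed

text \<open>Write \<open>f\<close> as \<open>g k\<close> plus a remainder. The weak-type estimate
  controls the Poisson integral of the remainder by \<open>64 * c\<close>, Markov's inequality the
  remainder itself by \<open>c\<close>, and the known limit for \<open>g k\<close> adds another
  \<open>c\<close>: hence \<open>66 * c\<close>. The exceptional sets have measure at most
  \<open>(20 + 1) / c\<close> times the L1 distance, which tends to 0.\<close>

lemma fatou_property_L1_limit:
  assumes f: "integrable \<mm> f" and g: "\<And>k. fatou_property (g k)"
    and lim: "(\<lambda>k. \<integral>\<xi>. cmod (f \<xi> - g k \<xi>) \<partial>\<mm>) \<longlonglongrightarrow> 0"
  shows "fatou_property f"
proof -
  have gi: "integrable \<mm> (g k)" for k using g by (simp add: fatou_property_def)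
  define good where "good c x \<longleftrightarrow> (\<forall>\<^sub>F r in at_left 1. cmod (poisson_integral f (of_real r * x) - f x) \<le> 66 * c)" for c x
  have AEgood: "AE x in \<mm>. good c x" if c: "0 < c" for c
  proof -
    define I where "I k = (\<integral>\<xi>. cmod (f \<xi> - g k \<xi>) \<partial>\<mm>)" for k
    have "\<exists>N\<in>sets \<mm>. emeasure \<mm> N \<le> ennreal (21 / c * I k) \<and>
        (AE x in \<mm>. x \<notin> N \<longrightarrow> good c x)" for k
    proof -
      have di: "integrable \<mm> (\<lambda>\<xi>. f \<xi> - g k \<xi>)" using f gi by simp
      obtain N where N: "N \<in> sets \<mm>" "emeasure \<mm> N \<le> ennreal (20 / c * I k)"
        "\<And>x r. x \<in> sphere 0 1 - N \<Longrightarrow> 0 \<le> r \<Longrightarrow> r < 1 \<Longrightarrow>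
          cmod (poisson_integral (\<lambda>\<xi>. f \<xi> - g k \<xi>) (of_real r * x)) \<le> 64 * c"
        using maximal_weak_type[OF di c] unfolding I_def by blast
      define N2 where "N2 = {\<xi> \<in> space \<mm>. c \<le> cmod (f \<xi> - g k \<xi>)}"
      have N2: "N2 \<in> sets \<mm>" unfolding N2_def using di by measurable
      have "emeasure \<mm> N2 \<le> ennreal (1 / c) * (\<integral>\<^sup>+\<xi>. ennreal (cmod (f \<xi> - g k \<xi>)) * indicator (space \<mm>) \<xi> \<partial>\<mm>)"
      proof -
        have "N2 = {\<xi> \<in> space \<mm>. 1 \<le> ennreal (1 / c) * ennreal (cmod (f \<xi> - g k \<xi>))}"
          using c by (auto simp: N2_def ennreal_mult[symmetric] field_simps ennreal_1[symmetric] simp del: ennreal_1)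
        then show ?thesis
          using nn_integral_Markov_inequality[of "\<lambda>\<xi>. ennreal (cmod (f \<xi> - g k \<xi>))" "space \<mm>" \<mm> "ennreal (1/c)"] di
            sets.top[of \<mm>]
          by simp
      qed
      also have "\<dots> = ennreal (1 / c) * ennreal (I k)"
        unfolding I_def using di
        by (subst nn_integral_eq_integral[symmetric]) (auto intro!: arg_cong2[where f="(*)"] nn_integral_cong)
      also have "\<dots> = ennreal (1 / c * I k)" using c by (subst ennreal_mult) (auto simp: I_def)
      finally have N2le: "emeasure \<mm> N2 \<le> ennreal (1 / c * I k)" .
      show ?thesis
      proof (intro bexI[of _ "N \<union> N2"] conjI)
        have "emeasure \<mm> (N \<union> N2) \<le> emeasure \<mm> N + emeasure \<mm> N2"
          by (rule emeasure_subadditive) (use N N2 in auto)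
        also have "\<dots> \<le> ennreal (20 / c * I k) + ennreal (1 / c * I k)" by (intro add_mono N N2le)
        also have "\<dots> = ennreal (21 / c * I k)"
          using c by (subst ennreal_plus[symmetric]) (auto simp: I_def field_simps)
        finally show "emeasure \<mm> (N \<union> N2) \<le> ennreal (21 / c * I k)" .
        show "AE x in \<mm>. x \<notin> N \<union> N2 \<longrightarrow> good c x"
          using g[of k, unfolded fatou_property_def, THEN conjunct2] AE_space
        proof eventually_elim
          case (elim x)
          show ?case
          proof
            assume z: "x \<notin> N \<union> N2"
            have "\<forall>\<^sub>F r in at_left 1. cmod (poisson_integral (g k) (of_real r * x) - g k x) < c"
              using tendstoD[OF elim(1) c] by (simp add: dist_norm)
            then show "good c x"
              unfolding good_def using eventually_at_left_1
            proof eventually_elim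
              case (elim r)
              then have nz: "cmod (of_real r * x) < 1" using \<open>x \<in> space \<mm>\<close> by (simp add: norm_mult)
              have "cmod (poisson_integral (\<lambda>\<xi>. f \<xi> - g k \<xi>) (of_real r * x)) \<le> 64 * c"
                using N(3) elim z \<open>x \<in> space \<mm>\<close> by auto
              then have 1: "cmod (poisson_integral f (of_real r * x) - poisson_integral (g k) (of_real r * x)) \<le> 64 * c"
                by (simp add: poisson_integral_diff[OF f gi nz])
              have 2: "cmod (g k x - f x) \<le> c"
                using z \<open>x \<in> space \<mm>\<close> by (auto simp: N2_def norm_minus_commute)
              have "poisson_integral f (of_real r * x) - f x =
                (poisson_integral f (of_real r * x) - poisson_integral (g k) (of_real r * x))
                + ((poisson_integral (g k) (of_real r * x) - g k x) + (g k x - f x))" by simp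
              also have "cmod \<dots> \<le> 64 * c + (c + c)"
                using elim 1 2 by (intro norm_triangle_mono) auto
              finally show ?case by simp
            qed
          qed
        qed
      qed (use N N2 in auto)
    qed
    then obtain N where N: "\<And>k. N k \<in> sets \<mm>"
      "\<And>k. emeasure \<mm> (N k) \<le> ennreal (21 / c * I k)"
      "\<And>k. AE x in \<mm>. x \<notin> N k \<longrightarrow> good c x" by metis
    have "(\<lambda>k. ennreal (21 / c * I k)) \<longlonglongrightarrow> ennreal (21 / c * 0)"
      unfolding I_def by (intro tendsto_ennrealI tendsto_mult_left lim)
    then have "(\<lambda>k. ennreal (21 / c * I k)) \<longlonglongrightarrow> 0" by simp
    \<comment> \<open>\<open>good\<close> does not mention \<open>k\<close>: almost every point
      outside even one of the sets \<open>N k\<close> is good, so the bad points lie, up to a null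
      set, in their intersection.\<close>
    then have "emeasure \<mm> (\<Inter>k. N k) \<le> 0"
    proof (rule LIMSEQ_le_const)
      have "emeasure \<mm> (\<Inter>k. N k) \<le> ennreal (21 / c * I k)" for k
        using emeasure_mono[of "\<Inter>k. N k" "N k" \<mm>] N(1,2)[of k] by (meson INT_lower UNIV_I order_trans)
      then show "\<exists>M. \<forall>n\<ge>M. emeasure \<mm> (\<Inter>k. N k) \<le> ennreal (21 / c * I n)" by blast
    qed
    moreover have "(\<Inter>k. N k) \<in> sets \<mm>" using N(1) by (intro sets.countable_INT) auto
    ultimately have "(\<Inter>k. N k) \<in> null_sets \<mm>" by (auto intro!: null_setsI)
    then have "AE x in \<mm>. x \<notin> (\<Inter>k. N k)" by (rule AE_not_in)
    moreover have "AE x in \<mm>. \<forall>k. x \<notin> N k \<longrightarrow> good c x"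
      unfolding AE_all_countable using N(3) by blast
    ultimately show ?thesis by eventually_elim auto
  qed
  have "AE x in \<mm>. \<forall>n::nat. good (1 / Suc n) x"
    unfolding AE_all_countable using AEgood by simp
  then have "AE x in \<mm>. ((\<lambda>r. poisson_integral f (of_real r * x)) \<longlongrightarrow> f x) (at_left 1)"
  proof eventually_elim
    case (elim x)
    show ?case
    proof (rule tendstoI)
      fix e :: real assume "e > 0"
      then obtain n where "inverse (real (Suc n)) < e / 66" using reals_Archimedean[of "e/66"] by auto
      then have n: "66 * (1 / Suc n) < e" by (simp add: field_simps)
      have "\<forall>\<^sub>F r in at_left 1. cmod (poisson_integral f (of_real r * x) - f x) \<le> 66 * (1 / Suc n)"
        using elim by (simp add: good_def)
      then show "\<forall>\<^sub>F r in at_left 1. dist (poisson_integral f (of_real r * x)) (f x) < e"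
        by eventually_elim (use n in \<open>simp add: dist_norm\<close>)
    qed
  qed
  then show ?thesis using f by (simp add: fatou_property_def)
qed

lemma fatou_property_dominated_limit:
  assumes g: "\<And>k. fatou_property (g k)" and lim: "\<And>\<xi>. \<xi> \<in> sphere 0 1 \<Longrightarrow> (\<lambda>k. g k \<xi>) \<longlonglongrightarrow> f \<xi>"
    and dom: "\<And>k \<xi>. \<xi> \<in> sphere 0 1 \<Longrightarrow> cmod (g k \<xi>) \<le> w \<xi>" and w: "integrable \<mm> w"
  shows "fatou_property f"
proof -
  have gi: "integrable \<mm> (g k)" for k using g by (simp add: fatou_property_def)
  have fm: "f \<in> borel_measurable \<mm>"
    by (rule borel_measurable_LIMSEQ_metric[of g]) (use gi lim in auto)
  have f: "integrable \<mm> f"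
    by (rule integrable_dominated_convergence[of f _ g w]) (use fm gi w lim dom in auto)
  have "cmod (f \<xi>) \<le> w \<xi>" if "\<xi> \<in> sphere 0 1" for \<xi>
    by (rule LIMSEQ_le_const2[OF tendsto_norm[OF lim[OF that]]]) (use dom that in auto)
  then have bound: "cmod (f \<xi> - g k \<xi>) \<le> 2 * w \<xi>" if "\<xi> \<in> sphere 0 1" for \<xi> k
    using norm_triangle_ineq4[of "f \<xi>" "g k \<xi>"] dom[OF that, of k] that by fastforce
  have "(\<lambda>k. \<integral>\<xi>. cmod (f \<xi> - g k \<xi>) \<partial>\<mm>) \<longlonglongrightarrow> (\<integral>\<xi>. 0 \<partial>\<mm>)"
  proof (rule integral_dominated_convergence[where w="\<lambda>\<xi>. 2 * w \<xi>"])
    show "AE \<xi> in \<mm>. (\<lambda>k. cmod (f \<xi> - g k \<xi>)) \<longlonglongrightarrow> 0"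
    proof (rule AE_I2)
      fix \<xi> assume "\<xi> \<in> space \<mm>"
      then have "(\<lambda>k. f \<xi> - g k \<xi>) \<longlonglongrightarrow> f \<xi> - f \<xi>" by (intro tendsto_intros lim) simp
      then show "(\<lambda>k. cmod (f \<xi> - g k \<xi>)) \<longlonglongrightarrow> 0" using tendsto_norm_zero by fastforce
    qed
    show "(\<lambda>\<xi>. cmod (f \<xi> - g k \<xi>)) \<in> borel_measurable \<mm>" for k
      using fm gi[of k] by measurable
  qed (use bound w in auto)
  then show ?thesis by (intro fatou_property_L1_limit[OF f g]) simp
qed

lemma fatou_property_continuous:
  assumes cont: "continuous_on (sphere 0 1) f" shows "fatou_property f"
proof -
  obtain B where B: "0 < B" "\<And>y. y \<in> sphere 0 1 \<Longrightarrow> cmod (f y) \<le> B"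
    using continuous_on_sphere_bounded[OF cont] by blast
  have f: "integrable \<mm> f"
    using continuous_on_sphere_L2[OF cont circle.finite_measure_axioms] by (simp add: L2_integrable)
  have "((\<lambda>r. poisson_integral f (of_real r * y)) \<longlongrightarrow> f y) (at_left 1)" if z: "y \<in> sphere 0 1" for y
  proof (rule tendstoI)
    fix e :: real assume e: "e > 0"
    obtain \<eta> where \<eta>: "\<eta> > 0" "\<And>\<xi>. \<xi> \<in> sphere 0 1 \<Longrightarrow> dist \<xi> y < \<eta> \<Longrightarrow> dist (f \<xi>) (f y) < e / 2"
      using cont z e unfolding continuous_on_iff by (metis half_gt_zero)
    \<comment> \<open>At distance \<eta> or more from \<open>y\<close> the kernel is at most
      \<open>8 * (1 - r) / \<eta>\<^sup>2\<close> and the oscillation of \<open>f\<close> at most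
      \<open>2 * B\<close>; \<open>K\<close> is the product of the constants.\<close>
    define K where "K = 16 * B / \<eta>\<^sup>2"
    have "((\<lambda>r. K * (1 - r)) \<longlongrightarrow> K * (1 - 1)) (at_left (1::real))" by (intro tendsto_intros)
    then have "\<forall>\<^sub>F r in at_left 1. K * (1 - r) < e / 2" using e by (intro order_tendstoD) auto
    then show "\<forall>\<^sub>F r in at_left 1. dist (poisson_integral f (of_real r * y)) (f y) < e"
      using eventually_at_left_1
    proof eventually_elim
      case (elim r)
      let ?z = "of_real r * y"
      have nz: "cmod ?z < 1" "cmod ?z = r" using elim z by (simp_all add: norm_mult)
      have gi: "integrable \<mm> (\<lambda>\<xi>. f \<xi> - f y)" using f by simp
      have pi1: "integrable \<mm> (poisson ?z)"
        using integrable_Re[OF integrable_poisson_mult[of "\<lambda>_. 1", OF _ nz(1)]] by simp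
      have p1: "(\<integral>\<xi>. poisson ?z \<xi> \<partial>\<mm>) = 1"
        using poisson_integral_one[OF nz(1)] by (simp add: poisson_integral_def)
      have "poisson_integral f ?z - f y = poisson_integral (\<lambda>\<xi>. f \<xi> - f y) ?z"
        using poisson_integral_diff[OF f _ nz(1), of "\<lambda>_. f y"] poisson_integral_scale[of "f y" "\<lambda>_. 1" ?z]
          poisson_integral_one[OF nz(1)] by simp
      then have "cmod (poisson_integral f ?z - f y) \<le> (\<integral>\<xi>. poisson ?z \<xi> * cmod (f \<xi> - f y) \<partial>\<mm>)"
        using norm_poisson_integral_le[OF gi nz(1)] by simp
      also have "\<dots> \<le> (\<integral>\<xi>. e / 2 * poisson ?z \<xi> + K * (1 - r) \<partial>\<mm>)"
      proof (rule integral_mono)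
        show "integrable \<mm> (\<lambda>\<xi>. poisson ?z \<xi> * cmod (f \<xi> - f y))"
          using integrable_norm[OF integrable_poisson_mult[OF gi nz(1)]] poisson_nonneg[OF nz(1)]
          by (simp add: norm_mult)
        show "integrable \<mm> (\<lambda>\<xi>. e / 2 * poisson ?z \<xi> + K * (1 - r))" using pi1 by simp
        fix \<xi> assume x: "\<xi> \<in> space \<mm>"
        show "poisson ?z \<xi> * cmod (f \<xi> - f y) \<le> e / 2 * poisson ?z \<xi> + K * (1 - r)"
        proof (cases "dist \<xi> y < \<eta>")
          case True
          then have "poisson ?z \<xi> * cmod (f \<xi> - f y) \<le> poisson ?z \<xi> * (e / 2)"
            using \<eta>(2)[of \<xi>] x poisson_nonneg[OF nz(1)]
            by (intro mult_left_mono) (auto simp: dist_norm intro: less_imp_le)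
          moreover have "0 \<le> K * (1 - r)" using B elim by (simp add: K_def)
          ultimately show ?thesis by (simp add: mult.commute)
        next
          case False
          have "y - ?z = of_real (1 - r) * y" by (simp add: algebra_simps)
          then have "cmod (y - ?z) = 1 - r" using z elim by (simp only: norm_mult norm_of_real) simp
          moreover have "1 - r \<le> cmod (\<xi> - ?z)" using norm_triangle_ineq2[of \<xi> ?z] x nz by simp
          moreover have "cmod (\<xi> - y) \<le> cmod (\<xi> - ?z) + cmod (y - ?z)"
            using norm_triangle_ineq4[of "\<xi> - ?z" "y - ?z"] by simp
          ultimately have "\<eta> / 2 \<le> cmod (\<xi> - ?z)" using False by (simp add: dist_norm)
          then have "(\<eta> / 2)\<^sup>2 \<le> (cmod (\<xi> - ?z))\<^sup>2" "0 < cmod (\<xi> - ?z)"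
            using \<eta>(1) by (auto intro!: power_mono simp del: zero_less_norm_iff)
          then have "poisson ?z \<xi> \<le> (1 - r\<^sup>2) / (\<eta> / 2)\<^sup>2"
            unfolding poisson_def nz using \<eta>(1) elim by (intro divide_left_mono) (auto simp: power_le_one intro!: mult_pos_pos)
          also have "\<dots> \<le> (2 * (1 - r)) / (\<eta> / 2)\<^sup>2"
          proof (rule divide_right_mono)
            have "1 - r\<^sup>2 = (1 + r) * (1 - r)" by (simp add: power2_eq_square algebra_simps)
            also have "\<dots> \<le> 2 * (1 - r)" using elim by (intro mult_right_mono) auto
            finally show "1 - r\<^sup>2 \<le> 2 * (1 - r)" .
          qed simp
          finally have P: "poisson ?z \<xi> \<le> 8 * (1 - r) / \<eta>\<^sup>2" by (simp add: power_divide)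
          have "cmod (f \<xi> - f y) \<le> 2 * B"
            using norm_triangle_ineq4[of "f \<xi>" "f y"] B(2)[of \<xi>] B(2)[of y] x z by simp
          then have "poisson ?z \<xi> * cmod (f \<xi> - f y) \<le> (8 * (1 - r) / \<eta>\<^sup>2) * (2 * B)"
            using P elim by (intro mult_mono) auto
          also have "\<dots> = K * (1 - r)" by (simp add: K_def)
          finally show ?thesis using poisson_nonneg[OF nz(1), of \<xi>] e mult_nonneg_nonneg[of "e/2" "poisson ?z \<xi>"] by linarith
        qed
      qed
      also have "\<dots> = e / 2 + K * (1 - r)" using pi1 p1 circle.prob_space by simp
      finally show ?case using elim by (simp add: dist_norm)
    qed
  qed
  then show ?thesis using f by (auto simp: fatou_property_def)
qed

text \<open>Dynkin's argument: the relatively open sets are an intersection-stable generator, and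
  the Fatou property passes to complements by linearity and to disjoint unions by dominated
  convergence.\<close>

lemma fatou_property_indicator:
  assumes "A \<in> sets circle_borel" shows "fatou_property (indicator A)"
proof -
  let ?G = "(\<lambda>U. U \<inter> sphere 0 1) ` {U :: complex set. open U}"
  have sets: "sets circle_borel = sigma_sets (sphere 0 1) ?G"
  proof -
    have "sets circle_borel = (\<lambda>U. sphere 0 1 \<inter> U) ` sigma_sets UNIV {U :: complex set. open U}"
      by (simp add: circle_borel_def sets_restrict_space borel_def)
    also have "\<dots> = sigma_sets (sphere 0 1) ((\<lambda>U. sphere 0 1 \<inter> U) ` {U. open U})"
      by (rule sigma_sets_Int) (simp_all flip: sets_borel)
    finally show ?thesis by (simp add: Int_commute)
  qed
  have one: "fatou_property (\<lambda>_. 1)" by (rule fatou_property_continuous) (rule continuous_on_const)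
  have "Int_stable ?G"
  proof (rule Int_stableI)
    fix a b assume "a \<in> ?G" "b \<in> ?G"
    then obtain U V where "a = U \<inter> sphere 0 1" "b = V \<inter> sphere 0 1" "open U" "open V" by auto
    then have "a \<inter> b = (U \<inter> V) \<inter> sphere 0 1" "open (U \<inter> V)" by auto
    then show "a \<inter> b \<in> ?G" by blast
  qed
  moreover have "?G \<subseteq> Pow (sphere 0 1)" by auto
  moreover have "A \<in> sigma_sets (sphere 0 1) ?G" using assms sets by simp
  ultimately show ?thesis
  proof (induction A rule: sigma_sets_induct_disjoint)
    case (basic A)
    then obtain U where U: "open U" "A = U \<inter> sphere 0 1" by auto
    show ?case
    \<comment> \<open>The approximation uses the distance to the complement of \<open>U\<close>, and
      \<open>infdist\<close> is 0 when that complement is empty.\<close>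
    proof (cases "U = UNIV")
      case True
      then show ?thesis using U by (intro fatou_property_cong[OF one]) auto
    next
      case False
      define g where "g k \<xi> = complex_of_real (min 1 (real k * infdist \<xi> (- U)))" for k \<xi>
      show ?thesis
      proof (rule fatou_property_dominated_limit[where g=g and w="\<lambda>_. 1"])
        show "fatou_property (g k)" for k
          unfolding g_def[abs_def] by (intro fatou_property_continuous continuous_intros)
        show "cmod (g k \<xi>) \<le> 1" for k \<xi> by (simp add: g_def infdist_nonneg)
        fix \<xi> :: complex assume x: "\<xi> \<in> sphere 0 1"
        show "(\<lambda>k. g k \<xi>) \<longlonglongrightarrow> indicator A \<xi>"
        proof (cases "\<xi> \<in> U")
          case True
          have "infdist \<xi> (- U) \<noteq> 0"
            using U True False in_closed_iff_infdist_zero[of "- U" \<xi>] by (auto simp: closed_def)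
          then have d: "infdist \<xi> (- U) > 0" using infdist_nonneg[of \<xi> "- U"] by simp
          obtain n where n: "1 / infdist \<xi> (- U) \<le> real n" using real_arch_simple by blast
          have "g k \<xi> = 1" if "k \<ge> n" for k
          proof -
            have "1 / infdist \<xi> (- U) \<le> real k" using n that by linarith
            then have "1 \<le> real k * infdist \<xi> (- U)" using d by (simp add: field_simps)
            then show ?thesis by (simp add: g_def)
          qed
          then have "\<forall>\<^sub>F k in sequentially. g k \<xi> = 1" by (auto simp: eventually_sequentially)
          then have "(\<lambda>k. g k \<xi>) \<longlonglongrightarrow> 1" by (rule tendsto_eventually)
          then show ?thesis using U x True by simp
        next
          case False
          then have "g k \<xi> = 0" for k by (simp add: g_def)
          then show ?thesis using U False by simp
        qed
      qed simp
    qed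
  next
    case empty
    then show ?case using fatou_property_scale[OF one, of 0] by (simp add: fatou_property_cong)
  next
    case (compl A)
    have "fatou_property (\<lambda>\<xi>. 1 + (-1) * indicator A \<xi>)"
      by (intro fatou_property_add one fatou_property_scale compl)
    then show ?case by (rule fatou_property_cong) (auto simp: indicator_def)
  next
    case (union A)
    have fin: "fatou_property (\<lambda>\<xi>. \<Sum>i<k. indicator (A i) \<xi>)" for k
    proof (induction k)
      case 0
      then show ?case using fatou_property_scale[OF one, of 0] by simp
    next
      case (Suc k)
      then show ?case using fatou_property_add[OF Suc union(3)] by simp
    qed
    have eq: "(\<Sum>i<k. indicator (A i) \<xi>) = (indicator (\<Union>i<k. A i) \<xi> :: complex)" for k \<xi>
      using union(1) by (subst indicator_UN_disjoint) (auto simp: disjoint_family_on_def)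
    show ?case
    proof (rule fatou_property_dominated_limit[OF fin, where w="\<lambda>_. 1"])
      show "(\<lambda>k. \<Sum>i<k. indicator (A i) \<xi>) \<longlonglongrightarrow> (indicator (\<Union>i. A i) \<xi> :: complex)" for \<xi>
        unfolding eq by (rule LIMSEQ_indicator_UN)
      show "cmod (\<Sum>i<k. indicator (A i) \<xi>) \<le> 1" for k \<xi> unfolding eq by (auto simp: indicator_def)
    qed simp
  qed
qed

theorem fatou:
  assumes "integrable \<mm> f" shows "fatou_property f"
  using assms
proof (induction f rule: integrable_induct)
  case (base A c)
  have "fatou_property (\<lambda>\<xi>. c * indicator A \<xi>)"
    using base by (intro fatou_property_scale fatou_property_indicator) simp
  then show ?case by (rule fatou_property_cong) (auto simp: indicator_def)
next
  case (add f g)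
  then show ?case by (intro fatou_property_add)
next
  case (lim f s)
  show ?case
    by (rule fatou_property_dominated_limit[where g=s and w="\<lambda>\<xi>. 2 * cmod (f \<xi>)"]) (use lim in auto)
qed

section \<open>Hardy spaces in terms of Fourier coefficients\<close>

lemma sphere_pow_L2 [simp]: "(\<lambda>z. z ^ n) \<in> L2_space \<mm>"
  using powi_L2[of "int n"] by simp

lemma circle_poly_L2 [simp]: "(\<lambda>z. \<Sum>n\<in>I. c n * z ^ n) \<in> L2_space \<mm>"
  by (intro L2_sum L2_scale sphere_pow_L2)

lemma L2_inner_pow: "L2_inner \<mm> f (\<lambda>z. z ^ n) = fourier f (int n)"
  by (simp add: fourier_eq_inner)

lemma fourier_pow: "fourier (\<lambda>z. z ^ k) n = (if n = int k then 1 else 0)"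
  using fourier_powi[of "int k" n] by simp

lemma fourier_add:
  "f \<in> L2_space \<mm> \<Longrightarrow> g \<in> L2_space \<mm> \<Longrightarrow>
   fourier (\<lambda>z. f z + g z) n = fourier f n + fourier g n"
  by (simp add: fourier_eq_inner L2_inner_add_left)

lemma fourier_diff:
  "f \<in> L2_space \<mm> \<Longrightarrow> g \<in> L2_space \<mm> \<Longrightarrow>
   fourier (\<lambda>z. f z - g z) n = fourier f n - fourier g n"
  by (simp add: fourier_eq_inner L2_inner_diff_left)

lemma fourier_scale: "fourier (\<lambda>z. c * f z) n = c * fourier f n"
  by (simp add: fourier_eq_inner L2_inner_scale_left)

lemma fourier_cong_AE:
  assumes "f \<in> borel_measurable \<mm>" "g \<in> borel_measurable \<mm>"
    "AE z in \<mm>. f z = g z"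
  shows "fourier f n = fourier g n"
  unfolding fourier_eq_inner by (rule L2_inner_cong_AE[OF assms]) auto

lemma fourier_poly:
  assumes "finite I"
  shows "fourier (\<lambda>z. \<Sum>i\<in>I. c i * z ^ i) n = (if 0 \<le> n \<and> nat n \<in> I then c (nat n) else 0)"
proof -
  have "fourier (\<lambda>z. \<Sum>i\<in>I. c i * z ^ i) n = (\<Sum>i\<in>I. c i * fourier (\<lambda>z. z ^ i) n)"
    unfolding fourier_eq_inner
    by (subst L2_inner_sum_left) (auto intro: L2_scale simp: L2_inner_scale_left)
  also have "\<dots> = (\<Sum>i\<in>I. if i = nat n \<and> 0 \<le> n then c (nat n) else 0)"
    by (rule sum.cong) (auto simp: fourier_pow)
  also have "\<dots> = (if 0 \<le> n \<and> nat n \<in> I then c (nat n) else 0)" using assms by (cases "0 \<le> n") (auto simp: sum.delta)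
  finally show ?thesis .
qed

lemma L2_inner_poly_left:
  "f \<in> L2_space \<mm> \<Longrightarrow>
   L2_inner \<mm> (\<lambda>z. \<Sum>i\<in>I. c i * z ^ i) f = (\<Sum>i\<in>I. c i * cnj (fourier f (int i)))"
  by (subst L2_inner_sum_left)
     (auto intro: L2_scale simp: L2_inner_scale_left L2_inner_pow[symmetric] L2_inner_commute[of _ _ f])

lemma L2_norm_poly:
  assumes "finite I"
  shows "(L2_norm \<mm> (\<lambda>z. \<Sum>i\<in>I. c i * z ^ i))\<^sup>2 = (\<Sum>i\<in>I. (cmod (c i))\<^sup>2)"
proof -
  have "complex_of_real ((L2_norm \<mm> (\<lambda>z. \<Sum>i\<in>I. c i * z ^ i))\<^sup>2) = of_real (\<Sum>i\<in>I. (cmod (c i))\<^sup>2)"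
    unfolding L2_inner_self[symmetric]
    using assms by (subst L2_inner_poly_left) (auto simp: fourier_poly complex_norm_square[symmetric] intro!: sum.cong)
  then show ?thesis by (simp only: of_real_eq_iff)
qed

section \<open>Bessel's inequality, Riesz-Fischer, and functions with nonnegative
  frequencies\<close>

lemma bessel:
  assumes f: "f \<in> L2_space \<mm>" and "finite I"
  shows "(\<Sum>n\<in>I. (cmod (fourier f (int n)))\<^sup>2) \<le> (L2_norm \<mm> f)\<^sup>2"
proof -
  define S where "S z = (\<Sum>i\<in>I. fourier f (int i) * z ^ i)" for z
  define T where "T = (\<Sum>n\<in>I. (cmod (fourier f (int n)))\<^sup>2)"
  have S: "S \<in> L2_space \<mm>" by (simp add: S_def[abs_def])
  have "L2_inner \<mm> S f = (\<Sum>i\<in>I. fourier f (int i) * cnj (fourier f (int i)))"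
    unfolding S_def[abs_def] by (rule L2_inner_poly_left[OF f])
  then have "L2_inner \<mm> S f = of_real T" by (simp only: T_def of_real_sum complex_norm_square)
  then have "L2_inner \<mm> f S = of_real T"
    using L2_inner_commute[of \<mm> f S] by simp
  moreover have "(L2_norm \<mm> S)\<^sup>2 = T"
    unfolding S_def[abs_def] T_def by (rule L2_norm_poly[OF \<open>finite I\<close>])
  ultimately have "(L2_norm \<mm> (\<lambda>z. f z - 1 * S z))\<^sup>2 = (L2_norm \<mm> f)\<^sup>2 - T"
    by (subst L2_norm_sq_diff_scale[OF f S]) simp
  then show ?thesis unfolding T_def using zero_le_power2 by (metis diff_ge_0_iff_ge)
qed

lemma bessel_summable:
  assumes f: "f \<in> L2_space \<mm>" shows "summable (\<lambda>n. (cmod (fourier f (int n)))\<^sup>2)"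
  by (rule summableI_nonneg_bounded[where x="(L2_norm \<mm> f)\<^sup>2"]) (auto intro: bessel[OF f])

lemma riesz_fischer:
  fixes c :: "nat \<Rightarrow> complex"
  assumes c: "summable (\<lambda>n. (cmod (c n))\<^sup>2)"
  obtains g where "g \<in> L2_space \<mm>" "\<And>n. fourier g (int n) = c n" "\<And>n. n < 0 \<Longrightarrow> fourier g n = 0"
    "(\<lambda>N. L2_norm \<mm> (\<lambda>z. (\<Sum>n<N. c n * z ^ n) - g z)) \<longlonglongrightarrow> 0"
proof -
  define S where "S N z = (\<Sum>n<N. c n * z ^ n)" for N z
  have SL: "S N \<in> L2_space \<mm>" for N by (simp add: S_def[abs_def])
  have dif: "(L2_norm \<mm> (\<lambda>z. S j z - S i z))\<^sup>2 = (\<Sum>n=i..<j. (cmod (c n))\<^sup>2)" if "i \<le> j" for i j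
  proof -
    have "S j z - S i z = (\<Sum>n\<in>{i..<j}. c n * z ^ n)" for z
      unfolding S_def using that by (metis sum_diff_nat_ivl lessThan_atLeast0 le0)
    then show ?thesis by (simp add: L2_norm_poly)
  qed
  obtain g where g: "g \<in> L2_space \<mm>" "(\<lambda>N. L2_norm \<mm> (\<lambda>z. S N z - g z)) \<longlonglongrightarrow> 0"
  proof (rule L2_complete[OF SL])
    fix e :: real assume e: "e > 0"
    then obtain N where N: "\<And>m n. m \<ge> N \<Longrightarrow> norm (\<Sum>i=m..<n. (cmod (c i))\<^sup>2) < e\<^sup>2"
      using c[unfolded summable_Cauchy] by (meson zero_less_power)
    have 1: "L2_norm \<mm> (\<lambda>z. S j z - S i z) < e" if "N \<le> i" "i \<le> j" for i j
      using N[of i j] dif[OF that(2)] that e by (intro power2_less_imp_less[of _ e]) auto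
    have "L2_norm \<mm> (\<lambda>z. S i z - S j z) < e" if "N \<le> i" "N \<le> j" for i j
      using 1[of i j] 1[of j i] that L2_norm_minus_commute[of \<mm> "S i" "S j"]
      by (cases "i \<le> j") auto
    then show "\<exists>N. \<forall>i\<ge>N. \<forall>j\<ge>N. L2_norm \<mm> (\<lambda>z. S i z - S j z) < e" by blast
  qed
  have lim: "(\<lambda>N. fourier (S N) k) \<longlonglongrightarrow> fourier g k" for k
    unfolding fourier_eq_inner by (rule L2_limit_inner[OF SL g]) simp
  have fS: "fourier (S N) k = (if 0 \<le> k \<and> nat k < N then c (nat k) else 0)" for N k
    unfolding S_def[abs_def] by (subst fourier_poly) auto
  show ?thesis
  proof (rule that[OF g(1)])
    fix n
    have "(\<lambda>N. fourier (S N) (int n)) \<longlonglongrightarrow> c n"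
      by (rule tendsto_eventually) (auto simp: fS eventually_sequentially intro!: exI[of _ "Suc n"])
    then show "fourier g (int n) = c n" using lim LIMSEQ_unique by blast
  next
    fix n :: int assume "n < 0"
    then have "fourier (S N) n = 0" for N by (simp add: fS)
    then show "fourier g n = 0" using lim[of n] LIMSEQ_unique by (simp add: LIMSEQ_const_iff)
  qed (use g(2) in \<open>simp add: S_def\<close>)
qed

text \<open>Conjugation moves the coefficients to nonpositive indices, so only the constant term
  survives in the power series. This is why Poisson and Cauchy integrals agree for analytic boundary
  data.\<close>

lemma cauchy_integral_cnj_analytic:
  assumes f: "integrable \<mm> f" and neg: "\<And>n. n < 0 \<Longrightarrow> fourier f n = 0" and z: "cmod z < 1"
  shows "cauchy_integral (\<lambda>\<xi>. cnj (f \<xi>)) z = cnj (fourier f 0)"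
proof -
  have fc: "integrable \<mm> (\<lambda>\<xi>. cnj (f \<xi>))" using f by (rule integrable_cnj)
  have "(\<lambda>n. fourier (\<lambda>\<xi>. cnj (f \<xi>)) (int n) * z ^ n) sums cauchy_integral (\<lambda>\<xi>. cnj (f \<xi>)) z"
    by (rule cauchy_integral_sums(1)[OF fc z])
  moreover have "(\<lambda>n. fourier (\<lambda>\<xi>. cnj (f \<xi>)) (int n) * z ^ n) = (\<lambda>n. if n = 0 then cnj (fourier f 0) else 0)"
    by (auto simp: fourier_cnj neg)
  moreover have "(\<lambda>n. if n = (0::nat) then cnj (fourier f 0) else 0) sums cnj (fourier f 0)"
    using sums_single[of 0 "\<lambda>_. cnj (fourier f 0)"] by simp
  ultimately show ?thesis using sums_unique2 by metis
qed

lemma poisson_integral_analytic: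
  assumes f: "integrable \<mm> f" and neg: "\<And>n. n < 0 \<Longrightarrow> fourier f n = 0" and z: "cmod z < 1"
  shows "poisson_integral f z = cauchy_integral f z"
  using poisson_integral_eq_cauchy[OF f z] cauchy_integral_cnj_analytic[OF f neg z] by simp

lemma boundary_cauchy_integral:
  assumes f: "integrable \<mm> f" and neg: "\<And>n. n < 0 \<Longrightarrow> fourier f n = 0"
  shows "has_boundary_values (cauchy_integral f) f"
  unfolding has_boundary_values_def
proof -
  have "AE z in \<mm>. ((\<lambda>r. poisson_integral f (of_real r * z)) \<longlongrightarrow> f z) (at_left 1)"
    using fatou[OF f] by (simp add: fatou_property_def)
  then show "AE z in \<mm>. ((\<lambda>r. cauchy_integral f (of_real r * z)) \<longlongrightarrow> f z) (at_left 1)"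
    using AE_space
  proof eventually_elim
    case (elim z)
    show ?case
    proof (rule Lim_transform_eventually[OF elim(1)])
      show "\<forall>\<^sub>F r in at_left 1. poisson_integral f (of_real r * z) = cauchy_integral f (of_real r * z)"
        using eventually_at_left_1
        by eventually_elim (rule poisson_integral_analytic[OF f neg], use elim(2) in \<open>auto simp: norm_mult\<close>)
    qed
  qed
qed

text \<open>Vanishing coefficients make the Cauchy integral zero in the disc, and Fatou's theorem
  recovers \<open>f\<close> as its radial limit.\<close>

lemma fourier_unique:
  assumes f: "integrable \<mm> f" and zero: "\<And>n. fourier f n = 0"
  shows "AE x in \<mm>. f x = 0"
proof -
  have "cauchy_integral f z = 0" if "cmod z < 1" for z
    using cauchy_integral_sums(1)[OF f that] by (simp add: zero sums_unique2[OF _ sums_zero])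
  moreover have "AE x in \<mm>. ((\<lambda>r. cauchy_integral f (of_real r * x)) \<longlongrightarrow> f x) (at_left 1)"
    using boundary_cauchy_integral[OF f] zero by (simp add: has_boundary_values_def)
  ultimately show ?thesis
    using AE_space
  proof (elim AE_mp, intro AE_I2 impI)
    fix x assume z: "\<And>z. cmod z < 1 \<Longrightarrow> cauchy_integral f z = 0" "x \<in> space \<mm>"
      and lim: "((\<lambda>r. cauchy_integral f (of_real r * x)) \<longlongrightarrow> f x) (at_left 1)"
    have "((\<lambda>r. cauchy_integral f (of_real r * x)) \<longlongrightarrow> 0) (at_left (1::real))"
    proof (rule tendsto_eventually)
      show "\<forall>\<^sub>F r in at_left (1::real). cauchy_integral f (of_real r * x) = 0"
        using eventually_at_left_1 by eventually_elim (rule z(1), use z(2) in \<open>auto simp: norm_mult\<close>)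
    qed
    then show "f x = 0" using lim tendsto_unique[of "at_left (1::real)"] by force
  qed
qed

text \<open>The Fourier-side description of \<open>H2\<close>; the two sets are shown equal once the
  boundary behaviour of holomorphic functions is known.\<close>

definition analytic_L2 :: "(complex \<Rightarrow> complex) set" where
  "analytic_L2 = {f \<in> L2_space \<mm>. \<forall>n<0. fourier f n = 0}"

lemma analytic_L2_expansion:
  assumes f: "f \<in> analytic_L2"
  shows "(\<lambda>N. L2_norm \<mm> (\<lambda>z. (\<Sum>n<N. fourier f (int n) * z ^ n) - f z)) \<longlonglongrightarrow> 0"
proof -
  have fL: "f \<in> L2_space \<mm>" using f by (simp add: analytic_L2_def)
  obtain g where g: "g \<in> L2_space \<mm>" "\<And>n. fourier g (int n) = fourier f (int n)"
    "\<And>n. n < 0 \<Longrightarrow> fourier g n = 0"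
    "(\<lambda>N. L2_norm \<mm> (\<lambda>z. (\<Sum>n<N. fourier f (int n) * z ^ n) - g z)) \<longlonglongrightarrow> 0"
    by (rule riesz_fischer[OF bessel_summable[OF fL]]) blast
  have "fourier (\<lambda>z. g z - f z) n = 0" for n
    using f g by (cases "n \<ge> 0") (auto simp: fourier_diff fL analytic_L2_def elim!: nonneg_int_cases)
  then have ae: "AE z in \<mm>. g z = f z"
    using fourier_unique[OF L2_integrable[OF L2_diff[OF g(1) fL]]] by simp
  have "L2_norm \<mm> (\<lambda>z. (\<Sum>n<N. fourier f (int n) * z ^ n) - g z)
      = L2_norm \<mm> (\<lambda>z. (\<Sum>n<N. fourier f (int n) * z ^ n) - f z)" for N
  proof (rule L2_norm_cong_AE)
    show "AE z in \<mm>. (\<Sum>n<N. fourier f (int n) * z ^ n) - g z = (\<Sum>n<N. fourier f (int n) * z ^ n) - f z"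
      using ae by eventually_elim simp
  qed (auto intro!: L2_measurable L2_diff fL g(1))
  then show ?thesis using g(4) by simp
qed

text \<open>The partial sums of the dilated series obey the bound by orthogonality,
  \<open>r ^ n \<le> 1\<close> and Bessel's inequality; on a fixed circle they converge
  boundedly.\<close>

lemma sq_mean_cauchy_integral:
  assumes f: "f \<in> L2_space \<mm>" and r: "0 \<le> r" "r < 1"
  shows "(\<integral>z. (cmod (cauchy_integral f (of_real r * z)))\<^sup>2 \<partial>\<mm>) \<le> (L2_norm \<mm> f)\<^sup>2"
proof -
  have fi: "integrable \<mm> f" using f by (rule L2_integrable)
  define a where "a n = fourier f (int n) * of_real r ^ n" for n
  define S where "S N z = (\<Sum>n<N. a n * z ^ n)" for N z
  have sm: "summable (\<lambda>n. cmod (a n))"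
    using cauchy_integral_sums(2)[OF fi, of "of_real r"] r by (simp add: a_def)
  have lim: "(\<lambda>N. S N z) \<longlonglongrightarrow> cauchy_integral f (of_real r * z)" if "z \<in> sphere 0 1" for z
    using cauchy_integral_sums(1)[OF fi, of "of_real r * z"] that r
    by (simp add: sums_def S_def a_def norm_mult power_mult_distrib mult.assoc)
  have Sle: "cmod (S N z) \<le> (\<Sum>n. cmod (a n))" if "z \<in> sphere 0 1" for N z
  proof -
    have "cmod (S N z) \<le> (\<Sum>n<N. cmod (a n))"
      unfolding S_def by (rule sum_norm_le) (use that in \<open>simp add: norm_mult norm_power\<close>)
    also have "\<dots> \<le> (\<Sum>n. cmod (a n))" by (rule sum_le_suminf[OF sm]) auto
    finally show ?thesis .
  qed
  have "(\<lambda>N. \<integral>z. (cmod (S N z))\<^sup>2 \<partial>\<mm>) \<longlonglongrightarrow> (\<integral>z. (cmod (cauchy_integral f (of_real r * z)))\<^sup>2 \<partial>\<mm>)"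
  proof (rule integral_dominated_convergence[where w="\<lambda>_. (\<Sum>n. cmod (a n))\<^sup>2"])
    show m: "(\<lambda>z. (cmod (S N z))\<^sup>2) \<in> borel_measurable \<mm>" for N
      using L2_measurable[OF circle_poly_L2[of a "{..<N}"]] unfolding S_def by measurable
    show "(\<lambda>z. (cmod (cauchy_integral f (of_real r * z)))\<^sup>2) \<in> borel_measurable \<mm>"
      by (rule borel_measurable_LIMSEQ_metric[OF m]) (use lim in \<open>auto intro!: tendsto_intros\<close>)
  qed (use lim Sle in \<open>auto intro!: tendsto_intros AE_I2 power_mono\<close>)
  moreover have "(\<integral>z. (cmod (S N z))\<^sup>2 \<partial>\<mm>) \<le> (L2_norm \<mm> f)\<^sup>2" for N
  proof -
    have "(\<integral>z. (cmod (S N z))\<^sup>2 \<partial>\<mm>) = (\<Sum>n<N. (cmod (a n))\<^sup>2)"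
      unfolding S_def using L2_norm_poly[of "{..<N}" a] by (simp add: L2_norm_sq)
    also have "\<dots> \<le> (\<Sum>n<N. (cmod (fourier f (int n)))\<^sup>2)"
    proof (rule sum_mono)
      fix n
      have "cmod (a n) \<le> cmod (fourier f (int n)) * 1"
        unfolding a_def norm_mult using r by (intro mult_left_mono) (auto simp: norm_power power_le_one)
      then show "(cmod (a n))\<^sup>2 \<le> (cmod (fourier f (int n)))\<^sup>2" by (intro power_mono) auto
    qed
    also have "\<dots> \<le> (L2_norm \<mm> f)\<^sup>2" by (rule bessel[OF f]) simp
    finally show ?thesis .
  qed
  ultimately show ?thesis by (intro LIMSEQ_le_const2) auto
qed

lemma analytic_L2_subset_H2: "analytic_L2 \<subseteq> H2"
proof
  fix f assume f: "f \<in> analytic_L2"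
  then have fL: "f \<in> L2_space \<mm>" by (simp add: analytic_L2_def)
  have "cauchy_integral f \<in> H2_disc"
    unfolding H2_disc_def using cauchy_integral_holomorphic[OF L2_integrable[OF fL]] sq_mean_cauchy_integral[OF fL]
    by (intro CollectI conjI exI[of _ "(L2_norm \<mm> f)\<^sup>2"]) auto
  moreover have "has_boundary_values (cauchy_integral f) f"
    using boundary_cauchy_integral[OF L2_integrable[OF fL]] f by (simp add: analytic_L2_def)
  ultimately show "f \<in> H2" using fL by (auto simp: H2_def)
qed

section \<open>Taylor coefficients and boundary functions\<close>

definition taylor :: "(complex \<Rightarrow> complex) \<Rightarrow> nat \<Rightarrow> complex" where
  "taylor F n = (deriv ^^ n) F 0 / fact n"

lemma taylor_sums:
  assumes "F holomorphic_on ball 0 1" "cmod z < 1"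
  shows "(\<lambda>n. taylor F n * z ^ n) sums F z"
  using holomorphic_power_series[OF assms(1), of z] assms(2) by (simp add: taylor_def)

lemma power_series_dilation_summable:
  fixes c :: "nat \<Rightarrow> complex"
  assumes "\<And>z. cmod z < 1 \<Longrightarrow> (\<lambda>n. c n * z ^ n) sums F z" "0 \<le> r" "r < 1"
  shows "summable (\<lambda>n. cmod (c n) * r ^ n)"
proof -
  define s where "s = (1 + r) / 2"
  have s: "r < s" "s < 1" "0 < s" using assms(2,3) by (auto simp: s_def)
  have "summable (\<lambda>n. c n * of_real s ^ n)"
    using assms(1)[of "of_real s"] s by (auto simp: sums_iff)
  then have "summable (\<lambda>n. norm (c n * of_real r ^ n))"
    by (rule powser_insidea) (use s assms in simp)
  then show ?thesis using assms by (simp add: norm_mult norm_power)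
qed

lemma fourier_power_series:
  assumes F: "\<And>z. cmod z < 1 \<Longrightarrow> (\<lambda>n. c n * z ^ n) sums F z" and r: "0 \<le> r" "r < 1"
  shows "fourier (\<lambda>x. F (of_real r * x)) k = (if 0 \<le> k then c (nat k) * of_real r ^ nat k else 0)"
proof -
  define u where "u n x = (c n * of_real r ^ n) * (x ^ n * x powi (- k))" for n x
  have int: "integrable \<mm> (u n)" for n
    using integrable_mult_powi[OF L2_integrable[OF sphere_pow_L2[of n]], of "- k"] unfolding u_def by simp
  have nu: "cmod (u n x) = cmod (c n) * r ^ n" if "x \<in> sphere 0 1" for n x
    using that r by (simp add: u_def norm_mult norm_power norm_power_int)
  have sm: "summable (\<lambda>n. cmod (c n) * r ^ n)" by (rule power_series_dilation_summable[OF F r])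
  have "(\<lambda>n. \<integral>x. u n x \<partial>\<mm>) sums (\<integral>x. (\<Sum>n. u n x) \<partial>\<mm>)"
  proof (rule sums_integral[OF int])
    show "AE x in \<mm>. summable (\<lambda>n. norm (u n x))"
      using sm by (intro AE_I2) (simp add: nu)
    have "(\<integral>x. norm (u n x) \<partial>\<mm>) = cmod (c n) * r ^ n" for n
      using circle.prob_space nu by (subst Bochner_Integration.integral_cong[OF refl, of _ _ "\<lambda>_. cmod (c n) * r ^ n"]) auto
    then show "summable (\<lambda>n. \<integral>x. norm (u n x) \<partial>\<mm>)" using sm by simp
  qed
  moreover have "(\<integral>x. (\<Sum>n. u n x) \<partial>\<mm>) = fourier (\<lambda>x. F (of_real r * x)) k"
    unfolding fourier_def
  proof (rule Bochner_Integration.integral_cong[OF refl])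
    fix x assume "x \<in> space \<mm>"
    then have "(\<lambda>n. c n * (of_real r * x) ^ n) sums F (of_real r * x)"
      using r by (intro F) (simp add: norm_mult)
    then have "(\<lambda>n. c n * (of_real r * x) ^ n * x powi (- k)) sums (F (of_real r * x) * x powi (- k))"
      by (rule sums_mult2)
    then have "(\<lambda>n. u n x) sums (F (of_real r * x) * x powi (- k))"
      by (simp add: u_def power_mult_distrib mult_ac)
    then show "(\<Sum>n. u n x) = F (of_real r * x) * x powi (- k)" by (rule sums_unique[symmetric])
  qed
  moreover have "(\<integral>x. u n x \<partial>\<mm>) = (if 0 \<le> k \<and> n = nat k then c (nat k) * of_real r ^ nat k else 0)" for n
  proof -
    have "(\<integral>x. u n x \<partial>\<mm>) = (c n * of_real r ^ n) * fourier (\<lambda>x. x ^ n) k"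
      unfolding u_def fourier_def by (rule integral_mult_right_zero)
    then show ?thesis by (auto simp: fourier_pow)
  qed
  ultimately have "(\<lambda>n. if 0 \<le> k \<and> n = nat k then c (nat k) * of_real r ^ nat k else 0)
      sums fourier (\<lambda>x. F (of_real r * x)) k" by simp
  moreover have "(\<lambda>n. if 0 \<le> k \<and> n = nat k then c (nat k) * of_real r ^ nat k else 0)
      sums (if 0 \<le> k then c (nat k) * of_real r ^ nat k else 0)"
  proof (cases "0 \<le> k")
    case True
    then show ?thesis
      using sums_single[of "nat k" "\<lambda>_. c (nat k) * of_real r ^ nat k"] by simp
  qed simp
  ultimately show ?thesis using sums_unique2 by blast
qed

lemma fourier_dilation:
  assumes "F holomorphic_on ball 0 1" "0 \<le> r" "r < 1"
  shows "fourier (\<lambda>z. F (of_real r * z)) k = (if 0 \<le> k then taylor F (nat k) * of_real r ^ nat k else 0)"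
  by (rule fourier_power_series[OF taylor_sums[OF assms(1)] assms(2,3)])

lemma taylor_unique:
  assumes F: "\<And>z. cmod z < 1 \<Longrightarrow> (\<lambda>n. c n * z ^ n) sums F z"
  shows "taylor F n = c n"
proof -
  have "F holomorphic_on ball 0 1"
    by (rule power_series_holomorphic[of 0 1 c]) (use F in simp)
  then have "taylor F n * of_real (1/2) ^ n = c n * of_real (1/2) ^ n"
    using fourier_dilation[of F "1/2" "int n"] fourier_power_series[OF F, of "1/2" "int n"] by simp
  then show ?thesis by simp
qed

lemma dilation_L2:
  assumes F: "F holomorphic_on ball 0 1" and r: "0 \<le> r" "r < 1"
  shows "(\<lambda>z. F (of_real r * z)) \<in> L2_space \<mm>"
proof (rule continuous_on_sphere_L2[OF _ circle.finite_measure_axioms])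
  show "continuous_on (sphere 0 1) (\<lambda>z. F (of_real r * z))"
    by (rule continuous_on_compose2[OF holomorphic_on_imp_continuous_on[OF F]])
       (use r in \<open>auto intro!: continuous_intros simp: norm_mult\<close>)
qed simp

text \<open>Bessel's inequality on the circle of radius \<open>r\<close>, as \<open>r\<close> tends
  to 1, makes the Taylor coefficients square summable. Riesz-Fischer gives an L2 function with these
  coefficients, its Cauchy integral is \<open>F\<close>, and Fatou's theorem identifies it as the
  radial limit.\<close>

lemma H2_disc_boundary:
  assumes F: "F holomorphic_on ball 0 1"
    and C: "\<And>r. 0 \<le> r \<Longrightarrow> r < 1 \<Longrightarrow> (\<integral>y. (cmod (F (of_real r * y)))\<^sup>2 \<partial>\<mm>) \<le> C"
  obtains g where "g \<in> analytic_L2" "has_boundary_values F g" "\<And>n. fourier g (int n) = taylor F n"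
proof -
  have "(\<Sum>n<N. (cmod (taylor F n))\<^sup>2) \<le> C" for N
  proof (rule tendsto_upperbound)
    have "((\<lambda>r. \<Sum>n<N. (cmod (taylor F n) * r ^ n)\<^sup>2) \<longlongrightarrow> (\<Sum>n<N. (cmod (taylor F n) * 1 ^ n)\<^sup>2)) (at_left (1::real))"
      by (intro tendsto_intros)
    then show "((\<lambda>r. \<Sum>n<N. (cmod (taylor F n) * r ^ n)\<^sup>2) \<longlongrightarrow> (\<Sum>n<N. (cmod (taylor F n))\<^sup>2)) (at_left (1::real))"
      by simp
    show "\<forall>\<^sub>F r in at_left 1. (\<Sum>n<N. (cmod (taylor F n) * r ^ n)\<^sup>2) \<le> C"
      using eventually_at_left_1
    proof eventually_elim
      case (elim r)
      have "(\<Sum>n<N. (cmod (taylor F n) * r ^ n)\<^sup>2) = (\<Sum>n<N. (cmod (fourier (\<lambda>y. F (of_real r * y)) (int n)))\<^sup>2)"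
        using elim by (simp add: fourier_dilation[OF F] norm_mult norm_power)
      also have "\<dots> \<le> (L2_norm \<mm> (\<lambda>y. F (of_real r * y)))\<^sup>2"
        using elim by (intro bessel dilation_L2[OF F]) auto
      also have "\<dots> \<le> C" using C[of r] elim by (simp add: L2_norm_sq)
      finally show ?case .
    qed
  qed simp
  then have "summable (\<lambda>n. (cmod (taylor F n))\<^sup>2)"
    by (intro summableI_nonneg_bounded[where x=C]) auto
  then obtain g where g: "g \<in> L2_space \<mm>" "\<And>n. fourier g (int n) = taylor F n"
    "\<And>n. n < 0 \<Longrightarrow> fourier g n = 0"
    using riesz_fischer by metis
  have gi: "integrable \<mm> g" using g(1) by (rule L2_integrable)
  have Fz: "cauchy_integral g z = F z" if "cmod z < 1" for z
    using cauchy_integral_sums(1)[OF gi that] taylor_sums[OF F that] g(2) sums_unique2 by simp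
  have "AE y in \<mm>. ((\<lambda>r. cauchy_integral g (of_real r * y)) \<longlongrightarrow> g y) (at_left 1)"
    using boundary_cauchy_integral[OF gi g(3)] by (simp add: has_boundary_values_def)
  then have "AE y in \<mm>. ((\<lambda>r. F (of_real r * y)) \<longlongrightarrow> g y) (at_left 1)"
    using AE_space
  proof eventually_elim
    case (elim y)
    show ?case
    proof (rule Lim_transform_eventually[OF elim(1)])
      show "\<forall>\<^sub>F r in at_left 1. cauchy_integral g (of_real r * y) = F (of_real r * y)"
        using eventually_at_left_1 by eventually_elim (rule Fz, use elim(2) in \<open>auto simp: norm_mult\<close>)
    qed
  qed
  then show ?thesis using g by (intro that[of g]) (auto simp: analytic_L2_def has_boundary_values_def)
qed

lemma boundary_values_unique:
  assumes "has_boundary_values F f" "has_boundary_values F g"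
  shows "AE z in \<mm>. f z = g z"
  using assms unfolding has_boundary_values_def
  by eventually_elim (rule tendsto_unique[of "at_left (1::real)"], auto)

lemma H2_eq_analytic_L2: "H2 = analytic_L2"
proof
  show "H2 \<subseteq> analytic_L2"
  proof
    fix f assume "f \<in> H2"
    then obtain F C where f: "f \<in> L2_space \<mm>" "has_boundary_values F f"
      and F: "F holomorphic_on ball 0 1"
      and "\<forall>r\<in>{0..<1}. (\<integral>z. (cmod (F (of_real r * z)))\<^sup>2 \<partial>\<mm>) \<le> C"
      unfolding H2_def H2_disc_def by blast
    then have C: "(\<integral>z. (cmod (F (of_real r * z)))\<^sup>2 \<partial>\<mm>) \<le> C" if "0 \<le> r" "r < 1" for r
      using that by simp
    obtain g where g: "g \<in> analytic_L2" "has_boundary_values F g"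
      using H2_disc_boundary[OF F C] by blast
    have "AE z in \<mm>. f z = g z" by (rule boundary_values_unique[OF f(2) g(2)])
    then have "fourier f n = fourier g n" for n
      using f(1) g(1) by (intro fourier_cong_AE) (auto simp: analytic_L2_def)
    then show "f \<in> analytic_L2" using f g by (simp add: analytic_L2_def)
  qed
qed (rule analytic_L2_subset_H2)

lemma Hinf_disc_boundary:
  assumes F: "F holomorphic_on ball 0 1" and B: "\<And>z. z \<in> ball 0 1 \<Longrightarrow> cmod (F z) \<le> B"
  obtains g where "g \<in> H2" "g \<in> Hinf" "has_boundary_values F g" "\<And>n. fourier g (int n) = taylor F n"
    "AE x in \<mm>. cmod (g x) \<le> B"
proof -
  have "(\<integral>x. (cmod (F (of_real r * x)))\<^sup>2 \<partial>\<mm>) \<le> B\<^sup>2" if r: "0 \<le> r" "r < 1" for r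
  proof -
    have "(\<integral>x. (cmod (F (of_real r * x)))\<^sup>2 \<partial>\<mm>) \<le> (\<integral>x. B\<^sup>2 \<partial>\<mm>)"
    proof (rule integral_mono)
      show "integrable \<mm> (\<lambda>x. (cmod (F (of_real r * x)))\<^sup>2)"
        by (rule L2_integrable_sq[OF dilation_L2[OF F r]])
      show "(cmod (F (of_real r * x)))\<^sup>2 \<le> B\<^sup>2" if "x \<in> space \<mm>" for x
        using that r by (intro power_mono B) (auto simp: norm_mult)
    qed simp
    then show ?thesis using circle.prob_space by simp
  qed
  then obtain g where g: "g \<in> analytic_L2" "has_boundary_values F g" "\<And>n. fourier g (int n) = taylor F n"
    using H2_disc_boundary[OF F] by metis
  have "F \<in> Hinf_disc" using F B by (auto simp: Hinf_disc_def bounded_iff intro!: exI[of _ B])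
  then have "g \<in> Hinf" using g by (auto simp: Hinf_def analytic_L2_def intro: L2_measurable)
  moreover have "AE x in \<mm>. cmod (g x) \<le> B"
    using g(2)[unfolded has_boundary_values_def] AE_space
  proof eventually_elim
    case (elim x)
    show ?case
    proof (rule tendsto_upperbound[OF tendsto_norm[OF elim(1)]])
      show "\<forall>\<^sub>F r in at_left 1. cmod (F (of_real r * x)) \<le> B"
        using eventually_at_left_1
        by eventually_elim (rule B, use elim(2) in \<open>auto simp: norm_mult\<close>)
    qed simp
  qed
  ultimately show ?thesis using g that H2_eq_analytic_L2 by blast
qed

lemma Hinf_bounded:
  assumes "f \<in> Hinf"
  obtains B where "0 < B" "AE x in \<mm>. cmod (f x) \<le> B" "f \<in> H2"
proof -
  obtain F where F: "F \<in> Hinf_disc" "has_boundary_values F f" and fm: "f \<in> borel_measurable \<mm>"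
    using assms by (auto simp: Hinf_def)
  then obtain B where B: "0 < B" "\<And>z. z \<in> ball 0 1 \<Longrightarrow> cmod (F z) \<le> B" "F holomorphic_on ball 0 1"
    unfolding Hinf_disc_def bounded_pos by auto
  obtain g where g: "g \<in> H2" "has_boundary_values F g" "AE x in \<mm>. cmod (g x) \<le> B"
    using Hinf_disc_boundary[OF B(3,2)] by blast
  have ae: "AE x in \<mm>. f x = g x" by (rule boundary_values_unique[OF F(2) g(2)])
  have gL: "g \<in> L2_space \<mm>" using g(1) by (simp add: H2_def)
  have "f \<in> L2_space \<mm>" by (rule L2_cong_AE[OF gL fm]) (use ae in eventually_elim, simp)
  moreover have "fourier f n = fourier g n" for n by (rule fourier_cong_AE[OF fm _ ae]) (use gL in auto)
  ultimately have "f \<in> H2" using g(1) by (simp add: H2_eq_analytic_L2 analytic_L2_def)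
  moreover have "AE x in \<mm>. cmod (f x) \<le> B" using ae g(3) by eventually_elim simp
  ultimately show ?thesis using B(1) that by blast
qed

lemma H2_L2: "f \<in> H2 \<Longrightarrow> f \<in> L2_space \<mm>"
  by (simp add: H2_def)

lemma H2_neg: "f \<in> H2 \<Longrightarrow> n < 0 \<Longrightarrow> fourier f n = 0"
  by (simp add: H2_eq_analytic_L2 analytic_L2_def)

lemma H2I: "f \<in> L2_space \<mm> \<Longrightarrow> (\<And>n. n < 0 \<Longrightarrow> fourier f n = 0) \<Longrightarrow> f \<in> H2"
  by (simp add: H2_eq_analytic_L2 analytic_L2_def)

lemma H2_pow [simp]: "(\<lambda>z. z ^ j) \<in> H2"
  by (rule H2I) (auto simp: fourier_pow)

lemma H2_expansion:
  "f \<in> H2 \<Longrightarrow> (\<lambda>N. L2_norm \<mm> (\<lambda>z. (\<Sum>n<N. fourier f (int n) * z ^ n) - f z)) \<longlonglongrightarrow> 0"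
  using analytic_L2_expansion by (simp add: H2_eq_analytic_L2)

lemma fourier_mult_pow: "fourier (\<lambda>z. f z * z ^ k) n = fourier f (n - int k)"
  unfolding fourier_def
proof (rule Bochner_Integration.integral_cong[OF refl])
  fix z assume "z \<in> space \<mm>"
  then have "z \<noteq> 0" by auto
  then show "f z * z ^ k * z powi (- n) = f z * z powi (- (n - int k))"
    using power_int_add[of z "int k" "- n"] by simp
qed

text \<open>The coefficient is an inner product of \<open>b\<close> with a fixed L2 function
  \<open>c\<close>, hence continuous in \<open>b\<close>, and can be computed on the partial sums of
  \<open>b\<close>. The factor \<open>a\<close> may have frequencies of both signs.\<close>

lemma fourier_mult_sums:
  assumes a: "a \<in> L2_space \<mm>" and b: "b \<in> H2"
  shows "(\<lambda>k. fourier b (int k) * fourier a (n - int k)) sums fourier (\<lambda>z. a z * b z) n"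
proof -
  have bL: "b \<in> L2_space \<mm>" using b by (rule H2_L2)
  define S where "S N z = (\<Sum>k<N. fourier b (int k) * z ^ k)" for N z
  have SL: "S N \<in> L2_space \<mm>" for N by (simp add: S_def[abs_def])
  define c where "c z = cnj (a z * z powi (- n))" for z
  have cL: "c \<in> L2_space \<mm>"
    unfolding c_def
    by (intro L2_cnj, subst mult.commute, rule L2_mult_bounded[OF a, of _ 1]) (auto intro!: AE_I2)
  have e: "L2_inner \<mm> g c = fourier (\<lambda>z. a z * g z) n" for g
    unfolding L2_inner_def fourier_def c_def by (simp add: mult_ac)
  have "(\<lambda>N. L2_inner \<mm> (S N) c) \<longlonglongrightarrow> L2_inner \<mm> b c"
    by (rule L2_limit_inner[OF SL bL _ cL]) (use H2_expansion[OF b] in \<open>simp add: S_def\<close>)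
  moreover have "L2_inner \<mm> (S N) c = (\<Sum>k<N. fourier b (int k) * fourier a (n - int k))" for N
  proof -
    have "L2_inner \<mm> (S N) c = (\<Sum>k<N. fourier b (int k) * L2_inner \<mm> (\<lambda>z. z ^ k) c)"
      unfolding S_def[abs_def] by (subst L2_inner_sum_left) (auto intro: L2_scale cL simp: L2_inner_scale_left)
    then show ?thesis by (simp add: e fourier_mult_pow)
  qed
  ultimately show ?thesis by (simp add: sums_def e)
qed

text \<open>Multiplication by an analytic function only brings in coefficients of \<open>a\<close>
  with index at most \<open>n\<close>.\<close>

lemma fourier_mult_eq_0:
  assumes "a \<in> L2_space \<mm>" "b \<in> H2" "\<And>j. j \<le> n \<Longrightarrow> fourier a j = 0"
  shows "fourier (\<lambda>z. a z * b z) n = 0"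
  using fourier_mult_sums[OF assms(1,2), of n] assms(3) sums_unique2[OF _ sums_zero] by simp

lemma H2_mult_bounded:
  assumes "f \<in> H2" "g \<in> H2" "AE z in \<mm>. cmod (g z) \<le> B"
  shows "(\<lambda>z. g z * f z) \<in> H2"
proof (rule H2I)
  show "(\<lambda>z. g z * f z) \<in> L2_space \<mm>"
    using assms by (intro L2_mult_bounded[of f _ g B]) (auto dest: H2_L2)
  show "fourier (\<lambda>z. g z * f z) n = 0" if "n < 0" for n
    using assms that by (intro fourier_mult_eq_0) (auto simp: H2_neg dest: H2_L2)
qed

section \<open>Model spaces\<close>

locale inner_fun =
  fixes \<Theta> :: "complex \<Rightarrow> complex"
  assumes inner: "inner_function \<Theta>"
begin

abbreviation "K \<equiv> model_space \<Theta>"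

lemma Theta_H2: "\<Theta> \<in> H2"
  using inner Hinf_bounded by (auto simp: inner_function_def)

lemma Theta_norm: "AE z in \<mm>. cmod (\<Theta> z) = 1"
  using inner by (simp add: inner_function_def)

lemma Theta_le: "AE z in \<mm>. cmod (\<Theta> z) \<le> 1"
  using Theta_norm by eventually_elim simp

lemma Theta_measurable [measurable]: "\<Theta> \<in> borel_measurable \<mm>"
  using Theta_H2 by (auto dest: H2_L2)

lemma Theta_mult_L2: "g \<in> L2_space \<mm> \<Longrightarrow> (\<lambda>z. \<Theta> z * g z) \<in> L2_space \<mm>"
  by (rule L2_mult_bounded[OF _ Theta_measurable Theta_le])

text \<open>Monomials suffice as tests: polynomials are dense in \<open>H2\<close>, and
  multiplication by \<Theta> does not increase the norm.\<close>

lemma model_space_iff: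
  "f \<in> K \<longleftrightarrow> f \<in> H2 \<and> (\<forall>j::nat. L2_inner \<mm> f (\<lambda>z. \<Theta> z * z ^ j) = 0)"
proof
  assume "f \<in> K" then show "f \<in> H2 \<and> (\<forall>j::nat. L2_inner \<mm> f (\<lambda>z. \<Theta> z * z ^ j) = 0)"
    by (simp add: model_space_def)
next
  assume *: "f \<in> H2 \<and> (\<forall>j::nat. L2_inner \<mm> f (\<lambda>z. \<Theta> z * z ^ j) = 0)"
  then have fL: "f \<in> L2_space \<mm>" by (auto dest: H2_L2)
  have "L2_inner \<mm> f (\<lambda>z. \<Theta> z * g z) = 0" if g: "g \<in> H2" for g
  proof -
    have gL: "g \<in> L2_space \<mm>" using g by (rule H2_L2)
    define S where "S N z = \<Theta> z * (\<Sum>k<N. fourier g (int k) * z ^ k)" for N z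
    have SL: "S N \<in> L2_space \<mm>" for N unfolding S_def[abs_def] by (intro Theta_mult_L2) simp
    have "L2_inner \<mm> (S N) f = 0" for N
    proof -
      have "S N = (\<lambda>z. \<Sum>k<N. fourier g (int k) * (\<Theta> z * z ^ k))"
        by (auto simp: S_def fun_eq_iff sum_distrib_left mult_ac)
      moreover have "L2_inner \<mm> (\<lambda>z. \<Theta> z * z ^ k) f = 0" for k
        using * L2_inner_commute[of \<mm> "\<lambda>z. \<Theta> z * z ^ k" f] by simp
      ultimately show ?thesis using fL
        by (simp add: L2_inner_sum_left L2_inner_scale_left L2_scale Theta_mult_L2)
    qed
    moreover have "(\<lambda>N. L2_inner \<mm> (S N) f) \<longlonglongrightarrow> L2_inner \<mm> (\<lambda>z. \<Theta> z * g z) f"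
    proof (rule L2_limit_inner[OF SL Theta_mult_L2[OF gL] _ fL])
      show "(\<lambda>N. L2_norm \<mm> (\<lambda>z. S N z - \<Theta> z * g z)) \<longlonglongrightarrow> 0"
      proof (rule Lim_null_comparison[OF _ H2_expansion[OF g]])
        have e: "(\<lambda>z. S N z - \<Theta> z * g z) = (\<lambda>z. \<Theta> z * ((\<Sum>k<N. fourier g (int k) * z ^ k) - g z))" for N
          by (simp add: S_def fun_eq_iff algebra_simps)
        have "L2_norm \<mm> (\<lambda>z. S N z - \<Theta> z * g z)
            \<le> 1 * L2_norm \<mm> (\<lambda>z. (\<Sum>k<N. fourier g (int k) * z ^ k) - g z)" for N
          unfolding e using gL by (intro L2_norm_mult_bounded Theta_le L2_diff) auto
        then show "\<forall>\<^sub>F N in sequentially. norm (L2_norm \<mm> (\<lambda>z. S N z - \<Theta> z * g z))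
            \<le> L2_norm \<mm> (\<lambda>z. (\<Sum>k<N. fourier g (int k) * z ^ k) - g z)" by simp
      qed
    qed
    ultimately have "L2_inner \<mm> (\<lambda>z. \<Theta> z * g z) f = 0" by (simp add: LIMSEQ_const_iff)
    then show ?thesis using L2_inner_commute[of \<mm> f] by simp
  qed
  then show "f \<in> K" using * by (simp add: model_space_def)
qed

lemma K_H2: "f \<in> K \<Longrightarrow> f \<in> H2" and K_L2: "f \<in> K \<Longrightarrow> f \<in> L2_space \<mm>"
  by (auto simp: model_space_def H2_L2)

text \<open>Membership in \<open>H2\<close> is itself an orthogonality condition, against the
  negative powers. In this form the projection lemma applies to the model space.\<close>

lemma model_space_eq_orthogonal_complement:
  "K = {f \<in> L2_space \<mm>. \<forall>b \<in> (\<lambda>n. \<lambda>z. z powi n) ` {..<0} \<union> range (\<lambda>j::nat. \<lambda>z. \<Theta> z * z ^ j).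
     L2_inner \<mm> f b = 0}"
  by (auto simp: model_space_iff H2_eq_analytic_L2 analytic_L2_def fourier_eq_inner)

lemma K_add: "f \<in> K \<Longrightarrow> g \<in> K \<Longrightarrow> (\<lambda>x. f x + g x) \<in> K"
  and K_diff: "f \<in> K \<Longrightarrow> g \<in> K \<Longrightarrow> (\<lambda>x. f x - g x) \<in> K"
  and K_scale: "f \<in> K \<Longrightarrow> (\<lambda>x. c * f x) \<in> K"
  unfolding model_space_eq_orthogonal_complement
  by (auto simp: L2_add L2_diff L2_scale L2_inner_add_left L2_inner_diff_left L2_inner_scale_left Theta_mult_L2)

lemma model_projection:
  assumes "h \<in> L2_space \<mm>"
  shows "model_projection \<Theta> h \<in> K"
    and "g \<in> K \<Longrightarrow> L2_inner \<mm> (\<lambda>z. h z - model_projection \<Theta> h z) g = 0"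
proof -
  let ?B = "(\<lambda>n. \<lambda>z. z powi n) ` {..<0} \<union> range (\<lambda>j::nat. \<lambda>z. \<Theta> z * z ^ j)"
  have "?B \<subseteq> L2_space \<mm>" by (auto intro: Theta_mult_L2)
  then obtain k where "k \<in> K" "\<And>g. g \<in> K \<Longrightarrow> L2_inner \<mm> (\<lambda>z. h z - k z) g = 0"
    by (rule L2_orthogonal_projection[OF _ assms])
       (unfold model_space_eq_orthogonal_complement[symmetric], blast)
  then have "\<exists>k. k \<in> K \<and> (\<forall>g\<in>K. L2_inner \<mm> (\<lambda>z. h z - k z) g = 0)" by blast
  from someI_ex[OF this] show "model_projection \<Theta> h \<in> K"
    "g \<in> K \<Longrightarrow> L2_inner \<mm> (\<lambda>z. h z - model_projection \<Theta> h z) g = 0"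
    by (auto simp: model_projection_def)
qed

text \<open>The projection disappears when paired with an element of the model space; what remains
  is the form given by multiplication with \<phi>.\<close>

lemma TTO_form:
  assumes A: "A \<in> TTO \<Theta>"
  obtains \<phi> where "\<phi> \<in> L2_space \<mm>"
    "\<And>f g. f \<in> K \<inter> Hinf \<Longrightarrow> g \<in> K \<Longrightarrow>
      L2_inner \<mm> (A f) g = L2_inner \<mm> (\<lambda>z. \<phi> z * f z) g"
proof -
  from A obtain \<phi> where \<phi>: "\<phi> \<in> L2_space \<mm>"
    and Af: "\<And>f. f \<in> K \<inter> Hinf \<Longrightarrow> AE z in \<mm>. A f z = model_projection \<Theta> (\<lambda>\<xi>. \<phi> \<xi> * f \<xi>) z"
    and AK: "\<And>f. f \<in> K \<Longrightarrow> A f \<in> K"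
    by (auto simp: TTO_def bounded_operator_on_model_def L2_bounded_linear_def)
  show ?thesis
  proof (rule that[OF \<phi>])
    fix f g assume f: "f \<in> K \<inter> Hinf" and g: "g \<in> K"
    have fL: "(\<lambda>z. \<phi> z * f z) \<in> L2_space \<mm>"
    proof -
      obtain B where "AE z in \<mm>. cmod (f z) \<le> B" using f Hinf_bounded by blast
      then have "(\<lambda>z. f z * \<phi> z) \<in> L2_space \<mm>"
        using f by (intro L2_mult_bounded[OF \<phi>]) (auto dest: K_L2)
      then show ?thesis by (simp add: mult.commute)
    qed
    note P = model_projection[OF fL]
    have "L2_inner \<mm> (A f) g = L2_inner \<mm> (model_projection \<Theta> (\<lambda>\<xi>. \<phi> \<xi> * f \<xi>)) g"
      using Af[OF f] f g P(1) AK[of f] K_L2 by (intro L2_inner_cong_AE L2_measurable) auto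
    also have "\<dots> = L2_inner \<mm> (\<lambda>z. \<phi> z * f z) g"
      using P(2)[OF g] fL P(1) g by (subst (asm) L2_inner_diff_left) (auto dest: K_L2)
    finally show "L2_inner \<mm> (A f) g = L2_inner \<mm> (\<lambda>z. \<phi> z * f z) g" .
  qed
qed

end

section \<open>Contractive multipliers\<close>

lemma taylor_cauchy_integral:
  assumes "integrable \<mm> f" shows "taylor (cauchy_integral f) n = fourier f (int n)"
  by (rule taylor_unique[of "\<lambda>n. fourier f (int n)"]) (rule cauchy_integral_sums(1)[OF assms])

lemma taylor_mult:
  assumes "F holomorphic_on ball 0 1" "G holomorphic_on ball 0 1"
  shows "taylor (\<lambda>z. F z * G z) n = (\<Sum>i\<le>n. taylor F i * taylor G (n - i))"
proof -
  have "taylor (\<lambda>z. F z * G z) n = (\<Sum>i = 0..n. of_nat (n choose i) * (deriv ^^ i) F 0 * (deriv ^^ (n - i)) G 0) / fact n"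
    unfolding taylor_def by (subst higher_deriv_mult[OF assms]) auto
  also have "\<dots> = (\<Sum>i = 0..n. taylor F i * taylor G (n - i))"
    unfolding sum_divide_distrib
  proof (rule sum.cong[OF refl])
    fix i assume "i \<in> {0..n}"
    then have "(of_nat (n choose i) :: complex) = fact n / (fact i * fact (n - i))" by (intro binomial_fact) auto
    then show "of_nat (n choose i) * (deriv ^^ i) F 0 * (deriv ^^ (n - i)) G 0 / fact n = taylor F i * taylor G (n - i)"
      by (simp add: taylor_def)
  qed
  finally show ?thesis by (simp add: atMost_atLeast0)
qed

lemma taylor_linear:
  assumes "F holomorphic_on ball 0 1" "G holomorphic_on ball 0 1"
  shows "taylor (\<lambda>z. a * F z + b * G z) n = a * taylor F n + b * taylor G n"
proof (rule taylor_unique)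
  fix z :: complex assume "cmod z < 1"
  then have "(\<lambda>n. a * (taylor F n * z ^ n) + b * (taylor G n * z ^ n)) sums (a * F z + b * G z)"
    by (intro sums_add sums_mult taylor_sums assms)
  then show "(\<lambda>n. (a * taylor F n + b * taylor G n) * z ^ n) sums (a * F z + b * G z)"
    by (simp add: algebra_simps)
qed

lemma taylor_0: "taylor F 0 = F 0"
  by (simp add: taylor_def)

text \<open>The boundary function of \<open>F\<close> has L2 norm at most \<open>C\<close>, and the
  sum is the inner product of a polynomial with it. The bound on one coefficient is the case of a
  monomial.\<close>

lemma taylor_bound:
  assumes F: "F holomorphic_on ball 0 1" and C: "\<And>z. z \<in> ball 0 1 \<Longrightarrow> cmod (F z) \<le> C"
  shows "cmod (\<Sum>l\<in>I. c l * cnj (taylor F l)) \<le> L2_norm \<mm> (\<lambda>x. \<Sum>l\<in>I. c l * x ^ l) * C"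
    and "cmod (taylor F n) \<le> C"
proof -
  have C0: "0 \<le> C" by (rule order_trans[OF norm_ge_zero[of "F 0"]]) (simp add: C)
  obtain g where g: "g \<in> H2" "\<And>n. fourier g (int n) = taylor F n" "AE x in \<mm>. cmod (g x) \<le> C"
    using Hinf_disc_boundary[OF F C] by blast
  have gL: "g \<in> L2_space \<mm>" using g(1) by (rule H2_L2)
  have gn: "L2_norm \<mm> g \<le> C"
    by (rule circle.L2_norm_le_bound) (use gL g C0 in auto)
  have "cmod (\<Sum>l\<in>J. b l * cnj (taylor F l)) \<le> L2_norm \<mm> (\<lambda>x. \<Sum>l\<in>J. b l * x ^ l) * C" for b J
  proof -
    have "(\<Sum>l\<in>J. b l * cnj (taylor F l)) = L2_inner \<mm> (\<lambda>x. \<Sum>l\<in>J. b l * x ^ l) g"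
      by (simp add: L2_inner_poly_left[OF gL] g(2))
    also have "cmod \<dots> \<le> L2_norm \<mm> (\<lambda>x. \<Sum>l\<in>J. b l * x ^ l) * L2_norm \<mm> g"
      by (rule L2_Cauchy_Schwarz[OF _ gL]) simp
    also have "\<dots> \<le> L2_norm \<mm> (\<lambda>x. \<Sum>l\<in>J. b l * x ^ l) * C"
      using gn by (intro mult_left_mono) auto
    finally show ?thesis .
  qed
  from this[of c I] this[of "\<lambda>_. 1" "{n}"] L2_norm_poly[of "{n}" "\<lambda>_. 1"]
  show "cmod (\<Sum>l\<in>I. c l * cnj (taylor F l)) \<le> L2_norm \<mm> (\<lambda>x. \<Sum>l\<in>I. c l * x ^ l) * C"
    "cmod (taylor F n) \<le> C"
    by (simp_all add: power2_eq_1_iff) (metis L2_norm_nonneg mult_1 neg_0_le_iff_le not_one_le_zero)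
qed

text \<open>Since \<open>2 * (\<xi> / (\<xi> - z)) - 1 = (\<xi> + z) / (\<xi> - z)\<close>, this is
  the Herglotz integral of \<psi>: its real part is the Poisson integral, and its value at 0 is the
  mean of \<psi>.\<close>

definition herglotz :: "(complex \<Rightarrow> real) \<Rightarrow> complex \<Rightarrow> complex" where
  "herglotz \<psi> z = 2 * cauchy_integral (\<lambda>\<xi>. of_real (\<psi> \<xi>)) z - of_real (\<integral>\<xi>. \<psi> \<xi> \<partial>\<mm>)"

context
  fixes \<psi> :: "complex \<Rightarrow> real"
  assumes psi: "integrable \<mm> \<psi>"
begin

lemma fourier_0_of_real: "fourier (\<lambda>\<xi>. of_real (\<psi> \<xi>)) 0 = of_real (\<integral>\<xi>. \<psi> \<xi> \<partial>\<mm>)"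
  by (simp add: fourier_def)

lemma herglotz_holomorphic: "herglotz \<psi> holomorphic_on ball 0 1"
  unfolding herglotz_def[abs_def]
  by (intro holomorphic_intros cauchy_integral_holomorphic) (use psi in simp)

lemma herglotz_0: "herglotz \<psi> 0 = of_real (\<integral>\<xi>. \<psi> \<xi> \<partial>\<mm>)"
proof -
  have "cauchy_integral (\<lambda>\<xi>. of_real (\<psi> \<xi>)) 0 = of_real (\<integral>\<xi>. \<psi> \<xi> \<partial>\<mm>)"
    unfolding fourier_0_of_real[symmetric] taylor_0[symmetric]
    using taylor_cauchy_integral[of "\<lambda>\<xi>. of_real (\<psi> \<xi>)" 0] psi by simp
  then show ?thesis by (simp add: herglotz_def)
qed

lemma Re_herglotz:
  assumes "cmod z < 1"
  shows "Re (herglotz \<psi> z) = (\<integral>\<xi>. poisson z \<xi> * \<psi> \<xi> \<partial>\<mm>)"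
proof -
  have i: "integrable \<mm> (\<lambda>\<xi>. complex_of_real (\<psi> \<xi>))" using psi by simp
  have "poisson_integral (\<lambda>\<xi>. of_real (\<psi> \<xi>)) z = of_real (\<integral>\<xi>. poisson z \<xi> * \<psi> \<xi> \<partial>\<mm>)"
    unfolding poisson_integral_def integral_complex_of_real[symmetric] by simp
  moreover have "poisson_integral (\<lambda>\<xi>. of_real (\<psi> \<xi>)) z =
      cauchy_integral (\<lambda>\<xi>. of_real (\<psi> \<xi>)) z + cnj (cauchy_integral (\<lambda>\<xi>. of_real (\<psi> \<xi>)) z) - of_real (\<integral>\<xi>. \<psi> \<xi> \<partial>\<mm>)"
    using poisson_integral_eq_cauchy[OF i assms] by (simp add: fourier_0_of_real)
  ultimately have "of_real (\<integral>\<xi>. poisson z \<xi> * \<psi> \<xi> \<partial>\<mm>) =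
      cauchy_integral (\<lambda>\<xi>. of_real (\<psi> \<xi>)) z + cnj (cauchy_integral (\<lambda>\<xi>. of_real (\<psi> \<xi>)) z) - of_real (\<integral>\<xi>. \<psi> \<xi> \<partial>\<mm>)"
    by simp
  from arg_cong[OF this, of Re] show ?thesis by (simp add: herglotz_def)
qed

lemma Re_herglotz_nonneg:
  assumes "\<And>\<xi>. 0 \<le> \<psi> \<xi>" "cmod z < 1" shows "0 \<le> Re (herglotz \<psi> z)"
  unfolding Re_herglotz[OF assms(2)] using assms
  by (intro Bochner_Integration.integral_nonneg mult_nonneg_nonneg poisson_nonneg)

end

text \<open>For \<open>w\<close> in the right half plane \<open>1 + w\<close> has modulus at least 1
  and at least \<open>cmod w\<close>. So \<open>1 / (1 + w)\<close> is a contraction whose product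
  with \<open>w\<close> is bounded as well; such factors tame unbounded Herglotz integrals.\<close>

lemma half_plane_estimates:
  fixes w :: complex
  assumes "0 \<le> Re w"
  shows "cmod (1 / (1 + w)) \<le> 1" "cmod (w / (1 + w)) \<le> 1" "(cmod (w / (1 + w)))\<^sup>2 \<le> Re (w / (1 + w))" "1 + w \<noteq> 0"
proof -
  have sq: "(cmod (1 + w))\<^sup>2 = 1 + 2 * Re w + (cmod w)\<^sup>2"
    unfolding cmod_power2 by (simp add: power2_eq_square algebra_simps)
  then have ge: "1\<^sup>2 \<le> (cmod (1 + w))\<^sup>2" "(cmod w)\<^sup>2 \<le> (cmod (1 + w))\<^sup>2" using assms by auto
  then have ge': "1 \<le> cmod (1 + w)" "cmod w \<le> cmod (1 + w)" using power2_le_imp_le norm_ge_zero by blast+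
  show ne: "1 + w \<noteq> 0" using ge'(1) by auto
  show "cmod (1 / (1 + w)) \<le> 1" "cmod (w / (1 + w)) \<le> 1"
    using ge' ne by (simp_all add: norm_divide)
  have "w / (1 + w) = w * cnj (1 + w) / of_real ((cmod (1 + w))\<^sup>2)"
    by (rule complex_div_cnj)
  then have "Re (w / (1 + w)) = Re (w * cnj (1 + w)) / (cmod (1 + w))\<^sup>2"
    by (simp only: Re_divide_of_real)
  also have "Re (w * cnj (1 + w)) = Re w + (cmod w)\<^sup>2"
    unfolding cmod_power2 by (simp add: power2_eq_square algebra_simps)
  finally show "(cmod (w / (1 + w)))\<^sup>2 \<le> Re (w / (1 + w))"
    using assms by (simp add: norm_divide power_divide divide_right_mono)
qed

text \<open>
  The mean value property makes the half-plane estimate \<open>|w/(1+w)|\<^sup>2 \<le> Re (w/(1+w))\<close> into an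
  \<open>L\<^sup>2\<close> bound by the value at the centre.
\<close>

lemma L2_norm_half_plane:
  assumes H: "H holomorphic_on ball 0 1" and Re: "\<And>z. z \<in> ball 0 1 \<Longrightarrow> 0 \<le> Re (H z)"
    and H0: "H 0 = of_real s" and r: "0 \<le> r" "r < 1"
  shows "L2_norm \<mm> (\<lambda>x. H (of_real r * x) / (1 + H (of_real r * x))) \<le> sqrt s"
proof -
  define \<Phi> where "\<Phi> z = H z / (1 + H z)" for z
  have \<Phi>: "\<Phi> holomorphic_on ball 0 1"
    unfolding \<Phi>_def by (intro holomorphic_intros H) (use half_plane_estimates(4) Re in auto)
  have s: "0 \<le> s" using Re[of 0] H0 by simp
  note L = dilation_L2[OF \<Phi> r]
  have "(L2_norm \<mm> (\<lambda>x. \<Phi> (of_real r * x)))\<^sup>2 \<le> (\<integral>x. Re (\<Phi> (of_real r * x)) \<partial>\<mm>)"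
    unfolding L2_norm_sq
  proof (rule integral_mono)
    show "integrable \<mm> (\<lambda>x. Re (\<Phi> (of_real r * x)))" using L2_integrable[OF L] by simp
    fix x assume "x \<in> space \<mm>"
    then have "of_real r * x \<in> ball 0 1" using r by (simp add: norm_mult)
    then show "(cmod (\<Phi> (of_real r * x)))\<^sup>2 \<le> Re (\<Phi> (of_real r * x))"
      unfolding \<Phi>_def by (intro half_plane_estimates(3) Re)
  qed (use L2_integrable_sq[OF L] in simp)
  also have "\<dots> = Re (fourier (\<lambda>x. \<Phi> (of_real r * x)) 0)"
    using integral_Re[OF L2_integrable[OF L]] by (simp add: fourier_def)
  also have "\<dots> = Re (\<Phi> 0)" using fourier_dilation[OF \<Phi> r, of 0] by (simp add: taylor_0)
  also have "\<Phi> 0 = of_real (s / (1 + s))" using H0 by (simp add: \<Phi>_def)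
  also have "Re (of_real (s / (1 + s))) = s / (1 + s)" by (rule Re_complex_of_real)
  also have "\<dots> \<le> s" using s by (simp add: field_simps)
  finally show ?thesis unfolding \<Phi>_def by (rule real_le_rsqrt)
qed

text \<open>Closeness to 1 is measured on all smaller circles instead of the boundary: this
  condition passes to locally uniform limits, is convex, and refers to no boundary function.\<close>

definition contractions :: "real \<Rightarrow> (complex \<Rightarrow> complex) set" where
  "contractions e = {G. G holomorphic_on ball 0 1 \<and> (\<forall>z\<in>ball 0 1. cmod (G z) \<le> 1) \<and>
     (\<forall>r\<in>{0..<1}. L2_norm \<mm> (\<lambda>x. 1 - G (of_real r * x)) \<le> e)}"

lemma contractions_dilation_L2:
  assumes "G \<in> contractions e" "0 \<le> r" "r < 1"
  shows "(\<lambda>x. 1 - G (of_real r * x)) \<in> L2_space \<mm>"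
proof -
  have "(\<lambda>z. 1 - G z) holomorphic_on ball 0 1"
    using assms(1) by (auto simp: contractions_def intro!: holomorphic_intros)
  from dilation_L2[OF this assms(2,3)] show ?thesis .
qed

lemma one_in_contractions: "0 \<le> e \<Longrightarrow> (\<lambda>_. 1) \<in> contractions e"
  by (auto simp: contractions_def L2_norm_def)

lemma contractions_convex:
  assumes F: "F \<in> contractions e" and G: "G \<in> contractions e" and t: "0 \<le> t" "t \<le> 1"
  shows "(\<lambda>z. of_real (1 - t) * F z + of_real t * G z) \<in> contractions e"
proof -
  have "(\<lambda>z. of_real (1 - t) * F z + of_real t * G z) holomorphic_on ball 0 1"
    using F G by (auto simp: contractions_def intro!: holomorphic_intros)
  moreover have "cmod (of_real (1 - t) * F z + of_real t * G z) \<le> 1" if "z \<in> ball 0 1" for z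
  proof -
    have "cmod (of_real (1 - t) * F z + of_real t * G z) \<le> (1 - t) * cmod (F z) + t * cmod (G z)"
      using t norm_triangle_ineq[of "of_real (1 - t) * F z" "of_real t * G z"]
      by (simp add: norm_mult del: of_real_diff)
    also have "\<dots> \<le> (1 - t) * 1 + t * 1"
      using F G t that by (intro add_mono mult_left_mono) (auto simp: contractions_def)
    finally show ?thesis by simp
  qed
  moreover have "L2_norm \<mm> (\<lambda>x. 1 - (of_real (1 - t) * F (of_real r * x) + of_real t * G (of_real r * x))) \<le> e"
    if r: "0 \<le> r" "r < 1" for r
  proof -
    note L = contractions_dilation_L2[OF F r] contractions_dilation_L2[OF G r]
    have "(\<lambda>x. 1 - (of_real (1 - t) * F (of_real r * x) + of_real t * G (of_real r * x)))
        = (\<lambda>x. of_real (1 - t) * (1 - F (of_real r * x)) + of_real t * (1 - G (of_real r * x)))"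
      by (simp add: algebra_simps)
    then have "L2_norm \<mm> (\<lambda>x. 1 - (of_real (1 - t) * F (of_real r * x) + of_real t * G (of_real r * x)))
      \<le> cmod (of_real (1 - t)) * L2_norm \<mm> (\<lambda>x. 1 - F (of_real r * x))
        + cmod (of_real t) * L2_norm \<mm> (\<lambda>x. 1 - G (of_real r * x))"
      using L2_norm_triangle[OF L2_scale[OF L(1)] L2_scale[OF L(2)]] by (simp only: L2_norm_scale)
    also have "\<dots> \<le> (1 - t) * e + t * e"
      using F G t r by (intro add_mono mult_mono) (auto simp: contractions_def simp del: of_real_diff)
    finally show ?thesis by (simp add: algebra_simps)
  qed
  ultimately show ?thesis by (simp add: contractions_def)
qed

text \<open>Sequential compactness of the class with respect to Taylor coefficients. It serves
  twice: to obtain minimisers, and to pass from finitely many conditions to all of them.\<close>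

lemma contractions_montel:
  assumes rng: "range \<G> \<subseteq> contractions e"
  obtains G r where "G \<in> contractions e" "strict_mono (r :: nat \<Rightarrow> nat)"
    "\<And>n. (\<lambda>k. taylor (\<G> (r k)) n) \<longlonglongrightarrow> taylor G n"
proof -
  obtain G r where G: "G holomorphic_on ball 0 1" and r: "strict_mono (r :: nat \<Rightarrow> nat)"
    and pt: "\<And>x. x \<in> ball 0 1 \<Longrightarrow> ((\<lambda>n. \<G> (r n) x) \<longlongrightarrow> G x) sequentially"
    and ul: "\<And>K. compact K \<Longrightarrow> K \<subseteq> ball 0 1 \<Longrightarrow> uniform_limit K (\<G> \<circ> r) G sequentially"
  proof (rule Montel[of "ball 0 1" "contractions e" \<G>])
    show "\<exists>B. \<forall>h\<in>contractions e. \<forall>z\<in>K. cmod (h z) \<le> B" if "K \<subseteq> ball 0 1" for K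
      using that by (intro exI[of _ 1]) (auto simp: contractions_def)
  qed (use rng in \<open>auto simp: contractions_def\<close>)
  have gk: "\<G> k \<in> contractions e" for k using rng by auto
  have "cmod (G z) \<le> 1" if "z \<in> ball 0 1" for z
    by (rule LIMSEQ_le_const2[OF tendsto_norm[OF pt[OF that]]])
       (use gk that in \<open>auto simp: contractions_def\<close>)
  moreover have "L2_norm \<mm> (\<lambda>y. 1 - G (of_real s * y)) \<le> e" if s: "0 \<le> s" "s < 1" for s
  proof -
    have G1: "(\<lambda>y. 1 - G (of_real s * y)) \<in> L2_space \<mm>"
      by (rule L2_diff[OF _ dilation_L2[OF G s]]) (use sphere_pow_L2[of 0] in simp)
    have "(\<lambda>k. L2_norm \<mm> (\<lambda>y. (1 - \<G> (r k) (of_real s * y)) - (1 - G (of_real s * y)))) \<longlonglongrightarrow> 0"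
    proof (rule LIMSEQ_I)
      fix \<epsilon> :: real assume "\<epsilon> > 0"
      have "uniform_limit (cball 0 s) (\<G> \<circ> r) G sequentially" using s by (intro ul) auto
      then have "\<forall>\<^sub>F n in sequentially. \<forall>z\<in>cball 0 s. dist ((\<G> \<circ> r) n z) (G z) < \<epsilon> / 2"
        using \<open>\<epsilon> > 0\<close> unfolding uniform_limit_iff by (meson half_gt_zero)
      then obtain N where N: "\<And>n z. n \<ge> N \<Longrightarrow> z \<in> cball 0 s \<Longrightarrow> cmod (\<G> (r n) z - G z) < \<epsilon> / 2"
        unfolding eventually_sequentially dist_norm comp_def by blast
      have "norm (L2_norm \<mm> (\<lambda>y. (1 - \<G> (r k) (of_real s * y)) - (1 - G (of_real s * y))) - 0) < \<epsilon>"
        if "k \<ge> N" for k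
      proof -
        have "L2_norm \<mm> (\<lambda>y. (1 - \<G> (r k) (of_real s * y)) - (1 - G (of_real s * y))) \<le> \<epsilon> / 2"
        proof (rule circle.L2_norm_le_bound)
          show "(\<lambda>y. (1 - \<G> (r k) (of_real s * y)) - (1 - G (of_real s * y))) \<in> borel_measurable \<mm>"
            by (intro L2_measurable L2_diff[OF contractions_dilation_L2[OF gk s] G1])
          show "AE y in \<mm>. cmod ((1 - \<G> (r k) (of_real s * y)) - (1 - G (of_real s * y))) \<le> \<epsilon> / 2"
          proof (rule AE_I2)
            fix y assume "y \<in> space \<mm>"
            then show "cmod ((1 - \<G> (r k) (of_real s * y)) - (1 - G (of_real s * y))) \<le> \<epsilon> / 2"
              using N[OF that, of "of_real s * y"] s norm_minus_commute[of "\<G> (r k) (of_real s * y)"]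
              by (simp add: norm_mult algebra_simps)
          qed
        qed (use \<open>\<epsilon> > 0\<close> in simp)
        then show ?thesis using \<open>\<epsilon> > 0\<close> by simp
      qed
      then show "\<exists>N. \<forall>k\<ge>N. norm (L2_norm \<mm> (\<lambda>y. (1 - \<G> (r k) (of_real s * y)) - (1 - G (of_real s * y))) - 0) < \<epsilon>"
        by blast
    qed
    then have "(\<lambda>k. L2_norm \<mm> (\<lambda>y. 1 - \<G> (r k) (of_real s * y))) \<longlonglongrightarrow> L2_norm \<mm> (\<lambda>y. 1 - G (of_real s * y))"
      by (intro L2_limit_norm contractions_dilation_L2[OF gk s] G1)
    then show ?thesis
      by (rule LIMSEQ_le_const2) (use gk s in \<open>auto simp: contractions_def\<close>)
  qed
  ultimately have GC: "G \<in> contractions e" using G by (simp add: contractions_def)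
  have "(\<lambda>k. taylor (\<G> (r k)) n) \<longlonglongrightarrow> taylor G n" for n
  proof -
    have "uniform_limit (ball 0 (1/2)) (\<lambda>k. \<G> (r k)) G sequentially"
      using uniform_limit_on_subset[OF ul[of "cball 0 (1/2)"], of "ball 0 (1/2)"]
      by (simp add: comp_def cball_subset_ball_iff)
    then have "(\<lambda>k. (deriv ^^ n) (\<G> (r k)) 0) \<longlonglongrightarrow> (deriv ^^ n) G 0"
    proof (rule higher_deriv_complex_uniform_limit)
      show "\<forall>\<^sub>F k in sequentially. \<G> (r k) holomorphic_on ball 0 (1/2)"
      proof (intro always_eventually allI)
        fix k
        have "\<G> (r k) holomorphic_on ball 0 1" using gk by (simp add: contractions_def)
        then show "\<G> (r k) holomorphic_on ball 0 (1/2)" by (rule holomorphic_on_subset) auto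
      qed
    qed auto
    then show ?thesis unfolding taylor_def by (intro tendsto_divide tendsto_const) auto
  qed
  then show ?thesis using GC r that by blast
qed

text \<open>
  \<open>toep g I a\<close> is the analytic part of \<open>cnj g\<close> times the polynomial with coefficients \<open>a\<close>: a co-analytic
  Toeplitz operator applied to a polynomial.
\<close>

definition toep :: "(nat \<Rightarrow> complex) \<Rightarrow> nat set \<Rightarrow> (nat \<Rightarrow> complex) \<Rightarrow> complex \<Rightarrow> complex" where
  "toep g I a z = (\<Sum>l\<in>I. a l * (\<Sum>n\<le>l. cnj (g n) * z ^ (l - n)))"

lemma toep_continuous [continuous_intros]: "continuous_on S (toep g I a)"
  unfolding toep_def[abs_def] by (intro continuous_intros)

lemma toep_holomorphic: "toep g I a holomorphic_on S"
  unfolding toep_def[abs_def] by (intro holomorphic_intros)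

lemma toep_L2 [simp]: "toep g I a \<in> L2_space \<mm>"
  by (rule continuous_on_sphere_L2[OF toep_continuous circle.finite_measure_axioms]) simp

text \<open>Duality: the co-analytic operator acts on the other side as multiplication of the
  analytic part of \<psi>. For \<open>g = taylor G\<close> the inner sums are the Taylor
  coefficients of \<open>G\<close> times the Cauchy integral of \<psi>.\<close>

lemma toep_inner:
  assumes "\<psi> \<in> L2_space \<mm>"
  shows "L2_inner \<mm> (toep g I a) \<psi> = (\<Sum>l\<in>I. a l * cnj (\<Sum>n\<le>l. g n * fourier \<psi> (int (l - n))))"
proof -
  have p: "L2_inner \<mm> (\<lambda>z. z ^ k) \<psi> = cnj (fourier \<psi> (int k))" for k
    using L2_inner_commute[of \<mm> "\<lambda>z. z ^ k" \<psi>] by (simp add: L2_inner_pow)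
  have "L2_inner \<mm> (toep g I a) \<psi>
      = (\<Sum>l\<in>I. L2_inner \<mm> (\<lambda>z. a l * (\<Sum>n\<le>l. cnj (g n) * z ^ (l - n))) \<psi>)"
    unfolding toep_def[abs_def]
    by (rule L2_inner_sum_left) (auto intro!: L2_scale L2_sum assms)
  also have "\<dots> = (\<Sum>l\<in>I. a l * (\<Sum>n\<le>l. cnj (g n) * cnj (fourier \<psi> (int (l - n)))))"
    unfolding L2_inner_scale_left
    by (intro sum.cong refl arg_cong2[where f="(*)"], subst L2_inner_sum_left)
       (auto intro!: L2_scale assms simp: L2_inner_scale_left p)
  finally show ?thesis by simp
qed

lemma toep_linear:
  assumes "\<And>n. h n = of_real s * f n + of_real t * g n"
  shows "toep h I a z = of_real s * toep f I a z + of_real t * toep g I a z"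
  unfolding toep_def assms
  by (simp add: sum_distrib_left sum.distrib algebra_simps)

lemma toep_tendsto:
  assumes "\<And>n. (\<lambda>k. g k n) \<longlonglongrightarrow> h n"
  shows "(\<lambda>k. toep (g k) I a z) \<longlonglongrightarrow> toep h I a z"
  unfolding toep_def by (intro tendsto_intros assms)

lemma toep_bound:
  assumes "\<And>n. cmod (g n) \<le> 1" "cmod z \<le> 1"
  shows "cmod (toep g I a z) \<le> (\<Sum>l\<in>I. cmod (a l) * real (Suc l))"
  unfolding toep_def
proof (rule sum_norm_le)
  fix l
  have "cmod (\<Sum>n\<le>l. cnj (g n) * z ^ (l - n)) \<le> (\<Sum>n\<le>l. 1)"
  proof (rule sum_norm_le)
    fix n
    have "cmod (g n) * cmod z ^ (l - n) \<le> 1 * 1"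
      by (rule mult_mono) (use assms in \<open>auto intro: power_le_one\<close>)
    then show "cmod (cnj (g n) * z ^ (l - n)) \<le> 1" by (simp add: norm_mult norm_power)
  qed
  then show "cmod (a l * (\<Sum>n\<le>l. cnj (g n) * z ^ (l - n))) \<le> cmod (a l) * real (Suc l)"
    by (simp add: norm_mult mult_left_mono)
qed

text \<open>Positive parts of the four rotations of \<open>z\<close>. A complex density becomes a
  combination of four nonnegative ones, whose Herglotz integrals take values in the right half
  plane.\<close>

definition quarter :: "nat \<Rightarrow> complex \<Rightarrow> real" where
  "quarter j z = max 0 (Re (cnj (\<i> ^ j) * z))"

lemma quarter_nonneg: "0 \<le> quarter j z" and quarter_le: "quarter j z \<le> cmod z"
proof -
  show "0 \<le> quarter j z" by (simp add: quarter_def)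
  have "Re (cnj (\<i> ^ j) * z) \<le> cmod (cnj (\<i> ^ j) * z)" by (rule complex_Re_le_cmod)
  also have "\<dots> = cmod z" by (simp add: norm_mult norm_power)
  finally show "quarter j z \<le> cmod z" by (simp add: quarter_def)
qed

lemma quarter_sum: "z = (\<Sum>j<4. \<i> ^ j * of_real (quarter j z))"
  by (simp add: quarter_def eval_nat_numeral complex_eq_iff max_def)

lemma quarter_continuous: "continuous_on S f \<Longrightarrow> continuous_on S (\<lambda>x. quarter j (f x))"
  unfolding quarter_def by (intro continuous_intros)

text \<open>\<open>G\<close> is the product of the factors \<open>1 / (1 + w p)\<close>, where
  \<open>w p\<close> is a multiple of the Herglotz integral of one quarter of some
  \<open>\<psi> k\<close>. Each factor bounds its own Herglotz integral, so \<open>G\<close> times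
  the Cauchy integral of \<open>\<psi> k\<close> is bounded by a constant that involves only L1
  norms. The target \<open>S\<close> is the support functional of the later constraint: the largest
  real pairing of the \<open>\<psi> k\<close> with functions of modulus at most
  \<open>1 / 2 ^ k\<close>.\<close>

lemma competitor:
  fixes \<psi> :: "nat \<Rightarrow> complex \<Rightarrow> complex"
  assumes cont: "\<And>k. k < m \<Longrightarrow> continuous_on (sphere 0 1) (\<psi> k)"
    and a: "\<And>k. k < m \<Longrightarrow> L2_norm \<mm> (\<lambda>x. \<Sum>l\<in>I k. a l * x ^ l) \<le> \<delta> / 16 ^ k"
    and S: "S = (\<Sum>k<m. (\<integral>\<xi>. cmod (\<psi> k \<xi>) \<partial>\<mm>) / 2 ^ k)" "S > 0"
    and \<kappa>: "0 < \<kappa>" "\<kappa> \<le> 1" "8 * sqrt \<kappa> \<le> e" and \<delta>: "0 \<le> \<delta>" "8 * \<delta> \<le> \<kappa>"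
  shows "\<exists>G\<in>contractions e. Re (\<Sum>k<m. L2_inner \<mm> (toep (taylor G) (I k) a) (\<psi> k)) \<le> S"
proof -
  define s where "s k = (\<integral>\<xi>. cmod (\<psi> k \<xi>) \<partial>\<mm>)" for k
  \<comment> \<open>The scale balances two demands. Small: \<open>b k\<close> times the L1 norm of
    \<open>\<psi> k\<close> is at most \<open>\<kappa> / 4 ^ k\<close>, so the four factors of level
    \<open>k\<close> move \<open>G\<close> from 1 by at most
    \<open>4 * sqrt \<kappa> / 2 ^ k\<close>, in total by \<open>8 * sqrt \<kappa>\<close>. Large:
    \<open>4 / b k\<close> bounds \<open>G\<close> times the Cauchy integral and grows like
    \<open>8 ^ k\<close>, which the block norms \<open>\<delta> / 16 ^ k\<close> still beat.\<close>
  define b where "b k = \<kappa> / 8 ^ k / S" for k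
  have bpos: "0 < b k" for k using \<kappa> S by (simp add: b_def)
  define q where "q p \<xi> = quarter (snd p) (\<psi> (fst p) \<xi>)" for p \<xi>
  define J where "J = {..<m} \<times> {..<4::nat}"
  have finJ: "finite J" by (simp add: J_def)
  have \<psi>L: "\<psi> k \<in> L2_space \<mm>" if "k < m" for k
    by (rule continuous_on_sphere_L2[OF cont[OF that] circle.finite_measure_axioms]) simp
  have s0: "0 \<le> s k" for k by (simp add: s_def)
  have s_le: "s k \<le> 2 ^ k * S" if "k < m" for k
  proof -
    have "s k / 2 ^ k \<le> S" unfolding S(1) s_def using that
      by (intro member_le_sum[of k "{..<m}" "\<lambda>k. (\<integral>\<xi>. cmod (\<psi> k \<xi>) \<partial>\<mm>) / 2 ^ k"]) auto
    then show ?thesis by (simp add: field_simps)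
  qed
  have qi: "integrable \<mm> (q p)" and qs: "(\<integral>\<xi>. q p \<xi> \<partial>\<mm>) \<le> s (fst p)" if "p \<in> J" for p
  proof -
    have k: "fst p < m" using that by (auto simp: J_def)
    have "continuous_on (sphere 0 1) (\<lambda>\<xi>. complex_of_real (q p \<xi>))"
      unfolding q_def by (intro continuous_intros quarter_continuous cont k)
    then have "(\<lambda>\<xi>. complex_of_real (q p \<xi>)) \<in> L2_space \<mm>"
      by (rule continuous_on_sphere_L2[OF _ circle.finite_measure_axioms]) simp
    then show qi: "integrable \<mm> (q p)" using integrable_Re[OF L2_integrable] by fastforce
    show "(\<integral>\<xi>. q p \<xi> \<partial>\<mm>) \<le> s (fst p)"
      unfolding s_def
    proof (rule integral_mono)
      show "q p \<xi> \<le> cmod (\<psi> (fst p) \<xi>)" for \<xi> by (simp add: q_def quarter_le)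
    qed (use L2_integrable[OF \<psi>L[OF k]] qi in auto)
  qed
  have q0: "0 \<le> q p \<xi>" for p \<xi> by (simp add: q_def quarter_nonneg)
  define w where "w p z = of_real (b (fst p)) * herglotz (q p) z" for p z
  have wh: "w p holomorphic_on ball 0 1" if "p \<in> J" for p
    unfolding w_def[abs_def] by (intro holomorphic_intros herglotz_holomorphic qi that)
  have Rew: "0 \<le> Re (w p z)" if "p \<in> J" "z \<in> ball 0 1" for p z
    using Re_herglotz_nonneg[OF qi[OF that(1)] q0, of z] that(2) bpos[of "fst p"] by (simp add: w_def)
  have w0: "w p 0 = of_real (b (fst p) * (\<integral>\<xi>. q p \<xi> \<partial>\<mm>))" if "p \<in> J" for p
    using herglotz_0[OF qi[OF that]] by (simp add: w_def)
  define G where "G z = (\<Prod>p\<in>J. 1 / (1 + w p z))" for z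
  have Gh: "G holomorphic_on ball 0 1"
    unfolding G_def using half_plane_estimates(4)[OF Rew] by (intro holomorphic_intros wh) auto
  have prod_le: "cmod (\<Prod>p\<in>J'. 1 / (1 + w p z)) \<le> 1" if "J' \<subseteq> J" "z \<in> ball 0 1" for J' z
    unfolding prod_norm[symmetric] using half_plane_estimates(1)[OF Rew] that
    by (intro prod_le_1) auto
  \<comment> \<open>One factor absorbs \<open>w p\<close>; the product of the others is a
    contraction.\<close>
  have Gw: "cmod (G z * w p z) \<le> 1" if p: "p \<in> J" and z: "z \<in> ball 0 1" for p z
  proof -
    have "G z * w p z = (w p z / (1 + w p z)) * (\<Prod>p\<in>J - {p}. 1 / (1 + w p z))"
      unfolding G_def by (subst prod.remove[OF finJ p]) simp
    also have "cmod \<dots> \<le> 1 * 1"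
      unfolding norm_mult using p z
      by (intro mult_mono prod_le half_plane_estimates(2) Rew) auto
    finally show ?thesis by simp
  qed
  have GC: "G \<in> contractions e"
    unfolding contractions_def
  proof (intro CollectI conjI ballI Gh)
    fix z assume "z \<in> ball (0::complex) 1"
    then show "cmod (G z) \<le> 1" unfolding G_def by (intro prod_le) auto
  next
    fix r :: real assume "r \<in> {0..<1}"
    then have r: "0 \<le> r" "r < 1" by auto
    define \<Phi> where "\<Phi> p z = w p z / (1 + w p z)" for p z
    have \<Phi>h: "\<Phi> p holomorphic_on ball 0 1" if "p \<in> J" for p
      unfolding \<Phi>_def using half_plane_estimates(4)[OF Rew[OF that]] by (intro holomorphic_intros wh that) auto
    have \<Phi>L: "(\<lambda>x. of_real (cmod (\<Phi> p (of_real r * x)))) \<in> L2_space \<mm>" if "p \<in> J" for p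
    proof -
      have [measurable]: "(\<lambda>x. \<Phi> p (of_real r * x)) \<in> borel_measurable \<mm>"
        by (rule L2_measurable[OF dilation_L2[OF \<Phi>h[OF that] r]])
      have "(\<lambda>x. complex_of_real (cmod (\<Phi> p (of_real r * x)))) \<in> borel_measurable \<mm>" by measurable
      then show ?thesis using dilation_L2[OF \<Phi>h[OF that] r] by (simp add: L2_space_def)
    qed
    have "L2_norm \<mm> (\<lambda>x. 1 - G (of_real r * x))
        \<le> L2_norm \<mm> (\<lambda>x. \<Sum>p\<in>J. of_real (cmod (\<Phi> p (of_real r * x))))"
    proof (rule L2_norm_mono)
      show "(\<lambda>x. \<Sum>p\<in>J. complex_of_real (cmod (\<Phi> p (of_real r * x)))) \<in> L2_space \<mm>"
        by (intro L2_sum \<Phi>L)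
      have "(\<lambda>z. 1 - G z) holomorphic_on ball 0 1" by (intro holomorphic_intros Gh)
      from dilation_L2[OF this r]
      show "(\<lambda>x. 1 - G (of_real r * x)) \<in> borel_measurable \<mm>" by (rule L2_measurable)
      show "AE x in \<mm>. cmod (1 - G (of_real r * x)) \<le> cmod (\<Sum>p\<in>J. complex_of_real (cmod (\<Phi> p (of_real r * x))))"
      proof (rule AE_I2)
        fix x assume "x \<in> space \<mm>"
        then have z: "of_real r * x \<in> ball 0 1" using r by (simp add: norm_mult)
        have "1 - G (of_real r * x) = (\<Prod>p\<in>J. 1) - (\<Prod>p\<in>J. 1 / (1 + w p (of_real r * x)))" by (simp add: G_def)
        also have "cmod \<dots> \<le> (\<Sum>p\<in>J. cmod (1 - 1 / (1 + w p (of_real r * x))))"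
          by (rule norm_prod_diff) (use half_plane_estimates(1)[OF Rew[OF _ z]] in auto)
        also have "\<dots> = (\<Sum>p\<in>J. cmod (\<Phi> p (of_real r * x)))"
        proof (rule sum.cong[OF refl])
          fix p assume "p \<in> J"
          then have "1 + w p (of_real r * x) \<noteq> 0" using half_plane_estimates(4)[OF Rew[OF _ z]] by blast
          then show "cmod (1 - 1 / (1 + w p (of_real r * x))) = cmod (\<Phi> p (of_real r * x))"
            by (simp add: \<Phi>_def diff_divide_eq_iff)
        qed
        also have "\<dots> = cmod (\<Sum>p\<in>J. complex_of_real (cmod (\<Phi> p (of_real r * x))))"
          unfolding of_real_sum[symmetric] norm_of_real by (intro abs_of_nonneg[symmetric] sum_nonneg) simp
        finally show "cmod (1 - G (of_real r * x)) \<le> cmod (\<Sum>p\<in>J. complex_of_real (cmod (\<Phi> p (of_real r * x))))" .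
      qed
    qed
    also have "\<dots> \<le> (\<Sum>p\<in>J. L2_norm \<mm> (\<lambda>x. complex_of_real (cmod (\<Phi> p (of_real r * x)))))"
      by (rule L2_norm_sum_le[OF finJ \<Phi>L])
    also have "\<dots> \<le> (\<Sum>p\<in>J. sqrt \<kappa> * (1/2) ^ fst p)"
    proof (rule sum_mono)
      fix p assume p: "p \<in> J"
      then have k: "fst p < m" by (auto simp: J_def)
      have "L2_norm \<mm> (\<lambda>x. complex_of_real (cmod (\<Phi> p (of_real r * x)))) = L2_norm \<mm> (\<lambda>x. \<Phi> p (of_real r * x))"
        by (simp add: L2_norm_def)
      also have "\<dots> \<le> sqrt (b (fst p) * (\<integral>\<xi>. q p \<xi> \<partial>\<mm>))"
        unfolding \<Phi>_def by (rule L2_norm_half_plane[OF wh[OF p] Rew[OF p] w0[OF p] r])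
      also have "\<dots> \<le> sqrt (\<kappa> / 4 ^ fst p)"
      proof (rule real_sqrt_le_mono)
        have "b (fst p) * (\<integral>\<xi>. q p \<xi> \<partial>\<mm>) \<le> b (fst p) * (2 ^ fst p * S)"
          using qs[OF p] s_le[OF k] bpos by (intro mult_left_mono order_trans[OF qs[OF p] s_le[OF k]] less_imp_le)
        also have "\<dots> = \<kappa> / 4 ^ fst p"
        proof -
          have "(8::real) ^ fst p = 4 ^ fst p * 2 ^ fst p" by (simp flip: power_mult_distrib)
          then show ?thesis using S by (simp add: b_def)
        qed
        finally show "b (fst p) * (\<integral>\<xi>. q p \<xi> \<partial>\<mm>) \<le> \<kappa> / 4 ^ fst p" .
      qed
      also have "\<dots> = sqrt \<kappa> * (1/2) ^ fst p"
      proof -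
        have "sqrt (4 ^ fst p) = 2 ^ fst p"
          by (rule real_sqrt_unique) (auto simp: power2_eq_square simp flip: power_mult_distrib)
        then show ?thesis by (simp add: real_sqrt_divide power_one_over)
      qed
      finally show "L2_norm \<mm> (\<lambda>x. complex_of_real (cmod (\<Phi> p (of_real r * x)))) \<le> sqrt \<kappa> * (1/2) ^ fst p" .
    qed
    also have "\<dots> = 4 * sqrt \<kappa> * (\<Sum>k<m. (1/2) ^ k)"
      unfolding J_def sum.cartesian_product[symmetric, of "\<lambda>k j. sqrt \<kappa> * (1/2) ^ k", unfolded case_prod_unfold]
      by (simp add: sum_distrib_left mult_ac)
    also have "\<dots> \<le> 4 * sqrt \<kappa> * 2"
      using \<kappa> by (intro mult_left_mono) (auto simp: geometric_sum)
    finally show "L2_norm \<mm> (\<lambda>x. 1 - G (of_real r * x)) \<le> e" using \<kappa> by simp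
  qed
  have inner: "cmod (L2_inner \<mm> (toep (taylor G) (I k) a) (\<psi> k)) \<le> S / 2 ^ Suc k" if k: "k < m" for k
  proof -
    define \<Psi> where "\<Psi> = cauchy_integral (\<psi> k)"
    have \<psi>i: "integrable \<mm> (\<psi> k)" by (rule L2_integrable[OF \<psi>L[OF k]])
    have \<Psi>h: "\<Psi> holomorphic_on ball 0 1" unfolding \<Psi>_def by (rule cauchy_integral_holomorphic[OF \<psi>i])
    have GP: "(\<lambda>z. G z * \<Psi> z) holomorphic_on ball 0 1" by (intro holomorphic_intros Gh \<Psi>h)
    have Jk: "(k, j) \<in> J" if "j < 4" for j using k that by (simp add: J_def)
    \<comment> \<open>On each quarter the Cauchy integral is half the sum of the Herglotz integral
      and the mean.\<close>
    have \<Psi>z: "\<Psi> z = (\<Sum>j<4. \<i> ^ j * ((herglotz (q (k, j)) z + of_real (\<integral>\<xi>. q (k, j) \<xi> \<partial>\<mm>)) / 2))" if z: "z \<in> ball 0 1" for z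
    proof -
      have "\<Psi> z = (\<integral>\<xi>. (\<Sum>j<4. \<i> ^ j * (of_real (q (k, j) \<xi>) * (\<xi> / (\<xi> - z)))) \<partial>\<mm>)"
        unfolding \<Psi>_def cauchy_integral_def
        by (rule Bochner_Integration.integral_cong[OF refl], subst quarter_sum)
           (simp add: q_def sum_distrib_right sum_divide_distrib mult.assoc)
      also have "\<dots> = (\<Sum>j<4. \<integral>\<xi>. \<i> ^ j * (of_real (q (k, j) \<xi>) * (\<xi> / (\<xi> - z))) \<partial>\<mm>)"
      proof (rule Bochner_Integration.integral_sum)
        fix j assume "j \<in> {..<(4::nat)}"
        then have "integrable \<mm> (\<lambda>\<xi>. complex_of_real (q (k, j) \<xi>))" using qi[OF Jk[of j]] by simp
        then show "integrable \<mm> (\<lambda>\<xi>. \<i> ^ j * (of_real (q (k, j) \<xi>) * (\<xi> / (\<xi> - z))))"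
          using z by (intro integrable_mult_right integrable_kernel) auto
      qed
      also have "\<dots> = (\<Sum>j<4. \<i> ^ j * cauchy_integral (\<lambda>\<xi>. of_real (q (k, j) \<xi>)) z)"
        unfolding cauchy_integral_def by (intro sum.cong refl integral_mult_right_zero)
      finally show ?thesis by (simp add: herglotz_def)
    qed
    have bound: "cmod (G z * \<Psi> z) \<le> 4 * S * 8 ^ k / \<kappa>" if z: "z \<in> ball 0 1" for z
    proof -
      have "cmod (G z * \<Psi> z) = cmod (\<Sum>j<4. \<i> ^ j * ((G z * herglotz (q (k, j)) z + G z * of_real (\<integral>\<xi>. q (k, j) \<xi> \<partial>\<mm>)) / 2))"
        by (simp add: \<Psi>z[OF z] sum_distrib_left algebra_simps)
      also have "\<dots> \<le> (\<Sum>j<(4::nat). (1 / b k + s k) / 2)"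
      proof (rule sum_norm_le)
        fix j assume "j \<in> {..<(4::nat)}"
        then have p: "(k, j) \<in> J" using Jk by simp
        have "cmod (G z * herglotz (q (k, j)) z) \<le> 1 / b k"
        proof -
          have "b k * cmod (G z * herglotz (q (k, j)) z) \<le> 1"
            using Gw[OF p z] bpos[of k] by (simp add: w_def norm_mult mult_ac)
          then show ?thesis using bpos[of k] by (simp add: field_simps)
        qed
        moreover have "cmod (G z * of_real (\<integral>\<xi>. q (k, j) \<xi> \<partial>\<mm>)) \<le> 1 * s k"
          unfolding norm_mult using GC z qs[OF p] q0
          by (intro mult_mono) (auto simp: contractions_def abs_of_nonneg)
        ultimately have "cmod (G z * herglotz (q (k, j)) z + G z * of_real (\<integral>\<xi>. q (k, j) \<xi> \<partial>\<mm>)) \<le> 1 / b k + s k"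
          by (intro norm_triangle_le) simp
        then show "cmod (\<i> ^ j * ((G z * herglotz (q (k, j)) z + G z * of_real (\<integral>\<xi>. q (k, j) \<xi> \<partial>\<mm>)) / 2)) \<le> (1 / b k + s k) / 2"
          by (simp add: norm_mult norm_power norm_divide)
      qed
      also have "\<dots> = 2 * (S * 8 ^ k / \<kappa> + s k)" using S by (simp add: b_def)
      also have "\<dots> \<le> 2 * (S * 8 ^ k / \<kappa> + S * 8 ^ k / \<kappa>)"
      proof -
        have "s k \<le> 2 ^ k * S" by (rule s_le[OF k])
        also have "\<dots> \<le> 8 ^ k * S" using S by (intro mult_right_mono power_mono) auto
        also have "\<dots> \<le> S * 8 ^ k / \<kappa>" using S \<kappa> by (simp add: field_simps)
        finally show ?thesis by simp
      qed
      finally show ?thesis by simp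
    qed
    have "L2_inner \<mm> (toep (taylor G) (I k) a) (\<psi> k) = (\<Sum>l\<in>I k. a l * cnj (taylor (\<lambda>z. G z * \<Psi> z) l))"
      unfolding toep_inner[OF \<psi>L[OF k]] taylor_mult[OF Gh \<Psi>h]
      by (simp add: \<Psi>_def taylor_cauchy_integral[OF \<psi>i])
    also have "cmod \<dots> \<le> L2_norm \<mm> (\<lambda>x. \<Sum>l\<in>I k. a l * x ^ l) * (4 * S * 8 ^ k / \<kappa>)"
      by (rule taylor_bound(1)[OF GP bound])
    also have "\<dots> \<le> (\<delta> / 16 ^ k) * (4 * S * 8 ^ k / \<kappa>)"
      using S \<kappa> by (intro mult_right_mono a k) auto
    also have "\<dots> = (4 * \<delta> / \<kappa>) * (S / 2 ^ k)"
    proof -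
      have "(16::real) ^ k = 8 ^ k * 2 ^ k" by (simp flip: power_mult_distrib)
      then show ?thesis by (simp add: mult_ac)
    qed
    also have "\<dots> \<le> (1 / 2) * (S / 2 ^ k)"
      using S \<kappa> \<delta> by (intro mult_right_mono) (auto simp: field_simps)
    finally show ?thesis by simp
  qed
  have "Re (\<Sum>k<m. L2_inner \<mm> (toep (taylor G) (I k) a) (\<psi> k)) \<le> (\<Sum>k<m. S / 2 ^ Suc k)"
    unfolding Re_sum using inner complex_Re_le_cmod by (intro sum_mono) (meson lessThan_iff order_trans)
  also have "\<dots> = (S / 2) * (\<Sum>k<m. (1/2) ^ k)" by (simp add: sum_distrib_left power_one_over)
  also have "\<dots> \<le> (S / 2) * 2" using S by (intro mult_left_mono) (auto simp: geometric_sum)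
  finally show ?thesis using GC by auto
qed

section \<open>The disc algebra, the maximum principle, and multipliers that make Toeplitz images
  small\<close>

lemma disc_algebra:
  assumes c: "continuous_on (cball 0 1) F" and h: "F holomorphic_on ball 0 1"
  shows disc_algebra_fourier: "fourier F k = (if 0 \<le> k then taylor F (nat k) else 0)"
    and disc_algebra_H2: "F \<in> H2"
    and disc_algebra_cauchy: "cmod z < 1 \<Longrightarrow> cauchy_integral F z = F z"
proof -
  have cs: "continuous_on (sphere 0 1) F" by (rule continuous_on_subset[OF c]) auto
  have FL: "F \<in> L2_space \<mm>"
    by (rule continuous_on_sphere_L2[OF cs circle.finite_measure_axioms]) simp
  have "bounded (F ` cball 0 1)" by (intro compact_imp_bounded compact_continuous_image c compact_cball)
  then obtain B where B: "\<And>z. z \<in> cball 0 1 \<Longrightarrow> cmod (F z) \<le> B" unfolding bounded_iff by blast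
  define r where "r n = 1 - 1 / real (Suc n)" for n
  have r: "0 \<le> r n" "r n < 1" for n by (auto simp: r_def)
  have rlim: "r \<longlonglongrightarrow> 1"
    unfolding r_def using tendsto_diff[OF tendsto_const[of "1::real"] LIMSEQ_inverse_real_of_nat]
    by (simp add: inverse_eq_divide)
  show four: "fourier F k = (if 0 \<le> k then taylor F (nat k) else 0)" for k
  proof -
    have "(\<lambda>n. fourier (\<lambda>x. F (of_real (r n) * x)) k) \<longlonglongrightarrow> fourier F k"
      unfolding fourier_def
    proof (rule integral_dominated_convergence[where w="\<lambda>_. B"])
      have [measurable]: "F \<in> borel_measurable \<mm>"
        "(\<lambda>x. F (of_real (r n) * x)) \<in> borel_measurable \<mm>" for n
        by (auto intro!: L2_measurable FL dilation_L2[OF h r])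
      show "(\<lambda>x. F x * x powi (- k)) \<in> borel_measurable \<mm>"
        "(\<lambda>x. F (of_real (r n) * x) * x powi (- k)) \<in> borel_measurable \<mm>" for n
        by measurable
      show "AE x in \<mm>. (\<lambda>n. F (of_real (r n) * x) * x powi (- k)) \<longlonglongrightarrow> F x * x powi (- k)"
      proof (rule AE_I2)
        fix x assume z: "x \<in> space \<mm>"
        have "(\<lambda>n. of_real (r n) * x) \<longlonglongrightarrow> of_real 1 * x" by (intro tendsto_intros rlim)
        then have "(\<lambda>n. F (of_real (r n) * x)) \<longlonglongrightarrow> F x"
          using z r by (intro continuous_on_tendsto_compose[OF c]) (auto simp: norm_mult less_imp_le)
        then show "(\<lambda>n. F (of_real (r n) * x) * x powi (- k)) \<longlonglongrightarrow> F x * x powi (- k)"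
          by (intro tendsto_intros)
      qed
      show "AE x in \<mm>. norm (F (of_real (r n) * x) * x powi (- k)) \<le> B" for n
        using r[of n] by (intro AE_I2) (auto simp: norm_mult intro!: B)
    qed simp
    moreover have "(\<lambda>n. if 0 \<le> k then taylor F (nat k) * of_real (r n) ^ nat k else 0)
        \<longlonglongrightarrow> (if 0 \<le> k then taylor F (nat k) * of_real 1 ^ nat k else 0)"
    proof (cases "0 \<le> k")
      case True
      have "(\<lambda>n. taylor F (nat k) * of_real (r n) ^ nat k) \<longlonglongrightarrow> taylor F (nat k) * of_real 1 ^ nat k"
        by (intro tendsto_intros rlim)
      then show ?thesis using True by simp
    qed simp
    ultimately show ?thesis
      unfolding fourier_dilation[OF h r] using LIMSEQ_unique by fastforce
  qed
  show "F \<in> H2" using FL four by (intro H2I) auto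
  assume "cmod z < 1"
  then show "cauchy_integral F z = F z"
    using cauchy_integral_sums(1)[OF L2_integrable[OF FL], of z] taylor_sums[OF h, of z] sums_unique2
    by (simp add: four)
qed

lemma cauchy_integral_sup_bound:
  assumes f: "f \<in> H2" and B: "AE x in \<mm>. cmod (f x) \<le> B" and z: "cmod z < 1"
  shows "cmod (cauchy_integral f z) \<le> B"
proof -
  have fi: "integrable \<mm> f" by (rule L2_integrable[OF H2_L2[OF f]])
  have pi1: "integrable \<mm> (poisson z)"
    using integrable_Re[OF integrable_poisson_mult[of "\<lambda>_. 1", OF _ z]] by simp
  have p1: "(\<integral>\<xi>. poisson z \<xi> \<partial>\<mm>) = 1"
    using poisson_integral_one[OF z] by (simp add: poisson_integral_def)
  have "cmod (cauchy_integral f z) = cmod (poisson_integral f z)"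
    using poisson_integral_analytic[OF fi H2_neg[OF f] z] by simp
  also have "\<dots> \<le> (\<integral>\<xi>. poisson z \<xi> * cmod (f \<xi>) \<partial>\<mm>)"
    by (rule norm_poisson_integral_le[OF fi z])
  also have "\<dots> \<le> (\<integral>\<xi>. poisson z \<xi> * B \<partial>\<mm>)"
  proof (rule integral_mono_AE)
    show "integrable \<mm> (\<lambda>\<xi>. poisson z \<xi> * cmod (f \<xi>))"
      using integrable_norm[OF integrable_poisson_mult[OF fi z]] poisson_nonneg[OF z] by (simp add: norm_mult)
    show "AE \<xi> in \<mm>. poisson z \<xi> * cmod (f \<xi>) \<le> poisson z \<xi> * B"
      using B by eventually_elim (intro mult_left_mono poisson_nonneg[OF z])
  qed (use pi1 in simp)
  finally show ?thesis using p1 by simp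
qed

lemma disc_algebra_sup_bound:
  assumes "continuous_on (cball 0 1) F" "F holomorphic_on ball 0 1"
    and "AE x in \<mm>. cmod (F x) \<le> B" and z: "z \<in> cball 0 1"
  shows "cmod (F z) \<le> B"
proof (rule continuous_on_closure_norm_le[of "ball 0 1" F B])
  show "\<forall>y\<in>ball 0 1. cmod (F y) \<le> B"
    using cauchy_integral_sup_bound[OF disc_algebra_H2[OF assms(1,2)] assms(3)]
      disc_algebra_cauchy[OF assms(1,2)] by simp
qed (use assms in auto)

text \<open>\<open>z\<close> minus its nearest point in the closed disc of radius \<epsilon>, so its
  modulus is the distance to that disc. The \<open>max\<close> in the denominator yields 0 inside
  the disc and keeps the map continuous.\<close>

definition shrink :: "real \<Rightarrow> complex \<Rightarrow> complex" where
  "shrink \<epsilon> z = z * of_real (1 - \<epsilon> / max \<epsilon> (cmod z))"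

lemma norm_shrink: "0 < \<epsilon> \<Longrightarrow> cmod (shrink \<epsilon> z) = max 0 (cmod z - \<epsilon>)"
proof (cases "cmod z \<le> \<epsilon>")
  case True
  moreover assume "0 < \<epsilon>"
  ultimately show ?thesis by (simp add: shrink_def)
next
  case False
  moreover assume "0 < \<epsilon>"
  moreover from calculation have "z \<noteq> 0" by auto
  ultimately show ?thesis
    by (simp add: shrink_def norm_mult max_def field_simps del: of_real_diff of_real_divide)
qed

lemma shrink_le: "0 < \<epsilon> \<Longrightarrow> cmod q \<le> \<epsilon> \<Longrightarrow> cmod (shrink \<epsilon> z) \<le> cmod (z - q)"
  using norm_triangle_ineq2[of z q] by (simp add: norm_shrink)

lemma norm_sub_shrink: "0 < \<epsilon> \<Longrightarrow> cmod (z - shrink \<epsilon> z) \<le> \<epsilon>"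
proof -
  assume e: "0 < \<epsilon>"
  have "z - shrink \<epsilon> z = z * of_real (\<epsilon> / max \<epsilon> (cmod z))" by (simp add: shrink_def algebra_simps)
  then have "cmod (z - shrink \<epsilon> z) = cmod z * (\<epsilon> / max \<epsilon> (cmod z))"
    using e by (simp add: norm_mult del: of_real_divide)
  also have "\<dots> \<le> \<epsilon>" using e by (simp add: field_simps max_def)
  finally show ?thesis .
qed

lemma shrink_tendsto:
  assumes "0 < \<epsilon>" "(f \<longlongrightarrow> l) F" shows "((\<lambda>x. shrink \<epsilon> (f x)) \<longlongrightarrow> shrink \<epsilon> l) F"
  unfolding shrink_def using assms by (intro tendsto_intros) auto

lemma shrink_continuous:
  assumes "0 < \<epsilon>" "continuous_on S f" shows "continuous_on S (\<lambda>x. shrink \<epsilon> (f x))"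
  using assms unfolding continuous_on_def by (auto intro: shrink_tendsto)

text \<open>Convex separation by minimisation. \<open>J G\<close> is the sum of the squared L2
  distances of the Toeplitz images to the functions of modulus at most \<open>\<epsilon> k\<close>;
  by Montel a minimiser exists. Its residuals \<open>\<Psi> G k\<close> become the test functions of
  \<open>competitor\<close>, and moving towards the multiplier \<open>H\<close> found there would
  decrease \<open>J\<close> unless \<open>J G = 0\<close>.\<close>

lemma finitely_many_small_toeplitz:
  assumes a: "\<And>k. k < m \<Longrightarrow> L2_norm \<mm> (\<lambda>x. \<Sum>l\<in>I k. a l * x ^ l) \<le> \<delta> / 16 ^ k"
    and \<kappa>: "0 < \<kappa>" "\<kappa> \<le> 1" "8 * sqrt \<kappa> \<le> e" and \<delta>: "0 \<le> \<delta>" "8 * \<delta> \<le> \<kappa>"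
  shows "\<exists>G\<in>contractions e. \<forall>k<m. \<forall>z\<in>cball 0 1. cmod (toep (taylor G) (I k) a z) \<le> 1 / 2 ^ k"
proof -
  define \<epsilon> where "\<epsilon> k = 1 / (2::real) ^ k" for k :: nat
  have \<epsilon>: "0 < \<epsilon> k" for k by (simp add: \<epsilon>_def)
  define F where "F G k = toep (taylor G) (I k) a" for G k
  define \<Psi> where "\<Psi> G k x = shrink (\<epsilon> k) (F G k x)" for G k x
  have FL: "F G k \<in> L2_space \<mm>" for G k by (simp add: F_def)
  have \<Psi>c: "continuous_on S (\<Psi> G k)" for S G k
    unfolding \<Psi>_def F_def by (intro shrink_continuous \<epsilon> toep_continuous)
  have \<Psi>L: "\<Psi> G k \<in> L2_space \<mm>" for G k
    by (rule continuous_on_sphere_L2[OF \<Psi>c circle.finite_measure_axioms]) simp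
  define J where "J G = (\<Sum>k<m. (L2_norm \<mm> (\<Psi> G k))\<^sup>2)" for G
  have J0: "0 \<le> J G" for G by (simp add: J_def sum_nonneg)
  have e0: "0 \<le> e" using \<kappa> by (meson mult_nonneg_nonneg order_trans real_sqrt_ge_0_iff less_imp_le zero_le_numeral)
  have ne: "contractions e \<noteq> {}" using one_in_contractions[OF e0] by blast
  define d where "d = (INF G\<in>contractions e. J G)"
  have bdd: "bdd_below (J ` contractions e)" by (rule bdd_belowI[of _ 0]) (auto simp: J0)
  have dle: "d \<le> J G" if "G \<in> contractions e" for G unfolding d_def by (rule cINF_lower[OF bdd that])
  have "\<exists>G\<in>contractions e. J G < d + 1 / Suc n" for n :: nat
    using cInf_lessD[of "J ` contractions e" "d + 1 / Suc n"] ne by (auto simp: d_def)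
  then obtain \<G> where \<G>: "\<And>n. \<G> n \<in> contractions e" "\<And>n. J (\<G> n) < d + 1 / Suc n" by metis
  obtain G r where G: "G \<in> contractions e" and r: "strict_mono r"
    and tl: "\<And>n. (\<lambda>k. taylor (\<G> (r k)) n) \<longlonglongrightarrow> taylor G n"
    using contractions_montel[of \<G> e] \<G>(1) by blast
  have tb: "cmod (taylor H n) \<le> 1" if "H \<in> contractions e" for H n
    using that by (intro taylor_bound(2)) (auto simp: contractions_def)
  have Jlim: "(\<lambda>n. J (\<G> (r n))) \<longlonglongrightarrow> J G"
    unfolding J_def L2_norm_sq
  proof (intro tendsto_sum)
    fix k
    define B where "B = (\<Sum>l\<in>I k. cmod (a l) * real (Suc l))"
    have FB: "cmod (\<Psi> H k x) \<le> B" if "H \<in> contractions e" "x \<in> sphere 0 1" for H x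
    proof -
      have "cmod (\<Psi> H k x) \<le> cmod (F H k x - 0)"
        unfolding \<Psi>_def using \<epsilon>[of k] by (intro shrink_le) auto
      also have "\<dots> \<le> B" unfolding F_def B_def using toep_bound[OF tb[OF that(1)], of x] that(2) by simp
      finally show ?thesis .
    qed
    show "(\<lambda>n. \<integral>x. (cmod (\<Psi> (\<G> (r n)) k x))\<^sup>2 \<partial>\<mm>) \<longlonglongrightarrow> (\<integral>x. (cmod (\<Psi> G k x))\<^sup>2 \<partial>\<mm>)"
    proof (rule integral_dominated_convergence[where w="\<lambda>_. B\<^sup>2"])
      have m [measurable]: "\<Psi> H k \<in> borel_measurable \<mm>" for H by (rule L2_measurable[OF \<Psi>L])
      show "(\<lambda>x. (cmod (\<Psi> G k x))\<^sup>2) \<in> borel_measurable \<mm>" by measurable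
      show "(\<lambda>x. (cmod (\<Psi> (\<G> (r n)) k x))\<^sup>2) \<in> borel_measurable \<mm>" for n by measurable
      show "AE x in \<mm>. (\<lambda>n. (cmod (\<Psi> (\<G> (r n)) k x))\<^sup>2) \<longlonglongrightarrow> (cmod (\<Psi> G k x))\<^sup>2"
        unfolding \<Psi>_def F_def by (intro AE_I2 tendsto_intros shrink_tendsto \<epsilon> toep_tendsto tl)
      show "AE x in \<mm>. norm ((cmod (\<Psi> (\<G> (r n)) k x))\<^sup>2) \<le> B\<^sup>2" for n
        using FB[OF \<G>(1)] by (intro AE_I2) (auto intro!: power_mono)
    qed simp
  qed
  have "J G \<le> d"
  proof (rule LIMSEQ_le[OF Jlim])
    show "(\<lambda>n. d + 1 / Suc n) \<longlonglongrightarrow> d"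
      using tendsto_add[OF tendsto_const LIMSEQ_inverse_real_of_nat, of d] by (simp add: inverse_eq_divide)
    have "J (\<G> (r n)) \<le> d + 1 / Suc n" for n
    proof -
      have "1 / real (Suc (r n)) \<le> 1 / real (Suc n)"
        using strict_mono_imp_increasing[OF r, of n] by (intro divide_left_mono) auto
      then show ?thesis using \<G>(2)[of "r n"] by linarith
    qed
    then show "\<exists>N. \<forall>n\<ge>N. J (\<G> (r n)) \<le> d + 1 / Suc n" by blast
  qed
  then have min: "J G \<le> J H" if "H \<in> contractions e" for H using dle[OF that] by simp
  define S where "S = (\<Sum>k<m. (\<integral>\<xi>. cmod (\<Psi> G k \<xi>) \<partial>\<mm>) / 2 ^ k)"
  have S0: "0 \<le> S" unfolding S_def by (intro sum_nonneg) auto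
  have "J G = 0"
  proof (cases "S = 0")
    case True
    have "L2_norm \<mm> (\<Psi> G k) = 0" if k: "k < m" for k
    proof -
      have "\<forall>k\<in>{..<m}. (\<integral>\<xi>. cmod (\<Psi> G k \<xi>) \<partial>\<mm>) / 2 ^ k = 0"
        using True unfolding S_def by (subst (asm) sum_nonneg_eq_0_iff) auto
      then have "(\<integral>\<xi>. cmod (\<Psi> G k \<xi>) \<partial>\<mm>) = 0" using k by simp
      then have "AE \<xi> in \<mm>. \<Psi> G k \<xi> = 0"
        using L2_integrable[OF \<Psi>L] by (subst (asm) integral_nonneg_eq_0_iff_AE) auto
      then show ?thesis using L2_norm_eq_0_iff[OF \<Psi>L] by blast
    qed
    then show ?thesis by (simp add: J_def)
  next
    case False
    then have Spos: "S > 0" using S0 by simp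
    obtain H where H: "H \<in> contractions e"
      and HS: "Re (\<Sum>k<m. L2_inner \<mm> (toep (taylor H) (I k) a) (\<Psi> G k)) \<le> S"
      using competitor[OF \<Psi>c a S_def Spos \<kappa> \<delta>] by blast
    \<comment> \<open>Among functions of modulus at most \<open>\<epsilon> k\<close>,
      \<open>q k\<close> has the largest real pairing with \<open>\<Psi> G k\<close>. These pairings
      sum to \<open>S\<close>, so those of the images under \<open>H\<close> do not exceed them in
      total.\<close>
    define q where "q k x = \<Psi> G k x * of_real (\<epsilon> k / cmod (\<Psi> G k x))" for k x
    have qn: "cmod (q k x) \<le> \<epsilon> k" for k x
      using \<epsilon>[of k] by (simp add: q_def norm_mult del: of_real_divide)
    have qm: "q k \<in> borel_measurable \<mm>" for k
    proof -
      have [measurable]: "\<Psi> G k \<in> borel_measurable \<mm>" by (rule L2_measurable[OF \<Psi>L])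
      show ?thesis unfolding q_def[abs_def] by measurable
    qed
    have qL: "q k \<in> L2_space \<mm>" for k
      by (rule L2_space_bounded[OF circle.finite_measure_axioms qm, of _ "\<epsilon> k"]) (use qn in simp)
    have qin: "Re (L2_inner \<mm> (q k) (\<Psi> G k)) = (\<integral>\<xi>. cmod (\<Psi> G k \<xi>) \<partial>\<mm>) / 2 ^ k" for k
    proof -
      have "q k \<xi> * cnj (\<Psi> G k \<xi>) = of_real (\<epsilon> k * cmod (\<Psi> G k \<xi>))" for \<xi>
      proof (cases "\<Psi> G k \<xi> = 0")
        case False
        have "q k \<xi> * cnj (\<Psi> G k \<xi>) = of_real (\<epsilon> k / cmod (\<Psi> G k \<xi>)) * (\<Psi> G k \<xi> * cnj (\<Psi> G k \<xi>))"
          by (simp add: q_def mult_ac)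
        also have "\<dots> = of_real (\<epsilon> k / cmod (\<Psi> G k \<xi>) * (cmod (\<Psi> G k \<xi>))\<^sup>2)"
          by (simp only: complex_norm_square[symmetric] of_real_mult)
        also have "\<epsilon> k / cmod (\<Psi> G k \<xi>) * (cmod (\<Psi> G k \<xi>))\<^sup>2 = \<epsilon> k * cmod (\<Psi> G k \<xi>)"
          using False by (simp add: power2_eq_square)
        finally show ?thesis .
      qed (simp add: q_def)
      then have "L2_inner \<mm> (q k) (\<Psi> G k) = of_real (\<integral>\<xi>. \<epsilon> k * cmod (\<Psi> G k \<xi>) \<partial>\<mm>)"
        unfolding L2_inner_def by (simp only: integral_complex_of_real)
      then show ?thesis by (simp add: \<epsilon>_def)
    qed
    define u where "u k x = F H k x - q k x" for k x
    have uL: "u k \<in> L2_space \<mm>" for k unfolding u_def[abs_def] by (intro L2_diff FL qL)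
    have ReS: "(\<Sum>k<m. Re (L2_inner \<mm> (\<Psi> G k) (u k))) \<le> 0"
    proof -
      have "Re (L2_inner \<mm> (\<Psi> G k) (u k)) = Re (L2_inner \<mm> (F H k) (\<Psi> G k)) - (\<integral>\<xi>. cmod (\<Psi> G k \<xi>) \<partial>\<mm>) / 2 ^ k" for k
        unfolding qin[symmetric] using L2_inner_commute[of \<mm> "\<Psi> G k" "u k"]
          L2_inner_diff_left[OF FL qL \<Psi>L] by (simp add: u_def[abs_def])
      then have "(\<Sum>k<m. Re (L2_inner \<mm> (\<Psi> G k) (u k))) = (\<Sum>k<m. Re (L2_inner \<mm> (F H k) (\<Psi> G k))) - S"
        by (simp add: sum_subtractf S_def)
      then show ?thesis using HS by (simp add: F_def)
    qed
    define M where "M = (\<Sum>k<m. (L2_norm \<mm> (u k))\<^sup>2)"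
    have "2 * J G \<le> 0"
    proof (rule nonpos_if_quadratic_bound)
      fix t :: real assume t: "0 < t" "t \<le> 1"
      define Gt where "Gt z = of_real (1 - t) * G z + of_real t * H z" for z
      have GtC: "Gt \<in> contractions e" unfolding Gt_def[abs_def] by (rule contractions_convex[OF G H]) (use t in auto)
      have Ft: "F Gt k z = of_real (1 - t) * F G k z + of_real t * F H k z" for k z
        unfolding F_def
        by (rule toep_linear, unfold Gt_def[abs_def], rule taylor_linear) (use G H in \<open>auto simp: contractions_def\<close>)
      have est: "(L2_norm \<mm> (\<Psi> Gt k))\<^sup>2 \<le> (1 - t)\<^sup>2 * (L2_norm \<mm> (\<Psi> G k))\<^sup>2
          + 2 * ((1 - t) * t) * Re (L2_inner \<mm> (\<Psi> G k) (u k)) + t\<^sup>2 * (L2_norm \<mm> (u k))\<^sup>2" for k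
      proof -
        have L: "(\<lambda>x. of_real (1 - t) * \<Psi> G k x) \<in> L2_space \<mm>" by (intro L2_scale \<Psi>L)
        have "L2_norm \<mm> (\<Psi> Gt k) \<le> L2_norm \<mm> (\<lambda>x. of_real (1 - t) * \<Psi> G k x - of_real (- t) * u k x)"
        proof (rule L2_norm_mono)
          show "(\<lambda>x. of_real (1 - t) * \<Psi> G k x - of_real (- t) * u k x) \<in> L2_space \<mm>"
            by (intro L2_diff L2_scale \<Psi>L uL)
          show "AE x in \<mm>. cmod (\<Psi> Gt k x) \<le> cmod (of_real (1 - t) * \<Psi> G k x - of_real (- t) * u k x)"
          proof (rule AE_I2)
            fix x
            \<comment> \<open>A point of the disc of radius \<open>\<epsilon> k\<close>: a convex
              combination of the point nearest to \<open>F G k x\<close> and of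
              \<open>q k x\<close>. The distance of \<open>F Gt k x\<close> to the disc is at most
              its distance to \<open>c\<close>.\<close>
            define c where "c = of_real (1 - t) * (F G k x - \<Psi> G k x) + of_real t * q k x"
            have "cmod c \<le> (1 - t) * \<epsilon> k + t * \<epsilon> k"
              unfolding c_def
            proof (rule norm_triangle_mono)
              show "cmod (of_real (1 - t) * (F G k x - \<Psi> G k x)) \<le> (1 - t) * \<epsilon> k"
                unfolding norm_mult \<Psi>_def using t norm_sub_shrink[OF \<epsilon>]
                by (simp add: mult_left_mono del: of_real_diff)
              show "cmod (of_real t * q k x) \<le> t * \<epsilon> k"
                using t qn by (simp add: norm_mult mult_left_mono)
            qed
            then have "cmod c \<le> \<epsilon> k" by (simp add: algebra_simps)
            then have "cmod (\<Psi> Gt k x) \<le> cmod (F Gt k x - c)" unfolding \<Psi>_def by (intro shrink_le \<epsilon>)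
            also have "F Gt k x - c = of_real (1 - t) * \<Psi> G k x - of_real (- t) * u k x"
              by (simp add: Ft c_def u_def algebra_simps)
            finally show "cmod (\<Psi> Gt k x) \<le> cmod (of_real (1 - t) * \<Psi> G k x - of_real (- t) * u k x)" .
          qed
        qed (rule L2_measurable[OF \<Psi>L])
        then have "(L2_norm \<mm> (\<Psi> Gt k))\<^sup>2 \<le> (L2_norm \<mm> (\<lambda>x. of_real (1 - t) * \<Psi> G k x - of_real (- t) * u k x))\<^sup>2"
          by (intro power_mono) auto
        also have "\<dots> = (1 - t)\<^sup>2 * (L2_norm \<mm> (\<Psi> G k))\<^sup>2
          + 2 * ((1 - t) * t) * Re (L2_inner \<mm> (\<Psi> G k) (u k)) + t\<^sup>2 * (L2_norm \<mm> (u k))\<^sup>2"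
          by (subst L2_norm_sq_diff_scale[OF L uL])
             (simp add: L2_norm_scale L2_inner_scale_left power_mult_distrib del: of_real_diff)
        finally show ?thesis .
      qed
      have "J G \<le> J Gt" by (rule min[OF GtC])
      also have "\<dots> \<le> (\<Sum>k<m. (1 - t)\<^sup>2 * (L2_norm \<mm> (\<Psi> G k))\<^sup>2
          + 2 * ((1 - t) * t) * Re (L2_inner \<mm> (\<Psi> G k) (u k)) + t\<^sup>2 * (L2_norm \<mm> (u k))\<^sup>2)"
        unfolding J_def by (rule sum_mono) (rule est)
      also have "\<dots> = (1 - t)\<^sup>2 * J G + 2 * ((1 - t) * t) * (\<Sum>k<m. Re (L2_inner \<mm> (\<Psi> G k) (u k))) + t\<^sup>2 * M"
        by (simp add: sum.distrib sum_distrib_left J_def M_def)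
      also have "\<dots> \<le> (1 - t)\<^sup>2 * J G + 0 + t\<^sup>2 * M"
        using ReS t by (intro add_mono order_refl) (simp add: mult_nonneg_nonpos)
      finally show "2 * J G * t \<le> (J G + M) * t\<^sup>2" by (simp add: power2_eq_square algebra_simps)
    qed
    then show ?thesis using J0[of G] by simp
  qed
  then have z: "\<forall>k\<in>{..<m}. (L2_norm \<mm> (\<Psi> G k))\<^sup>2 = 0"
    unfolding J_def by (subst (asm) sum_nonneg_eq_0_iff) auto
  \<comment> \<open>Zero residual is the bound a.e. on the circle; the maximum principle extends it
    to the closed disc.\<close>
  have "cmod (F G k z) \<le> \<epsilon> k" if k: "k < m" and z: "z \<in> cball 0 1" for k z
  proof (rule disc_algebra_sup_bound[OF _ _ _ z])
    have "AE x in \<mm>. \<Psi> G k x = 0"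
      using z k \<open>\<forall>k\<in>{..<m}. _\<close> L2_norm_eq_0_iff[OF \<Psi>L] by simp
    then show "AE x in \<mm>. cmod (F G k x) \<le> \<epsilon> k"
    proof eventually_elim
      case (elim x)
      then have "max 0 (cmod (F G k x) - \<epsilon> k) = 0" using norm_shrink[OF \<epsilon>, of k "F G k x"] by (simp add: \<Psi>_def)
      then show ?case by simp
    qed
  qed (auto simp: F_def intro: toep_continuous toep_holomorphic)
  then have "\<forall>k<m. \<forall>z\<in>cball 0 1. cmod (toep (taylor G) (I k) a z) \<le> 1 / 2 ^ k"
    unfolding F_def \<epsilon>_def by blast
  then show ?thesis using G by blast
qed

text \<open>A limit point of the multipliers for the first \<open>m\<close> conditions satisfies
  every condition, because a fixed Toeplitz image depends continuously on the Taylor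
  coefficients.\<close>

lemma small_toeplitz:
  assumes a: "\<And>k. L2_norm \<mm> (\<lambda>x. \<Sum>l\<in>I k. a l * x ^ l) \<le> \<delta> / 16 ^ k"
    and \<kappa>: "0 < \<kappa>" "\<kappa> \<le> 1" "8 * sqrt \<kappa> \<le> e" and \<delta>: "0 \<le> \<delta>" "8 * \<delta> \<le> \<kappa>"
  shows "\<exists>G\<in>contractions e. \<forall>k. \<forall>z\<in>cball 0 1. cmod (toep (taylor G) (I k) a z) \<le> 1 / 2 ^ k"
proof -
  have "\<forall>m. \<exists>G\<in>contractions e. \<forall>k<m. \<forall>z\<in>cball 0 1. cmod (toep (taylor G) (I k) a z) \<le> 1 / 2 ^ k"
    using finitely_many_small_toeplitz[OF a \<kappa> \<delta>] by blast
  then obtain \<G> where \<G>: "\<And>m. \<G> m \<in> contractions e"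
    "\<And>m k z. k < m \<Longrightarrow> z \<in> cball 0 1 \<Longrightarrow> cmod (toep (taylor (\<G> m)) (I k) a z) \<le> 1 / 2 ^ k"
    by metis
  obtain G r where G: "G \<in> contractions e" and r: "strict_mono r"
    and tl: "\<And>n. (\<lambda>k. taylor (\<G> (r k)) n) \<longlonglongrightarrow> taylor G n"
    using contractions_montel[of \<G> e] \<G>(1) by blast
  have "cmod (toep (taylor G) (I k) a z) \<le> 1 / 2 ^ k" if z: "z \<in> cball 0 1" for k z
  proof (rule LIMSEQ_le_const2[OF tendsto_norm[OF toep_tendsto[OF tl]]])
    have "cmod (toep (taylor (\<G> (r n))) (I k) a z) \<le> 1 / 2 ^ k" if "n \<ge> Suc k" for n
      using \<G>(2)[OF _ z, of k "r n"] strict_mono_imp_increasing[OF r, of n] that by simp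
    then show "\<exists>N. \<forall>n\<ge>N. cmod (toep (taylor (\<G> (r n))) (I k) a z) \<le> 1 / 2 ^ k" by blast
  qed
  then show ?thesis using G by blast
qed

section \<open>Density of the continuous functions in the model space\<close>

text \<open>Dominated convergence along radii tending to 1 carries the closeness to 1 over to the
  boundary function.\<close>

lemma contractions_boundary:
  assumes G: "G \<in> contractions e"
  obtains b where "b \<in> H2" "\<And>n. fourier b (int n) = taylor G n" "AE x in \<mm>. cmod (b x) \<le> 1"
    "L2_norm \<mm> (\<lambda>x. 1 - b x) \<le> e"
proof -
  have Gh: "G holomorphic_on ball 0 1" and G1: "\<And>z. z \<in> ball 0 1 \<Longrightarrow> cmod (G z) \<le> 1"
    using G by (auto simp: contractions_def)
  obtain b where b: "b \<in> H2" "has_boundary_values G b" "\<And>n. fourier b (int n) = taylor G n"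
    "AE x in \<mm>. cmod (b x) \<le> 1"
    by (rule Hinf_disc_boundary[OF Gh]) (erule G1, blast)
  define r where "r n = 1 - 1 / real (Suc n)" for n
  have r: "0 \<le> r n" "r n < 1" for n by (auto simp: r_def)
  have rlim: "filterlim r (at_left 1) sequentially"
  proof (rule tendsto_imp_filterlim_at_left)
    show "r \<longlonglongrightarrow> 1"
      unfolding r_def using tendsto_diff[OF tendsto_const[of "1::real"] LIMSEQ_inverse_real_of_nat]
      by (simp add: inverse_eq_divide)
  qed (use r in simp)
  have "(\<lambda>n. \<integral>x. (cmod (1 - G (of_real (r n) * x)))\<^sup>2 \<partial>\<mm>) \<longlonglongrightarrow> (\<integral>x. (cmod (1 - b x))\<^sup>2 \<partial>\<mm>)"
  proof (rule integral_dominated_convergence[where w="\<lambda>_. 2\<^sup>2"])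
    show "(\<lambda>x. (cmod (1 - b x))\<^sup>2) \<in> borel_measurable \<mm>"
      using H2_L2[OF b(1), THEN L2_measurable] by measurable
    show "(\<lambda>x. (cmod (1 - G (of_real (r n) * x)))\<^sup>2) \<in> borel_measurable \<mm>" for n
      using L2_measurable[OF contractions_dilation_L2[OF G r]] by measurable
    show "AE x in \<mm>. (\<lambda>n. (cmod (1 - G (of_real (r n) * x)))\<^sup>2) \<longlonglongrightarrow> (cmod (1 - b x))\<^sup>2"
      using b(2)[unfolded has_boundary_values_def]
    proof eventually_elim
      case (elim x)
      from filterlim_compose[OF elim rlim] show ?case by (intro tendsto_intros)
    qed
    show "AE x in \<mm>. norm ((cmod (1 - G (of_real (r n) * x)))\<^sup>2) \<le> 2\<^sup>2" for n
    proof (rule AE_I2)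
      fix x assume "x \<in> space \<mm>"
      then have "cmod (G (of_real (r n) * x)) \<le> 1" using r[of n] by (intro G1) (simp add: norm_mult)
      then have "cmod (1 - G (of_real (r n) * x)) \<le> 2" using norm_triangle_ineq4[of 1 "G (of_real (r n) * x)"] by simp
      then have "(cmod (1 - G (of_real (r n) * x)))\<^sup>2 \<le> 2\<^sup>2" by (intro power_mono) auto
      then show "norm ((cmod (1 - G (of_real (r n) * x)))\<^sup>2) \<le> 2\<^sup>2" by simp
    qed
  qed simp
  moreover have "(\<integral>x. (cmod (1 - G (of_real (r n) * x)))\<^sup>2 \<partial>\<mm>) \<le> e\<^sup>2" for n
    using G r[of n] unfolding L2_norm_sq[symmetric] by (intro power_mono) (auto simp: contractions_def)
  ultimately have "(L2_norm \<mm> (\<lambda>x. 1 - b x))\<^sup>2 \<le> e\<^sup>2"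
    unfolding L2_norm_sq by (intro LIMSEQ_le_const2) auto
  moreover have "0 \<le> e"
    using G L2_norm_nonneg[of \<mm>] unfolding contractions_def
    by (metis (no_types, lifting) atLeastLessThan_iff mem_Collect_eq order_refl order_trans zero_less_one)
  ultimately have "L2_norm \<mm> (\<lambda>x. 1 - b x) \<le> e" by (rule power2_le_imp_le)
  then show ?thesis using b that by blast
qed

context inner_fun
begin

text \<open>
  Aleksandrov's theorem. Cut the Fourier series of \<open>f\<close> into blocks with rapidly decreasing
  \<open>L\<^sup>2\<close>-norms and apply a co-analytic Toeplitz operator with symbol \<open>cnj G\<close>, \<open>G\<close> close to 1, that makes
  the images of the blocks uniformly summable; these operators leave the model space invariant.
\<close>

theorem continuous_dense:
  assumes f: "f \<in> K" and \<eta>: "\<eta> > 0"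
  shows "\<exists>F\<in>K_cont \<Theta>. L2_norm \<mm> (\<lambda>y. F y - f y) < \<eta>"
proof -
  have fH: "f \<in> H2" and fL: "f \<in> L2_space \<mm>" using f by (auto simp: K_H2 K_L2)
  define a where "a n = fourier f (int n)" for n
  define P where "P N y = (\<Sum>l<N. a l * y ^ l)" for N y
  have PL: "P N \<in> L2_space \<mm>" for N by (simp add: P_def[abs_def])
  have Plim: "(\<lambda>N. L2_norm \<mm> (\<lambda>y. P N y - f y)) \<longlonglongrightarrow> 0"
    using H2_expansion[OF fH] by (simp add: P_def a_def)
  have tail: "\<exists>N>M. \<forall>n\<ge>N. L2_norm \<mm> (\<lambda>y. P n y - f y) \<le> \<epsilon>" if "\<epsilon> > 0" for \<epsilon> M
  proof -
    have "\<forall>\<^sub>F N in sequentially. L2_norm \<mm> (\<lambda>y. P N y - f y) < \<epsilon>"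
      using order_tendstoD(2)[OF Plim that] .
    then obtain N where "\<forall>n\<ge>N. L2_norm \<mm> (\<lambda>y. P n y - f y) < \<epsilon>" by (auto simp: eventually_sequentially)
    then show ?thesis by (intro exI[of _ "max N (Suc M)"]) (auto intro: less_imp_le)
  qed
  obtain N0 where N0: "L2_norm \<mm> (\<lambda>y. P N0 y - f y) \<le> \<eta> / 8"
    using tail[of "\<eta> / 8" 0] \<eta> by auto
  \<comment> \<open>\<open>P N0\<close> approximates \<open>f\<close> and is bounded by
    \<open>B\<close> on the circle, so pairing it with \<open>1 - b\<close> times a function costs
    at most \<open>B * e\<close>. The summand 1 keeps \<open>B\<close> positive.\<close>
  define B where "B = 1 + (\<Sum>l<N0. cmod (a l))"
  have B: "1 \<le> B" by (simp add: B_def sum_nonneg)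
  have PB: "cmod (P N0 y) \<le> B" if "y \<in> sphere 0 1" for y
  proof -
    have "cmod (P N0 y) \<le> (\<Sum>l<N0. cmod (a l))"
      unfolding P_def by (rule sum_norm_le) (use that in \<open>simp add: norm_mult norm_power\<close>)
    then show ?thesis by (simp add: B_def)
  qed
  \<comment> \<open>\<open>B * e \<le> \<eta> / 4\<close> serves the final estimate; \<kappa> and
    \<delta> are then fixed by \<open>8 * sqrt \<kappa> = e\<close> and
    \<open>8 * \<delta> = \<kappa>\<close>, as \<open>small_toeplitz\<close> requires.\<close>
  define e where "e = min 1 (\<eta> / (4 * B))"
  have e: "0 < e" "e \<le> 1" "B * e \<le> \<eta> / 4" using \<eta> B by (auto simp: e_def min_def field_simps)
  define \<kappa> where "\<kappa> = (e / 8)\<^sup>2"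
  have \<kappa>: "0 < \<kappa>" "\<kappa> \<le> 1" "8 * sqrt \<kappa> \<le> e"
    using e by (auto simp: \<kappa>_def real_sqrt_divide intro!: power_le_one)
  define \<delta> where "\<delta> = \<kappa> / 8"
  have \<delta>: "0 < \<delta>" "8 * \<delta> \<le> \<kappa>" using \<kappa> by (auto simp: \<delta>_def)
  have "\<forall>k M. \<exists>N>M. \<forall>n\<ge>N. L2_norm \<mm> (\<lambda>y. P n y - f y) \<le> \<delta> / 2 / 16 ^ k"
    using tail \<delta> by simp
  then obtain nx where nx: "\<And>k M. nx k M > M" "\<And>k M n. n \<ge> nx k M \<Longrightarrow> L2_norm \<mm> (\<lambda>y. P n y - f y) \<le> \<delta> / 2 / 16 ^ k"
    by metis
  \<comment> \<open>Block boundaries are placed recursively so far out that block \<open>k\<close>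
    has norm at most \<open>\<delta> / 16 ^ k\<close>. The part before \<open>N 0\<close> yields a
    polynomial and needs no smallness.\<close>
  define N where "N = rec_nat (nx 0 0) (\<lambda>k M. nx (Suc k) M)"
  have NS: "N (Suc k) > N k" for k by (simp add: N_def nx(1))
  have Nt: "L2_norm \<mm> (\<lambda>y. P n y - f y) \<le> \<delta> / 2 / 16 ^ k" if "n \<ge> N k" for n k
  proof (cases k)
    case 0
    then show ?thesis using nx(2)[of 0 0 n] that by (simp add: N_def)
  next
    case (Suc j)
    then have "n \<ge> nx k (N j)" using that by (simp add: N_def)
    then show ?thesis by (rule nx(2))
  qed
  have Nmono: "strict_mono N" by (rule strict_monoI_Suc) (rule NS)
  define I where "I k = {N k..<N (Suc k)}" for k
  have blk: "(\<Sum>l\<in>I k. a l * y ^ l) = P (N (Suc k)) y - P (N k) y" for k y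
    unfolding P_def I_def using NS[of k] by (metis sum_diff_nat_ivl lessThan_atLeast0 le0 less_imp_le)
  have blkn: "L2_norm \<mm> (\<lambda>y. \<Sum>l\<in>I k. a l * y ^ l) \<le> \<delta> / 16 ^ k" for k
  proof -
    have "L2_norm \<mm> (\<lambda>y. P (N (Suc k)) y - P (N k) y)
        \<le> L2_norm \<mm> (\<lambda>y. P (N (Suc k)) y - f y) + L2_norm \<mm> (\<lambda>y. P (N k) y - f y)"
      using L2_norm_triangle_diff[OF PL fL PL, of "N (Suc k)" "N k"] L2_norm_minus_commute[of \<mm> f "P (N k)"] by simp
    also have "\<dots> \<le> \<delta> / 2 / 16 ^ k + \<delta> / 2 / 16 ^ k"
      using NS[of k] by (intro add_mono Nt) auto
    finally show ?thesis by (simp add: blk)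
  qed
  obtain G where G: "G \<in> contractions e"
    and Gs: "\<And>k z. z \<in> cball 0 1 \<Longrightarrow> cmod (toep (taylor G) (I k) a z) \<le> 1 / 2 ^ k"
    using small_toeplitz[OF blkn \<kappa> less_imp_le[OF \<delta>(1)] \<delta>(2)] by blast
  obtain b where b: "b \<in> H2" "\<And>n. fourier b (int n) = taylor G n" "AE y in \<mm>. cmod (b y) \<le> 1"
    "L2_norm \<mm> (\<lambda>y. 1 - b y) \<le> e"
    using contractions_boundary[OF G] by blast
  have bL: "b \<in> L2_space \<mm>" using b(1) by (rule H2_L2)
  define T where "T M = toep (taylor G) {..<M} a" for M
  have TN: "T (N (Suc k)) z = T (N k) z + toep (taylor G) (I k) a z" for k z
  proof -
    have e: "{..<N (Suc k)} = {..<N k} \<union> I k" using NS[of k] by (auto simp: I_def)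
    have fin: "finite {..<N k}" "finite (I k)" by (simp_all add: I_def)
    have disj: "{..<N k} \<inter> I k = {}" by (auto simp: I_def)
    show ?thesis unfolding T_def toep_def e by (rule sum.union_disjoint[OF fin disj])
  qed
  have TS: "T (N k) z = T (N 0) z + (\<Sum>i<k. toep (taylor G) (I i) a z)" for k z
    by (induction k) (simp_all add: TN)
  define F where "F z = T (N 0) z + (\<Sum>i. toep (taylor G) (I i) a z)" for z
  have ul: "uniform_limit (cball 0 1) (\<lambda>k z. T (N k) z) F sequentially"
  proof -
    have "uniform_limit (cball 0 1) (\<lambda>k z. T (N 0) z + (\<Sum>i<k. toep (taylor G) (I i) a z)) F sequentially"
      unfolding F_def
    proof (intro uniform_limit_add uniform_limit_const Weierstrass_m_test[where M="\<lambda>i. (1/2) ^ i"])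
      show "norm (toep (taylor G) (I i) a z) \<le> (1/2) ^ i" if "z \<in> cball 0 1" for i z
        using Gs[OF that] by (simp add: power_one_over)
    qed (simp add: summable_geometric)
    moreover have "(\<lambda>k z. T (N k) z) = (\<lambda>k z. T (N 0) z + (\<Sum>i<k. toep (taylor G) (I i) a z))"
      by (intro ext TS)
    ultimately show ?thesis by (simp only:)
  qed
  have Tc: "continuous_on S (T M)" for S M unfolding T_def by (rule toep_continuous)
  have Fc: "continuous_on (cball 0 1) F"
    by (rule uniform_limit_theorem[OF _ ul]) (auto intro!: always_eventually Tc)
  have Fh: "F holomorphic_on ball 0 1"
  proof (rule holomorphic_uniform_sequence[of _ "\<lambda>k z. T (N k) z"])
    show "(\<lambda>z. T (N k) z) holomorphic_on ball 0 1" for k unfolding T_def by (rule toep_holomorphic)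
    fix x :: complex assume "x \<in> ball 0 1"
    then obtain d where "d > 0" "cball x d \<subseteq> ball 0 1" using open_contains_cball by (metis open_ball)
    moreover from this have "uniform_limit (cball x d) (\<lambda>k z. T (N k) z) F sequentially"
      by (intro uniform_limit_on_subset[OF ul]) (auto dest: subsetD[OF _ _])
    ultimately show "\<exists>d>0. cball x d \<subseteq> ball 0 1 \<and> uniform_limit (cball x d) (\<lambda>k z. T (N k) z) F sequentially" by blast
  qed auto
  have FH: "F \<in> H2" by (rule disc_algebra_H2[OF Fc Fh])
  have FL: "F \<in> L2_space \<mm>" using FH by (rule H2_L2)
  have TL: "T M \<in> L2_space \<mm>" for M by (simp add: T_def)
  have TF: "(\<lambda>k. L2_norm \<mm> (\<lambda>y. T (N k) y - F y)) \<longlonglongrightarrow> 0"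
  proof (rule LIMSEQ_I)
    fix \<epsilon> :: real assume "\<epsilon> > 0"
    then have "\<forall>\<^sub>F k in sequentially. \<forall>z\<in>cball 0 1. dist (T (N k) z) (F z) < \<epsilon> / 2"
      using ul unfolding uniform_limit_iff by (meson half_gt_zero)
    then obtain k0 where k0: "\<And>k z. k \<ge> k0 \<Longrightarrow> z \<in> cball 0 1 \<Longrightarrow> cmod (T (N k) z - F z) < \<epsilon> / 2"
      unfolding eventually_sequentially dist_norm by blast
    have "norm (L2_norm \<mm> (\<lambda>y. T (N k) y - F y) - 0) < \<epsilon>" if "k \<ge> k0" for k
    proof -
      have "L2_norm \<mm> (\<lambda>y. T (N k) y - F y) \<le> \<epsilon> / 2"
        using \<open>\<epsilon> > 0\<close> k0[OF that]
        by (intro circle.L2_norm_le_bound AE_I2 L2_measurable L2_diff TL FL) (auto intro: less_imp_le)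
      then show ?thesis using \<open>\<epsilon> > 0\<close> by simp
    qed
    then show "\<exists>no. \<forall>k\<ge>no. norm (L2_norm \<mm> (\<lambda>y. T (N k) y - F y) - 0) < \<epsilon>" by blast
  qed
  \<comment> \<open>\<open>F\<close> is the image of \<open>f\<close> under the co-analytic Toeplitz
    operator with symbol \<open>cnj b\<close>, expressed through its adjoint, multiplication by
    \<open>b\<close>.\<close>
  have FV: "L2_inner \<mm> F v = L2_inner \<mm> f (\<lambda>y. b y * v y)" if v: "v \<in> H2" for v
  proof -
    have vL: "v \<in> L2_space \<mm>" using v by (rule H2_L2)
    have bvL: "(\<lambda>y. b y * v y) \<in> L2_space \<mm>"
      by (rule L2_mult_bounded[OF vL _ b(3)]) (use bL in auto)
    have four: "fourier (\<lambda>y. b y * v y) (int l) = (\<Sum>n\<le>l. taylor G n * fourier v (int (l - n)))" for l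
    proof -
      have "(\<lambda>k. fourier b (int k) * fourier v (int l - int k)) sums fourier (\<lambda>y. v y * b y) (int l)"
        by (rule fourier_mult_sums[OF vL b(1)])
      moreover have "(\<lambda>k. fourier b (int k) * fourier v (int l - int k)) sums (\<Sum>k\<le>l. fourier b (int k) * fourier v (int l - int k))"
        by (rule sums_finite) (auto simp: H2_neg[OF v])
      ultimately have "fourier (\<lambda>y. v y * b y) (int l) = (\<Sum>k\<le>l. fourier b (int k) * fourier v (int l - int k))"
        by (rule sums_unique2)
      also have "\<dots> = (\<Sum>n\<le>l. taylor G n * fourier v (int (l - n)))"
        by (intro sum.cong) (auto simp: b(2) of_nat_diff)
      finally show ?thesis by (simp add: mult.commute)
    qed
    have "L2_inner \<mm> (T (N k)) v = L2_inner \<mm> (P (N k)) (\<lambda>y. b y * v y)" for k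
      unfolding T_def P_def[abs_def] toep_inner[OF vL] L2_inner_poly_left[OF bvL] four ..
    moreover have "(\<lambda>k. L2_inner \<mm> (T (N k)) v) \<longlonglongrightarrow> L2_inner \<mm> F v"
      by (rule L2_limit_inner[OF TL FL TF vL])
    moreover have "(\<lambda>k. L2_inner \<mm> (P (N k)) (\<lambda>y. b y * v y)) \<longlonglongrightarrow> L2_inner \<mm> f (\<lambda>y. b y * v y)"
      using LIMSEQ_subseq_LIMSEQ[OF L2_limit_inner[OF PL fL Plim bvL] Nmono] by (simp add: comp_def)
    ultimately show ?thesis using LIMSEQ_unique by simp
  qed
  have FK: "F \<in> K"
    unfolding model_space_iff
  proof (intro conjI allI FH)
    fix j :: nat
    have v: "(\<lambda>y. \<Theta> y * y ^ j) \<in> H2"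
      using H2_mult_bounded[OF H2_pow Theta_H2 Theta_le] .
    have w: "(\<lambda>y. b y * y ^ j) \<in> H2" by (rule H2_mult_bounded[OF H2_pow b(1,3)])
    \<comment> \<open>The adjoint keeps multiples of \<Theta>: \<open>b y * y ^ j\<close> is again
      in \<open>H2\<close>, so orthogonality of \<open>f\<close> is inherited by
      \<open>F\<close>.\<close>
    have "L2_inner \<mm> F (\<lambda>y. \<Theta> y * y ^ j) = L2_inner \<mm> f (\<lambda>y. \<Theta> y * (b y * y ^ j))"
      by (simp add: FV[OF v] mult_ac)
    then show "L2_inner \<mm> F (\<lambda>y. \<Theta> y * y ^ j) = 0"
      using f w by (simp add: model_space_def)
  qed
  \<comment> \<open>The error lies in \<open>H2\<close> and can itself be inserted in the duality:
    \<open>nv\<^sup>2\<close> is minus the pairing of \<open>f\<close> with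
    \<open>u y * v y\<close>. Splitting \<open>f\<close> into the bounded \<open>P N0\<close> and a
    remainder of norm at most \<open>\<eta> / 8\<close> bounds this by
    \<open>(\<eta> / 2) * nv\<close>.\<close>
  define v where "v y = F y - f y" for y
  have vL: "v \<in> L2_space \<mm>" unfolding v_def[abs_def] by (rule L2_diff[OF FL fL])
  have vH: "v \<in> H2"
    using FH fH by (intro H2I vL) (simp add: v_def[abs_def] fourier_diff FL fL H2_neg)
  define u where "u y = 1 - b y" for y
  have uL: "u \<in> L2_space \<mm>"
    unfolding u_def[abs_def] by (rule L2_diff[OF _ bL]) (use sphere_pow_L2[of 0] in simp)
  have u2: "AE y in \<mm>. cmod (u y) \<le> 2"
    using b(3)
  proof eventually_elim
    case (elim y)
    then show ?case using norm_triangle_ineq4[of 1 "b y"] by (simp add: u_def)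
  qed
  have uvL: "(\<lambda>y. u y * v y) \<in> L2_space \<mm>"
    by (rule L2_mult_bounded[OF vL _ u2]) (use uL in auto)
  have bvL: "(\<lambda>y. b y * v y) \<in> L2_space \<mm>"
    by (rule L2_mult_bounded[OF vL _ b(3)]) (use bL in auto)
  define nv where "nv = L2_norm \<mm> v"
  have nv0: "0 \<le> nv" by (simp add: nv_def)
  have "complex_of_real (nv\<^sup>2) = L2_inner \<mm> F v - L2_inner \<mm> f v"
    unfolding nv_def L2_inner_self[symmetric] using L2_inner_diff_left[OF FL fL vL] by (simp add: v_def[abs_def])
  also have "\<dots> = - L2_inner \<mm> f (\<lambda>y. v y - b y * v y)"
    by (simp add: FV[OF vH] L2_inner_diff_right[OF vL bvL fL])
  also have "(\<lambda>y. v y - b y * v y) = (\<lambda>y. u y * v y)" by (simp add: u_def algebra_simps)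
  also have "L2_inner \<mm> f (\<lambda>y. u y * v y) =
      L2_inner \<mm> (P N0) (\<lambda>y. u y * v y) - L2_inner \<mm> (\<lambda>y. P N0 y - f y) (\<lambda>y. u y * v y)"
    by (simp add: L2_inner_diff_left[OF PL fL uvL])
  finally have "complex_of_real (nv\<^sup>2) = - (L2_inner \<mm> (P N0) (\<lambda>y. u y * v y)
      - L2_inner \<mm> (\<lambda>y. P N0 y - f y) (\<lambda>y. u y * v y))" .
  then have "cmod (complex_of_real (nv\<^sup>2)) \<le> cmod (L2_inner \<mm> (P N0) (\<lambda>y. u y * v y))
      + cmod (L2_inner \<mm> (\<lambda>y. P N0 y - f y) (\<lambda>y. u y * v y))"
    by (simp only: norm_minus_cancel norm_triangle_ineq4)
  also have "cmod (L2_inner \<mm> (P N0) (\<lambda>y. u y * v y)) \<le> B * e * nv"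
  proof -
    have PuL: "(\<lambda>y. cnj (P N0 y) * u y) \<in> L2_space \<mm>"
      using PB by (intro L2_mult_bounded[OF uL, of _ B] AE_I2) (auto intro!: L2_measurable L2_cnj PL)
    have "L2_inner \<mm> (P N0) (\<lambda>y. u y * v y) = cnj (L2_inner \<mm> (\<lambda>y. cnj (P N0 y) * u y) (\<lambda>y. cnj (v y)))"
      unfolding L2_inner_def Bochner_Integration.integral_cnj[symmetric] by (simp add: mult_ac)
    then have "cmod (L2_inner \<mm> (P N0) (\<lambda>y. u y * v y)) \<le> L2_norm \<mm> (\<lambda>y. cnj (P N0 y) * u y) * nv"
      using L2_Cauchy_Schwarz[OF PuL L2_cnj[OF vL]] by (simp add: nv_def)
    also have "L2_norm \<mm> (\<lambda>y. cnj (P N0 y) * u y) \<le> B * L2_norm \<mm> u"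
      using PB B by (intro L2_norm_mult_bounded[OF uL] AE_I2) (auto intro!: L2_measurable L2_cnj PL)
    also have "\<dots> \<le> B * e" using b(4) B by (intro mult_left_mono) (auto simp: u_def[abs_def])
    finally show ?thesis using nv0 by (simp add: mult_right_mono)
  qed
  also have "cmod (L2_inner \<mm> (\<lambda>y. P N0 y - f y) (\<lambda>y. u y * v y)) \<le> (\<eta> / 8) * (2 * nv)"
  proof -
    have "L2_norm \<mm> (\<lambda>y. u y * v y) \<le> 2 * nv"
      unfolding nv_def by (rule L2_norm_mult_bounded[OF vL _ u2]) (use uL in auto)
    then have "L2_norm \<mm> (\<lambda>y. P N0 y - f y) * L2_norm \<mm> (\<lambda>y. u y * v y) \<le> (\<eta> / 8) * (2 * nv)"
      using N0 \<eta> by (intro mult_mono) auto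
    then show ?thesis using L2_Cauchy_Schwarz[OF L2_diff[OF PL fL] uvL, of N0] by linarith
  qed
  finally have "nv\<^sup>2 \<le> B * e * nv + (\<eta> / 8) * (2 * nv)" using nv0 by (simp add: norm_power)
  also have "\<dots> \<le> (\<eta> / 4) * nv + (\<eta> / 8) * (2 * nv)"
    using e nv0 by (intro add_right_mono mult_right_mono) auto
  finally have "nv * nv \<le> (\<eta> / 2) * nv" by (simp add: power2_eq_square algebra_simps)
  then have "nv \<le> \<eta> / 2" using nv0 \<eta> by (cases "nv = 0") (auto simp: mult_le_cancel_right)
  then have "L2_norm \<mm> (\<lambda>y. F y - f y) < \<eta>" using \<eta> by (simp add: nv_def v_def[abs_def])
  moreover have "F \<in> K_cont \<Theta>" using FK Fc Fh by (simp add: K_cont_def)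
  ultimately show ?thesis by blast
qed

end

section \<open>The embedding operator\<close>

text \<open>Operators are linear only up to null sets, so images of differences are compared in
  norm. \<open>D\<close> is an arbitrary set, hence the separate membership assumptions.\<close>

lemma L2_bounded_linear_diff_norm:
  assumes T: "L2_bounded_linear M D N (L2_space N) T"
    and D: "f \<in> D" "g \<in> D" "(\<lambda>x. (-1) * g x) \<in> D" "(\<lambda>x. f x - g x) \<in> D"
  shows "L2_norm N (T (\<lambda>x. f x - g x)) = L2_norm N (\<lambda>y. T f y - T g y)"
proof (rule L2_norm_cong_AE)
  have add: "AE y in N. T (\<lambda>x. f x + (-1) * g x) y = T f y + T (\<lambda>x. (-1) * g x) y"
    and sc: "AE y in N. T (\<lambda>x. (-1) * g x) y = (-1) * T g y"
  proof -
    have "\<forall>f\<in>D. \<forall>g\<in>D. AE y in N. T (\<lambda>x. f x + g x) y = T f y + T g y"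
      using T unfolding L2_bounded_linear_def by simp
    from bspec[OF bspec[OF this D(1)] D(3)] show "AE y in N. T (\<lambda>x. f x + (-1) * g x) y = T f y + T (\<lambda>x. (-1) * g x) y" .
    have "\<forall>f\<in>D. \<forall>c. AE y in N. T (\<lambda>x. c * f x) y = c * T f y"
      using T unfolding L2_bounded_linear_def by simp
    from spec[OF bspec[OF this D(2)]] show "AE y in N. T (\<lambda>x. (-1) * g x) y = (-1) * T g y" .
  qed
  have "(\<lambda>x. f x + (-1) * g x) = (\<lambda>x. f x - g x)" by auto
  then show "AE y in N. T (\<lambda>x. f x - g x) y = T f y - T g y"
    using add sc by (elim AE_mp, intro AE_I2 impI) auto
  have L: "\<And>f. f \<in> D \<Longrightarrow> T f \<in> L2_space N" using T by (simp add: L2_bounded_linear_def)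
  show "T (\<lambda>x. f x - g x) \<in> borel_measurable N" "(\<lambda>y. T f y - T g y) \<in> borel_measurable N"
    using L D by (auto intro!: L2_measurable L2_diff)
qed

lemma L2_bounded_linear_mono:
  "L2_bounded_linear M D N E T \<Longrightarrow> E \<subseteq> E' \<Longrightarrow> L2_bounded_linear M D N E' T"
  by (auto simp: L2_bounded_linear_def)

lemma L2_bounded_linear_bound:
  assumes "L2_bounded_linear M D N E T"
  obtains C where "0 < C" "\<And>f. f \<in> D \<Longrightarrow> L2_norm N (T f) \<le> C * L2_norm M f"
proof -
  obtain C where C: "\<And>f. f \<in> D \<Longrightarrow> L2_norm N (T f) \<le> C * L2_norm M f"
    using assms unfolding L2_bounded_linear_def by blast
  show ?thesis
  proof (rule that[of "\<bar>C\<bar> + 1"])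
    fix f assume "f \<in> D"
    then have "L2_norm N (T f) \<le> C * L2_norm M f" by (rule C)
    also have "\<dots> \<le> (\<bar>C\<bar> + 1) * L2_norm M f" by (intro mult_right_mono) auto
    finally show "L2_norm N (T f) \<le> (\<bar>C\<bar> + 1) * L2_norm M f" .
  qed auto
qed

context inner_fun
begin

lemma K_contD:
  assumes "F \<in> K_cont \<Theta>"
  shows "F \<in> K" "continuous_on (cball 0 1) F" "F holomorphic_on ball 0 1" "continuous_on (sphere 0 1) F"
  using assms continuous_on_subset[of "cball 0 1" F "sphere 0 1"] by (auto simp: K_cont_def)

lemma K_cont_diff: "F \<in> K_cont \<Theta> \<Longrightarrow> G \<in> K_cont \<Theta> \<Longrightarrow> (\<lambda>x. F x - G x) \<in> K_cont \<Theta>"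
  and K_cont_add: "F \<in> K_cont \<Theta> \<Longrightarrow> G \<in> K_cont \<Theta> \<Longrightarrow> (\<lambda>x. F x + G x) \<in> K_cont \<Theta>"
  and K_cont_scale: "F \<in> K_cont \<Theta> \<Longrightarrow> (\<lambda>x. c * F x) \<in> K_cont \<Theta>"
  by (auto simp: K_cont_def intro!: continuous_intros holomorphic_intros K_diff K_add K_scale)

lemma K_cont_Hinf: "F \<in> K_cont \<Theta> \<Longrightarrow> F \<in> Hinf"
proof -
  assume F: "F \<in> K_cont \<Theta>"
  note F' = K_contD[OF F]
  have fL: "F \<in> L2_space \<mm>" by (rule K_L2[OF F'(1)])
  have "bounded (F ` cball 0 1)" by (intro compact_imp_bounded compact_continuous_image F' compact_cball)
  then have "F \<in> Hinf_disc"
    using F'(3) bounded_subset[OF _ image_mono[OF ball_subset_cball]] by (auto simp: Hinf_disc_def)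
  moreover have "has_boundary_values F F"
    unfolding has_boundary_values_def
  proof (rule AE_I2)
    fix x assume z: "x \<in> space \<mm>"
    have "((\<lambda>r. of_real r * x) \<longlongrightarrow> of_real 1 * x) (at_left (1::real))" by (intro tendsto_intros)
    then have lim: "((\<lambda>r. of_real r * x) \<longlongrightarrow> x) (at_left (1::real))" by simp
    show "((\<lambda>r. F (of_real r * x)) \<longlongrightarrow> F x) (at_left 1)"
    proof (rule continuous_on_tendsto_compose[OF F'(2) lim])
      show "\<forall>\<^sub>F r in at_left (1::real). of_real r * x \<in> cball 0 1"
        using eventually_at_left_1 by eventually_elim (use z in \<open>simp add: norm_mult\<close>)
    qed (use z in simp)
  qed
  ultimately show ?thesis using fL by (auto simp: Hinf_def)
qed

lemma K_cont_L2_variation: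
  assumes "F \<in> K_cont \<Theta>" "complex_circle_measure \<mu>"
  shows "F \<in> L2_space (variation \<mu>)"
  by (rule continuous_on_sphere_L2[OF K_contD(4)[OF assms(1)] finite_measure_variation[OF assms(2)]]) simp

text \<open>\<open>embedding\<close> is a choice, so an extension has to be exhibited:
  \<open>T f\<close> is the limit, in L2 of the variation, of a sequence from
  \<open>K_cont \<Theta>\<close> tending to \<open>f\<close>. Both conclusions then hold for
  whatever the choice returns.\<close>

lemma embedding:
  assumes \<mu>: "\<mu> \<in> C2 \<Theta>"
  shows embedding_linear: "L2_bounded_linear \<mm> K (variation \<mu>) (L2_space (variation \<mu>)) (embedding \<Theta> \<mu>)"
    and embedding_cont: "F \<in> K_cont \<Theta> \<Longrightarrow> AE z in variation \<mu>. embedding \<Theta> \<mu> F z = F z"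
proof -
  let ?V = "variation \<mu>"
  have cm: "complex_circle_measure \<mu>" using \<mu> by (simp add: C2_def)
  obtain C where C: "C > 0" "\<And>F. F \<in> K_cont \<Theta> \<Longrightarrow> L2_norm ?V F \<le> C * L2_norm \<mm> F"
    using \<mu> by (auto simp: C2_def)
  note VL = K_cont_L2_variation[OF _ cm]
  have KcL: "F \<in> L2_space \<mm>" if "F \<in> K_cont \<Theta>" for F using K_L2[OF K_contD(1)[OF that]] .
  define approx where "approx f u \<longleftrightarrow> (\<forall>n. u n \<in> K_cont \<Theta>) \<and> (\<lambda>n. L2_norm \<mm> (\<lambda>z. u n z - f z)) \<longlonglongrightarrow> 0"
    for f :: "complex \<Rightarrow> complex" and u :: "nat \<Rightarrow> complex \<Rightarrow> complex"
  have ex: "\<exists>u. approx f u" if f: "f \<in> K" for f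
  proof -
    have "\<forall>n::nat. \<exists>F\<in>K_cont \<Theta>. L2_norm \<mm> (\<lambda>z. F z - f z) < inverse (real (Suc n))"
      by (intro allI continuous_dense[OF f]) simp
    then obtain u where u: "\<And>n. u n \<in> K_cont \<Theta>"
      "\<And>n. L2_norm \<mm> (\<lambda>z. u n z - f z) < inverse (real (Suc n))" by metis
    have "(\<lambda>n. L2_norm \<mm> (\<lambda>z. u n z - f z)) \<longlonglongrightarrow> 0"
      by (rule Lim_null_comparison[OF _ LIMSEQ_inverse_real_of_nat])
         (use u(2) in \<open>auto intro!: always_eventually less_imp_le\<close>)
    then show ?thesis using u(1) by (auto simp: approx_def)
  qed
  have diff0: "(\<lambda>n. L2_norm ?V (\<lambda>z. u n z - v n z)) \<longlonglongrightarrow> 0"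
    if u: "approx f u" and v: "approx f v" and f: "f \<in> K" for f u v
  proof (rule Lim_null_comparison)
    have "L2_norm ?V (\<lambda>z. u n z - v n z) \<le> C * (L2_norm \<mm> (\<lambda>z. u n z - f z) + L2_norm \<mm> (\<lambda>z. v n z - f z))" for n
    proof -
      have "L2_norm ?V (\<lambda>z. u n z - v n z) \<le> C * L2_norm \<mm> (\<lambda>z. u n z - v n z)"
        using u v by (intro C K_cont_diff) (auto simp: approx_def)
      also have "\<dots> \<le> C * (L2_norm \<mm> (\<lambda>z. u n z - f z) + L2_norm \<mm> (\<lambda>z. v n z - f z))"
        using C(1) u v L2_norm_triangle_diff[OF KcL K_L2[OF f] KcL, of "u n" "v n"] L2_norm_minus_commute[of \<mm> f "v n"]
        by (intro mult_left_mono) (auto simp: approx_def)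
      finally show ?thesis .
    qed
    then show "\<forall>\<^sub>F n in sequentially. norm (L2_norm ?V (\<lambda>z. u n z - v n z)) \<le>
        C * (L2_norm \<mm> (\<lambda>z. u n z - f z) + L2_norm \<mm> (\<lambda>z. v n z - f z))" by simp
    show "(\<lambda>n. C * (L2_norm \<mm> (\<lambda>z. u n z - f z) + L2_norm \<mm> (\<lambda>z. v n z - f z))) \<longlonglongrightarrow> 0"
      using tendsto_mult_left[OF tendsto_add, of _ 0 sequentially _ 0 C] u v by (auto simp: approx_def)
  qed
  have limit: "\<exists>g\<in>L2_space ?V. (\<lambda>n. L2_norm ?V (\<lambda>z. u n z - g z)) \<longlonglongrightarrow> 0" if u: "approx f u" and f: "f \<in> K" for f u
  proof -
    have uc: "u n \<in> K_cont \<Theta>" for n using u by (simp add: approx_def)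
    obtain g where "g \<in> L2_space ?V" "(\<lambda>n. L2_norm ?V (\<lambda>z. u n z - g z)) \<longlonglongrightarrow> 0"
    proof (rule L2_complete[of u ?V])
      fix e :: real assume e: "e > 0"
      then have "\<forall>\<^sub>F n in sequentially. L2_norm \<mm> (\<lambda>z. u n z - f z) < e / (2 * C)"
        using u C(1) by (intro order_tendstoD(2)[of _ 0]) (auto simp: approx_def)
      then obtain N where N: "\<And>n. n \<ge> N \<Longrightarrow> L2_norm \<mm> (\<lambda>z. u n z - f z) < e / (2 * C)"
        by (auto simp: eventually_sequentially)
      have "L2_norm ?V (\<lambda>z. u i z - u j z) < e" if "i \<ge> N" "j \<ge> N" for i j
      proof -
        have "L2_norm ?V (\<lambda>z. u i z - u j z) \<le> C * L2_norm \<mm> (\<lambda>z. u i z - u j z)"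
          by (intro C K_cont_diff uc)
        also have "\<dots> \<le> C * (L2_norm \<mm> (\<lambda>z. u i z - f z) + L2_norm \<mm> (\<lambda>z. u j z - f z))"
          using C(1) L2_norm_triangle_diff[OF KcL[OF uc] K_L2[OF f] KcL[OF uc], of i j] L2_norm_minus_commute[of \<mm> f "u j"]
          by (intro mult_left_mono) auto
        also have "\<dots> < C * (e / (2 * C) + e / (2 * C))"
          using C(1) N[OF that(1)] N[OF that(2)] by (intro mult_strict_left_mono add_strict_mono) auto
        finally show ?thesis using C(1) by simp
      qed
      then show "\<exists>N. \<forall>i\<ge>N. \<forall>j\<ge>N. L2_norm ?V (\<lambda>z. u i z - u j z) < e" by blast
    qed (use VL uc in auto)
    then show ?thesis by blast
  qed
  define seq where "seq f = (SOME u. approx f u)" for f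
  have seq: "approx f (seq f)" if "f \<in> K" for f unfolding seq_def by (rule someI_ex[OF ex[OF that]])
  define T where "T f = (SOME g. g \<in> L2_space ?V \<and> (\<lambda>n. L2_norm ?V (\<lambda>z. seq f n z - g z)) \<longlonglongrightarrow> 0)" for f
  have T: "T f \<in> L2_space ?V" "(\<lambda>n. L2_norm ?V (\<lambda>z. seq f n z - T f z)) \<longlonglongrightarrow> 0" if "f \<in> K" for f
    using someI_ex[of "\<lambda>g. g \<in> L2_space ?V \<and> (\<lambda>n. L2_norm ?V (\<lambda>z. seq f n z - g z)) \<longlonglongrightarrow> 0"]
      limit[OF seq[OF that] that] unfolding T_def by blast+
  \<comment> \<open>The limit is the same along every approximating sequence; linearity follows by
    adding and scaling sequences.\<close>
  have key: "(\<lambda>n. L2_norm ?V (\<lambda>z. v n z - T f z)) \<longlonglongrightarrow> 0" if v: "approx f v" and f: "f \<in> K" for f v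
  proof (rule Lim_null_comparison)
    have "L2_norm ?V (\<lambda>z. v n z - T f z) \<le> L2_norm ?V (\<lambda>z. v n z - seq f n z) + L2_norm ?V (\<lambda>z. seq f n z - T f z)" for n
      using v seq[OF f] by (intro L2_norm_triangle_diff T f VL) (auto simp: approx_def)
    then show "\<forall>\<^sub>F n in sequentially. norm (L2_norm ?V (\<lambda>z. v n z - T f z)) \<le>
        L2_norm ?V (\<lambda>z. v n z - seq f n z) + L2_norm ?V (\<lambda>z. seq f n z - T f z)" by simp
    show "(\<lambda>n. L2_norm ?V (\<lambda>z. v n z - seq f n z) + L2_norm ?V (\<lambda>z. seq f n z - T f z)) \<longlonglongrightarrow> 0"
      using tendsto_add[OF diff0[OF v seq[OF f] f] T(2)[OF f]] by simp
  qed
  have unique: "AE z in ?V. T f z = g z"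
    if "approx f v" "f \<in> K" "g \<in> L2_space ?V" "(\<lambda>n. L2_norm ?V (\<lambda>z. v n z - g z)) \<longlonglongrightarrow> 0" for f g v
    by (rule L2_limit_unique[OF _ T(1)[OF that(2)] that(3) key[OF that(1,2)] that(4)])
       (use that(1) VL in \<open>auto simp: approx_def\<close>)
  let ?P = "\<lambda>T. L2_bounded_linear \<mm> K ?V (L2_space ?V) T \<and> (\<forall>F\<in>K_cont \<Theta>. AE z in ?V. T F z = F z)"
  have "L2_bounded_linear \<mm> K ?V (L2_space ?V) T"
    unfolding L2_bounded_linear_def
  proof (intro conjI ballI allI exI)
    fix f assume f: "f \<in> K"
    then show "T f \<in> L2_space ?V" by (rule T)
    have sf: "seq f n \<in> K_cont \<Theta>" for n using seq[OF f] by (simp add: approx_def)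
    { fix g assume g: "g \<in> K"
      have sg: "seq g n \<in> K_cont \<Theta>" for n using seq[OF g] by (simp add: approx_def)
      have lim: "(\<lambda>n. L2_norm M (\<lambda>z. (seq f n z + seq g n z) - (f' z + g' z))) \<longlonglongrightarrow> 0"
        if "(\<lambda>n. L2_norm M (\<lambda>z. seq f n z - f' z)) \<longlonglongrightarrow> 0" "(\<lambda>n. L2_norm M (\<lambda>z. seq g n z - g' z)) \<longlonglongrightarrow> 0"
          "f' \<in> L2_space M" "g' \<in> L2_space M" "\<And>n. seq f n \<in> L2_space M" "\<And>n. seq g n \<in> L2_space M" for M f' g'
      proof (rule Lim_null_comparison)
        have "L2_norm M (\<lambda>z. (seq f n z - f' z) + (seq g n z - g' z)) \<le> L2_norm M (\<lambda>z. seq f n z - f' z) + L2_norm M (\<lambda>z. seq g n z - g' z)" for n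
          using that by (intro L2_norm_triangle L2_diff)
        moreover have "(\<lambda>z. (seq f n z - f' z) + (seq g n z - g' z)) = (\<lambda>z. (seq f n z + seq g n z) - (f' z + g' z))" for n
          by auto
        ultimately show "\<forall>\<^sub>F n in sequentially. norm (L2_norm M (\<lambda>z. (seq f n z + seq g n z) - (f' z + g' z)))
            \<le> L2_norm M (\<lambda>z. seq f n z - f' z) + L2_norm M (\<lambda>z. seq g n z - g' z)" by simp
        show "(\<lambda>n. L2_norm M (\<lambda>z. seq f n z - f' z) + L2_norm M (\<lambda>z. seq g n z - g' z)) \<longlonglongrightarrow> 0"
          using tendsto_add[OF that(1,2)] by simp
      qed
      have "approx (\<lambda>x. f x + g x) (\<lambda>n z. seq f n z + seq g n z)"
        unfolding approx_def using lim[of \<mm> f g] seq[OF f] seq[OF g] f g sf sg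
        by (auto intro: K_cont_add KcL K_L2 simp: approx_def)
      then show "AE y in ?V. T (\<lambda>x. f x + g x) y = T f y + T g y"
        using lim[of ?V "T f" "T g"] T[OF f] T[OF g] sf sg f g
        by (intro unique) (auto intro: VL L2_add K_add) }
    { fix c
      have lim: "(\<lambda>n. L2_norm M (\<lambda>z. c * seq f n z - c * f' z)) \<longlonglongrightarrow> 0"
        if "(\<lambda>n. L2_norm M (\<lambda>z. seq f n z - f' z)) \<longlonglongrightarrow> 0" for M f'
        using tendsto_mult_left[OF that, of "cmod c"] by (simp add: right_diff_distrib[symmetric] L2_norm_scale)
      have "approx (\<lambda>x. c * f x) (\<lambda>n z. c * seq f n z)"
        unfolding approx_def using lim[of \<mm> f] seq[OF f] sf by (auto intro: K_cont_scale simp: approx_def)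
      then show "AE y in ?V. T (\<lambda>x. c * f x) y = c * T f y"
        using lim[OF T(2)[OF f]] T(1)[OF f] f by (intro unique) (auto intro: L2_scale K_scale) }
    show "L2_norm ?V (T f) \<le> C * L2_norm \<mm> f"
    proof (rule LIMSEQ_le)
      show "(\<lambda>n. L2_norm ?V (seq f n)) \<longlonglongrightarrow> L2_norm ?V (T f)"
        by (rule L2_limit_norm[OF _ T[OF f]]) (use sf VL in auto)
      show "(\<lambda>n. C * L2_norm \<mm> (seq f n)) \<longlonglongrightarrow> C * L2_norm \<mm> f"
        using seq[OF f] sf f by (intro tendsto_mult_left L2_limit_norm) (auto simp: approx_def intro: KcL K_L2)
      show "\<exists>N. \<forall>n\<ge>N. L2_norm ?V (seq f n) \<le> C * L2_norm \<mm> (seq f n)" using C(2) sf by blast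
    qed
  qed
  moreover have "AE z in ?V. T F z = F z" if F: "F \<in> K_cont \<Theta>" for F
    using F K_contD(1)[OF F] by (intro unique[of F "\<lambda>_. F"]) (auto simp: approx_def L2_norm_def intro: VL)
  ultimately have PT: "?P T" by simp
  have P: "?P (embedding \<Theta> \<mu>)"
    unfolding embedding_def by (rule someI[where P = ?P, OF PT])
  from P show "L2_bounded_linear \<mm> K ?V (L2_space ?V) (embedding \<Theta> \<mu>)" by (rule conjunct1)
  from P show "AE z in ?V. embedding \<Theta> \<mu> F z = F z" if "F \<in> K_cont \<Theta>" using that by simp
qed

lemma K_minus: "g \<in> K \<Longrightarrow> (\<lambda>x. (-1) * g x) \<in> K"
  by (rule K_scale)

theorem compact_if_compact_embedding:
  assumes \<mu>: "\<mu> \<in> V2 \<Theta>" and A: "is_measure_operator \<Theta> \<mu> A"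
  shows "compact_on_model \<Theta> A"
proof -
  let ?V = "variation \<mu>" and ?\<iota> = "embedding \<Theta> \<mu>"
  have C2: "\<mu> \<in> C2 \<Theta>" and comp: "L2_compact_operator \<mm> K ?V ?\<iota>" using \<mu> by (auto simp: V2_def)
  have cm: "complex_circle_measure \<mu>" using C2 by (simp add: C2_def)
  note \<iota> = embedding_linear[OF C2]
  have \<iota>L: "?\<iota> f \<in> L2_space ?V" if "f \<in> K" for f using \<iota> that by (simp add: L2_bounded_linear_def)
  have bA: "L2_bounded_linear \<mm> K \<mm> K A"
    using A by (simp add: is_measure_operator_def bounded_operator_on_model_def)
  then have A': "L2_bounded_linear \<mm> K \<mm> (L2_space \<mm>) A"
    by (rule L2_bounded_linear_mono) (use K_L2 in blast)
  have AK: "A f \<in> K" if "f \<in> K" for f using bA that by (simp add: L2_bounded_linear_def)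
  obtain C where C: "C > 0" "\<And>f. f \<in> K \<Longrightarrow> L2_norm ?V (?\<iota> f) \<le> C * L2_norm \<mm> f"
    using L2_bounded_linear_bound[OF \<iota>] by metis
  have main: "L2_norm \<mm> (A u) \<le> C * L2_norm ?V (?\<iota> u)" if u: "u \<in> K" for u
  proof -
    let ?a = "L2_norm \<mm> (A u)"
    \<comment> \<open>The polar density has modulus 1 and is absorbed into the second factor, which
      leaves an integral against the variation.\<close>
    define b where "b z = polar_density \<mu> z * cnj (?\<iota> (A u) z)" for z
    have pd: "AE z in ?V. cmod (polar_density \<mu> z) \<le> 1"
      using polar_density(2)[OF cm] by (intro AE_I2) auto
    have bL: "b \<in> L2_space ?V" and bn: "L2_norm ?V b \<le> 1 * L2_norm ?V (\<lambda>z. cnj (?\<iota> (A u) z))"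
      unfolding b_def[abs_def]
      using L2_mult_bounded[OF L2_cnj[OF \<iota>L[OF AK[OF u]]] polar_density(1)[OF cm] pd]
        L2_norm_mult_bounded[OF L2_cnj[OF \<iota>L[OF AK[OF u]]] polar_density(1)[OF cm] pd] by auto
    have "of_real (?a\<^sup>2) = complex_measure_integral \<mu> (\<lambda>z. ?\<iota> u z * cnj (?\<iota> (A u) z))"
      unfolding L2_inner_self[symmetric] using A u AK[OF u] by (simp add: is_measure_operator_def)
    also have "\<dots> = (\<integral>z. ?\<iota> u z * b z \<partial>?V)"
      unfolding complex_measure_integral_def b_def by (simp add: mult_ac)
    finally have "cmod (of_real (?a\<^sup>2)) \<le> L2_norm ?V (?\<iota> u) * L2_norm ?V b"
      using L2_integral_mult_le[OF \<iota>L[OF u] bL] by simp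
    then have "?a\<^sup>2 \<le> L2_norm ?V (?\<iota> u) * L2_norm ?V b" by (simp add: norm_power)
    also have "\<dots> \<le> L2_norm ?V (?\<iota> u) * (C * ?a)"
      using bn C(2)[OF AK[OF u]] by (intro mult_left_mono) auto
    finally have "?a * ?a \<le> (C * L2_norm ?V (?\<iota> u)) * ?a" by (simp add: power2_eq_square mult_ac)
    moreover have "0 \<le> ?a" "0 \<le> C * L2_norm ?V (?\<iota> u)" using C(1) by auto
    ultimately show ?thesis by (cases "?a = 0") (auto simp: mult_le_cancel_right)
  qed
  show ?thesis
    unfolding compact_on_model_def
  proof (rule L2_compact_operator_transfer[OF _ _ comp])
    fix e :: real assume e: "e > 0"
    show "\<exists>d>0. \<forall>f\<in>K. \<forall>g\<in>K. L2_norm \<mm> f \<le> 1 \<longrightarrow> L2_norm \<mm> g \<le> 1 \<longrightarrow>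
      L2_norm ?V (\<lambda>x. ?\<iota> f x - ?\<iota> g x) < d \<longrightarrow> L2_norm \<mm> (\<lambda>x. A f x - A g x) < e"
    proof (intro exI[of _ "e / C"] conjI ballI impI)
      show "0 < e / C" using e C by simp
      fix f g assume f: "f \<in> K" and g: "g \<in> K" and d: "L2_norm ?V (\<lambda>x. ?\<iota> f x - ?\<iota> g x) < e / C"
      note fg = f g K_minus[OF g] K_diff[OF f g]
      have "L2_norm \<mm> (\<lambda>x. A f x - A g x) \<le> C * L2_norm ?V (\<lambda>x. ?\<iota> f x - ?\<iota> g x)"
        using main[OF fg(4)] unfolding L2_bounded_linear_diff_norm[OF A' fg] L2_bounded_linear_diff_norm[OF \<iota> fg] .
      also have "\<dots> < C * (e / C)" using d C by (intro mult_strict_left_mono) auto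
      finally show "L2_norm \<mm> (\<lambda>x. A f x - A g x) < e" using C by simp
    qed
  qed (use \<iota>L AK K_L2 in auto)
qed

end

section \<open>Positivity of the form on the symbol side\<close>

text \<open>\<open>g\<close> and \<open>g'\<close> are the boundary functions of the exponentials of
  plus and minus \<open>herglotz u z / 2\<close>. The real part of the Herglotz integral tends
  radially to \<open>u\<close>, which gives the modulus, and its boundedness makes both exponentials
  bounded. \<open>g'\<close> is kept so that division by \<open>g\<close> becomes multiplication by
  a bounded analytic function.\<close>

lemma bounded_outer_function:
  fixes u :: "complex \<Rightarrow> real"
  assumes u: "u \<in> borel_measurable \<mm>" and B: "\<And>\<xi>. \<bar>u \<xi>\<bar> \<le> B"
  obtains g g' where "g \<in> H2" "g \<in> Hinf" "g' \<in> H2" "AE x in \<mm>. cmod (g' x) \<le> exp (B / 2)"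
    "AE x in \<mm>. (cmod (g x))\<^sup>2 = exp (u x)" "AE x in \<mm>. g x * g' x = 1"
proof -
  have ui: "integrable \<mm> u"
    using u B by (intro circle.integrable_const_bound[of _ B]) auto
  have Re_le: "\<bar>Re (herglotz u z)\<bar> \<le> B" if z: "cmod z < 1" for z
  proof -
    have pi: "integrable \<mm> (\<lambda>\<xi>. poisson z \<xi> * f \<xi>)" if "integrable \<mm> f" for f :: "complex \<Rightarrow> real"
    proof -
      have "integrable \<mm> (\<lambda>\<xi>. complex_of_real (poisson z \<xi> * f \<xi>))"
        using integrable_poisson_mult[of "\<lambda>\<xi>. of_real (f \<xi>)" z] that z by simp
      then show ?thesis by (simp only: complex_of_real_integrable_eq)
    qed
    have "complex_of_real (\<integral>\<xi>. poisson z \<xi> \<partial>\<mm>) = 1"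
      using poisson_integral_one[OF z] by (simp add: poisson_integral_def)
    then have one: "(\<integral>\<xi>. poisson z \<xi> \<partial>\<mm>) = 1" by (simp only: of_real_eq_1_iff)
    have "\<bar>\<integral>\<xi>. poisson z \<xi> * u \<xi> \<partial>\<mm>\<bar> \<le> (\<integral>\<xi>. poisson z \<xi> * B \<partial>\<mm>)"
      using B poisson_nonneg[OF z] pi[OF ui] pi[of "\<lambda>_. B"]
      by (intro integral_abs_bound_integral) (auto simp: abs_mult intro!: mult_left_mono)
    then show ?thesis using Re_herglotz[OF ui z] one by simp
  qed
  have root: "\<exists>g. g \<in> H2 \<and> g \<in> Hinf \<and> has_boundary_values (\<lambda>z. exp (of_real s * herglotz u z / 2)) g \<and>
      (AE x in \<mm>. cmod (g x) \<le> exp (B / 2))" if s: "\<bar>s\<bar> = 1" for s :: real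
  proof -
    have "(\<lambda>z. exp (of_real s * herglotz u z / 2)) holomorphic_on ball 0 1"
      by (intro holomorphic_intros herglotz_holomorphic ui) auto
    moreover have "cmod (exp (of_real s * herglotz u z / 2)) \<le> exp (B / 2)" if "z \<in> ball 0 1" for z
    proof -
      have "s * Re (herglotz u z) \<le> \<bar>s\<bar> * \<bar>Re (herglotz u z)\<bar>" by (simp add: abs_mult[symmetric])
      also have "\<dots> \<le> B" using Re_le[of z] that s by simp
      finally show ?thesis by (simp add: norm_exp_eq_Re)
    qed
    ultimately obtain g where "g \<in> H2" "g \<in> Hinf" "has_boundary_values (\<lambda>z. exp (of_real s * herglotz u z / 2)) g"
      "AE x in \<mm>. cmod (g x) \<le> exp (B / 2)"
      by (rule Hinf_disc_boundary) blast+
    then show ?thesis by blast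
  qed
  obtain g where g: "g \<in> H2" "g \<in> Hinf" "has_boundary_values (\<lambda>z. exp (of_real 1 * herglotz u z / 2)) g"
    using root[of 1] by auto
  obtain g' where g': "g' \<in> H2" "has_boundary_values (\<lambda>z. exp (of_real (-1) * herglotz u z / 2)) g'"
      "AE x in \<mm>. cmod (g' x) \<le> exp (B / 2)"
    using root[of "-1"] by auto
  have f: "AE x in \<mm>. ((\<lambda>r. poisson_integral (\<lambda>\<xi>. of_real (u \<xi>)) (of_real r * x)) \<longlongrightarrow> of_real (u x)) (at_left 1)"
    using fatou[of "\<lambda>\<xi>. of_real (u \<xi>)"] ui by (simp add: fatou_property_def)
  have sp: "AE x in \<mm>. x \<in> sphere 0 1" by (rule AE_I2) simp
  have "AE x in \<mm>. (cmod (g x))\<^sup>2 = exp (u x)"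
    using f g(3)[unfolded has_boundary_values_def] sp
  proof eventually_elim
    case (elim x)
    have "((\<lambda>r. exp (Re (poisson_integral (\<lambda>\<xi>. of_real (u \<xi>)) (of_real r * x)))) \<longlongrightarrow> exp (Re (of_real (u x)))) (at_left 1)"
      by (intro tendsto_intros elim(1))
    moreover have "\<forall>\<^sub>F r in at_left 1. exp (Re (poisson_integral (\<lambda>\<xi>. of_real (u \<xi>)) (of_real r * x)))
        = (cmod (exp (of_real 1 * herglotz u (of_real r * x) / 2)))\<^sup>2"
      using eventually_at_left_1
    proof eventually_elim
      case (elim r)
      then have z: "cmod (of_real r * x) < 1" using \<open>x \<in> sphere 0 1\<close> by (simp add: norm_mult)
      have "poisson_integral (\<lambda>\<xi>. of_real (u \<xi>)) (of_real r * x) = of_real (\<integral>\<xi>. poisson (of_real r * x) \<xi> * u \<xi> \<partial>\<mm>)"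
        unfolding poisson_integral_def integral_complex_of_real[symmetric] by simp
      then show ?case using Re_herglotz[OF ui z] by (simp add: norm_exp_eq_Re power2_eq_square exp_add[symmetric])
    qed
    ultimately have "((\<lambda>r. (cmod (exp (of_real 1 * herglotz u (of_real r * x) / 2)))\<^sup>2) \<longlongrightarrow> exp (u x)) (at_left 1)"
      by (simp add: filterlim_cong)
    moreover have "((\<lambda>r. (cmod (exp (of_real 1 * herglotz u (of_real r * x) / 2)))\<^sup>2) \<longlongrightarrow> (cmod (g x))\<^sup>2) (at_left 1)"
      by (intro tendsto_intros elim(2))
    ultimately show ?case using tendsto_unique[of "at_left (1::real)"] by auto
  qed
  moreover have "AE x in \<mm>. g x * g' x = 1"
    using g(3)[unfolded has_boundary_values_def] g'(2)[unfolded has_boundary_values_def]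
  proof eventually_elim
    case (elim x)
    have "((\<lambda>r. exp (of_real 1 * herglotz u (of_real r * x) / 2) * exp (of_real (-1) * herglotz u (of_real r * x) / 2)) \<longlongrightarrow> g x * g' x) (at_left 1)"
      by (intro tendsto_intros elim)
    then have "((\<lambda>r::real. 1) \<longlongrightarrow> g x * g' x) (at_left 1)" by (simp add: exp_add[symmetric])
    then show ?case by (simp add: tendsto_const_iff)
  qed
  ultimately show ?thesis using g(1,2) g'(1,3) that by blast
qed

context inner_fun
begin

lemma modulus_square_of_model_space:
  fixes h :: "complex \<Rightarrow> real"
  assumes h: "h \<in> borel_measurable \<mm>" and \<epsilon>: "0 < \<epsilon>"
    and bound: "AE z in \<mm>. \<epsilon> \<le> h z \<and> h z \<le> B"
    and vanish: "\<And>n. n \<le> 0 \<Longrightarrow> fourier (\<lambda>z. \<Theta> z * of_real (h z)) n = 0"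
  obtains g where "g \<in> K" "g \<in> Hinf" "AE z in \<mm>. (cmod (g z))\<^sup>2 = h z"
proof -
  \<comment> \<open>\<open>h\<close> obeys its bounds only a.e.; clipping makes \<open>u\<close>
    bounded everywhere, and \<open>max \<epsilon> B\<close> keeps the upper clip positive.\<close>
  define u where "u z = ln (max \<epsilon> (min (max \<epsilon> B) (h z)))" for z
  have um: "u \<in> borel_measurable \<mm>" unfolding u_def using h by measurable
  have ub: "\<bar>u z\<bar> \<le> \<bar>ln \<epsilon>\<bar> + \<bar>ln (max \<epsilon> B)\<bar>" for z
  proof -
    have "ln \<epsilon> \<le> u z" "u z \<le> ln (max \<epsilon> B)" unfolding u_def using \<epsilon> by (auto simp: ln_le_cancel_iff)
    then show ?thesis by linarith
  qed
  obtain g g' where g: "g \<in> H2" "g \<in> Hinf" "g' \<in> H2" "AE z in \<mm>. cmod (g' z) \<le> exp ((\<bar>ln \<epsilon>\<bar> + \<bar>ln (max \<epsilon> B)\<bar>) / 2)"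
    "AE z in \<mm>. (cmod (g z))\<^sup>2 = exp (u z)" "AE z in \<mm>. g z * g' z = 1"
    by (rule bounded_outer_function[OF um ub])
  have sq: "AE z in \<mm>. (cmod (g z))\<^sup>2 = h z"
    using g(5) bound by eventually_elim (use \<epsilon> in \<open>simp add: u_def min_def max_def\<close>)
  have gm: "g \<in> borel_measurable \<mm>" "g' \<in> borel_measurable \<mm>"
    using g(1,3) H2_L2 L2_measurable by blast+
  have hL: "(\<lambda>z. of_real (h z)) \<in> L2_space \<mm>"
  proof (rule L2_space_bounded[OF circle.finite_measure_axioms])
    show "AE z in \<mm>. cmod (of_real (h z)) \<le> \<bar>B\<bar>"
      using bound by eventually_elim (use \<epsilon> in auto)
  qed (use h in measurable)
  have "L2_inner \<mm> g (\<lambda>z. \<Theta> z * z ^ j) = 0" for j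
  proof -
    \<comment> \<open>From \<open>h z = g z * cnj (g z)\<close> and \<open>g z * g' z = 1\<close>
      follows \<open>cnj (g z) = h z * g' z\<close>. The coefficients of \<Theta> times
      \<open>h\<close> vanish up to index 0, and multiplying by the analytic \<open>g'\<close>
      preserves this.\<close>
    have "fourier (\<lambda>z. \<Theta> z * cnj (g z)) (- int j) = fourier (\<lambda>z. (\<Theta> z * of_real (h z)) * g' z) (- int j)"
    proof (rule fourier_cong_AE)
      show "AE z in \<mm>. \<Theta> z * cnj (g z) = (\<Theta> z * of_real (h z)) * g' z"
        using sq g(6)
      proof eventually_elim
        case (elim z)
        have "of_real (h z) * g' z = cnj (g z) * (g z * g' z)"
          unfolding elim(1)[symmetric] complex_norm_square by (simp add: mult_ac)
        then have "of_real (h z) * g' z = cnj (g z)" unfolding elim(2) by simp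
        then show ?case by (simp only: mult.assoc)
      qed
    qed (use gm h in \<open>measurable, measurable\<close>)
    also have "\<dots> = 0"
      by (rule fourier_mult_eq_0[OF Theta_mult_L2[OF hL] g(3)]) (use vanish in auto)
    finally have "cnj (fourier (\<lambda>z. \<Theta> z * cnj (g z)) (- int j)) = 0" by simp
    also have "cnj (fourier (\<lambda>z. \<Theta> z * cnj (g z)) (- int j)) = L2_inner \<mm> g (\<lambda>z. \<Theta> z * z ^ j)"
      unfolding fourier_def L2_inner_def Bochner_Integration.integral_cnj[symmetric]
      by (intro Bochner_Integration.integral_cong refl) (simp add: mult_ac)
    finally show ?thesis .
  qed
  then show ?thesis using that[of g] g(1,2) sq model_space_iff by blast
qed

text \<open>Index 0 is included because orthogonality to \<Theta> times \<open>z ^ j\<close> covers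
  \<open>j = 0\<close>: \<Theta> times \<open>cnj (f z)\<close> has strictly positive frequencies,
  and multiplying by the analytic \<open>f\<close> keeps them positive.\<close>

lemma fourier_Theta_modulus_square:
  assumes f: "f \<in> K" "f \<in> Hinf" and n: "n \<le> 0"
  shows "fourier (\<lambda>z. \<Theta> z * of_real ((cmod (f z))\<^sup>2)) n = 0"
proof -
  have "fourier (\<lambda>z. \<Theta> z * cnj (f z)) j = 0" if "j \<le> n" for j
  proof -
    have "0 = cnj (L2_inner \<mm> f (\<lambda>z. \<Theta> z * z ^ nat (- j)))" using f(1) model_space_iff by simp
    also have "\<dots> = fourier (\<lambda>z. \<Theta> z * cnj (f z)) j"
      unfolding fourier_def L2_inner_def Bochner_Integration.integral_cnj[symmetric]
      using that n by (intro Bochner_Integration.integral_cong refl) (simp add: mult_ac power_int_def)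
    finally show ?thesis by simp
  qed
  then have "fourier (\<lambda>z. (\<Theta> z * cnj (f z)) * f z) n = 0"
    by (intro fourier_mult_eq_0[OF Theta_mult_L2[OF L2_cnj[OF K_L2[OF f(1)]]] K_H2[OF f(1)]])
  moreover have "(\<lambda>z. (\<Theta> z * cnj (f z)) * f z) = (\<lambda>z. \<Theta> z * of_real ((cmod (f z))\<^sup>2))"
    by (rule ext) (simp only: complex_norm_square mult_ac)
  ultimately show ?thesis by simp
qed

text \<open>
  The weight \<open>h0\<close>, bounded below, only serves to shift \<open>h\<close> away from zero, so that
  \<open>h + s h0\<close> is the squared modulus of an outer function, which then lies in the model space.
\<close>

lemma symbol_integral_nonneg:
  fixes h h0 :: "complex \<Rightarrow> real"
  assumes \<phi>: "\<phi> \<in> L2_space \<mm>"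
    and pos: "\<And>g. g \<in> K \<Longrightarrow> g \<in> Hinf \<Longrightarrow> 0 \<le> Re (\<integral>z. \<phi> z * of_real ((cmod (g z))\<^sup>2) \<partial>\<mm>)"
    and h: "h \<in> borel_measurable \<mm>" "AE z in \<mm>. 0 \<le> h z \<and> h z \<le> B"
      "\<And>n. n \<le> 0 \<Longrightarrow> fourier (\<lambda>z. \<Theta> z * of_real (h z)) n = 0"
    and h0: "h0 \<in> borel_measurable \<mm>" "AE z in \<mm>. \<delta> \<le> h0 z \<and> h0 z \<le> B"
      "\<And>n. n \<le> 0 \<Longrightarrow> fourier (\<lambda>z. \<Theta> z * of_real (h0 z)) n = 0" and \<delta>: "0 < \<delta>"
  shows "0 \<le> Re (\<integral>z. \<phi> z * of_real (h z) \<partial>\<mm>)"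
proof -
  let ?I = "\<lambda>h. \<integral>z. \<phi> z * complex_of_real (h z) \<partial>\<mm>"
  have L: "(\<lambda>z. complex_of_real (f z)) \<in> L2_space \<mm>"
    if "f \<in> borel_measurable \<mm>" "AE z in \<mm>. 0 \<le> f z \<and> f z \<le> B" for f
  proof (rule L2_space_bounded[OF circle.finite_measure_axioms])
    show "AE z in \<mm>. cmod (of_real (f z)) \<le> \<bar>B\<bar>"
      using that(2) by eventually_elim auto
  qed (use that(1) in measurable)
  have h0': "AE z in \<mm>. 0 \<le> h0 z \<and> h0 z \<le> B" using h0(2) \<delta> by (auto elim!: eventually_mono)
  note hL = L[OF h(1,2)] and h0L = L[OF h0(1) h0']
  have step: "0 \<le> Re (?I h) + s * Re (?I h0)" if s: "0 < s" for s
  proof -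
    have "AE z in \<mm>. s * \<delta> \<le> h z + s * h0 z \<and> h z + s * h0 z \<le> B + s * B"
      using h(2) h0(2)
    proof eventually_elim
      case (elim z)
      then have "s * \<delta> \<le> s * h0 z" "s * h0 z \<le> s * B" using s by (auto intro: mult_left_mono)
      then show ?case using elim by linarith
    qed
    moreover have "fourier (\<lambda>z. \<Theta> z * of_real (h z + s * h0 z)) n = 0" if "n \<le> 0" for n
    proof -
      have "(\<lambda>z. \<Theta> z * of_real (h z + s * h0 z)) = (\<lambda>z. \<Theta> z * of_real (h z) + of_real s * (\<Theta> z * of_real (h0 z)))"
        by (auto simp: algebra_simps)
      then show ?thesis
        using fourier_add[OF Theta_mult_L2[OF hL] L2_scale[OF Theta_mult_L2[OF h0L]], of "of_real s" n] h(3) h0(3) that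
        by (simp add: fourier_scale)
    qed
    ultimately obtain g where g: "g \<in> K" "g \<in> Hinf" "AE z in \<mm>. (cmod (g z))\<^sup>2 = h z + s * h0 z"
      using modulus_square_of_model_space[of "\<lambda>z. h z + s * h0 z" "s * \<delta>" "B + s * B"] s \<delta> h(1) h0(1) by auto
    have "?I (\<lambda>z. (cmod (g z))\<^sup>2) = ?I (\<lambda>z. h z + s * h0 z)"
      using g(3) L2_measurable[OF \<phi>] L2_measurable[OF K_L2[OF g(1)]] h(1) h0(1)
      by (intro integral_cong_AE) (auto elim!: eventually_mono simp del: of_real_power of_real_add)
    also have "\<dots> = (\<integral>z. \<phi> z * of_real (h z) + of_real s * (\<phi> z * of_real (h0 z)) \<partial>\<mm>)"
      by (simp add: algebra_simps)
    also have "\<dots> = ?I h + of_real s * ?I h0"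
      using L2_integrable_mult[OF \<phi> hL] L2_integrable_mult[OF \<phi> h0L] by simp
    finally show ?thesis using pos[OF g(1,2)] by simp
  qed
  have lim: "((\<lambda>s. Re (?I h) + s * Re (?I h0)) \<longlongrightarrow> Re (?I h) + 0 * Re (?I h0)) (at_right 0)"
    by (intro tendsto_intros)
  have "0 \<le> Re (?I h) + 0 * Re (?I h0)"
    by (rule tendsto_lowerbound[OF lim]) (auto intro!: eventually_mono[OF eventually_at_right_less[of 0]] step)
  then show ?thesis by simp
qed

end

section \<open>Weak limits of absolutely continuous measures\<close>

lemma circle_integral_uniform:
  fixes f :: "complex \<Rightarrow> 'a :: {banach, second_countable_topology}"
  assumes "f \<in> borel_measurable \<mm>"
  shows "(\<integral>z. f z \<partial>\<mm>) = (\<integral>t. f (cis t) \<partial>uniform_measure lborel {0..<2 * pi})"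
  unfolding circle_measure_def
  by (rule integral_distr[OF measurable_cis_uniform]) (use assms in \<open>simp add: circle_measurable_iff\<close>)

text \<open>The densities are carried to an interval of the real line, where tightness yields a
  weakly convergent subsequence, and the limit is pushed back by \<open>cis\<close>. Mass near the
  ends of the interval does no harm: a test function composed with \<open>cis\<close> is continuous
  on the whole line.\<close>

lemma normalized_density_weak_limit:
  fixes v :: "nat \<Rightarrow> complex \<Rightarrow> real"
  assumes v: "\<And>n. v n \<in> borel_measurable \<mm>" "\<And>n x. 0 \<le> v n x"
    "\<And>n. integrable \<mm> (v n)" "\<And>n. (\<integral>z. v n z \<partial>\<mm>) = 1"
  obtains r M where "strict_mono (r :: nat \<Rightarrow> nat)" "finite_measure M" "sets M = sets circle_borel"
    "\<And>f :: complex \<Rightarrow> real. continuous_on (sphere 0 1) f \<Longrightarrow>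
      (\<lambda>n. \<integral>z. v (r n) z * f z \<partial>\<mm>) \<longlonglongrightarrow> (\<integral>z. f z \<partial>M)"
proof -
  let ?U = "uniform_measure lborel {0..<2 * pi}"
  interpret U: prob_space ?U by (rule prob_space_uniform_measure) auto
  have cisU [measurable]: "cis \<in> measurable ?U \<mm>"
    using measurable_cis_uniform by (simp add: measurable_cong_sets[OF refl sets_circle_measure])
  have [measurable]: "(\<lambda>t. v n (cis t)) \<in> borel_measurable ?U" for n
    using measurable_compose[OF cisU v(1)] by simp
  then have vm [measurable]: "(\<lambda>t. v n (cis t)) \<in> borel_measurable borel" for n by simp
  define N where "N n = density ?U (\<lambda>t. ennreal (v n (cis t)))" for n
  have N_int: "(\<integral>t. g (cis t) \<partial>N n) = (\<integral>z. v n z * g z \<partial>\<mm>)"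
    if g: "g \<in> borel_measurable \<mm>" for g :: "complex \<Rightarrow> real" and n
  proof -
    have "(\<integral>t. g (cis t) \<partial>N n) = (\<integral>t. v n (cis t) *\<^sub>R g (cis t) \<partial>?U)"
      unfolding N_def using measurable_compose[OF cisU g] v(2) by (intro integral_density) auto
    also have "\<dots> = (\<integral>z. v n z * g z \<partial>\<mm>)"
      using g v(1) by (subst circle_integral_uniform) auto
    finally show ?thesis .
  qed
  have vU: "integrable ?U (\<lambda>t. v n (cis t))" "(\<integral>t. v n (cis t) \<partial>?U) = 1" for n
  proof -
    show "(\<integral>t. v n (cis t) \<partial>?U) = 1" using circle_integral_uniform[OF v(1)[of n]] v(4)[of n] by simp
    then show "integrable ?U (\<lambda>t. v n (cis t))" using not_integrable_integral_eq by fastforce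
  qed
  have N1: "emeasure (N n) UNIV = 1" for n
  proof -
    have "emeasure (N n) UNIV = (\<integral>\<^sup>+t. ennreal (v n (cis t)) \<partial>?U)"
      unfolding N_def by (subst emeasure_density) auto
    also have "\<dots> = ennreal 1" using nn_integral_eq_integral[OF vU(1)[of n]] v(2) vU(2)[of n] by simp
    finally show ?thesis by simp
  qed
  have N_rd: "real_distribution (N n)" for n
  proof -
    have "prob_space (N n)" by (rule prob_spaceI) (use N1 in \<open>simp add: N_def\<close>)
    then show ?thesis by (intro real_distribution.intro real_distribution_axioms.intro) (simp_all add: N_def)
  qed
  have N_Icc: "measure (N n) {-1<..2*pi} = 1" for n
  proof -
    interpret N: real_distribution "N n" by (rule N_rd)
    have "AE t in N n. t \<in> {-1<..2*pi}"
    proof -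
      have "AE t in ?U. t \<in> {0..<2*pi}" by (rule AE_uniform_measureI) auto
      then have "AE t in ?U. t \<in> {-1<..2*pi}" by eventually_elim auto
      then show ?thesis unfolding N_def by (subst AE_density) auto
    qed
    then show ?thesis using N.prob_eq_1 by simp
  qed
  have "tight N"
    unfolding tight_def
  proof (intro conjI allI impI)
    fix e :: real assume e: "e > 0"
    show "\<exists>a b. a < b \<and> (\<forall>n. 1 - e < measure (N n) {a<..b})"
    proof (intro exI conjI allI)
      show "- 1 < 2 * pi" using pi_gt_zero by linarith
      show "1 - e < measure (N n) {-1<..2*pi}" for n using e by (simp add: N_Icc)
    qed
  qed (rule N_rd)
  then obtain r M where r: "strict_mono r" and M: "real_distribution M" and lim: "weak_conv_m (N \<circ> r) M"
    using tight_imp_convergent_subsubsequence[of N "\<lambda>n. n"] by (auto simp: strict_mono_def comp_def)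
  interpret M: real_distribution M by (rule M)
  have cisM: "cis \<in> measurable M circle_borel"
    using measurable_cis_circle by (simp add: measurable_cong_sets[OF M.events_eq_borel refl])
  show ?thesis
  proof (rule that[OF r, of "distr M circle_borel cis"])
    show "finite_measure (distr M circle_borel cis)"
      using M.prob_space_distr[OF cisM] by (simp add: prob_space_def)
    fix f :: "complex \<Rightarrow> real" assume f: "continuous_on (sphere 0 1) f"
    have fm: "f \<in> borel_measurable circle_borel"
      unfolding circle_borel_def by (rule borel_measurable_continuous_on_restrict[OF f])
    have fc: "isCont (\<lambda>t. f (cis t)) t" for t
    proof -
      have "continuous_on UNIV (\<lambda>t. f (cis t))"
        by (rule continuous_on_compose2[OF f continuous_on_cis[OF continuous_on_id]]) auto
      then show ?thesis by (simp add: continuous_on_eq_continuous_at)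
    qed
    have "compact (f ` sphere 0 1)" by (intro compact_continuous_image f compact_sphere)
    then obtain B where B: "\<And>x. x \<in> f ` sphere 0 1 \<Longrightarrow> norm x \<le> B"
      using compact_imp_bounded bounded_iff by metis
    have "(\<lambda>n. \<integral>t. f (cis t) \<partial>(N \<circ> r) n) \<longlonglongrightarrow> (\<integral>t. f (cis t) \<partial>M)"
    proof (rule weak_conv_imp_integral_bdd_continuous_conv[OF _ M lim])
      show "\<And>n. real_distribution ((N \<circ> r) n)" using N_rd by simp
      show "\<And>t. isCont (\<lambda>t. f (cis t)) t" by (rule fc)
      show "\<And>t. norm (f (cis t)) \<le> B" by (rule B) auto
    qed
    moreover have "(\<integral>t. f (cis t) \<partial>M) = (\<integral>z. f z \<partial>distr M circle_borel cis)"
      by (rule integral_distr[OF cisM fm, symmetric])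
    ultimately show "(\<lambda>n. \<integral>z. v (r n) z * f z \<partial>\<mm>) \<longlonglongrightarrow> (\<integral>z. f z \<partial>distr M circle_borel cis)"
      using N_int[of f] fm by (simp add: circle_measurable_iff)
  qed simp
qed

text \<open>Along a subsequence the masses converge to some \<open>l\<close>; the densities are
  normalised, and the weak limit is multiplied by \<open>l\<close>.\<close>

lemma density_weak_limit:
  fixes w :: "nat \<Rightarrow> complex \<Rightarrow> real"
  assumes w: "\<And>n. w n \<in> borel_measurable \<mm>" "\<And>n x. 0 \<le> w n x"
    "\<And>n. integrable \<mm> (w n)" "\<And>n. (\<integral>z. w n z \<partial>\<mm>) \<le> R"
  obtains r M where "strict_mono (r :: nat \<Rightarrow> nat)" "finite_measure M" "sets M = sets circle_borel"
    "\<And>f :: complex \<Rightarrow> real. continuous_on (sphere 0 1) f \<Longrightarrow>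
      (\<lambda>n. \<integral>z. w (r n) z * f z \<partial>\<mm>) \<longlonglongrightarrow> (\<integral>z. f z \<partial>M)"
proof -
  define m where "m n = (\<integral>z. w n z \<partial>\<mm>)" for n
  have m0: "0 \<le> m n" and mR: "m n \<le> R" for n using w by (auto simp: m_def)
  have "seq_compact {0..R}" by (simp add: compact_imp_seq_compact)
  then obtain l s where s: "strict_mono s" "(m \<circ> s) \<longlonglongrightarrow> l" "l \<in> {0..R}"
    using m0 mR by (elim seq_compactE[of _ m]) auto
  \<comment> \<open>The summand \<open>1 / Suc n\<close> keeps the total mass positive, also when it tends to \<open>0\<close>.\<close>
  define d where "d n = inverse (real (Suc n))" for n
  have d: "d n > 0" for n by (simp add: d_def)
  define v where "v n z = (w (s n) z + d n) / (m (s n) + d n)" for n z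
  have md: "m (s n) + d n > 0" for n using m0[of "s n"] d[of n] by linarith
  obtain r M where r: "strict_mono (r :: nat \<Rightarrow> nat)" and M: "finite_measure M" "sets M = sets circle_borel"
    and lim: "\<And>f :: complex \<Rightarrow> real. continuous_on (sphere 0 1) f \<Longrightarrow>
      (\<lambda>n. \<integral>z. v (r n) z * f z \<partial>\<mm>) \<longlonglongrightarrow> (\<integral>z. f z \<partial>M)"
  proof (rule normalized_density_weak_limit[of v])
    fix n
    show "v n \<in> borel_measurable \<mm>" unfolding v_def[abs_def] using w(1) by measurable
    show "0 \<le> v n x" for x using w(2)[of "s n" x] md[of n] d[of n] by (simp add: v_def)
    show "integrable \<mm> (v n)" unfolding v_def[abs_def] using w(3)[of "s n"] by simp
    show "(\<integral>z. v n z \<partial>\<mm>) = 1"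
      unfolding v_def using w(3)[of "s n"] md[of n] circle.prob_space by (simp add: m_def)
  qed blast
  interpret M: finite_measure M by (rule M)
  show ?thesis
  proof (rule that[of "s \<circ> r" "density M (\<lambda>_. ennreal l)"])
    show "strict_mono (s \<circ> r)" using s(1) r by (rule strict_mono_o)
    show "finite_measure (density M (\<lambda>_. ennreal l))"
      by (rule finite_measureI) (simp add: emeasure_density_const ennreal_mult_eq_top_iff)
    fix f :: "complex \<Rightarrow> real" assume f: "continuous_on (sphere 0 1) f"
    have fm: "f \<in> borel_measurable circle_borel"
      unfolding circle_borel_def by (rule borel_measurable_continuous_on_restrict[OF f])
    have fmM: "f \<in> borel_measurable M" using fm by (simp add: measurable_cong_sets[OF M(2) refl])
    have "compact (f ` sphere 0 1)" by (intro compact_continuous_image f compact_sphere)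
    then obtain B where B: "\<And>x. x \<in> f ` sphere 0 1 \<Longrightarrow> norm x \<le> B"
      using compact_imp_bounded bounded_iff by metis
    have fi: "integrable \<mm> f" "integrable \<mm> (\<lambda>z. w n z * f z)" for n
    proof -
      show "integrable \<mm> f"
        using B fm by (intro circle.integrable_const_bound[of _ B]) (auto simp: circle_measurable_iff)
      show "integrable \<mm> (\<lambda>z. w n z * f z)"
      proof (rule Bochner_Integration.integrable_bound[of _ "\<lambda>z. B * w n z"])
        show "AE z in \<mm>. norm (w n z * f z) \<le> norm (B * w n z)"
        proof (rule AE_I2)
          fix z assume "z \<in> space \<mm>"
          then have "norm (f z) \<le> \<bar>B\<bar>" using B[of "f z"] by auto
          then have "norm (f z) * \<bar>w n z\<bar> \<le> \<bar>B\<bar> * \<bar>w n z\<bar>" by (intro mult_right_mono) auto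
          then show "norm (w n z * f z) \<le> norm (B * w n z)" by (simp add: abs_mult mult.commute)
        qed
      qed (use w fm in \<open>auto simp: circle_measurable_iff\<close>)
    qed
    have d0: "(\<lambda>n. d (r n)) \<longlonglongrightarrow> 0"
      using LIMSEQ_subseq_LIMSEQ[OF LIMSEQ_inverse_real_of_nat r] by (simp add: d_def comp_def)
    have mr: "(\<lambda>n. m (s (r n))) \<longlonglongrightarrow> l"
      using LIMSEQ_subseq_LIMSEQ[OF s(2) r] by (simp add: comp_def)
    have "(\<lambda>n. (m (s (r n)) + d (r n)) * (\<integral>z. v (r n) z * f z \<partial>\<mm>) - d (r n) * (\<integral>z. f z \<partial>\<mm>))
        \<longlonglongrightarrow> (l + 0) * (\<integral>z. f z \<partial>M) - 0 * (\<integral>z. f z \<partial>\<mm>)"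
      by (intro tendsto_intros mr d0 lim f)
    moreover have "(m (s (r n)) + d (r n)) * (\<integral>z. v (r n) z * f z \<partial>\<mm>) - d (r n) * (\<integral>z. f z \<partial>\<mm>)
        = (\<integral>z. w ((s \<circ> r) n) z * f z \<partial>\<mm>)" for n
    proof -
      have "(m (s (r n)) + d (r n)) * (\<integral>z. v (r n) z * f z \<partial>\<mm>)
          = (\<integral>z. (m (s (r n)) + d (r n)) * (v (r n) z * f z) \<partial>\<mm>)" by simp
      also have "\<dots> = (\<integral>z. w (s (r n)) z * f z + d (r n) * f z \<partial>\<mm>)"
        using md[of "r n"] by (intro Bochner_Integration.integral_cong refl) (simp add: v_def field_simps)
      also have "\<dots> = (\<integral>z. w (s (r n)) z * f z \<partial>\<mm>) + d (r n) * (\<integral>z. f z \<partial>\<mm>)"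
        using fi by simp
      finally show ?thesis by simp
    qed
    moreover have "(\<integral>z. f z \<partial>density M (\<lambda>_. ennreal l)) = l * (\<integral>z. f z \<partial>M)"
      using s(3) fmM by (subst integral_density) auto
    ultimately show "(\<lambda>n. \<integral>z. w ((s \<circ> r) n) z * f z \<partial>\<mm>) \<longlonglongrightarrow> (\<integral>z. f z \<partial>density M (\<lambda>_. ennreal l))"
      by simp
  qed (use M in simp)
qed

section \<open>A countable family of test functions\<close>

text \<open>Separability passes to subsets: for each \<open>q\<close> and precision \<open>n\<close>
  a member of \<open>S\<close> near \<open>q\<close> is chosen if there is one, with
  \<open>F0\<close> as default, and two approximations through \<open>q\<close> cost less than
  \<open>e / 2\<close> each.\<close>

lemma countable_dense_family:
  fixes X :: "'a set" and S Q :: "('a \<Rightarrow> 'b :: metric_space) set"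
  assumes Q: "countable Q" and S: "S \<noteq> {}"
    and approx: "\<And>F e. F \<in> S \<Longrightarrow> e > 0 \<Longrightarrow> \<exists>q\<in>Q. \<forall>x\<in>X. dist (F x) (q x) < e"
  obtains G :: "nat \<Rightarrow> 'a \<Rightarrow> 'b" where "range G \<subseteq> S"
    "\<And>F e. F \<in> S \<Longrightarrow> e > 0 \<Longrightarrow> \<exists>i. \<forall>x\<in>X. dist (F x) (G i x) < e"
proof -
  obtain F0 where F0: "F0 \<in> S" using S by blast
  define near where "near q n F \<longleftrightarrow> F \<in> S \<and> (\<forall>x\<in>X. dist (F x) (q x) < inverse (real (Suc n)))" for q F and n :: nat
  define P where "P = (\<lambda>(q, n). if \<exists>F. near q n F then SOME F. near q n F else F0) ` (Q \<times> (UNIV :: nat set))"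
  have PS: "P \<subseteq> S"
  proof -
    have "(if \<exists>F. near q n F then SOME F. near q n F else F0) \<in> S" for q n
      using someI_ex[of "near q n"] F0 by (auto simp: near_def)
    then show ?thesis by (auto simp: P_def)
  qed
  have "Q \<noteq> {}" using approx[OF F0, of 1] by auto
  then have "P \<noteq> {}" "countable P" using Q by (auto simp: P_def)
  then have rng: "range (from_nat_into P) = P" by (rule range_from_nat_into)
  show ?thesis
  proof (rule that[of "from_nat_into P"])
    show "range (from_nat_into P) \<subseteq> S" using rng PS by simp
    fix F and e :: real assume F: "F \<in> S" and e: "e > 0"
    obtain n where n: "inverse (real (Suc n)) < e / 2" using reals_Archimedean[of "e / 2"] e by auto
    obtain q where q: "q \<in> Q" "\<forall>x\<in>X. dist (F x) (q x) < inverse (real (Suc n))"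
      using approx[OF F, of "inverse (real (Suc n))"] by auto
    have ex: "near q n F" using F q(2) by (simp add: near_def)
    define F' where "F' = (SOME F. near q n F)"
    have F': "near q n F'" unfolding F'_def by (rule someI[of _ F], rule ex)
    have "F' \<in> P" using q(1) ex by (auto simp: P_def F'_def intro!: image_eqI[of _ _ "(q, n)"])
    then have "F' \<in> range (from_nat_into P)" unfolding rng .
    then obtain i where i: "from_nat_into P i = F'" by (metis rangeE)
    have "dist (F x) (F' x) < e" if "x \<in> X" for x
      using dist_triangle2[of "F x" "F' x" "q x"] q(2) F' n that unfolding near_def by fastforce
    then show "\<exists>i. \<forall>x\<in>X. dist (F x) (from_nat_into P i x) < e" using i by blast
  qed
qed

text \<open>Polynomials with coefficients in a countable dense set suffice: \<open>F\<close> is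
  replaced by a dilation, the dilation by a partial sum, and the coefficients are rounded, each at a
  cost of at most \<open>e / 4\<close>.\<close>

lemma disc_algebra_separable:
  obtains Q :: "(complex \<Rightarrow> complex) set" where "countable Q"
    "\<And>F e. continuous_on (cball 0 1) F \<Longrightarrow> F holomorphic_on ball 0 1 \<Longrightarrow> e > 0 \<Longrightarrow>
       \<exists>q\<in>Q. \<forall>x\<in>sphere 0 1. dist (F x) (q x) < e"
proof -
  obtain D :: "complex set" where D: "countable D" "\<And>X. open X \<Longrightarrow> X \<noteq> {} \<Longrightarrow> \<exists>d\<in>D. d \<in> X"
    by (rule countable_dense_setE) blast
  define Q where "Q = (\<lambda>xs z. \<Sum>n<length xs. xs ! n * z ^ n) ` lists D"
  show ?thesis
  proof (rule that[of Q])
    show "countable Q" unfolding Q_def using D(1) by simp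
    fix F :: "complex \<Rightarrow> complex" and e :: real
    assume F: "continuous_on (cball 0 1) F" "F holomorphic_on ball 0 1" and e: "e > 0"
    have "uniformly_continuous_on (cball 0 1) F" by (intro compact_uniformly_continuous F compact_cball)
    then obtain d where d: "d > 0" "\<And>x y. x \<in> cball 0 1 \<Longrightarrow> y \<in> cball 0 1 \<Longrightarrow> dist y x < d \<Longrightarrow> dist (F y) (F x) < e / 4"
      using e unfolding uniformly_continuous_on_def by (metis divide_pos_pos zero_less_numeral)
    define r where "r = max 0 (1 - d / 2)"
    have r: "0 \<le> r" "r < 1" "1 - r < d" using d(1) by (auto simp: r_def)
    have sm: "summable (\<lambda>n. cmod (taylor F n) * r ^ n)"
      by (rule power_series_dilation_summable[of _ F]) (use taylor_sums[OF F(2)] r in auto)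
    obtain N where N: "\<And>n. n \<ge> N \<Longrightarrow> cmod (\<Sum>i. cmod (taylor F (i + n)) * r ^ (i + n)) < e / 4"
      using suminf_exist_split[OF _ sm, of "e / 4"] e by auto
    have "\<exists>c\<in>D. dist c (taylor F n * of_real r ^ n) < e / (4 * real (Suc N))" for n
      using D(2)[of "ball (taylor F n * of_real r ^ n) (e / (4 * real (Suc N)))"] e
      unfolding mem_ball by (simp add: dist_commute not_le del: of_nat_Suc)
    then obtain c where c: "\<And>n. c n \<in> D" "\<And>n. dist (c n) (taylor F n * of_real r ^ n) < e / (4 * real (Suc N))"
      by metis
    define q where "q z = (\<Sum>n<N. c n * z ^ n)" for z
    have "q = (\<lambda>z. \<Sum>n<length (map c [0..<N]). map c [0..<N] ! n * z ^ n)" by (auto simp: q_def)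
    moreover have "map c [0..<N] \<in> lists D" using c(1) by auto
    ultimately have qQ: "q \<in> Q" unfolding Q_def by blast
    have "dist (F z) (q z) < e" if z: "z \<in> sphere 0 1" for z
    proof -
      have rz: "cmod (of_real r * z) = r" using z r by (simp add: norm_mult)
      have d1: "dist (F z) (F (of_real r * z)) < e / 4"
      proof (rule d(2))
        have "dist z (of_real r * z) = cmod ((1 - of_real r) * z)" by (simp add: dist_norm algebra_simps)
        also have "\<dots> = 1 - r" using z r norm_of_real[of "1 - r", where 'a=complex] by (simp add: norm_mult)
        finally show "dist z (of_real r * z) < d" using r by simp
      qed (use z rz r in auto)
      have su: "(\<lambda>n. taylor F n * (of_real r * z) ^ n) sums F (of_real r * z)"
        by (rule taylor_sums[OF F(2)]) (use rz r in simp)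
      have tn: "cmod (taylor F n * (of_real r * z) ^ n) = cmod (taylor F n) * r ^ n" for n
        using rz by (simp add: norm_mult norm_power)
      have d2: "dist (F (of_real r * z)) (\<Sum>n<N. taylor F n * (of_real r * z) ^ n) < e / 4"
      proof -
        have "F (of_real r * z) - (\<Sum>n<N. taylor F n * (of_real r * z) ^ n) = (\<Sum>i. taylor F (i + N) * (of_real r * z) ^ (i + N))"
          using suminf_minus_initial_segment[OF sums_summable[OF su], of N] sums_unique[OF su] by simp
        also have "cmod \<dots> \<le> (\<Sum>i. cmod (taylor F (i + N) * (of_real r * z) ^ (i + N)))"
          by (rule summable_norm) (simp only: tn summable_ignore_initial_segment[OF sm])
        also have "\<dots> \<le> cmod (\<Sum>i. cmod (taylor F (i + N)) * r ^ (i + N))" unfolding tn by simp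
        also have "\<dots> < e / 4" by (rule N) simp
        finally show ?thesis by (simp add: dist_norm)
      qed
      have d3: "dist (\<Sum>n<N. taylor F n * (of_real r * z) ^ n) (q z) \<le> e / 4"
      proof -
        have "dist (\<Sum>n<N. taylor F n * (of_real r * z) ^ n) (q z) \<le> (\<Sum>n<N. dist (taylor F n * (of_real r * z) ^ n) (c n * z ^ n))"
          unfolding q_def dist_norm sum_subtractf[symmetric] by (rule norm_sum)
        also have "\<dots> \<le> (\<Sum>n<N. e / (4 * real (Suc N)))"
        proof (rule sum_mono)
          fix n
          have "taylor F n * (of_real r * z) ^ n - c n * z ^ n = (taylor F n * of_real r ^ n - c n) * z ^ n"
            by (simp add: power_mult_distrib algebra_simps)
          then have "dist (taylor F n * (of_real r * z) ^ n) (c n * z ^ n) = dist (c n) (taylor F n * of_real r ^ n)"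
            using z by (simp add: dist_norm norm_mult norm_power norm_minus_commute)
          then show "dist (taylor F n * (of_real r * z) ^ n) (c n * z ^ n) \<le> e / (4 * real (Suc N))"
            using c(2)[of n] by simp
        qed
        also have "\<dots> \<le> e / 4" using e by (simp add: field_simps)
        finally show ?thesis .
      qed
      have "dist (F z) (q z) \<le> dist (F z) (F (of_real r * z)) + dist (F (of_real r * z)) (\<Sum>n<N. taylor F n * (of_real r * z) ^ n)
          + dist (\<Sum>n<N. taylor F n * (of_real r * z) ^ n) (q z)"
        by (rule order_trans[OF dist_triangle add_right_mono[OF dist_triangle]])
      then show ?thesis using d1 d2 d3 e by linarith
    qed
    then show "\<exists>q\<in>Q. \<forall>x\<in>sphere 0 1. dist (F x) (q x) < e" using qQ by blast
  qed
qed

context inner_fun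
begin

text \<open>The value at 0 makes the quotient holomorphic there. On the circle dividing by
  \<open>y\<close> is multiplying by \<open>cnj y\<close>, which turns the test function
  \<open>\<Theta> y * y ^ j\<close> into \<open>\<Theta> y * y ^ Suc j\<close>; the constant
  \<open>G 0\<close> contributes nothing, since that function has mean 0.\<close>

lemma K_cont_backward_shift:
  assumes G: "G \<in> K_cont \<Theta>"
  shows "(\<lambda>z. if z = 0 then deriv G 0 else (G z - G 0) / (z - 0)) \<in> K_cont \<Theta>" (is "?S \<in> _")
proof -
  note G' = K_contD[OF G]
  have hol: "?S holomorphic_on ball 0 1" by (rule pole_lemma_open[OF G'(3) open_ball])
  have cont: "continuous_on (cball 0 1) ?S"
    unfolding continuous_on_eq_continuous_within
  proof
    fix x :: complex assume x: "x \<in> cball 0 1"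
    show "continuous (at x within cball 0 1) ?S"
    proof (cases "x = 0")
      case True
      have "continuous (at 0) ?S"
        using holomorphic_on_imp_continuous_on[OF hol] continuous_on_interior[of "ball 0 1" ?S 0] by simp
      then show ?thesis using True continuous_at_imp_continuous_at_within by blast
    next
      case False
      have "continuous (at x within cball 0 1) (\<lambda>z. (G z - G 0) / (z - 0))"
        using G'(2) x False by (intro continuous_intros) (auto simp: continuous_on_eq_continuous_within)
      then show ?thesis
        by (rule continuous_transform_within[of _ _ _ "cmod x"]) (use False x in auto)
    qed
  qed
  have "L2_inner \<mm> ?S (\<lambda>y. \<Theta> y * y ^ j) = 0" for j
  proof -
    have TL: "(\<lambda>y. \<Theta> y * y ^ Suc j) \<in> L2_space \<mm>" by (rule Theta_mult_L2[OF sphere_pow_L2])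
    have "L2_inner \<mm> ?S (\<lambda>y. \<Theta> y * y ^ j) = L2_inner \<mm> (\<lambda>y. G y - G 0 * y ^ 0) (\<lambda>y. \<Theta> y * y ^ Suc j)"
      unfolding L2_inner_def
    proof (intro Bochner_Integration.integral_cong refl)
      fix y assume "y \<in> space \<mm>"
      then have z: "cmod y = 1" "y \<noteq> 0" by auto
      have "y * cnj y = 1" using z complex_norm_square[of y] by simp
      then have "cnj y = 1 / y" using z(2) by (simp add: eq_divide_eq mult.commute)
      then have "?S y = (G y - G 0) * cnj y" using z(2) by simp
      then show "?S y * cnj (\<Theta> y * y ^ j) = (G y - G 0 * y ^ 0) * cnj (\<Theta> y * y ^ Suc j)"
        by (simp only: complex_cnj_mult complex_cnj_power power_Suc power_0 mult_1_left mult_1_right mult_ac)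
    qed
    also have "\<dots> = L2_inner \<mm> G (\<lambda>y. \<Theta> y * y ^ Suc j) - G 0 * L2_inner \<mm> (\<lambda>y. y ^ 0) (\<lambda>y. \<Theta> y * y ^ Suc j)"
      unfolding L2_inner_diff_left[OF K_L2[OF G'(1)] L2_scale[OF sphere_pow_L2] TL] L2_inner_scale_left ..
    also have "L2_inner \<mm> G (\<lambda>y. \<Theta> y * y ^ Suc j) = 0" using G'(1) model_space_iff by blast
    also have "L2_inner \<mm> (\<lambda>y. y ^ 0) (\<lambda>y. \<Theta> y * y ^ Suc j) = cnj (fourier (\<lambda>y. \<Theta> y * y ^ Suc j) (int 0))"
      unfolding L2_inner_pow[symmetric] by (rule L2_inner_commute)
    also have "\<dots> = 0" unfolding fourier_mult_pow using H2_neg[OF Theta_H2, of "int 0 - int (Suc j)"] by simp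
    finally show ?thesis by simp
  qed
  then have "?S \<in> K" using model_space_iff disc_algebra_H2[OF cont hol] by blast
  then show ?thesis using cont hol by (simp add: K_cont_def)
qed

text \<open>If all functions, and hence all backward shifts, vanish at \<open>w\<close>, then
  \<open>G 0 = 0\<close> for every \<open>G\<close>. So \<open>F\<close> can be divided by
  \<open>z\<close> arbitrarily often; the quotients keep the bound of \<open>F\<close> on the
  circle, and \<open>cmod (F y) \<le> cmod y ^ n * B\<close> tends to 0 in the disc. Its use is to
  bound a sum of squared moduli away from 0 on the circle.\<close>

lemma K_cont_common_zero:
  assumes z: "w \<in> sphere 0 1" and zero: "\<And>G. G \<in> K_cont \<Theta> \<Longrightarrow> G w = 0"
    and F: "F \<in> K_cont \<Theta>" and x: "x \<in> sphere 0 1"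
  shows "F x = 0"
proof -
  let ?S = "\<lambda>G z. if z = 0 then deriv G 0 else (G z - G 0) / (z - 0)"
  have G0: "G 0 = 0" if "G \<in> K_cont \<Theta>" for G
    using zero[OF K_cont_backward_shift[OF that]] zero[OF that] z by (auto split: if_splits)
  have it: "(?S ^^ n) F \<in> K_cont \<Theta> \<and> (\<forall>z. F z = z ^ n * (?S ^^ n) F z)" for n
  proof (induction n)
    case (Suc n)
    let ?G = "(?S ^^ n) F"
    have G: "?G \<in> K_cont \<Theta>" using Suc by simp
    have "F z = z ^ Suc n * ?S ?G z" for z
    proof -
      have "F z = z ^ n * ?G z" using Suc by blast
      also have "?G z = z * ?S ?G z" using G0[OF G] by (cases "z = 0") simp_all
      finally show ?thesis by (simp only: power_Suc2 mult.assoc)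
    qed
    then show ?case unfolding funpow.simps(2) o_apply using K_cont_backward_shift[OF G] by blast
  qed (use F in simp)
  have "F y = 0" if y: "y \<in> ball 0 1" for y
  proof -
    obtain B where B: "0 < B" "\<And>w. w \<in> sphere 0 1 \<Longrightarrow> cmod (F w) \<le> B"
      using continuous_on_sphere_bounded[OF K_contD(4)[OF F]] by metis
    have "cmod (F y) \<le> cmod y ^ n * B" for n
    proof -
      obtain G where G: "G \<in> K_cont \<Theta>" and FG: "\<And>z. F z = z ^ n * G z" using it[of n] by blast
      have GB: "cmod (G \<xi>) \<le> B" if "\<xi> \<in> sphere 0 1" for \<xi>
        using B(2)[OF that] that FG[of \<xi>] by (simp add: norm_mult norm_power)
      have "cmod (G y) \<le> B"
      proof (rule disc_algebra_sup_bound[OF K_contD(2,3)[OF G]])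
        show "AE \<xi> in \<mm>. cmod (G \<xi>) \<le> B" by (rule AE_I2) (simp add: GB)
      qed (use y in simp)
      then show ?thesis using FG[of y] by (simp add: norm_mult norm_power mult_left_mono)
    qed
    moreover have "(\<lambda>n. cmod y ^ n * B) \<longlonglongrightarrow> 0 * B"
      using y by (intro tendsto_mult_right LIMSEQ_realpow_zero) auto
    ultimately have "cmod (F y) \<le> 0 * B" by (intro LIMSEQ_le_const[of "\<lambda>n. cmod y ^ n * B"]) blast+
    then show ?thesis by simp
  qed
  then have "F x = 0"
    by (rule continuous_constant_on_closure[of "ball 0 1", rotated]) (use K_contD(2)[OF F] x in simp_all)
  then show ?thesis .
qed

end

section \<open>A moment problem on the circle\<close>

lemma circle_sums_swap:
  fixes g :: "complex \<Rightarrow> 'a :: {banach, second_countable_topology}"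
  assumes g: "integrable \<mm> g" and p: "\<And>i. p i \<in> borel_measurable \<mm>"
    and p1: "\<And>i z. z \<in> sphere 0 1 \<Longrightarrow> \<bar>p i z\<bar> \<le> (1::real)" and b: "summable (\<lambda>i. \<bar>b i\<bar> :: real)"
  shows "(\<lambda>i. b i *\<^sub>R (\<integral>z. p i z *\<^sub>R g z \<partial>\<mm>)) sums
    (\<integral>z. (\<Sum>i. b i * p i z) *\<^sub>R g z \<partial>\<mm>)"
proof -
  have pg: "integrable \<mm> (\<lambda>z. p i z *\<^sub>R g z)" for i
    by (rule Bochner_Integration.integrable_bound[OF g])
       (use p g p1 in \<open>auto intro!: AE_I2 mult_left_le_one_le\<close>)
  have sm: "summable (\<lambda>i. b i * p i z)" if "z \<in> sphere 0 1" for z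
    by (rule summable_comparison_test'[OF b, of 0]) (use p1[OF that] in \<open>auto simp: abs_mult intro: mult_left_le\<close>)
  have "(\<lambda>i. \<integral>z. (b i * p i z) *\<^sub>R g z \<partial>\<mm>) sums (\<integral>z. (\<Sum>i. (b i * p i z) *\<^sub>R g z) \<partial>\<mm>)"
  proof (rule sums_integral)
    show bpg: "integrable \<mm> (\<lambda>z. (b i * p i z) *\<^sub>R g z)" for i
      using integrable_scaleR_right[OF pg[of i], of "b i"] by simp
    have le: "norm ((b i * p i z) *\<^sub>R g z) \<le> \<bar>b i\<bar> * norm (g z)" if "z \<in> sphere 0 1" for i z
      using p1[OF that, of i] by (auto simp: abs_mult intro!: mult_right_mono mult_left_le)
    show "AE z in \<mm>. summable (\<lambda>i. norm ((b i * p i z) *\<^sub>R g z))"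
    proof (rule AE_I2)
      fix z assume "z \<in> space \<mm>"
      then show "summable (\<lambda>i. norm ((b i * p i z) *\<^sub>R g z))"
        using le by (intro summable_comparison_test'[OF summable_mult2[OF b, of "norm (g z)"], of 0]) auto
    qed
    have le2: "(\<integral>z. norm ((b i * p i z) *\<^sub>R g z) \<partial>\<mm>) \<le> \<bar>b i\<bar> * (\<integral>z. norm (g z) \<partial>\<mm>)" for i
    proof -
      have "(\<integral>z. norm ((b i * p i z) *\<^sub>R g z) \<partial>\<mm>) \<le> (\<integral>z. \<bar>b i\<bar> * norm (g z) \<partial>\<mm>)"
        by (rule integral_mono[OF integrable_norm[OF bpg]]) (use g le[of _ i] in auto)
      then show ?thesis by simp
    qed
    show "summable (\<lambda>i. \<integral>z. norm ((b i * p i z) *\<^sub>R g z) \<partial>\<mm>)"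
      by (rule summable_comparison_test'[OF summable_mult2[OF b, of "\<integral>z. norm (g z) \<partial>\<mm>"], of 0])
         (use le2 in simp)
  qed
  moreover have "(\<integral>z. (\<Sum>i. (b i * p i z) *\<^sub>R g z) \<partial>\<mm>) = (\<integral>z. (\<Sum>i. b i * p i z) *\<^sub>R g z \<partial>\<mm>)"
    by (intro Bochner_Integration.integral_cong refl) (simp add: suminf_scaleR_left[OF sm])
  moreover have "(\<integral>z. (b i * p i z) *\<^sub>R g z \<partial>\<mm>) = b i *\<^sub>R (\<integral>z. p i z *\<^sub>R g z \<partial>\<mm>)" for i
    unfolding scaleR_scaleR[symmetric] by (rule integral_scaleR_right)
  ultimately show ?thesis by simp
qed

text \<open>Residual sums carry the weights \<open>(1/2) ^ i\<close>, so series built from bounded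
  sequences converge absolutely and can be rearranged termwise.\<close>

definition bounded_seq :: "(nat \<Rightarrow> real) \<Rightarrow> bool" where
  "bounded_seq x \<longleftrightarrow> (\<exists>D. \<forall>i. \<bar>x i\<bar> \<le> D)"

lemma bounded_seqI: "(\<And>i. \<bar>x i\<bar> \<le> D) \<Longrightarrow> bounded_seq x"
  by (auto simp: bounded_seq_def)

lemma bounded_seq_add: "bounded_seq x \<Longrightarrow> bounded_seq y \<Longrightarrow> bounded_seq (\<lambda>i. x i + y i)"
  unfolding bounded_seq_def by (meson abs_triangle_ineq add_mono order_trans)

lemma bounded_seq_mult:
  assumes "bounded_seq x" "bounded_seq y" shows "bounded_seq (\<lambda>i. x i * y i)"
proof -
  obtain X Y where "\<And>i. \<bar>x i\<bar> \<le> X" "\<And>i. \<bar>y i\<bar> \<le> Y" using assms by (auto simp: bounded_seq_def)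
  then have "\<bar>x i * y i\<bar> \<le> X * Y" for i
    unfolding abs_mult by (intro mult_mono) (auto intro: order_trans[OF abs_ge_zero])
  then show ?thesis by (rule bounded_seqI)
qed

lemma bounded_seq_scale: "bounded_seq x \<Longrightarrow> bounded_seq (\<lambda>i. c * x i)"
  by (rule bounded_seq_mult[OF bounded_seqI[of "\<lambda>_. c" "\<bar>c\<bar>"]]) auto

lemma bounded_seq_diff: "bounded_seq x \<Longrightarrow> bounded_seq y \<Longrightarrow> bounded_seq (\<lambda>i. x i - y i)"
  using bounded_seq_add[of x "\<lambda>i. -1 * y i"] bounded_seq_scale[of y "-1"] by simp

lemma bounded_seq_summable:
  assumes "bounded_seq x"
  shows "summable (\<lambda>i. \<bar>(1/2) ^ i * x i\<bar>)" "summable (\<lambda>i. (1/2) ^ i * x i)"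
proof -
  obtain D where D: "\<And>i. \<bar>x i\<bar> \<le> D" using assms by (auto simp: bounded_seq_def)
  show "summable (\<lambda>i. \<bar>(1/2) ^ i * x i\<bar>)"
    by (rule summable_comparison_test'[OF summable_mult2[OF summable_geometric[of "1/2 :: real"], of D], of 0])
       (auto simp: abs_mult intro!: mult_left_mono D)
  then show "summable (\<lambda>i. (1/2) ^ i * x i)" by (rule summable_rabs_cancel)
qed

lemma quadratic_minimum_first_order:
  assumes d: "bounded_seq d" and y: "bounded_seq y"
    and min: "\<And>t. 0 < t \<Longrightarrow> t \<le> 1 \<Longrightarrow> (\<Sum>i. (1/2) ^ i * (d i)\<^sup>2) \<le> (\<Sum>i. (1/2) ^ i * (d i + t * y i)\<^sup>2)"
  shows "0 \<le> (\<Sum>i. (1/2) ^ i * (d i * y i))"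
proof -
  note sm = bounded_seq_summable(2)
  note s = sm[OF bounded_seq_mult[OF d d]] sm[OF bounded_seq_mult[OF d y]] sm[OF bounded_seq_mult[OF y y]]
  have "- (2 * (\<Sum>i. (1/2) ^ i * (d i * y i))) \<le> 0"
  proof (rule nonpos_if_quadratic_bound)
    fix t :: real assume t: "0 < t" "t \<le> 1"
    have "(\<lambda>i. (1/2) ^ i * (d i * d i) + (2 * t) * ((1/2) ^ i * (d i * y i)) + t\<^sup>2 * ((1/2) ^ i * (y i * y i))) sums
      ((\<Sum>i. (1/2) ^ i * (d i * d i)) + (2 * t) * (\<Sum>i. (1/2) ^ i * (d i * y i)) + t\<^sup>2 * (\<Sum>i. (1/2) ^ i * (y i * y i)))"
      by (intro sums_add sums_mult summable_sums s)
    moreover have "(\<lambda>i. (1/2) ^ i * (d i * d i) + (2 * t) * ((1/2) ^ i * (d i * y i)) + t\<^sup>2 * ((1/2) ^ i * (y i * y i)))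
      = (\<lambda>i. (1/2) ^ i * (d i + t * y i)\<^sup>2)"
      by (rule ext) (simp add: power2_eq_square algebra_simps)
    ultimately have "(\<Sum>i. (1/2) ^ i * (d i + t * y i)\<^sup>2) =
      (\<Sum>i. (1/2) ^ i * (d i * d i)) + (2 * t) * (\<Sum>i. (1/2) ^ i * (d i * y i)) + t\<^sup>2 * (\<Sum>i. (1/2) ^ i * (y i * y i))"
      by (simp add: sums_iff)
    then show "- (2 * (\<Sum>i. (1/2) ^ i * (d i * y i))) * t \<le> (\<Sum>i. (1/2) ^ i * (y i * y i)) * t\<^sup>2"
      using min[OF t] by (simp add: power2_eq_square algebra_simps)
  qed
  then show ?thesis by simp
qed

text \<open>
  The measure is a weak limit of densities \<open>w\<close> minimising
  \<open>\<Sum>i. 2\<^sup>-\<^sup>i (\<integral> w p\<^sub>i - l\<^sub>i)\<^sup>2\<close>. Moving the minimiser in the direction of an arbitrary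
  nonnegative density shows that the residuals \<open>d\<^sub>i\<close> satisfy the hypothesis of \<open>pos\<close>, and moving it
  towards \<open>0\<close> then forces \<open>d = 0\<close>.
\<close>

theorem moment_problem:
  fixes p :: "nat \<Rightarrow> complex \<Rightarrow> real"
  assumes p: "\<And>i. continuous_on (sphere 0 1) (p i)" "\<And>i u. u \<in> sphere 0 1 \<Longrightarrow> 0 \<le> p i u \<and> p i u \<le> 1"
    and l: "\<And>i. \<bar>l i\<bar> \<le> L"
    and \<delta>: "0 < \<delta>" "\<And>u. u \<in> sphere 0 1 \<Longrightarrow> \<delta> \<le> (\<Sum>i. (1/2) ^ i * p i u)"
    and pos: "\<And>d. bounded_seq d \<Longrightarrow> (AE u in \<mm>. 0 \<le> (\<Sum>i. (1/2) ^ i * d i * p i u)) \<Longrightarrow>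
      0 \<le> (\<Sum>i. (1/2) ^ i * (d i * l i))"
  obtains M where "finite_measure M" "sets M = sets circle_borel" "\<And>i. (\<integral>u. p i u \<partial>M) = l i"
proof -
  \<comment> \<open>Bounded nonnegative densities form a convex cone: adding a multiple of any
    density and shrinking towards 0 both stay inside.\<close>
  define W :: "(complex \<Rightarrow> real) set" where
    "W = {w \<in> borel_measurable \<mm>. (\<forall>x. 0 \<le> w x) \<and> (\<exists>B. \<forall>x. w x \<le> B)}"
  define c where "c w i = (\<integral>u. w u * p i u \<partial>\<mm>)" for w i
  define J where "J x = (\<Sum>i. (1/2) ^ i * (x i - l i)\<^sup>2)" for x :: "nat \<Rightarrow> real"
  note sm = bounded_seq_summable(2)
  have pm: "p i \<in> borel_measurable \<mm>" for i
    using borel_measurable_continuous_on_restrict[OF p(1)] by (simp add: circle_measurable_iff circle_borel_def)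
  have p1: "\<bar>p i u\<bar> \<le> 1" if "u \<in> sphere 0 1" for i u using p(2)[OF that, of i] by simp
  have Wi: "integrable \<mm> w" if w: "w \<in> W" for w
  proof -
    obtain B where "\<And>x. w x \<le> B" using w unfolding W_def by blast
    then show ?thesis using that by (intro circle.integrable_const_bound[of _ B]) (auto simp: W_def)
  qed
  have Wpi: "integrable \<mm> (\<lambda>u. w u * p i u)" if "w \<in> W" for w i
    by (rule Bochner_Integration.integrable_bound[OF Wi[OF that]])
       (use that pm p1 in \<open>auto simp: W_def abs_mult intro!: AE_I2 mult_left_le\<close>)
  have cb: "0 \<le> c w i \<and> c w i \<le> (\<integral>u. w u \<partial>\<mm>)" if w: "w \<in> W" for w i
  proof
    show "0 \<le> c w i" unfolding c_def using w p(2) by (intro integral_nonneg_AE AE_I2) (auto simp: W_def)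
    show "c w i \<le> (\<integral>u. w u \<partial>\<mm>)"
      unfolding c_def using w p(2) by (intro integral_mono Wi Wpi) (auto simp: W_def intro!: mult_left_le)
  qed
  have cbd: "bounded_seq (c w)" if "w \<in> W" for w
  proof (rule bounded_seqI)
    fix i show "\<bar>c w i\<bar> \<le> (\<integral>u. w u \<partial>\<mm>)" using cb[OF that, of i] by simp
  qed
  have lbd: "bounded_seq l" using l by (rule bounded_seqI)
  have Jsm: "summable (\<lambda>i. (1/2) ^ i * (x i - l i)\<^sup>2)" if "bounded_seq x" for x
    using sm[OF bounded_seq_mult[OF bounded_seq_diff[OF that lbd] bounded_seq_diff[OF that lbd]]] by (simp add: power2_eq_square)
  have J0: "0 \<le> J x" if "bounded_seq x" for x unfolding J_def by (intro suminf_nonneg Jsm that) simp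
  have cd: "(\<lambda>i. (1/2) ^ i * (d i * c w i)) sums (\<integral>u. w u * (\<Sum>i. (1/2) ^ i * d i * p i u) \<partial>\<mm>)"
    if w: "w \<in> W" and d: "bounded_seq d" for w d
    using circle_sums_swap[OF Wi[OF w] pm p1 bounded_seq_summable(1)[OF d]]
    by (simp add: c_def mult.assoc mult.commute[of _ "w _"])
  \<comment> \<open>The lower bound \<delta> turns the weighted sum of moments into a bound on the
    mass, and \<open>x \<le> x\<^sup>2 + 1\<close> bounds the moments by the squared residuals. A
    minimising sequence is thus bounded in L1 and has a weak limit.\<close>
  have mass: "\<delta> * (\<integral>u. w u \<partial>\<mm>) \<le> J (c w) + (1 + L) * 2" if w: "w \<in> W" for w
  proof -
    have one: "bounded_seq (\<lambda>_. 1)" by (rule bounded_seqI[of _ 1]) simp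
    have h0: "\<bar>\<Sum>i. (1/2) ^ i * p i u\<bar> \<le> 2" if "u \<in> sphere 0 1" for u
    proof -
      have b: "bounded_seq (\<lambda>i. p i u)" using p1[OF that] by (rule bounded_seqI)
      have "(\<Sum>i. (1/2) ^ i * p i u) \<le> (\<Sum>i. (1/2 :: real) ^ i)"
        using p(2)[OF that] by (intro suminf_le sm[OF b] summable_geometric) (auto intro: mult_left_le)
      also have "\<dots> = 2" using suminf_geometric[of "1/2 :: real"] by simp
      finally show ?thesis using suminf_nonneg[OF sm[OF b]] p(2)[OF that] by simp
    qed
    have "\<delta> * (\<integral>u. w u \<partial>\<mm>) = (\<integral>u. w u * \<delta> \<partial>\<mm>)" by simp
    also have "\<dots> \<le> (\<integral>u. w u * (\<Sum>i. (1/2) ^ i * 1 * p i u) \<partial>\<mm>)"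
    proof (rule integral_mono)
      show "integrable \<mm> (\<lambda>u. w u * (\<Sum>i. (1/2) ^ i * 1 * p i u))"
      proof (rule Bochner_Integration.integrable_bound)
        show "integrable \<mm> (\<lambda>u. 2 * w u)" using Wi[OF w] by simp
        show "(\<lambda>u. w u * (\<Sum>i. (1/2) ^ i * 1 * p i u)) \<in> borel_measurable \<mm>"
          using w by (intro borel_measurable_times borel_measurable_suminf borel_measurable_const pm) (simp add: W_def)
        show "AE u in \<mm>. norm (w u * (\<Sum>i. (1/2) ^ i * 1 * p i u)) \<le> norm (2 * w u)"
          using h0 by (intro AE_I2) (auto simp: abs_mult mult.commute[of _ "\<bar>w _\<bar>"] intro!: mult_left_mono)
      qed
    qed (use w \<delta>(2) Wi[OF w] in \<open>auto simp: W_def intro!: mult_left_mono\<close>)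
    also have "\<dots> = (\<Sum>i. (1/2) ^ i * (1 * c w i))" using cd[OF w one] by (rule sums_unique)
    also have "\<dots> \<le> (\<Sum>i. (1/2) ^ i * (c w i - l i)\<^sup>2 + (1 + L) * (1/2) ^ i)"
    proof (rule suminf_le)
      fix i
      have "x \<le> x\<^sup>2 + 1" for x :: real using sum_squares_ge_zero[of "x - 1/2" 0] by (simp add: power2_eq_square algebra_simps)
      from this[of "c w i - l i"] have "c w i \<le> (c w i - l i)\<^sup>2 + (1 + L)" using l[of i] by linarith
      from mult_left_mono[OF this, of "(1/2) ^ i"]
      show "(1/2) ^ i * (1 * c w i) \<le> (1/2) ^ i * (c w i - l i)\<^sup>2 + (1 + L) * (1/2) ^ i"
        by (simp add: distrib_left mult.commute)
    qed (use cd[OF w one] in \<open>auto simp: sums_iff intro!: summable_add Jsm cbd w summable_mult summable_geometric\<close>)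
    also have "\<dots> = J (c w) + (1 + L) * 2"
      unfolding J_def
      by (subst suminf_add[symmetric]) (use suminf_geometric[of "1/2 :: real"] in
        \<open>auto simp: suminf_mult summable_geometric intro!: Jsm cbd w summable_mult\<close>)
    finally show ?thesis .
  qed
  define I where "I = Inf ((\<lambda>w. J (c w)) ` W)"
  have W0: "(\<lambda>_. 0) \<in> W" by (auto simp: W_def)
  have bdd: "bdd_below ((\<lambda>w. J (c w)) ` W)" using J0 cbd by (intro bdd_belowI[of _ 0]) auto
  have Ile: "I \<le> J (c w)" if "w \<in> W" for w unfolding I_def using bdd that by (intro cInf_lower) auto
  have "\<exists>w\<in>W. J (c w) < I + inverse (real (Suc n))" for n
    using cInf_lessD[of "(\<lambda>w. J (c w)) ` W" "I + inverse (real (Suc n))"] W0 unfolding I_def by force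
  then obtain w where w: "\<And>n. w n \<in> W" "\<And>n. J (c (w n)) < I + inverse (real (Suc n))" by metis
  define R where "R = (I + 1 + (1 + L) * 2) / \<delta>"
  have wR: "(\<integral>u. w n u \<partial>\<mm>) \<le> R" for n
  proof -
    have "inverse (real (Suc n)) \<le> 1" by (simp add: inverse_le_1_iff)
    then have "\<delta> * (\<integral>u. w n u \<partial>\<mm>) \<le> I + 1 + (1 + L) * 2" using mass[OF w(1)[of n]] w(2)[of n] by linarith
    then show ?thesis using \<delta>(1) by (simp add: R_def field_simps)
  qed
  obtain r M where r: "strict_mono (r :: nat \<Rightarrow> nat)" and M: "finite_measure M" "sets M = sets circle_borel"
    and lim: "\<And>f :: complex \<Rightarrow> real. continuous_on (sphere 0 1) f \<Longrightarrow>
      (\<lambda>n. \<integral>u. w (r n) u * f u \<partial>\<mm>) \<longlonglongrightarrow> (\<integral>u. f u \<partial>M)"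
  proof (rule density_weak_limit[of w R])
    show "w n \<in> borel_measurable \<mm>" "0 \<le> w n x" for n x using w(1)[of n] by (simp_all add: W_def)
  qed (rule Wi[OF w(1)], rule wR, rule that)
  define m where "m i = (\<integral>u. p i u \<partial>M)" for i
  have clim: "(\<lambda>n. c (w (r n)) i) \<longlonglongrightarrow> m i" for i unfolding c_def m_def by (rule lim[OF p(1)])
  have cR: "\<bar>c (w n) i\<bar> \<le> R" for n i using cb[OF w(1)[of n], of i] wR[of n] by linarith
  have mR: "\<bar>m i\<bar> \<le> R" for i
    by (rule LIMSEQ_le_const2[OF tendsto_rabs[OF clim]]) (use cR in blast)
  have mbd: "bounded_seq m" using mR by (rule bounded_seqI)
  \<comment> \<open>Tannery's theorem. The pairs used later are \<open>s = 1\<close> with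
    \<open>e = 0\<close>, \<open>s = 1\<close> with \<open>e\<close> a multiple of the moments of a
    density, and \<open>s = 1 - t\<close> with \<open>e = 0\<close>.\<close>
  have Jlim: "(\<lambda>n. J (\<lambda>i. s * c (w (r n)) i + e i)) \<longlonglongrightarrow> J (\<lambda>i. s * m i + e i)" if e: "bounded_seq e" for s e
  proof -
    obtain E where E: "\<And>i. \<bar>e i - l i\<bar> \<le> E" using bounded_seq_diff[OF e lbd] by (auto simp: bounded_seq_def)
    define T where "T = \<bar>s\<bar> * R + E"
    have bound: "norm ((1/2) ^ i * (s * c (w (r n)) i + e i - l i)\<^sup>2) \<le> T\<^sup>2 * (1/2) ^ i" for i n
    proof -
      have "\<bar>s * c (w (r n)) i + (e i - l i)\<bar> \<le> \<bar>s * c (w (r n)) i\<bar> + \<bar>e i - l i\<bar>" by (rule abs_triangle_ineq)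
      also have "\<dots> \<le> T" unfolding T_def abs_mult by (intro add_mono mult_left_mono cR E) simp
      finally have "(s * c (w (r n)) i + e i - l i)\<^sup>2 \<le> T\<^sup>2" by (simp add: abs_le_square_iff[symmetric] add_diff_eq)
      then show ?thesis by (simp add: mult.commute)
    qed
    have "(\<lambda>n. \<Sum>i. (1/2) ^ i * (s * c (w (r n)) i + e i - l i)\<^sup>2) \<longlonglongrightarrow> (\<Sum>i. (1/2) ^ i * (s * m i + e i - l i)\<^sup>2)"
    proof (rule tannerys_theorem[THEN conjunct2, THEN conjunct2])
      show "\<And>i. (\<lambda>n. (1/2) ^ i * (s * c (w (r n)) i + e i - l i)\<^sup>2) \<longlonglongrightarrow> (1/2) ^ i * (s * m i + e i - l i)\<^sup>2"
        by (intro tendsto_intros clim)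
      show "\<forall>\<^sub>F (i, n) in at_top \<times>\<^sub>F sequentially. norm ((1/2) ^ i * (s * c (w (r n)) i + e i - l i)\<^sup>2) \<le> T\<^sup>2 * (1/2) ^ i"
        using bound by (intro always_eventually) auto
      show "summable (\<lambda>i. T\<^sup>2 * (1/2) ^ i)" by (intro summable_mult summable_geometric) simp
    qed simp
    then show ?thesis by (simp add: J_def)
  qed
  define d where "d i = m i - l i" for i
  have dbd: "bounded_seq d" unfolding d_def[abs_def] by (rule bounded_seq_diff[OF mbd lbd])
  have zbd: "bounded_seq (\<lambda>_. 0)" by (rule bounded_seqI[of _ 0]) simp
  have Jm: "(\<Sum>i. (1/2) ^ i * (d i)\<^sup>2) \<le> I"
  proof -
    have "(\<lambda>n. J (c (w (r n)))) \<longlonglongrightarrow> J m" using Jlim[OF zbd, of 1] by simp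
    moreover have "(\<lambda>n. I + inverse (real (Suc (r n)))) \<longlonglongrightarrow> I + 0"
      using LIMSEQ_subseq_LIMSEQ[OF LIMSEQ_inverse_real_of_nat r] by (intro tendsto_add tendsto_const) (simp add: comp_def)
    ultimately have "J m \<le> I + 0" by (rule LIMSEQ_le) (use w(2) less_imp_le in blast)
    then show ?thesis by (simp add: J_def d_def)
  qed
  have variation: "0 \<le> (\<Sum>i. (1/2) ^ i * (d i * y i))"
    if y: "bounded_seq y" and yJ: "\<And>t. 0 < t \<Longrightarrow> t \<le> 1 \<Longrightarrow> I \<le> J (\<lambda>i. m i + t * y i)" for y
  proof (rule quadratic_minimum_first_order[OF dbd y])
    fix t :: real assume "0 < t" "t \<le> 1"
    from yJ[OF this] have "I \<le> (\<Sum>i. (1/2) ^ i * (d i + t * y i)\<^sup>2)"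
      by (simp add: J_def d_def algebra_simps)
    then show "(\<Sum>i. (1/2) ^ i * (d i)\<^sup>2) \<le> (\<Sum>i. (1/2) ^ i * (d i + t * y i)\<^sup>2)" using Jm by simp
  qed
  have Wadd: "(\<lambda>x. s * w n x + t * v x) \<in> W" if v: "v \<in> W" and st: "0 \<le> s" "0 \<le> t" for v s t n
  proof -
    obtain B1 B2 where "\<And>x. w n x \<le> B1" "\<And>x. v x \<le> B2" using w(1)[of n] v unfolding W_def by blast
    then have "s * w n x + t * v x \<le> s * B1 + t * B2" for x using st by (intro add_mono mult_left_mono) auto
    then show ?thesis using w(1)[of n] v st by (auto simp: W_def)
  qed
  have cadd: "c (\<lambda>x. s * w n x + t * v x) i = s * c (w n) i + t * c v i" if "v \<in> W" for v s t n i
    using Wpi[OF that, of i] Wpi[OF w(1)[of n], of i] by (simp add: c_def distrib_right mult.assoc)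
  \<comment> \<open>The limit moments \<open>m\<close> need not come from a density in
    \<open>W\<close>, so the comparison with the infimum is made along the minimising sequence and
    then passed to the limit.\<close>
  have dc: "0 \<le> (\<Sum>i. (1/2) ^ i * (d i * c v i))" if v: "v \<in> W" for v
  proof (rule variation[OF cbd[OF v]])
    fix t :: real assume t: "0 < t" "t \<le> 1"
    have "I \<le> J (\<lambda>i. 1 * c (w (r n)) i + t * c v i)" for n
      using Ile[OF Wadd[OF v, of 1 t "r n"]] t unfolding cadd[OF v] by simp
    then have "I \<le> J (\<lambda>i. 1 * m i + t * c v i)"
      by (intro LIMSEQ_le_const[OF Jlim[OF bounded_seq_scale[OF cbd[OF v]]]]) blast
    then show "I \<le> J (\<lambda>i. m i + t * c v i)" by simp
  qed
  \<comment> \<open>The direction is minus \<open>m\<close>; the factor \<open>1 - t\<close> stays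
    nonnegative because \<open>t \<le> 1\<close>.\<close>
  have dm: "(\<Sum>i. (1/2) ^ i * (d i * m i)) \<le> 0"
  proof -
    have "0 \<le> (\<Sum>i. (1/2) ^ i * (d i * (-1 * m i)))"
    proof (rule variation[OF bounded_seq_scale[OF mbd]])
      fix t :: real assume t: "0 < t" "t \<le> 1"
      have "I \<le> J (\<lambda>i. (1 - t) * c (w (r n)) i + 0)" for n
        using Ile[OF Wadd[OF W0, of "1 - t" 0 "r n"]] t unfolding cadd[OF W0] by simp
      then have "I \<le> J (\<lambda>i. (1 - t) * m i + 0)" by (intro LIMSEQ_le_const[OF Jlim[OF zbd]]) blast
      then show "I \<le> J (\<lambda>i. m i + t * (-1 * m i))" by (simp add: algebra_simps)
    qed
    then have "0 \<le> (\<Sum>i. - ((1/2) ^ i * (d i * m i)))" by simp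
    then show ?thesis using suminf_minus[OF sm[OF bounded_seq_mult[OF dbd mbd]]] by simp
  qed
  define h where "h u = (\<Sum>i. (1/2) ^ i * d i * p i u)" for u
  have hm [measurable]: "h \<in> borel_measurable \<mm>" unfolding h_def[abs_def]
    by (intro borel_measurable_times borel_measurable_suminf borel_measurable_const pm)
  obtain D where D: "\<And>i. \<bar>d i\<bar> \<le> D" using dbd by (auto simp: bounded_seq_def)
  have hD: "\<bar>h u\<bar> \<le> 2 * D" if z: "u \<in> sphere 0 1" for u
  proof -
    have "bounded_seq (\<lambda>i. d i * p i u)" using p1[OF z] by (intro bounded_seq_mult dbd) (rule bounded_seqI)
    note s = bounded_seq_summable[OF this]
    have "\<bar>h u\<bar> \<le> (\<Sum>i. \<bar>(1/2) ^ i * (d i * p i u)\<bar>)" unfolding h_def mult.assoc by (rule summable_rabs[OF s(1)])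
    also have "\<dots> \<le> (\<Sum>i. D * (1/2) ^ i)"
    proof (rule suminf_le[OF _ s(1)])
      fix i
      have "\<bar>d i\<bar> * \<bar>p i u\<bar> \<le> D * 1" using D[of i] p1[OF z, of i] by (intro mult_mono) auto
      then show "\<bar>(1/2) ^ i * (d i * p i u)\<bar> \<le> D * (1/2) ^ i" by (simp add: abs_mult mult.commute)
    qed (intro summable_mult summable_geometric, simp)
    also have "\<dots> = 2 * D" using suminf_geometric[of "1/2 :: real"] by (subst suminf_mult) (auto intro: summable_geometric)
    finally show ?thesis .
  qed
  have "AE u in \<mm>. 0 \<le> h u"
  proof -
    \<comment> \<open>Negative part of \<open>h\<close>, clipped to be a bounded density everywhere;
      on the circle the upper clip is inactive by \<open>hD\<close>. Pairing it with
      \<open>h\<close> gives minus the integral of its square.\<close>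
    define v where "v u = max 0 (min (2 * D) (- h u))" for u
    have D0: "0 \<le> D" using D[of 0] by linarith
    have v: "v \<in> W" unfolding W_def v_def[abs_def] using D0 by (auto intro!: exI[of _ "2 * D"])
    have vh: "v u * h u = - (v u)\<^sup>2" if "u \<in> sphere 0 1" for u
    proof -
      have "min (2 * D) (- h u) = - h u" using hD[OF that] by linarith
      then show ?thesis by (simp add: v_def power2_eq_square max_def)
    qed
    have "0 \<le> (\<integral>u. v u * h u \<partial>\<mm>)" using dc[OF v] sums_unique[OF cd[OF v dbd]] by (simp add: h_def)
    also have "\<dots> = (\<integral>u. - (v u)\<^sup>2 \<partial>\<mm>)" by (intro Bochner_Integration.integral_cong refl) (simp add: vh)
    finally have le: "(\<integral>u. (v u)\<^sup>2 \<partial>\<mm>) \<le> 0" by simp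
    have "integrable \<mm> (\<lambda>u. (v u)\<^sup>2)"
    proof (rule circle.integrable_const_bound)
      show "AE u in \<mm>. norm ((v u)\<^sup>2) \<le> (2 * D)\<^sup>2"
      proof (rule AE_I2)
        fix u
        have "0 \<le> v u" "v u \<le> 2 * D" using D0 by (auto simp: v_def)
        then show "norm ((v u)\<^sup>2) \<le> (2 * D)\<^sup>2" by (simp only: real_norm_def abs_power2) (rule power_mono)
      qed
    qed (simp add: v_def[abs_def])
    moreover have "(\<integral>u. (v u)\<^sup>2 \<partial>\<mm>) = 0"
      by (rule antisym[OF le]) (intro integral_nonneg_AE AE_I2, simp)
    ultimately have "AE u in \<mm>. (v u)\<^sup>2 = 0"
      using integral_nonneg_eq_0_iff_AE[of \<mm> "\<lambda>u. (v u)\<^sup>2"] by simp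
    moreover have "AE u in \<mm>. u \<in> sphere 0 1" by (rule AE_I2) simp
    ultimately show ?thesis
    proof eventually_elim
      case (elim u)
      then show ?case using hD[of u] by (auto simp: v_def max_def min_def split: if_splits)
    qed
  qed
  then have dl: "0 \<le> (\<Sum>i. (1/2) ^ i * (d i * l i))" unfolding h_def by (rule pos[OF dbd])
  \<comment> \<open>As \<open>d\<close> is \<open>m\<close> minus \<open>l\<close>, its pairing with
    itself is the difference of one that is at most 0 and one that is at least 0; so all residuals
    vanish.\<close>
  have "(\<Sum>i. (1/2) ^ i * (d i * d i)) = (\<Sum>i. (1/2) ^ i * (d i * m i)) - (\<Sum>i. (1/2) ^ i * (d i * l i))"
    by (subst suminf_diff) (use sm[OF bounded_seq_mult[OF dbd mbd]] sm[OF bounded_seq_mult[OF dbd lbd]] in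
      \<open>auto simp: d_def algebra_simps\<close>)
  then have "(\<Sum>i. (1/2) ^ i * (d i * d i)) \<le> 0" using dm dl by linarith
  moreover have "summable (\<lambda>i. (1/2) ^ i * (d i * d i))" by (rule sm[OF bounded_seq_mult[OF dbd dbd]])
  ultimately have "(1/2) ^ i * (d i * d i) = 0" for i
    using suminf_nonneg suminf_eq_zero_iff[of "\<lambda>i. (1/2) ^ i * (d i * d i)"] by (metis (no_types, lifting) order_antisym mult_nonneg_nonneg zero_le_power zero_le_square zero_le_divide_1_iff zero_le_numeral)
  then have "m i = l i" for i by (simp add: d_def)
  then show ?thesis using that[OF M] by (simp add: m_def)
qed

section \<open>Positive operators are induced by measures\<close>

context inner_fun
begin

text \<open>The moments are those of \<open>p i\<close>, the squared moduli of a family that is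
  uniformly dense in the sup-norm unit ball of \<open>K_cont \<Theta>\<close> on the circle; the
  prescribed values are their integrals against \<phi>. The positivity hypothesis of
  \<open>moment_problem\<close> is \<open>symbol_integral_nonneg\<close> for \<open>H d\<close>,
  with \<open>H (\<lambda>_. 1)\<close> as strictly positive weight.\<close>

lemma carleson_measure_exists:
  assumes A: "A \<in> TTO \<Theta>" and pos: "positive_on_model \<Theta> A"
  obtains M where "finite_measure M" "sets M = sets circle_borel"
    "\<And>F. F \<in> K_cont \<Theta> \<Longrightarrow> (\<integral>y. (cmod (F y))\<^sup>2 \<partial>M) = Re (L2_inner \<mm> (A F) F)"
proof (cases "\<exists>F\<in>K_cont \<Theta>. \<exists>y\<in>sphere 0 1. F y \<noteq> 0")
  \<comment> \<open>Without a continuous function that is nonzero somewhere on the circle there is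
    no positive weight; the zero measure serves here.\<close>
  case False
  have z: "F y = 0" if "F \<in> K_cont \<Theta>" "y \<in> sphere 0 1" for F y using False that by blast
  show ?thesis
  proof (rule that[of "null_measure circle_borel"])
    show "finite_measure (null_measure circle_borel)" by (rule finite_measureI) simp
    fix F assume F: "F \<in> K_cont \<Theta>"
    have "L2_inner \<mm> (A F) F = (\<integral>y. 0 \<partial>\<mm>)"
      unfolding L2_inner_def using z[OF F] by (intro Bochner_Integration.integral_cong refl) simp
    then show "(\<integral>y. (cmod (F y))\<^sup>2 \<partial>null_measure circle_borel) = Re (L2_inner \<mm> (A F) F)"
      by (simp add: integral_null_measure)
  qed simp
next
  case True
  obtain \<phi> where \<phi>: "\<phi> \<in> L2_space \<mm>"
    and form: "\<And>f g. f \<in> K \<inter> Hinf \<Longrightarrow> g \<in> K \<Longrightarrow>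
      L2_inner \<mm> (A f) g = L2_inner \<mm> (\<lambda>y. \<phi> y * f y) g"
    by (rule TTO_form[OF A]) blast
  let ?I = "\<lambda>u. \<integral>y. \<phi> y * complex_of_real (u y) \<partial>\<mm>"
  have AI: "L2_inner \<mm> (A f) f = ?I (\<lambda>y. (cmod (f y))\<^sup>2)" if "f \<in> K" "f \<in> Hinf" for f
    using form[of f f] that by (simp add: L2_inner_def mult.assoc complex_norm_square[symmetric])
  have Ipos: "0 \<le> Re (?I (\<lambda>y. (cmod (f y))\<^sup>2))" if "f \<in> K" "f \<in> Hinf" for f
    using pos that unfolding AI[OF that, symmetric] positive_on_model_def by (auto simp: complex_nonneg_Reals_iff)
  define S where "S = {F \<in> K_cont \<Theta>. \<forall>y\<in>sphere 0 1. cmod (F y) \<le> 1}"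
  have Sscale: "\<exists>c>0. (\<lambda>y. of_real c * G y) \<in> S" if G: "G \<in> K_cont \<Theta>" for G
  proof -
    obtain B where B: "0 < B" "\<And>y. y \<in> sphere 0 1 \<Longrightarrow> cmod (G y) \<le> B"
      using continuous_on_sphere_bounded[OF K_contD(4)[OF G]] by metis
    have "(\<lambda>y. of_real (inverse B) * G y) \<in> S"
      using K_cont_scale[OF G, of "of_real (inverse B)"] B by (auto simp: S_def norm_mult norm_divide field_simps)
    then show ?thesis using B(1) by (intro exI[of _ "inverse B"]) simp
  qed
  obtain Q :: "(complex \<Rightarrow> complex) set" where Q: "countable Q"
    "\<And>F e. continuous_on (cball 0 1) F \<Longrightarrow> F holomorphic_on ball 0 1 \<Longrightarrow> e > 0 \<Longrightarrow>
       \<exists>q\<in>Q. \<forall>x\<in>sphere 0 1. dist (F x) (q x) < e"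
    by (rule disc_algebra_separable) blast
  have "S \<noteq> {}" using True Sscale by blast
  then obtain F :: "nat \<Rightarrow> complex \<Rightarrow> complex" where rF: "range F \<subseteq> S"
    and dense: "\<And>G e. G \<in> S \<Longrightarrow> e > 0 \<Longrightarrow> \<exists>i. \<forall>x\<in>sphere 0 1. dist (G x) (F i x) < e"
  proof (rule countable_dense_family[OF Q(1)])
    show "\<exists>q\<in>Q. \<forall>x\<in>sphere 0 1. dist (G x) (q x) < e" if "G \<in> S" "e > 0" for G and e :: real
      using that K_contD(2,3) by (intro Q(2)) (auto simp: S_def)
  qed blast
  have FK: "F i \<in> K_cont \<Theta>" and F1: "\<And>y. y \<in> sphere 0 1 \<Longrightarrow> cmod (F i y) \<le> 1" for i
    using rF unfolding S_def by blast+
  note KcK = K_contD(1) and KcH = K_cont_Hinf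
  define p where "p i y = (cmod (F i y))\<^sup>2" for i y
  have pc: "continuous_on (sphere 0 1) (p i)" for i
    unfolding p_def[abs_def] by (intro continuous_intros K_contD(4) FK)
  have pm: "p i \<in> borel_measurable \<mm>" for i
    using borel_measurable_continuous_on_restrict[OF pc] by (simp add: circle_measurable_iff circle_borel_def)
  have p01: "0 \<le> p i y \<and> p i y \<le> 1" if "y \<in> sphere 0 1" for i y
    using F1[OF that] by (simp add: p_def power_le_one)
  then have p1: "\<bar>p i y\<bar> \<le> 1" if "y \<in> sphere 0 1" for i y using that by simp
  define l where "l i = Re (?I (p i))" for i
  have sums: "(\<lambda>i. b i *\<^sub>R (\<integral>y. g y * of_real (p i y) \<partial>\<mm>)) sums
      (\<integral>y. g y * of_real (\<Sum>i. b i * p i y) \<partial>\<mm>)"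
    if "integrable \<mm> g" "summable (\<lambda>i. \<bar>b i\<bar>)" for g :: "complex \<Rightarrow> complex" and b
    using circle_sums_swap[OF that(1) pm p1 that(2)] by (simp add: scaleR_conv_of_real mult.commute)
  have one: "bounded_seq (\<lambda>_. 1)" by (rule bounded_seqI[of _ 1]) simp
  have lL: "\<bar>l i\<bar> \<le> (\<integral>y. cmod (\<phi> y) \<partial>\<mm>)" for i
  proof -
    have "\<bar>l i\<bar> \<le> cmod (?I (p i))" unfolding l_def by (rule abs_Re_le_cmod)
    also have "\<dots> \<le> (\<integral>y. cmod (\<phi> y * of_real (p i y)) \<partial>\<mm>)" by (rule integral_norm_bound)
    also have "\<dots> \<le> (\<integral>y. cmod (\<phi> y) \<partial>\<mm>)"
    proof (rule integral_mono')
      show "integrable \<mm> (\<lambda>y. cmod (\<phi> y))" using L2_integrable[OF \<phi>] by simp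
      show "cmod (\<phi> y * of_real (p i y)) \<le> cmod (\<phi> y)" if "y \<in> space \<mm>" for y
        using p1[of y i] that by (simp add: norm_mult mult_left_le)
    qed simp
    finally show ?thesis .
  qed
  define H where "H d y = (\<Sum>i. (1/2) ^ i * d i * p i y)" for d y
  have Hm: "H d \<in> borel_measurable \<mm>" for d
    unfolding H_def[abs_def] by (intro borel_measurable_times borel_measurable_suminf borel_measurable_const pm)
  have Hb: "\<exists>B. \<forall>y\<in>sphere 0 1. \<bar>H d y\<bar> \<le> B" if d: "bounded_seq d" for d
  proof -
    note s = bounded_seq_summable(1)[OF d]
    have "\<bar>H d y\<bar> \<le> (\<Sum>i. \<bar>(1/2) ^ i * d i\<bar>)" if z: "y \<in> sphere 0 1" for y
    proof -
      have le: "\<bar>(1/2) ^ i * d i * p i y\<bar> \<le> \<bar>(1/2) ^ i * d i\<bar>" for i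
        using p1[OF z, of i] by (simp add: abs_mult mult_left_le)
      have s': "summable (\<lambda>i. \<bar>(1/2) ^ i * d i * p i y\<bar>)"
        by (rule summable_comparison_test'[OF s, of 0]) (use le in simp)
      have "\<bar>H d y\<bar> \<le> (\<Sum>i. \<bar>(1/2) ^ i * d i * p i y\<bar>)" unfolding H_def by (rule summable_rabs[OF s'])
      also have "\<dots> \<le> (\<Sum>i. \<bar>(1/2) ^ i * d i\<bar>)" by (rule suminf_le[OF le s' s])
      finally show ?thesis .
    qed
    then show ?thesis by blast
  qed
  have Hv: "fourier (\<lambda>y. \<Theta> y * of_real (H d y)) n = 0" if d: "bounded_seq d" and n: "n \<le> 0" for d n
  proof -
    have "integrable \<mm> (\<lambda>y. \<Theta> y * y powi (- n))"
      by (intro integrable_mult_powi L2_integrable H2_L2 Theta_H2)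
    from sums[OF this bounded_seq_summable(1)[OF d]]
    have "(\<lambda>i. ((1/2) ^ i * d i) *\<^sub>R fourier (\<lambda>y. \<Theta> y * of_real (p i y)) n) sums fourier (\<lambda>y. \<Theta> y * of_real (H d y)) n"
      by (simp add: fourier_def H_def mult_ac)
    moreover have "fourier (\<lambda>y. \<Theta> y * of_real (p i y)) n = 0" for i
      unfolding p_def by (rule fourier_Theta_modulus_square[OF KcK[OF FK] KcH[OF FK] n])
    ultimately have "(\<lambda>i::nat. 0) sums fourier (\<lambda>y. \<Theta> y * of_real (H d y)) n" by simp
    then show ?thesis using sums_unique2[OF sums_zero] by metis
  qed
  have HI: "(\<Sum>i. (1/2) ^ i * (d i * l i)) = Re (?I (H d))" if d: "bounded_seq d" for d
    using sums_Re[OF sums[OF L2_integrable[OF \<phi>] bounded_seq_summable(1)[OF d]]]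
    by (simp add: sums_iff l_def H_def mult.assoc)
  \<comment> \<open>The family has no common zero by \<open>K_cont_common_zero\<close>, so the
    series is positive at every point; it converges uniformly, hence is continuous and attains a
    positive minimum.\<close>
  have "\<exists>\<delta>>0. \<forall>y\<in>sphere 0 1. \<delta> \<le> H (\<lambda>_. 1) y"
  proof -
    have Hpos: "0 < H (\<lambda>_. 1) y" if z: "y \<in> sphere 0 1" for y
    proof -
      have "\<exists>i. F i y \<noteq> 0"
      proof (rule ccontr)
        assume "\<not> ?thesis"
        then have F0: "F i y = 0" for i by simp
        have "G y = 0" if G: "G \<in> S" for G
        proof (rule ccontr)
          assume "G y \<noteq> 0"
          then obtain i where "dist (G y) (F i y) < cmod (G y)" using dense[OF G, of "cmod (G y)"] z
            unfolding zero_less_norm_iff by blast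
          then show False by (simp add: F0)
        qed
        then have "G y = 0" if "G \<in> K_cont \<Theta>" for G using Sscale[OF that] by force
        then show False using True K_cont_common_zero[OF z] by blast
      qed
      then obtain j where j: "0 < p j y" by (auto simp: p_def)
      have "summable (\<lambda>i. (1/2) ^ i * p i y)"
        by (rule bounded_seq_summable(2)) (use p1[OF z] in \<open>rule bounded_seqI\<close>)
      then show ?thesis unfolding H_def using j p01[OF z] by (intro suminf_pos2[of _ j]) auto
    qed
    have "continuous_on (sphere 0 1) (H (\<lambda>_. 1))"
    proof (rule uniform_limit_theorem)
      show "\<forall>\<^sub>F n in sequentially. continuous_on (sphere 0 1) (\<lambda>y. \<Sum>i<n. (1/2) ^ i * 1 * p i y)"
        by (intro always_eventually allI continuous_intros pc)
      show "uniform_limit (sphere 0 1) (\<lambda>n y. \<Sum>i<n. (1/2) ^ i * 1 * p i y) (H (\<lambda>_. 1)) sequentially"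
        unfolding H_def[abs_def]
        by (rule Weierstrass_m_test[of _ _ "\<lambda>i. (1/2) ^ i"]) (use p1 in \<open>auto simp: abs_mult mult_left_le summable_geometric\<close>)
    qed simp
    then obtain \<xi> where "\<xi> \<in> sphere 0 1" "\<And>y. y \<in> sphere 0 1 \<Longrightarrow> H (\<lambda>_. 1) \<xi> \<le> H (\<lambda>_. 1) y"
      using continuous_attains_inf[of "sphere (0::complex) 1" "H (\<lambda>_. 1)"] by (auto simp: sphere_eq_empty)
    then show ?thesis using Hpos by blast
  qed
  then obtain \<delta> where \<delta>: "0 < \<delta>" "\<And>y. y \<in> sphere 0 1 \<Longrightarrow> \<delta> \<le> H (\<lambda>_. 1) y" by blast
  have dl: "0 \<le> (\<Sum>i. (1/2) ^ i * (d i * l i))"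
    if d: "bounded_seq d" and h: "AE y in \<mm>. 0 \<le> (\<Sum>i. (1/2) ^ i * d i * p i y)" for d
  proof -
    obtain B1 B2 where B: "\<forall>y\<in>sphere 0 1. \<bar>H d y\<bar> \<le> B1" "\<forall>y\<in>sphere 0 1. \<bar>H (\<lambda>_. 1) y\<bar> \<le> B2"
      using Hb[OF d] Hb[OF one] by blast
    have sp: "AE y in \<mm>. y \<in> sphere 0 1" by (rule AE_I2) simp
    have "0 \<le> Re (?I (H d))"
    proof (rule symbol_integral_nonneg[OF \<phi> Ipos Hm _ Hv[OF d] Hm _ Hv[OF one] \<delta>(1)])
      show "AE y in \<mm>. 0 \<le> H d y \<and> H d y \<le> max B1 B2"
        using h sp by eventually_elim (use B(1) in \<open>force simp: H_def\<close>)
      show "AE y in \<mm>. \<delta> \<le> H (\<lambda>_. 1) y \<and> H (\<lambda>_. 1) y \<le> max B1 B2"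
        using sp by eventually_elim (use B(2) \<delta>(2) in force)
    qed
    then show ?thesis unfolding HI[OF d] .
  qed
  obtain M where M: "finite_measure M" "sets M = sets circle_borel" and Ml: "\<And>i. (\<integral>y. p i y \<partial>M) = l i"
    by (rule moment_problem[OF pc p01 lL \<delta>(1) _ dl]) (use \<delta>(2) in \<open>auto simp: H_def\<close>)
  interpret M: finite_measure M by (rule M)
  have spM: "space M = sphere 0 1" using sets_eq_imp_space_eq[OF M(2)] by (simp add: space_circle_borel)
  have int2: "integrable N (\<lambda>y. (cmod (G y))\<^sup>2)" if "G \<in> K_cont \<Theta>" "finite_measure N" "sets N = sets circle_borel" for G N
    using continuous_on_sphere_L2[OF K_contD(4)[OF that(1)] that(2,3)] by (rule L2_integrable_sq)
  show ?thesis
  proof (rule that[OF M])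
    let ?P = "\<lambda>G. (\<integral>y. (cmod (G y))\<^sup>2 \<partial>M) = Re (?I (\<lambda>y. (cmod (G y))\<^sup>2))"
    \<comment> \<open>Replacing \<open>G\<close> by a family member within \<open>e\<close> changes
      the two sides together by at most \<open>2 * e * T\<close>; with
      \<open>e = a / (2 * T + 1)\<close> this is less than the supposed gap
      \<open>a\<close>.\<close>
    have PS: "?P G" if G: "G \<in> S" for G
    proof (rule ccontr)
      assume ne: "\<not> ?P G"
      define a where "a = \<bar>(\<integral>y. (cmod (G y))\<^sup>2 \<partial>M) - Re (?I (\<lambda>y. (cmod (G y))\<^sup>2))\<bar>"
      define T where "T = measure M (space M) + (\<integral>y. cmod (\<phi> y) \<partial>\<mm>)"
      have a: "0 < a" using ne by (simp add: a_def)
      have T: "0 \<le> T" unfolding T_def by (intro add_nonneg_nonneg integral_nonneg_AE AE_I2) auto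
      define e where "e = a / (2 * T + 1)"
      have e: "0 < e" using a T by (simp add: e_def)
      obtain i where i: "\<And>x. x \<in> sphere 0 1 \<Longrightarrow> dist (G x) (F i x) < e" using dense[OF G e] by blast
      have GK: "G \<in> K_cont \<Theta>" and G1: "\<And>x. x \<in> sphere 0 1 \<Longrightarrow> cmod (G x) \<le> 1" using G by (auto simp: S_def)
      have near: "\<bar>(cmod (G x))\<^sup>2 - p i x\<bar> \<le> 2 * e" if x: "x \<in> sphere 0 1" for x
      proof -
        have "\<bar>(cmod (G x))\<^sup>2 - p i x\<bar> = \<bar>cmod (G x) - cmod (F i x)\<bar> * \<bar>cmod (G x) + cmod (F i x)\<bar>"
          unfolding p_def abs_mult[symmetric] by (simp add: power2_eq_square algebra_simps)
        also have "\<dots> \<le> e * 2"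
          using i[OF x] G1[OF x] F1[OF x, of i] norm_triangle_ineq3[of "G x" "F i x"] e
          by (intro mult_mono) (auto simp: dist_norm)
        finally show ?thesis by simp
      qed
      have pM: "integrable M (p i)" unfolding p_def[abs_def] by (rule int2[OF FK M])
      have "\<bar>(\<integral>y. (cmod (G y))\<^sup>2 \<partial>M) - l i\<bar> = \<bar>\<integral>y. (cmod (G y))\<^sup>2 - p i y \<partial>M\<bar>"
        using int2[OF GK M] pM by (simp add: Ml)
      also have "\<dots> \<le> (\<integral>y. 2 * e \<partial>M)"
        using int2[OF GK M] pM near by (intro integral_abs_bound_integral) (auto simp: spM)
      finally have 1: "\<bar>(\<integral>y. (cmod (G y))\<^sup>2 \<partial>M) - l i\<bar> \<le> 2 * e * measure M (space M)" by (simp add: mult_ac)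
      have \<phi>i: "integrable \<mm> (\<lambda>y. \<phi> y * of_real ((cmod (g y))\<^sup>2))" if "g \<in> K_cont \<Theta>" for g
      proof -
        obtain B where "\<And>y. y \<in> sphere 0 1 \<Longrightarrow> cmod (g y) \<le> B"
          using continuous_on_sphere_bounded[OF K_contD(4)[OF \<open>g \<in> K_cont \<Theta>\<close>]] by metis
        moreover have gL: "g \<in> L2_space \<mm>" by (rule K_L2[OF K_contD(1)[OF \<open>g \<in> K_cont \<Theta>\<close>]])
        ultimately have "(\<lambda>y. g y * cnj (g y)) \<in> L2_space \<mm>"
          by (intro L2_mult_bounded[OF L2_cnj, of _ _ _ B] AE_I2) auto
        from L2_integrable_mult[OF \<phi> this] show ?thesis unfolding complex_norm_square .
      qed
      have "\<bar>Re (?I (\<lambda>y. (cmod (G y))\<^sup>2)) - l i\<bar> \<le> cmod (?I (\<lambda>y. (cmod (G y))\<^sup>2) - ?I (p i))"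
        unfolding l_def minus_complex.sel(1)[symmetric] by (rule abs_Re_le_cmod)
      also have "?I (\<lambda>y. (cmod (G y))\<^sup>2) - ?I (p i) = (\<integral>y. \<phi> y * of_real ((cmod (G y))\<^sup>2) - \<phi> y * of_real (p i y) \<partial>\<mm>)"
        unfolding p_def by (rule Bochner_Integration.integral_diff[symmetric]) (rule \<phi>i GK FK)+
      also have "cmod \<dots> \<le> (\<integral>y. cmod (\<phi> y * of_real ((cmod (G y))\<^sup>2) - \<phi> y * of_real (p i y)) \<partial>\<mm>)"
        by (rule integral_norm_bound)
      also have "\<dots> \<le> (\<integral>y. cmod (\<phi> y) * (2 * e) \<partial>\<mm>)"
      proof (rule integral_mono')
        show "integrable \<mm> (\<lambda>y. cmod (\<phi> y) * (2 * e))" using L2_integrable[OF \<phi>] by simp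
        fix y assume z: "y \<in> space \<mm>"
        have "cmod (\<phi> y * of_real ((cmod (G y))\<^sup>2) - \<phi> y * of_real (p i y)) = cmod (\<phi> y) * \<bar>(cmod (G y))\<^sup>2 - p i y\<bar>"
          unfolding right_diff_distrib[symmetric] of_real_diff[symmetric] norm_mult norm_of_real ..
        then show "cmod (\<phi> y * of_real ((cmod (G y))\<^sup>2) - \<phi> y * of_real (p i y)) \<le> cmod (\<phi> y) * (2 * e)"
          using near[of y] z by (simp add: mult_left_mono)
      qed (use e in simp)
      also have "\<dots> = 2 * e * (\<integral>y. cmod (\<phi> y) \<partial>\<mm>)" by simp
      finally have "a \<le> 2 * e * T" using 1 unfolding a_def T_def distrib_left by linarith
      also have "2 * e * T < a" using a T by (simp add: e_def field_simps)
      finally show False by simp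
    qed
    fix G assume G: "G \<in> K_cont \<Theta>"
    obtain c where c: "0 < c" "(\<lambda>y. of_real c * G y) \<in> S" using Sscale[OF G] by blast
    have "c\<^sup>2 * (\<integral>y. (cmod (G y))\<^sup>2 \<partial>M) = c\<^sup>2 * Re (?I (\<lambda>y. (cmod (G y))\<^sup>2))"
    proof -
      have "(\<integral>y. c\<^sup>2 * (cmod (G y))\<^sup>2 \<partial>M) = Re (\<integral>y. of_real (c\<^sup>2) * (\<phi> y * of_real ((cmod (G y))\<^sup>2)) \<partial>\<mm>)"
        using PS[OF c(2)] by (simp add: norm_mult power_mult_distrib mult_ac)
      then show ?thesis unfolding integral_mult_right_zero by (simp del: of_real_power)
    qed
    then show "(\<integral>y. (cmod (G y))\<^sup>2 \<partial>M) = Re (L2_inner \<mm> (A G) G)"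
      using c(1) AI[OF KcK[OF G] KcH[OF G]] by simp
  qed
qed

end

section \<open>Forms of bounded operators: expansion, limits and polarization\<close>

lemma L2_form_expand:
  assumes T: "L2_bounded_linear M D N (L2_space N) T" and S: "L2_bounded_linear M D N (L2_space N) S"
    and D: "f \<in> D" "g \<in> D" "(\<lambda>x. c * g x) \<in> D" "(\<lambda>x. f x + c * g x) \<in> D"
  shows "L2_inner N (T (\<lambda>x. f x + c * g x)) (S (\<lambda>x. f x + c * g x)) =
    L2_inner N (T f) (S f) + cnj c * L2_inner N (T f) (S g) + c * L2_inner N (T g) (S f)
      + (cmod c)\<^sup>2 * L2_inner N (T g) (S g)"
proof -
  have ae: "AE y in N. R (\<lambda>x. f x + c * g x) y = R f y + c * R g y"
    and L: "\<And>f. f \<in> D \<Longrightarrow> R f \<in> L2_space N"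
    if R: "L2_bounded_linear M D N (L2_space N) R" for R
  proof -
    have "\<forall>f\<in>D. \<forall>g\<in>D. AE y in N. R (\<lambda>x. f x + g x) y = R f y + R g y"
      "\<forall>f\<in>D. \<forall>c. AE y in N. R (\<lambda>x. c * f x) y = c * R f y"
      using R unfolding L2_bounded_linear_def by simp_all
    from bspec[OF bspec[OF this(1) D(1)] D(3)] spec[OF bspec[OF this(2) D(2)], of c]
    show "AE y in N. R (\<lambda>x. f x + c * g x) y = R f y + c * R g y" by eventually_elim simp
    show "\<And>f. f \<in> D \<Longrightarrow> R f \<in> L2_space N" using R unfolding L2_bounded_linear_def by simp
  qed
  note l = L[OF T D(1)] L[OF T D(2)] L[OF S D(1)] L[OF S D(2)]
  have "L2_inner N (T (\<lambda>x. f x + c * g x)) (S (\<lambda>x. f x + c * g x)) =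
      L2_inner N (\<lambda>y. T f y + c * T g y) (\<lambda>y. S f y + c * S g y)"
    by (intro L2_inner_cong_AE ae T S L2_measurable L[OF T] L[OF S] D L2_add L2_scale l)
  then show ?thesis
    using l complex_norm_square[of c, symmetric]
    by (simp add: L2_inner_add_left L2_inner_add_right L2_add L2_scale L2_inner_scale_left
      L2_inner_scale_right algebra_simps)
qed

lemma L2_limit_form:
  assumes u: "\<And>n. u n \<in> L2_space N" and v: "\<And>n. v n \<in> L2_space N" and fg: "f \<in> L2_space N" "g \<in> L2_space N"
    and lim: "(\<lambda>n. L2_norm N (\<lambda>x. u n x - f x)) \<longlonglongrightarrow> 0" "(\<lambda>n. L2_norm N (\<lambda>x. v n x - g x)) \<longlonglongrightarrow> 0"
  shows "(\<lambda>n. L2_inner N (u n) (v n)) \<longlonglongrightarrow> L2_inner N f g"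
proof (rule LIM_zero_cancel, rule Lim_null_comparison)
  show "\<forall>\<^sub>F n in sequentially. norm (L2_inner N (u n) (v n) - L2_inner N f g) \<le>
      L2_norm N (\<lambda>x. u n x - f x) * L2_norm N (v n) + L2_norm N f * L2_norm N (\<lambda>x. v n x - g x)"
  proof (intro always_eventually allI)
    fix n
    have "L2_inner N (u n) (v n) - L2_inner N f g = L2_inner N (\<lambda>x. u n x - f x) (v n) + L2_inner N f (\<lambda>x. v n x - g x)"
      by (simp add: L2_inner_diff_left[OF u fg(1) v] L2_inner_diff_right[OF v fg(2) fg(1)])
    also have "cmod \<dots> \<le> L2_norm N (\<lambda>x. u n x - f x) * L2_norm N (v n) + L2_norm N f * L2_norm N (\<lambda>x. v n x - g x)"
      by (intro norm_triangle_mono L2_Cauchy_Schwarz L2_diff u v fg)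
    finally show "norm (L2_inner N (u n) (v n) - L2_inner N f g) \<le>
      L2_norm N (\<lambda>x. u n x - f x) * L2_norm N (v n) + L2_norm N f * L2_norm N (\<lambda>x. v n x - g x)" .
  qed
  have "(\<lambda>n. L2_norm N (\<lambda>x. u n x - f x) * L2_norm N (v n) + L2_norm N f * L2_norm N (\<lambda>x. v n x - g x))
      \<longlonglongrightarrow> 0 * L2_norm N g + L2_norm N f * 0"
    by (intro tendsto_intros lim L2_limit_norm[OF v fg(2)])
  then show "(\<lambda>n. L2_norm N (\<lambda>x. u n x - f x) * L2_norm N (v n) + L2_norm N f * L2_norm N (\<lambda>x. v n x - g x)) \<longlonglongrightarrow> 0"
    by simp
qed

context inner_fun
begin

lemma form_limit:
  assumes T: "L2_bounded_linear \<mm> K N (L2_space N) T" and S: "L2_bounded_linear \<mm> K N (L2_space N) S"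
    and u: "\<And>n. u n \<in> K" and f: "f \<in> K" and lim: "(\<lambda>n. L2_norm \<mm> (\<lambda>z. u n z - f z)) \<longlonglongrightarrow> 0"
  shows "(\<lambda>n. L2_inner N (T (u n)) (S (u n))) \<longlonglongrightarrow> L2_inner N (T f) (S f)"
proof -
  have *: "(\<lambda>n. L2_norm N (\<lambda>y. R (u n) y - R f y)) \<longlonglongrightarrow> 0" if R: "L2_bounded_linear \<mm> K N (L2_space N) R" for R
  proof -
    obtain C where C: "C > 0" "\<And>f. f \<in> K \<Longrightarrow> L2_norm N (R f) \<le> C * L2_norm \<mm> f"
      using L2_bounded_linear_bound[OF R] by metis
    show ?thesis
    proof (rule Lim_null_comparison)
      show "\<forall>\<^sub>F n in sequentially. norm (L2_norm N (\<lambda>y. R (u n) y - R f y)) \<le> C * L2_norm \<mm> (\<lambda>z. u n z - f z)"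
        using C(2)[OF K_diff[OF u f]] L2_bounded_linear_diff_norm[OF R u f K_minus[OF f] K_diff[OF u f]] by simp
      show "(\<lambda>n. C * L2_norm \<mm> (\<lambda>z. u n z - f z)) \<longlonglongrightarrow> 0" using tendsto_mult_left[OF lim, of C] by simp
    qed
  qed
  have L: "R f \<in> L2_space N" if "L2_bounded_linear \<mm> K N (L2_space N) R" "f \<in> K" for R f
    using that by (simp add: L2_bounded_linear_def)
  show ?thesis by (intro L2_limit_form * T S L[OF T] L[OF S] u f)
qed

text \<open>Both forms agree on the diagonal of the dense set \<open>K_cont \<Theta>\<close>; polarization does the rest.\<close>

lemma forms_eq:
  assumes T: "L2_bounded_linear \<mm> K N (L2_space N) T" and S: "L2_bounded_linear \<mm> K N (L2_space N) S"
    and T': "L2_bounded_linear \<mm> K N' (L2_space N') T'" and S': "L2_bounded_linear \<mm> K N' (L2_space N') S'"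
    and eq: "\<And>F. F \<in> K_cont \<Theta> \<Longrightarrow> L2_inner N (T F) (S F) = L2_inner N' (T' F) (S' F)"
    and fg: "f \<in> K" "g \<in> K"
  shows "L2_inner N (T f) (S g) = L2_inner N' (T' f) (S' g)"
proof -
  have diag: "L2_inner N (T f) (S f) = L2_inner N' (T' f) (S' f)" if f: "f \<in> K" for f
  proof -
    have "\<forall>n::nat. \<exists>F\<in>K_cont \<Theta>. L2_norm \<mm> (\<lambda>z. F z - f z) < inverse (real (Suc n))"
      by (intro allI continuous_dense[OF f]) simp
    then obtain u where u: "\<And>n. u n \<in> K_cont \<Theta>"
      "\<And>n. L2_norm \<mm> (\<lambda>z. u n z - f z) < inverse (real (Suc n))" by metis
    have lim: "(\<lambda>n. L2_norm \<mm> (\<lambda>z. u n z - f z)) \<longlonglongrightarrow> 0"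
      by (rule Lim_null_comparison[OF _ LIMSEQ_inverse_real_of_nat])
         (use u(2) in \<open>auto intro!: always_eventually less_imp_le\<close>)
    have "(\<lambda>n. L2_inner N (T (u n)) (S (u n))) \<longlonglongrightarrow> L2_inner N (T f) (S f)"
      by (rule form_limit[OF T S K_contD(1)[OF u(1)] f lim])
    moreover have "(\<lambda>n. L2_inner N (T (u n)) (S (u n))) \<longlonglongrightarrow> L2_inner N' (T' f) (S' f)"
      unfolding eq[OF u(1)] by (rule form_limit[OF T' S' K_contD(1)[OF u(1)] f lim])
    ultimately show ?thesis by (rule LIMSEQ_unique)
  qed
  define \<Delta> where "\<Delta> f g = L2_inner N (T f) (S g) - L2_inner N' (T' f) (S' g)" for f g
  have "cnj c * \<Delta> f g + c * \<Delta> g f = 0" for c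
  proof -
    note D = fg K_scale[OF fg(2), of c] K_add[OF fg(1) K_scale[OF fg(2), of c]]
    show ?thesis
      using diag[OF D(4)] diag[OF D(1)] diag[OF D(2)]
      unfolding L2_form_expand[OF T S D] L2_form_expand[OF T' S' D] \<Delta>_def by (simp add: algebra_simps)
  qed
  \<comment> \<open>The values 1 and \<open>\<i>\<close> of \<open>c\<close> give the sum and the
    difference of \<open>\<Delta> f g\<close> and \<open>\<Delta> g f\<close>.\<close>
  from this[of 1] this[of \<i>] have "\<Delta> f g + \<Delta> g f = 0" "\<i> * (\<Delta> g f - \<Delta> f g) = 0" by (simp_all add: algebra_simps)
  then have "\<Delta> f g = 0" by simp
  then show ?thesis by (simp add: \<Delta>_def)
qed

theorem positive_compact_measure:
  assumes A: "A \<in> TTO \<Theta>" and comp: "compact_on_model \<Theta> A" and pos: "positive_on_model \<Theta> A"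
  shows "\<exists>\<mu>\<in>V2_pos \<Theta>. is_measure_operator \<Theta> \<mu> A"
proof -
  obtain M where M: "finite_measure M" "sets M = sets circle_borel"
    and MF: "\<And>F. F \<in> K_cont \<Theta> \<Longrightarrow> (\<integral>z. (cmod (F z))\<^sup>2 \<partial>M) = Re (L2_inner \<mm> (A F) F)"
    by (rule carleson_measure_exists[OF A pos]) blast
  define \<mu> :: "complex set \<Rightarrow> complex" where "\<mu> E = of_real (measure M E)" for E
  have \<mu>_eq: "\<mu> = (\<lambda>E. of_real (measure M E))" by (rule ext) (simp add: \<mu>_def)
  have pcm: "positive_circle_measure \<mu>" unfolding \<mu>_eq by (rule positive_circle_measure_of_measure[OF M])
  have V: "variation \<mu> = M" unfolding \<mu>_eq by (rule variation_of_measure[OF M])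
  have bA: "bounded_operator_on_model \<Theta> A" using A by (simp add: TTO_def)
  then have bA': "L2_bounded_linear \<mm> K \<mm> (L2_space \<mm>) A"
    unfolding bounded_operator_on_model_def by (rule L2_bounded_linear_mono) (use K_L2 in blast)
  have AK: "A f \<in> K" if "f \<in> K" for f
    using bA that by (simp add: bounded_operator_on_model_def L2_bounded_linear_def)
  obtain C where C: "C > 0" "\<And>f. f \<in> K \<Longrightarrow> L2_norm \<mm> (A f) \<le> C * L2_norm \<mm> f"
    using L2_bounded_linear_bound[OF bA'] by metis
  \<comment> \<open>The moment problem fixes only real parts; positivity makes the diagonal of the
    form real, so nothing is lost.\<close>
  have A_real: "L2_inner \<mm> (A f) f = of_real (Re (L2_inner \<mm> (A f) f))" if "f \<in> K" for f
    using pos that by (auto simp: positive_on_model_def complex_nonneg_Reals_iff complex_eq_iff)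
  have \<mu>: "\<mu> \<in> C2 \<Theta>"
    unfolding C2_def
  proof (intro CollectI conjI exI ballI)
    show "complex_circle_measure \<mu>" using pcm by (simp add: positive_circle_measure_def)
    \<comment> \<open>The squared norm of \<open>F\<close> in the variation is
      \<open>Re (L2_inner \<mm> (A F) F)\<close>, at most \<open>C\<close> times the squared norm on
      the circle.\<close>
    show "0 < sqrt C" using C by simp
    fix F assume F: "F \<in> K_cont \<Theta>"
    note FK = K_contD(1)[OF F]
    show "L2_norm (variation \<mu>) F \<le> sqrt C * L2_norm \<mm> F"
    proof (rule power2_le_imp_le)
      have "(L2_norm (variation \<mu>) F)\<^sup>2 = Re (L2_inner \<mm> (A F) F)" by (simp add: V L2_norm_sq MF[OF F])
      also have "\<dots> \<le> L2_norm \<mm> (A F) * L2_norm \<mm> F"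
        using complex_Re_le_cmod L2_Cauchy_Schwarz[OF K_L2[OF AK[OF FK]] K_L2[OF FK]] by (rule order_trans)
      also have "\<dots> \<le> (C * L2_norm \<mm> F) * L2_norm \<mm> F" by (intro mult_right_mono C FK) simp
      also have "\<dots> = (sqrt C * L2_norm \<mm> F)\<^sup>2" using C(1) by (simp add: power_mult_distrib power2_eq_square)
      finally show "(L2_norm (variation \<mu>) F)\<^sup>2 \<le> (sqrt C * L2_norm \<mm> F)\<^sup>2" .
    qed (use C in simp)
  qed
  let ?\<iota> = "embedding \<Theta> \<mu>"
  note \<iota> = embedding_linear[OF \<mu>, unfolded V]
  have \<iota>L: "?\<iota> f \<in> L2_space M" if "f \<in> K" for f using \<iota> that by (simp add: L2_bounded_linear_def)
  have id: "L2_bounded_linear \<mm> K \<mm> (L2_space \<mm>) (\<lambda>f. f)"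
    unfolding L2_bounded_linear_def using K_L2 by (auto intro!: exI[of _ 1])
  have form: "L2_inner \<mm> (A f) g = L2_inner M (?\<iota> f) (?\<iota> g)" if fg: "f \<in> K" "g \<in> K" for f g
  proof (rule forms_eq[OF bA' id \<iota> \<iota> _ fg])
    fix F assume F: "F \<in> K_cont \<Theta>"
    note FK = K_contD(1)[OF F]
    have FM: "F \<in> L2_space M" by (rule continuous_on_sphere_L2[OF K_contD(4)[OF F] M])
    have ae: "AE z in M. ?\<iota> F z = F z" using embedding_cont[OF \<mu> F] unfolding V .
    have "L2_inner M (?\<iota> F) (?\<iota> F) = L2_inner M F F"
      by (intro L2_inner_cong_AE ae L2_measurable FM \<iota>L FK)
    also have "\<dots> = of_real (Re (L2_inner \<mm> (A F) F))" by (simp add: L2_inner_self L2_norm_sq MF[OF F])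
    finally show "L2_inner \<mm> (A F) F = L2_inner M (?\<iota> F) (?\<iota> F)" using A_real[OF FK] by simp
  qed
  have op: "is_measure_operator \<Theta> \<mu> A"
    unfolding is_measure_operator_def
  proof (intro conjI ballI bA)
    fix f g assume fg: "f \<in> K" "g \<in> K"
    have "(\<lambda>z. ?\<iota> f z * cnj (?\<iota> g z)) \<in> borel_measurable M"
      using L2_measurable[OF \<iota>L[OF fg(1)]] L2_measurable[OF \<iota>L[OF fg(2)]] by measurable
    from complex_measure_integral_of_measure[OF M this]
    show "L2_inner \<mm> (A f) g = complex_measure_integral \<mu> (\<lambda>z. ?\<iota> f z * cnj (?\<iota> g z))"
      using form[OF fg] unfolding \<mu>_eq L2_inner_def by simp
  qed
  have "L2_compact_operator \<mm> K (variation \<mu>) ?\<iota>"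
  proof (rule L2_compact_operator_transfer[OF _ _ comp[unfolded compact_on_model_def]])
    fix e :: real assume e: "e > 0"
    show "\<exists>d>0. \<forall>f\<in>K. \<forall>g\<in>K. L2_norm \<mm> f \<le> 1 \<longrightarrow> L2_norm \<mm> g \<le> 1 \<longrightarrow>
       L2_norm \<mm> (\<lambda>x. A f x - A g x) < d \<longrightarrow> L2_norm (variation \<mu>) (\<lambda>x. ?\<iota> f x - ?\<iota> g x) < e"
    \<comment> \<open>The difference of two elements of the unit ball has norm at most 2, so the
      squared norm of its embedding is at most twice the norm of its image under
      \<open>A\<close>.\<close>
    proof (intro exI[of _ "e\<^sup>2 / 2"] conjI ballI impI)
      show "0 < e\<^sup>2 / 2" using e by simp
      fix f g assume f: "f \<in> K" and g: "g \<in> K" and 1: "L2_norm \<mm> f \<le> 1" "L2_norm \<mm> g \<le> 1"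
        and d: "L2_norm \<mm> (\<lambda>x. A f x - A g x) < e\<^sup>2 / 2"
      let ?h = "\<lambda>x. f x - g x"
      note fg = f g K_minus[OF g] K_diff[OF f g]
      have h2: "L2_norm \<mm> ?h \<le> 2" using L2_norm_triangle_sub[OF K_L2[OF f] K_L2[OF g]] 1 by linarith
      have "complex_of_real ((L2_norm M (?\<iota> ?h))\<^sup>2) = L2_inner \<mm> (A ?h) ?h"
        unfolding L2_inner_self[symmetric] by (rule form[OF fg(4) fg(4), symmetric])
      then have "cmod (complex_of_real ((L2_norm M (?\<iota> ?h))\<^sup>2)) \<le> L2_norm \<mm> (A ?h) * L2_norm \<mm> ?h"
        using L2_Cauchy_Schwarz[OF K_L2[OF AK[OF fg(4)]] K_L2[OF fg(4)]] by simp
      then have "(L2_norm M (?\<iota> ?h))\<^sup>2 \<le> L2_norm \<mm> (\<lambda>x. A f x - A g x) * L2_norm \<mm> ?h"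
        unfolding L2_bounded_linear_diff_norm[OF bA' fg] by (simp add: norm_power)
      also have "\<dots> \<le> L2_norm \<mm> (\<lambda>x. A f x - A g x) * 2" using h2 by (intro mult_left_mono) auto
      also have "\<dots> < e\<^sup>2" using d by simp
      finally have "L2_norm M (?\<iota> ?h) < e" using e by (simp add: power2_less_imp_less)
      then show "L2_norm (variation \<mu>) (\<lambda>x. ?\<iota> f x - ?\<iota> g x) < e"
        unfolding V L2_bounded_linear_diff_norm[OF \<iota> fg] .
    qed
  qed (use \<iota>L AK K_L2 V in auto)
  then have "\<mu> \<in> V2_pos \<Theta>" using \<mu> pcm by (simp add: V2_pos_def V2_def)
  then show ?thesis using op by blast
qed

end

theorem theorem6p3:
  fixes \<Theta> :: "complex \<Rightarrow> complex"
    and A :: "(complex \<Rightarrow> complex) \<Rightarrow> (complex \<Rightarrow> complex)"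
  assumes "inner_function \<Theta>" and "A \<in> TTO \<Theta>"
  shows "((\<exists>\<mu>\<in>V2 \<Theta>. is_measure_operator \<Theta> \<mu> A) \<longrightarrow> compact_on_model \<Theta> A) \<and>
         (compact_on_model \<Theta> A \<and> positive_on_model \<Theta> A \<longrightarrow>
            (\<exists>\<mu>\<in>V2_pos \<Theta>. is_measure_operator \<Theta> \<mu> A))"
proof -
  interpret inner_fun \<Theta> by unfold_locales (rule assms(1))
  show ?thesis using compact_if_compact_embedding positive_compact_measure[OF assms(2)] by blast
qed

end
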